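(* Fix $2<p<\infty$. Let $E\subset\mathbb{R}^2$ be finite with cardinality $N$. Then there exist a linear operator $T:L^{2,p}(\mathbb{R}^2)|_E\to L^{2,p}(\mathbb{R}^2)$, linear functionals $\lambda_1,\dots,\lambda_{N_0}$ on $L^{2,p}(\mathbb{R}^2)|_E=\{f:E\to\mathbb{R}\}$ with $N_0\le CN^2$, and, setting $M(f)=\big(\sum_{i=1}^{N_0}|\lambda_i(f)|^p\big)^{1/p}$, the following hold for every $f:E\to\mathbb{R}$: (1) $Tf|_E=f$; (2) $C^{-1}M(f)\le \|f\|_{L^{2,p}(\mathbb{R}^2)|_E}\le\|Tf\|_{L^{2,p}(\mathbb{R}^2)}\le C\|f\|_{L^{2,p}(\mathbb{R}^2)|_E}\le C^2 M(f)$, where $C$ depends only on $p$ (and not on $E$ or $N$).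
   Context: $L^{2,p}(\mathbb{R}^2)$ is the homogeneous Sobolev space of functions $F:\mathbb{R}^2\to\mathbb{R}$ with finite seminorm $\|F\|_{L^{2,p}(\mathbb{R}^2)}=\|\nabla^2F\|_{L^p(\mathbb{R}^2)}$; for $p>2$ such functions are (after modification on a null set) continuously differentiable. For $E\subset\mathbb{R}^2$ and $f:E\to\mathbb{R}$, the trace seminorm is $\|f\|_{L^{2,p}(\mathbb{R}^2)|_E}=\inf\{\|F\|_{L^{2,p}(\mathbb{R}^2)}:F|_E=f\}$. *)

theory Defs
  imports "HOL-Analysis.Analysis"
begin

definition dirderiv :: "(real^2 \<Rightarrow> real) \<Rightarrow> real^2 \<Rightarrow> real^2 \<Rightarrow> real" where
  "dirderiv \<phi> v x = deriv (\<lambda>t. \<phi> (x + t *\<^sub>R v)) 0"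

fun iter_dirderiv :: "(real^2) list \<Rightarrow> (real^2 \<Rightarrow> real) \<Rightarrow> real^2 \<Rightarrow> real" where
  "iter_dirderiv [] \<phi> = \<phi>"
| "iter_dirderiv (v # vs) \<phi> = dirderiv (iter_dirderiv vs \<phi>) v"

definition smooth_fun :: "(real^2 \<Rightarrow> real) \<Rightarrow> bool" where
  "smooth_fun \<phi> \<longleftrightarrow> (\<forall>vs x. iter_dirderiv vs \<phi> differentiable (at x))"

definition test_fun :: "(real^2 \<Rightarrow> real) \<Rightarrow> bool" where
  "test_fun \<phi> \<longleftrightarrow> smooth_fun \<phi> \<and> bounded {x. \<phi> x \<noteq> 0}"

definition pd2 :: "(real^2 \<Rightarrow> real) \<Rightarrow> 2 \<Rightarrow> 2 \<Rightarrow> real^2 \<Rightarrow> real" where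
  "pd2 \<phi> i j = dirderiv (dirderiv \<phi> (axis j 1)) (axis i 1)"

definition weak_hessian :: "(real^2 \<Rightarrow> real) \<Rightarrow> (2 \<Rightarrow> 2 \<Rightarrow> real^2 \<Rightarrow> real) \<Rightarrow> bool" where
  "weak_hessian F g \<longleftrightarrow>
     (\<forall>\<phi>. test_fun \<phi> \<longrightarrow> (\<forall>i j.
        integrable lborel (\<lambda>x. F x * pd2 \<phi> i j x) \<and>
        integrable lborel (\<lambda>x. g i j x * \<phi> x) \<and>
        (\<integral>x. F x * pd2 \<phi> i j x \<partial>lborel) = (\<integral>x. g i j x * \<phi> x \<partial>lborel)))"

definition Lp_hessian :: "real \<Rightarrow> (2 \<Rightarrow> 2 \<Rightarrow> real^2 \<Rightarrow> real) \<Rightarrow> bool" where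
  "Lp_hessian p g \<longleftrightarrow> (\<forall>i j. g i j \<in> borel_measurable lborel \<and>
                           integrable lborel (\<lambda>x. \<bar>g i j x\<bar> powr p))"

definition hess_pnorm :: "real \<Rightarrow> (2 \<Rightarrow> 2 \<Rightarrow> real^2 \<Rightarrow> real) \<Rightarrow> real" where
  "hess_pnorm p g = (\<integral>x. (sqrt (\<Sum>i\<in>UNIV. \<Sum>j\<in>UNIV. (g i j x)\<^sup>2)) powr p \<partial>lborel) powr (1 / p)"

text \<open>Membership in L^{2,p}(R^2), taking the continuous representative.\<close>
definition in_L2p :: "real \<Rightarrow> (real^2 \<Rightarrow> real) \<Rightarrow> bool" where
  "in_L2p p F \<longleftrightarrow> continuous_on UNIV F \<and> (\<exists>g. weak_hessian F g \<and> Lp_hessian p g)"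

definition L2p_norm :: "real \<Rightarrow> (real^2 \<Rightarrow> real) \<Rightarrow> real" where
  "L2p_norm p F = Inf {hess_pnorm p g | g. weak_hessian F g \<and> Lp_hessian p g}"

definition trace_norm :: "real \<Rightarrow> (real^2) set \<Rightarrow> (real^2 \<Rightarrow> real) \<Rightarrow> real" where
  "trace_norm p E f = Inf {L2p_norm p F | F. in_L2p p F \<and> (\<forall>x\<in>E. F x = f x)}"

text \<open>A linear map on functions E -> R (functions are represented on all of R^2, only
  their values on E matter).\<close>
definition linear_functional_on_traces :: "(real^2) set \<Rightarrow> ((real^2 \<Rightarrow> real) \<Rightarrow> real) \<Rightarrow> bool" where
  "linear_functional_on_traces E L \<longleftrightarrow>
     (\<forall>f g. L (\<lambda>x. f x + g x) = L f + L g) \<and>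
     (\<forall>c f. L (\<lambda>x. c * f x) = c * L f) \<and>
     (\<forall>f g. (\<forall>x\<in>E. f x = g x) \<longrightarrow> L f = L g)"

definition linear_operator_on_traces :: "(real^2) set \<Rightarrow> ((real^2 \<Rightarrow> real) \<Rightarrow> (real^2 \<Rightarrow> real)) \<Rightarrow> bool" where
  "linear_operator_on_traces E T \<longleftrightarrow>
     (\<forall>f g. T (\<lambda>x. f x + g x) = (\<lambda>y. T f y + T g y)) \<and>
     (\<forall>c f. T (\<lambda>x. c * f x) = (\<lambda>y. c * T f y)) \<and>
     (\<forall>f g. (\<forall>x\<in>E. f x = g x) \<longrightarrow> T f = T g)"

end

theory Submission
  imports Defs
begin

text \<open>
  A jet \<open>(f, \<xi>)\<close> on \<open>E\<close> is extended in Whitney's manner, with a partition of unity obtained by mollifying the indicator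
  functions of the Voronoi cells of \<open>E\<close> at scales comparable to the distance to \<open>E\<close>. The \<open>p\<close>-th power of the norm of
  the extension is at most an energy with \<open>O(N\<^sup>2)\<close> terms, the \<open>p\<close>-th powers of functionals linear in the jet. It
  remains to choose \<open>\<xi>\<close> linearly in \<open>f\<close> such that every extension \<open>F\<close> of \<open>f\<close> bounds the energy. By Morrey's inequality and the
  maximal theorem the gradient of \<open>F\<close> itself would do, but it is not determined by \<open>f\<close>.

  Suppose that \<open>E\<close> is not collinear. Each \<open>x\<close> in \<open>E\<close> has a scale \<open>r x\<close> at which \<open>E\<close> stops being close to the zero set of
  a function with unit gradient and small Hessian. At this scale \<open>f\<close> determines the gradient of \<open>F\<close> at \<open>x\<close> up to an error
  bounded by the energy of \<open>F\<close> in the ball of radius \<open>2 r x\<close>, and Hahn--Banach yields a linear choice with the same error.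
  Make this choice on a subset \<open>K\<close>, selected greedily such that these balls are disjoint, extend the resulting jets, and subtract the
  extension. The remaining function has an extension whose gradient is small on \<open>K\<close>. For it, and for every function
  when \<open>E\<close> is collinear, take the difference quotient to the nearest neighbour as the tangential part of \<open>\<xi>\<close> and \<open>0\<close>
  as its normal part. Far from \<open>E\<close>, compared with \<open>r x\<close>, the gradient to be matched is small; closer
  to \<open>E\<close>, the directions to nearest neighbours are almost parallel, so that the neglected normal parts almost cancel.
\<close>

section \<open>Bump functions\<close>

text \<open>The energy estimates are pointwise in z, at distance d from E, and compare jets only
  with the jet at the nearest point y of E. The weights of the other points at z have bounded sum,
  because Voronoi cells share the area of one ball; neighbours are never counted. Integrating z over
  the cell of y leaves one coefficient per pair (x,y), whence the quadratic number of terms.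
  Conversely, an energy is bounded by exhibiting one integrable density that dominates the rescaled
  jet differences at almost every z. The maximal theorem fails in L1, so Morrey's inequality is
  applied with an exponent strictly between 2 and p. The recurring power r^(2-p) is the p-energy of
  a Hessian of size 1/r on a ball of radius r, the cost of turning a unit gradient there. Two greedy
  selections run in opposite orders. Small scales come first for K, so that each point has in K a
  point of no larger scale at distance at most 4 times its own scale; large scales come first when
  directions are compared, so that each point lies deep inside a ball where E is almost
  straight.\<close>

definition expk :: "nat \<Rightarrow> real \<Rightarrow> real" where
  "expk n s = (if s \<le> 0 then 0 else (1/s)^n * exp (-(1/s)))"

lemma power_exp_minus_le: 
  fixes y :: real assumes "0 \<le> y" shows "y ^ n * exp (-y) \<le> fact n"
proof -
  have s: "(\<lambda>k. y ^ k /\<^sub>R fact k) sums exp y" by (rule exp_converges)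
  have "y ^ n /\<^sub>R fact n \<le> exp y"
    using sum_le_suminf[OF sums_summable[OF s], of "{n}"] sums_unique[OF s] assms by auto
  then have "y ^ n \<le> fact n * exp y" by (simp add: field_simps)
  then show ?thesis by (simp add: exp_minus field_simps)
qed

lemma expk_nonneg: "0 \<le> expk n s" by (simp add: expk_def)

text \<open>The exponential absorbs two more powers of \<open>1/s\<close> than are present. This
  leaves the factor \<open>s^2\<close>, hence a vanishing difference quotient at 0.\<close>

lemma expk_le_lin: "0 \<le> s \<Longrightarrow> expk n s \<le> fact (n+2) * s^2"
proof (cases "s = 0")
  case False 
  assume "0 \<le> s" 
  then have s: "s > 0" using False by simp
  have "(1/s)^(n+2) * exp (-(1/s)) \<le> fact (n+2)" using power_exp_minus_le[of "1/s" "n+2"] s by simp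
  then have "(1/s)^(n+2) * exp (-(1/s)) * s^2 \<le> fact (n+2) * s^2" by (rule mult_right_mono) simp
  moreover have "(1/s)^(n+2) * exp (-(1/s)) * s^2 = expk n s" using s by (simp add: expk_def power_add field_simps power2_eq_square)
  ultimately show ?thesis by simp
qed (simp add: expk_def)

text \<open>The powers of \<open>1/s\<close> make the family stable: derivatives are linear
  combinations of its members, so that smoothness across \<open>s = 0\<close> follows by induction
  and no higher derivative has to be estimated.\<close>

lemma DERIV_expk: "(expk n has_real_derivative (expk (n+2) s - n * expk (n+1) s)) (at s)"
proof (cases s "0::real" rule: linorder_cases)
  case less
  have "((\<lambda>s. 0::real) has_real_derivative 0) (at s)" by simp
  then have "(expk n has_real_derivative 0) (at s)"
    by (rule has_field_derivative_transform_within_open[of _ _ _ "{..<0}"]) (use less in \<open>auto simp: expk_def\<close>)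
  then show ?thesis using less by (simp add: expk_def)
next
  case greater
  have "((\<lambda>s. (1/s)^n * exp (-(1/s))) has_real_derivative (expk (n+2) s - n * expk (n+1) s)) (at s)"
  proof (cases n)
    case 0 then show ?thesis using greater
      by (auto intro!: derivative_eq_intros simp: expk_def field_simps power2_eq_square)
  next
    case (Suc m) show ?thesis unfolding Suc using greater
      by (auto intro!: derivative_eq_intros simp: expk_def power2_eq_square) (cases m; simp add: field_simps)
  qed
  then show ?thesis
    by (rule has_field_derivative_transform_within_open[of _ _ _ "{0<..}"]) (use greater in \<open>auto simp: expk_def\<close>)
next
  case equal
  have "((\<lambda>h. (expk n (0+h) - expk n 0) / h) \<longlongrightarrow> 0) (at 0)"
  proof (rule Lim_null_comparison)
    show "\<forall>\<^sub>F h in at 0. norm ((expk n (0+h) - expk n 0) / h) \<le> fact (n+2) * \<bar>h\<bar>"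
    proof (rule always_eventually, rule allI)
      fix h :: real
      show "norm ((expk n (0+h) - expk n 0) / h) \<le> fact (n+2) * \<bar>h\<bar>"
      proof (cases "h > 0")
        case True
        then have "expk n h / h \<le> fact (n+2) * h^2 / h" by (intro divide_right_mono expk_le_lin) auto
        then show ?thesis using True by (simp add: expk_def[of n 0] expk_nonneg power2_eq_square del: fact_Suc)
      next
      case False
      then have "expk n h = 0" "expk n 0 = 0" by (auto simp: expk_def)
      then show ?thesis by simp
    qed
    qed
    show "((\<lambda>h::real. fact (n+2) * \<bar>h\<bar>) \<longlongrightarrow> 0) (at 0)" by (rule tendsto_eq_intros refl | simp)+
  qed
  then show ?thesis using equal by (simp add: DERIV_def expk_def[of _ 0])
qed

text \<open>Differentiating \<open>expk n (1 - x\<bullet>x)\<close> along v yields the factor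
  \<open>x \<bullet> v\<close> times further members of the family. The closure rules are exactly
  those that keep the class stable under any number of directional derivatives.\<close>

inductive bumplike :: "(real^2 \<Rightarrow> real) \<Rightarrow> bool" where
  base: "bumplike (\<lambda>x. expk n (1 - x\<bullet>x))"
| add: "bumplike f \<Longrightarrow> bumplike g \<Longrightarrow> bumplike (\<lambda>x. f x + g x)"
| scale: "bumplike f \<Longrightarrow> bumplike (\<lambda>x. c * f x)"
| coord: "bumplike f \<Longrightarrow> bumplike (\<lambda>x. (x \<bullet> v) * f x)"

lemma dirderiv_has_derivative:
  assumes "(f has_derivative f') (at x)" shows "dirderiv f v x = f' v"
proof -
  interpret bounded_linear f' using assms by (rule has_derivative_bounded_linear)
  have "((\<lambda>t. x + t *\<^sub>R v) has_derivative (\<lambda>t. t *\<^sub>R v)) (at 0)"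
    by (auto intro!: derivative_eq_intros)
  from has_derivative_compose[OF this, of f f'] assms
  have "((\<lambda>t. f (x + t *\<^sub>R v)) has_derivative (\<lambda>t. f' (t *\<^sub>R v))) (at 0)" by simp
  then have "((\<lambda>t. f (x + t *\<^sub>R v)) has_real_derivative f' v) (at 0)"
    by (simp add: has_field_derivative_def scaleR mult.commute[of _ "f' v"])
  then show ?thesis unfolding dirderiv_def by (rule DERIV_imp_deriv)
qed

text \<open>The three properties go through a single induction, because the derivative of a sum or
  product is computable only once its parts are known to be differentiable.\<close>

lemma bumplike_deriv:
  assumes "bumplike f" 
  shows "(\<forall>x. f differentiable (at x)) \<and> (\<forall>v. bumplike (dirderiv f v)) \<and> (\<forall>x. norm x \<ge> 1 \<longrightarrow> f x = 0)"
  using assms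
proof induction
  case (base n)
  let ?s = "\<lambda>x. 1 - x\<bullet>x"
  have der: "((\<lambda>x. expk n (?s x)) has_derivative (\<lambda>h. (expk (n+2) (?s x) - n * expk (n+1) (?s x)) * (-(2 * (x \<bullet> h))))) (at x)" for x
  proof -
    have 1: "(?s has_derivative (\<lambda>h. -(2 * (x \<bullet> h)))) (at x)"
      by (auto intro!: derivative_eq_intros simp: inner_commute)
    show ?thesis
      using has_derivative_compose[OF 1 DERIV_expk[of n, unfolded has_field_derivative_def]] by simp
  qed
  have "dirderiv (\<lambda>x. expk n (?s x)) v = (\<lambda>x. (-2) * ((x \<bullet> v) * expk (n+2) (?s x)) + (2*n) * ((x \<bullet> v) * expk (n+1) (?s x)))" for v
    unfolding dirderiv_has_derivative[OF der] by (rule ext) (simp add: left_diff_distrib right_diff_distrib mult_ac)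
  moreover have "bumplike (\<lambda>x. (-2) * ((x \<bullet> v) * expk (n+2) (?s x)) + (2*n) * ((x \<bullet> v) * expk (n+1) (?s x)))" for v
    by (intro bumplike.intros)
  ultimately have "\<forall>v. bumplike (dirderiv (\<lambda>x. expk n (?s x)) v)" by simp
  moreover have "expk n (?s x) = 0" if "norm x \<ge> 1" for x :: "real^2"
  proof -
    have "1\<^sup>2 \<le> x\<bullet>x" using that by (simp add: dot_square_norm)
    then show ?thesis by (simp add: expk_def)
  qed
  ultimately show ?case using der unfolding differentiable_def by blast
next
  case (add f g)
  have "dirderiv (\<lambda>x. f x + g x) v = (\<lambda>x. dirderiv f v x + dirderiv g v x)" for v
  proof
    fix x
    obtain f' g' where "(f has_derivative f') (at x)" "(g has_derivative g') (at x)" using add.IH unfolding differentiable_def by blast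
    then show "dirderiv (\<lambda>x. f x + g x) v x = dirderiv f v x + dirderiv g v x"
      by (simp add: dirderiv_has_derivative dirderiv_has_derivative[OF has_derivative_add])
  qed
  then show ?case using add by (auto intro: bumplike.intros)
next
  case (scale f c)
  have "dirderiv (\<lambda>x. c * f x) v = (\<lambda>x. c * dirderiv f v x)" for v
  proof
    fix x
    obtain f' where "(f has_derivative f') (at x)" using scale.IH unfolding differentiable_def by blast
    then show "dirderiv (\<lambda>x. c * f x) v x = c * dirderiv f v x"
      by (simp add: dirderiv_has_derivative dirderiv_has_derivative[OF has_derivative_mult_right])
  qed
  then show ?case using scale by (auto intro: bumplike.intros)
next
  case (coord f u)
  have d: "((\<lambda>x. (x \<bullet> u)) has_derivative (\<lambda>h. h \<bullet> u)) (at x)" for x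
    by (auto intro!: derivative_eq_intros)
  have "dirderiv (\<lambda>x. (x \<bullet> u) * f x) v = (\<lambda>x. (x \<bullet> u) * dirderiv f v x + (v \<bullet> u) * f x)" for v
  proof
    fix x
    obtain f' where "(f has_derivative f') (at x)" using coord.IH unfolding differentiable_def by blast
    then show "dirderiv (\<lambda>x. (x \<bullet> u) * f x) v x = (x \<bullet> u) * dirderiv f v x + (v \<bullet> u) * f x"
      by (simp add: dirderiv_has_derivative dirderiv_has_derivative[OF has_derivative_mult[OF d]])
  qed
  moreover have "(\<lambda>x. (x \<bullet> u) * f x) differentiable (at x)" for x
    using coord.IH has_derivative_mult[OF d] unfolding differentiable_def by blast
  ultimately show ?case using coord by (auto intro!: bumplike.intros(2,3,4))
qed

lemma bumplike_test_fun:
  assumes "bumplike f" shows "test_fun f"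
proof -
  have "bumplike (iter_dirderiv vs f)" for vs
    by (induction vs) (use assms bumplike_deriv in auto)
  then have "smooth_fun f" unfolding smooth_fun_def using bumplike_deriv by blast
  moreover have "{x. f x \<noteq> 0} \<subseteq> cball 0 1"
    using bumplike_deriv[OF assms(1)] by force
  ultimately show ?thesis unfolding test_fun_def using bounded_subset bounded_cball by metis
qed

text \<open>\<open>iter_dirderiv\<close> applies the head of the list last, so an additional
  innermost derivative is appended at the end. The support grows at most to its closure.\<close>

lemma test_fun_dirderiv:
  assumes "test_fun f" shows "test_fun (dirderiv f v)"
proof -
  have "iter_dirderiv vs (dirderiv f v) = iter_dirderiv (vs @ [v]) f" for vs
    by (induction vs) auto
  then have "smooth_fun (dirderiv f v)" using assms unfolding test_fun_def smooth_fun_def by metis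
  moreover have "{x. dirderiv f v x \<noteq> 0} \<subseteq> closure {x. f x \<noteq> 0}"
  proof (rule ccontr)
    assume "\<not> ?thesis"
    then obtain x where x: "dirderiv f v x \<noteq> 0" "x \<in> - closure {x. f x \<noteq> 0}" by blast
    have "open (- closure {x. f x \<noteq> 0})" by auto
    have "((\<lambda>_. 0) has_derivative (\<lambda>_. 0)) (at x)" by simp
    then have "(f has_derivative (\<lambda>_. 0)) (at x)"
      by (rule has_derivative_transform_within_open[OF _ \<open>open (- closure {x. f x \<noteq> 0})\<close> x(2)])
         (use closure_subset[of "{x. f x \<noteq> 0}"] in auto)
    from dirderiv_has_derivative[OF this, of v] x show False by simp
  qed
  ultimately show ?thesis using assms bounded_subset bounded_closure unfolding test_fun_def by metis
qed

lemma test_fun_differentiable: "test_fun f \<Longrightarrow> f differentiable (at x)"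
  unfolding test_fun_def smooth_fun_def by (metis iter_dirderiv.simps(1))

lemma test_fun_has_derivative:
  assumes "test_fun f" shows "(f has_derivative (\<lambda>h. dirderiv f h x)) (at x)"
proof -
  obtain f' where f': "(f has_derivative f') (at x)" 
    using test_fun_differentiable[OF assms] unfolding differentiable_def by blast
  then have "f' = (\<lambda>h. dirderiv f h x)" by (auto simp: dirderiv_has_derivative)
  then show ?thesis using f' by simp
qed

lemma test_fun_continuous: "test_fun f \<Longrightarrow> continuous_on UNIV f"
  by (simp add: continuous_at_imp_continuous_on differentiable_imp_continuous_within test_fun_differentiable)

text \<open>The value of a convolution at \<open>a\<close> is a pairing with the reflected profile
  \<open>(a - w) /\<^sub>R r\<close>; each derivative in \<open>w\<close> costs the factor
  \<open>-1/r\<close>.\<close>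

lemma dirderiv_reflect:
  assumes "f differentiable (at ((a - x) /\<^sub>R r))"
  shows "dirderiv (\<lambda>w. c * f ((a - w) /\<^sub>R r)) v x = (- c / r) * dirderiv f v ((a - x) /\<^sub>R r)"
proof -
  obtain f' where f': "(f has_derivative f') (at ((a - x) /\<^sub>R r))" 
    using assms unfolding differentiable_def by blast
  have 1: "((\<lambda>w. (a - w) /\<^sub>R r) has_derivative (\<lambda>h. (- h) /\<^sub>R r)) (at x)"
    by (auto intro!: derivative_eq_intros)
  note d = has_derivative_mult_right[OF has_derivative_compose[OF 1 f'], of c]
  interpret bounded_linear f' using f' by (rule has_derivative_bounded_linear)
  show ?thesis
    using dirderiv_has_derivative[OF d, of v] dirderiv_has_derivative[OF f', of v] 
    by (simp add: scaleR neg divide_inverse)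
qed

lemma test_fun_reflect:
  assumes "test_fun f" "r \<noteq> 0"
  shows "test_fun (\<lambda>w. c * f ((a - w) /\<^sub>R r))"
proof -
  have d: "iter_dirderiv vs f differentiable (at x)" for vs x
    using assms unfolding test_fun_def smooth_fun_def by blast
  have "\<exists>c'. iter_dirderiv vs (\<lambda>w. c * f ((a - w) /\<^sub>R r)) = (\<lambda>w. c' * iter_dirderiv vs f ((a - w) /\<^sub>R r))" for vs
  proof (induction vs)
    case (Cons v vs)
    then show ?case using dirderiv_reflect[OF d] by (metis (no_types, lifting) ext iter_dirderiv.simps(2))
  qed auto
  moreover have "(\<lambda>w. c' * iter_dirderiv vs f ((a - w) /\<^sub>R r)) differentiable (at x)" for c' vs x
  proof -
    have 1: "(\<lambda>w. (a - w) /\<^sub>R r) differentiable (at x)" by (intro derivative_intros)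
    have "(iter_dirderiv vs f \<circ> (\<lambda>w. (a - w) /\<^sub>R r)) differentiable (at x)"
      by (rule differentiable_chain_at[OF 1 d])
    from differentiable_mult[OF differentiable_const this, of c'] show ?thesis by (simp add: o_def)
  qed
  ultimately have "smooth_fun (\<lambda>w. c * f ((a - w) /\<^sub>R r))" unfolding smooth_fun_def by metis
  moreover obtain B where B: "\<And>x. f x \<noteq> 0 \<Longrightarrow> norm x \<le> B"
    using assms unfolding test_fun_def bounded_iff by blast
  have "{w. c * f ((a - w) /\<^sub>R r) \<noteq> 0} \<subseteq> cball a (B * \<bar>r\<bar>)"
  proof
    fix w assume "w \<in> {w. c * f ((a - w) /\<^sub>R r) \<noteq> 0}"
    then have "norm ((a - w) /\<^sub>R r) \<le> B" by (intro B) auto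
    then show "w \<in> cball a (B * \<bar>r\<bar>)" using assms(2) by (simp add: dist_norm divide_simps norm_minus_commute)
  qed
  ultimately show ?thesis unfolding test_fun_def using bounded_subset bounded_cball by metis
qed

section \<open>Convolutions and weak Hessians\<close>

text \<open>Balls about the origin exhaust the space, and every kernel used below vanishes outside
  one of them.\<close>

definition locint :: "('a::euclidean_space \<Rightarrow> real) \<Rightarrow> bool" where
  "locint u \<longleftrightarrow> (\<forall>r. integrable lborel (\<lambda>x. indicator (ball 0 r) x * u x))"

lemma locintD: "locint u \<Longrightarrow> integrable lborel (\<lambda>x. indicator (ball 0 r) x * u x)"
  by (simp add: locint_def)

lemma locint_continuous:
  assumes "continuous_on UNIV u" shows "locint u"
  unfolding locint_def
proof
  fix r
  have "integrable lborel (\<lambda>x. indicator (cball 0 r) x *\<^sub>R u x)"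
    by (rule borel_integrable_compact) (use assms continuous_on_subset in auto)
  then have "set_integrable lborel (cball 0 r) u" unfolding set_integrable_def .
  then have "set_integrable lborel (ball 0 r) u" by (rule set_integrable_subset) auto
  then show "integrable lborel (\<lambda>x. indicator (ball 0 r) x * u x)" unfolding set_integrable_def by simp
qed

lemma locint_indicator:
  assumes "V \<in> sets borel" shows "locint (indicator V :: 'a::euclidean_space \<Rightarrow> real)"
  unfolding locint_def
proof
  fix r
  have "integrable lborel (indicator (ball 0 r \<inter> V) :: 'a \<Rightarrow> real)"
  proof (rule integrable_real_indicator)
    have "emeasure lborel (ball 0 r \<inter> V) \<le> emeasure lborel (ball (0::'a) r)" by (rule emeasure_mono) auto
    also have "\<dots> < \<infinity>" using emeasure_bounded_finite[OF bounded_ball] by auto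
    finally show "emeasure lborel (ball 0 r \<inter> V) < \<infinity>" .
  qed (use assms in auto)
  then show "integrable lborel (\<lambda>x. indicator (ball 0 r) x * indicator V x :: real)"
    unfolding indicator_inter_arith[symmetric] .
qed

lemma locint_measurable_mult:
  assumes "locint u" "k \<in> borel_measurable borel" "\<And>x. norm x \<ge> \<rho> \<Longrightarrow> k x = 0"
  shows "(\<lambda>x. u x * k x) \<in> borel_measurable borel"
proof -
  have "(\<lambda>x. (indicator (ball 0 \<rho>) x * u x) * k x) \<in> borel_measurable borel"
    using borel_measurable_times[of _ borel, OF _ assms(2)] borel_measurable_integrable[OF locintD[OF assms(1), of \<rho>]] by simp
  moreover have "(\<lambda>x. (indicator (ball 0 \<rho>) x * u x) * k x) = (\<lambda>x. u x * k x)"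
    using assms(3) by (auto simp: indicator_def fun_eq_iff)
  ultimately show ?thesis by simp
qed

lemma locint_integrable_mult:
  assumes "locint u" "k \<in> borel_measurable borel" "\<And>x. norm x \<ge> \<rho> \<Longrightarrow> k x = 0" "\<And>x. \<bar>k x\<bar> \<le> B"
  shows "integrable lborel (\<lambda>x. u x * k x)"
proof (rule Bochner_Integration.integrable_bound)
  show "integrable lborel (\<lambda>x. B * (indicator (ball 0 \<rho>) x * u x))" using locintD[OF assms(1)] by simp
  show "(\<lambda>x. u x * k x) \<in> borel_measurable lborel" using locint_measurable_mult[OF assms(1-3)] by simp
  have "norm (u x * k x) \<le> norm (B * (indicator (ball 0 \<rho>) x * u x))" for x
  proof (cases "norm x < \<rho>")
    case True
    then show ?thesis using mult_right_mono[OF order_trans[OF assms(4)[of x] abs_ge_self], of "\<bar>u x\<bar>"]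
      by (simp add: abs_mult mult.commute)
  qed (simp add: assms(3))
  then show "AE x in lborel. norm (u x * k x) \<le> norm (B * (indicator (ball 0 \<rho>) x * u x))" by simp
qed

lemma continuous_bounded_support:
  fixes f :: "'a::euclidean_space \<Rightarrow> real"
  assumes "continuous_on UNIV f" "\<And>x. norm x \<ge> \<rho> \<Longrightarrow> f x = 0"
  obtains B where "B \<ge> 0" "\<And>x. \<bar>f x\<bar> \<le> B"
proof -
  have "compact (f ` cball 0 \<rho>)" using assms(1) by (intro compact_continuous_image) (auto intro: continuous_on_subset)
  then obtain B where B: "\<And>x. x \<in> cball 0 \<rho> \<Longrightarrow> \<bar>f x\<bar> \<le> B" using compact_imp_bounded bounded_iff by (metis imageI real_norm_def)
  have "\<bar>f x\<bar> \<le> max 0 B" for x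
    using B[of x] assms(2)[of x] by (cases "norm x \<le> \<rho>") auto
  then show ?thesis using that[of "max 0 B"] by simp
qed

text \<open>Dominated convergence along sequences: the mean value theorem bounds the difference
  quotients by \<open>B\<close>, and the common support confines them to a ball on which
  \<open>u\<close> is integrable.\<close>

lemma derivative_under_integral:
  fixes k :: "real \<Rightarrow> 'a::euclidean_space \<Rightarrow> real"
  assumes u: "locint u" and "e > 0"
    and der: "\<And>t x. \<bar>t - t0\<bar> < e \<Longrightarrow> ((\<lambda>t. k t x) has_real_derivative k' t x) (at t)"
    and bnd: "\<And>t x. \<bar>t - t0\<bar> < e \<Longrightarrow> \<bar>k' t x\<bar> \<le> B"
    and bnd0: "\<And>t x. \<bar>t - t0\<bar> < e \<Longrightarrow> \<bar>k t x\<bar> \<le> B0"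
    and supp: "\<And>t x. \<bar>t - t0\<bar> < e \<Longrightarrow> norm x \<ge> \<rho> \<Longrightarrow> k t x = 0"
    and meas: "\<And>t. \<bar>t - t0\<bar> < e \<Longrightarrow> k t \<in> borel_measurable borel"
  shows "((\<lambda>t. \<integral>x. u x * k t x \<partial>lborel) has_real_derivative (\<integral>x. u x * k' t0 x \<partial>lborel)) (at t0)"
proof -
  have int: "integrable lborel (\<lambda>x. u x * k t x)" if "\<bar>t - t0\<bar> < e" for t
    by (rule locint_integrable_mult[OF u meas[OF that] supp[OF that] bnd0[OF that]])
  have lip: "\<bar>k (t0 + h) x - k t0 x\<bar> \<le> B * \<bar>h\<bar>" if "\<bar>h\<bar> < e" for h x
  proof -
    have "norm (k (t0 + h) x - k t0 x) \<le> B * norm (t0 + h - t0)"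
    proof (rule field_differentiable_bound[of "ball t0 e"])
      fix z assume "z \<in> ball t0 e"
      then have z: "\<bar>z - t0\<bar> < e" by (simp add: dist_real_def abs_minus_commute)
      show "((\<lambda>t. k t x) has_field_derivative k' z x) (at z within ball t0 e)" using der[OF z] by (rule has_field_derivative_at_within)
      show "norm (k' z x) \<le> B" using bnd[OF z] by simp
    qed (use that in \<open>auto simp: dist_real_def\<close>)
    then show ?thesis by simp
  qed
  have "((\<lambda>h. ((\<integral>x. u x * k (t0+h) x \<partial>lborel) - (\<integral>x. u x * k t0 x \<partial>lborel)) / h) \<longlongrightarrow> (\<integral>x. u x * k' t0 x \<partial>lborel)) (at 0)"
    unfolding tendsto_at_iff_sequentially
  proof (intro allI impI)
    fix X :: "nat \<Rightarrow> real" assume X0: "\<forall>i. X i \<in> UNIV - {0}" and Xl: "X \<longlonglongrightarrow> 0"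
    have ev: "\<forall>\<^sub>F i in sequentially. \<bar>X i\<bar> < e" using Xl \<open>e > 0\<close> by (metis (no_types, lifting) LIMSEQ_D eventually_sequentially diff_zero real_norm_def)
    \<comment> \<open>The value 0 for the finitely many large \<open>X i\<close> makes every member
      of the sequence integrable, since nothing is assumed of \<open>k\<close> at those
      parameters.\<close>
    define s where "s i x = (if \<bar>X i\<bar> < e then u x * ((k (t0 + X i) x - k t0 x) / X i) else 0)" for i x
    have lim: "(\<lambda>i. s i x) \<longlonglongrightarrow> u x * k' t0 x" for x
    proof -
      have "((\<lambda>h. (k (t0+h) x - k t0 x) / h) \<longlongrightarrow> k' t0 x) (at 0)" using der[of t0 x] \<open>e > 0\<close> by (simp add: DERIV_def)
      then have "(\<lambda>i. (k (t0 + X i) x - k t0 x) / X i) \<longlonglongrightarrow> k' t0 x"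
        using X0 Xl unfolding tendsto_at_iff_sequentially o_def by blast
      then have "(\<lambda>i. u x * ((k (t0 + X i) x - k t0 x) / X i)) \<longlonglongrightarrow> u x * k' t0 x" by (rule tendsto_mult_left)
      moreover have "\<forall>\<^sub>F i in sequentially. s i x = u x * ((k (t0 + X i) x - k t0 x) / X i)"
        using ev by eventually_elim (simp add: s_def)
      ultimately show ?thesis by (simp add: tendsto_cong)
    qed
    have sint: "integrable lborel (s i)" for i
    proof (cases "\<bar>X i\<bar> < e")
      case True
      have "integrable lborel (\<lambda>x. (u x * k (t0 + X i) x - u x * k t0 x) / X i)"
        using int[of "t0 + X i"] int[of t0] True \<open>e > 0\<close> by simp
      then show ?thesis using True by (simp add: s_def[abs_def] right_diff_distrib)
    qed (simp add: s_def[abs_def])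
    have smeas: "s i \<in> borel_measurable lborel" for i using sint by (rule borel_measurable_integrable)
    have conv: "(\<lambda>i. integral\<^sup>L lborel (s i)) \<longlonglongrightarrow> (\<integral>x. u x * k' t0 x \<partial>lborel)"
    proof (rule integral_dominated_convergence[where w="\<lambda>x. \<bar>B * (indicator (ball 0 \<rho>) x * u x)\<bar>"])
      show "(\<lambda>x. u x * k' t0 x) \<in> borel_measurable lborel"
        by (rule borel_measurable_LIMSEQ_real[OF lim]) (use smeas in auto)
      show "integrable lborel (\<lambda>x. \<bar>B * (indicator (ball 0 \<rho>) x * u x)\<bar>)" using locintD[OF u] by simp
      fix i
      have "norm (s i x) \<le> \<bar>B * (indicator (ball 0 \<rho>) x * u x)\<bar>" for x
      proof (cases "\<bar>X i\<bar> < e \<and> norm x < \<rho>")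
        case True
        have "\<bar>(k (t0 + X i) x - k t0 x) / X i\<bar> \<le> B" 
          using lip[of "X i" x] True X0 by (simp add: abs_divide divide_le_eq)
        then have "\<bar>u x\<bar> * \<bar>(k (t0 + X i) x - k t0 x) / X i\<bar> \<le> \<bar>u x\<bar> * \<bar>B\<bar>" by (intro mult_left_mono) auto
        then show ?thesis using True by (simp add: s_def abs_mult mult.commute)
      next
        case False
        then have "s i x = 0" using supp[of "t0 + X i" x] supp[of t0 x] \<open>e > 0\<close> by (auto simp: s_def)
        then show ?thesis by simp
      qed
      then show "AE x in lborel. norm (s i x) \<le> \<bar>B * (indicator (ball 0 \<rho>) x * u x)\<bar>" by simp
    qed (use lim smeas in auto)
    have "\<forall>\<^sub>F i in sequentially. integral\<^sup>L lborel (s i) = ((\<integral>x. u x * k (t0 + X i) x \<partial>lborel) - (\<integral>x. u x * k t0 x \<partial>lborel)) / X i"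
      using ev
    proof eventually_elim
      case (elim i)
      have "integral\<^sup>L lborel (s i) = (\<integral>x. (u x * k (t0 + X i) x - u x * k t0 x) / X i \<partial>lborel)"
        by (rule Bochner_Integration.integral_cong) (use elim in \<open>simp_all add: s_def right_diff_distrib\<close>)
      also have "\<dots> = ((\<integral>x. u x * k (t0 + X i) x \<partial>lborel) - (\<integral>x. u x * k t0 x \<partial>lborel)) / X i"
        using int[of "t0 + X i"] int[of t0] elim \<open>e > 0\<close> by simp
      finally show ?case .
    qed
    then show "((\<lambda>h. ((\<integral>x. u x * k (t0+h) x \<partial>lborel) - (\<integral>x. u x * k t0 x \<partial>lborel)) / h) \<circ> X) \<longlonglongrightarrow> (\<integral>x. u x * k' t0 x \<partial>lborel)"
      unfolding o_def using conv by (simp add: tendsto_cong)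
  qed
  then show ?thesis by (simp add: DERIV_def)
qed

section \<open>Derivatives along lines and integration by parts\<close>

definition line_deriv :: "('a::real_normed_vector \<Rightarrow> real) \<Rightarrow> 'a \<Rightarrow> ('a \<Rightarrow> real) \<Rightarrow> bool" where
  "line_deriv f v f' \<longleftrightarrow> (\<forall>x. ((\<lambda>t. f (x + t *\<^sub>R v)) has_real_derivative f' x) (at 0))"

lemma line_deriv_at:
  assumes "line_deriv f v f'" shows "((\<lambda>t. f (x + t *\<^sub>R v)) has_real_derivative f' (x + t0 *\<^sub>R v)) (at t0)"
proof -
  have "((\<lambda>t. f ((x + t0 *\<^sub>R v) + t *\<^sub>R v)) has_real_derivative f' (x + t0 *\<^sub>R v)) (at 0)"
    using assms unfolding line_deriv_def by blast
  then have "((\<lambda>t. f (x + (t0 + t) *\<^sub>R v)) has_real_derivative f' (x + t0 *\<^sub>R v)) (at 0)"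
    by (simp add: algebra_simps)
  then show ?thesis using DERIV_at_within_shift[of "\<lambda>t. f (x + t *\<^sub>R v)" "f' (x + t0 *\<^sub>R v)" t0 0 UNIV] by simp
qed

lemma line_deriv_mult:
  assumes "line_deriv f v f'" "line_deriv g v g'"
  shows "line_deriv (\<lambda>x. f x * g x) v (\<lambda>x. f' x * g x + f x * g' x)"
  unfolding line_deriv_def
proof
  fix x
  have "((\<lambda>t. f (x + t *\<^sub>R v) * g (x + t *\<^sub>R v)) has_real_derivative f' x * g (x + 0 *\<^sub>R v) + g' x * f (x + 0 *\<^sub>R v)) (at 0)"
    using assms unfolding line_deriv_def by (intro DERIV_mult) auto
  then show "((\<lambda>t. f (x + t *\<^sub>R v) * g (x + t *\<^sub>R v)) has_real_derivative f' x * g x + f x * g' x) (at 0)"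
    by (simp add: mult.commute)
qed

lemma line_deriv_add:
  "line_deriv f v f' \<Longrightarrow> line_deriv g v g' \<Longrightarrow> line_deriv (\<lambda>x. f x + g x) v (\<lambda>x. f' x + g' x)"
  unfolding line_deriv_def by (auto intro: DERIV_add)

lemma line_deriv_diff:
  "line_deriv f v f' \<Longrightarrow> line_deriv g v g' \<Longrightarrow> line_deriv (\<lambda>x. f x - g x) v (\<lambda>x. f' x - g' x)"
  unfolding line_deriv_def by (auto intro: DERIV_diff)

lemma line_deriv_sum:
  "(\<And>s. s \<in> A \<Longrightarrow> line_deriv (f s) v (f' s)) \<Longrightarrow> line_deriv (\<lambda>x. \<Sum>s\<in>A. f s x) v (\<lambda>x. \<Sum>s\<in>A. f' s x)"
  unfolding line_deriv_def by (auto intro: DERIV_sum)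

lemma line_deriv_const: "line_deriv (\<lambda>x. c) v (\<lambda>x. 0)"
  unfolding line_deriv_def by auto

lemma line_deriv_inner: "line_deriv (\<lambda>x. x \<bullet> b) v (\<lambda>x. v \<bullet> b)"
  unfolding line_deriv_def by (auto intro!: derivative_eq_intros simp: inner_add_left)

lemma line_deriv_local_zero:
  assumes "line_deriv f v f'" "open S" "x \<in> S" "\<And>y. y \<in> S \<Longrightarrow> f y = c"
  shows "f' x = 0"
proof -
  have d: "((\<lambda>t. f (x + t *\<^sub>R v)) has_real_derivative f' x) (at 0)" using assms unfolding line_deriv_def by blast
  have "continuous_on UNIV (\<lambda>t::real. x + t *\<^sub>R v)" by (intro continuous_intros)
  then have "open ((\<lambda>t::real. x + t *\<^sub>R v) -` S)" using assms(2) by (rule open_vimage[rotated])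
  then have "((\<lambda>t::real. c) has_real_derivative f' x) (at 0)"
    by (rule has_field_derivative_transform_within_open[OF d]) (use assms in auto)
  then show ?thesis using DERIV_const DERIV_unique by metis
qed

lemma line_deriv_support:
  assumes "line_deriv f v f'" "\<And>x. norm x \<ge> \<rho> \<Longrightarrow> f x = 0" "norm x > \<rho>" shows "f' x = 0"
proof (rule line_deriv_local_zero[OF assms(1)])
  show "open (- cball 0 \<rho>)" by auto
qed (use assms in \<open>auto simp: dist_norm\<close>)

text \<open>The integral of a translate does not depend on the translation; differentiating it in
  the translation parameter gives the integral of \<open>h'\<close>.\<close>

lemma integral_line_deriv_zero:
  fixes h :: "'a::euclidean_space \<Rightarrow> real"
  assumes h: "continuous_on UNIV h" "continuous_on UNIV h'" "line_deriv h v h'" and supp: "\<And>x. norm x \<ge> \<rho> \<Longrightarrow> h x = 0"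
  shows "(\<integral>x. h' x \<partial>lborel) = 0"
proof -
  obtain B0 where B0: "\<And>x. \<bar>h x\<bar> \<le> B0" using continuous_bounded_support[OF h(1) supp] by blast
  have "h' x = 0" if "norm x \<ge> \<rho> + 1" for x
    using line_deriv_support[OF h(3) supp] that by auto
  then obtain B where B: "\<And>x. \<bar>h' x\<bar> \<le> B" using continuous_bounded_support[OF h(2), of "\<rho> + 1"] by blast
  have "((\<lambda>t. \<integral>x. 1 * h (x + t *\<^sub>R v) \<partial>lborel) has_real_derivative (\<integral>x. 1 * h' (x + 0 *\<^sub>R v) \<partial>lborel)) (at 0)"
  proof (rule derivative_under_integral[where e=1 and B=B and ?B0.0=B0 and \<rho>="\<rho> + norm v"])
    show "locint (\<lambda>x::'a. 1)" by (rule locint_continuous) auto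
    fix t :: real and x :: 'a assume "\<bar>t - 0\<bar> < (1::real)" "\<rho> + norm v \<le> norm x"
    then have "norm (t *\<^sub>R v) \<le> norm v" by (simp add: mult_left_le_one_le)
    then have "norm (x + t *\<^sub>R v) \<ge> \<rho>" using \<open>\<rho> + norm v \<le> norm x\<close> norm_diff_ineq[of x "t *\<^sub>R v"] by linarith
    then show "h (x + t *\<^sub>R v) = 0" by (rule supp)
  next
    fix t :: real
    have "continuous_on UNIV (\<lambda>x. h (x + t *\<^sub>R v))" by (rule continuous_on_compose2[OF h(1)]) (auto intro!: continuous_intros)
    then show "(\<lambda>x. h (x + t *\<^sub>R v)) \<in> borel_measurable borel" by (rule borel_measurable_continuous_onI)
  qed (use line_deriv_at[OF h(3)] B B0 in auto)
  moreover have "(\<integral>x. 1 * h (x + t *\<^sub>R v) \<partial>lborel) = (\<integral>x. h x \<partial>lborel)" for t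
  proof -
    have "h \<in> borel_measurable borel" by (rule borel_measurable_continuous_onI[OF h(1)])
    then have "integral\<^sup>L (distr lborel borel ((+) (t *\<^sub>R v))) h = (\<integral>x. h (t *\<^sub>R v + x) \<partial>lborel)"
      by (intro integral_distr) auto
    then show ?thesis by (simp add: lborel_distr_plus add.commute)
  qed
  ultimately have "((\<lambda>t. \<integral>x. h x \<partial>lborel) has_real_derivative (\<integral>x. h' x \<partial>lborel)) (at 0)" by simp
  then show ?thesis using DERIV_const DERIV_unique by metis
qed

lemma integral_by_parts_line:
  fixes u :: "'a::euclidean_space \<Rightarrow> real"
  assumes u: "continuous_on UNIV u" "continuous_on UNIV u'" "line_deriv u v u'"
    and w: "continuous_on UNIV w" "continuous_on UNIV w'" "line_deriv w v w'" and supp: "\<And>x. norm x \<ge> \<rho> \<Longrightarrow> w x = 0"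
  shows "integrable lborel (\<lambda>x. u x * w' x)" "integrable lborel (\<lambda>x. u' x * w x)"
    "(\<integral>x. u x * w' x \<partial>lborel) = - (\<integral>x. u' x * w x \<partial>lborel)"
proof -
  obtain B0 where B0: "\<And>x. \<bar>w x\<bar> \<le> B0" using continuous_bounded_support[OF w(1) supp] by blast
  have supp': "w' x = 0" if "norm x \<ge> \<rho> + 1" for x
    using line_deriv_support[OF w(3) supp] that by auto
  then obtain B where B: "\<And>x. \<bar>w' x\<bar> \<le> B" using continuous_bounded_support[OF w(2), of "\<rho> + 1"] by blast
  show i1: "integrable lborel (\<lambda>x. u x * w' x)"
    by (rule locint_integrable_mult[OF locint_continuous[OF u(1)] borel_measurable_continuous_onI[OF w(2)] supp' B])
  show i2: "integrable lborel (\<lambda>x. u' x * w x)"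
    by (rule locint_integrable_mult[OF locint_continuous[OF u(2)] borel_measurable_continuous_onI[OF w(1)] supp B0])
  have "(\<integral>x. u' x * w x + u x * w' x \<partial>lborel) = 0"
    by (rule integral_line_deriv_zero[OF _ _ line_deriv_mult[OF u(3) w(3)], of \<rho>])
       (use u w supp in \<open>auto intro!: continuous_intros\<close>)
  then show "(\<integral>x. u x * w' x \<partial>lborel) = - (\<integral>x. u' x * w x \<partial>lborel)" using i1 i2 by simp
qed

lemma test_fun_line_deriv: "test_fun \<phi> \<Longrightarrow> line_deriv \<phi> v (dirderiv \<phi> v)"
  unfolding line_deriv_def
proof
  fix x :: "real^2" assume "test_fun \<phi>"
  have "((\<lambda>t. x + t *\<^sub>R v) has_derivative (\<lambda>t. t *\<^sub>R v)) (at 0)"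
    by (auto intro!: derivative_eq_intros)
  from has_derivative_compose[OF this, of \<phi>] test_fun_has_derivative[OF \<open>test_fun \<phi>\<close>, of x]
  have d: "((\<lambda>t. \<phi> (x + t *\<^sub>R v)) has_derivative (\<lambda>t. dirderiv \<phi> (t *\<^sub>R v) x)) (at 0)" by simp
  interpret bounded_linear "\<lambda>h. dirderiv \<phi> h x" 
    using test_fun_has_derivative[OF \<open>test_fun \<phi>\<close>] by (rule has_derivative_bounded_linear)
  show "((\<lambda>t. \<phi> (x + t *\<^sub>R v)) has_real_derivative dirderiv \<phi> v x) (at 0)"
    using d by (simp add: has_field_derivative_def scaleR mult.commute[of _ "dirderiv \<phi> v x"])
qed

lemma test_fun_support: 
  assumes "test_fun \<phi>" obtains \<rho> where "\<And>x. norm x \<ge> \<rho> \<Longrightarrow> \<phi> x = 0"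
proof -
  obtain B where "\<And>x. \<phi> x \<noteq> 0 \<Longrightarrow> norm x \<le> B" using assms unfolding test_fun_def bounded_iff by blast
  then show ?thesis using that[of "B + 1"] by force
qed

text \<open>Two integrations by parts. \<open>pd2 \<phi> i j\<close> differentiates along j first
  and along i second, so the outer derivative i moves to \<open>F\<close> first; this fixes the
  order in which \<open>F1 i\<close> is differentiated again along j.\<close>

lemma weak_hessian_classical:
  assumes F: "continuous_on UNIV F" "\<And>i. continuous_on UNIV (F1 i)" "\<And>i j. continuous_on UNIV (F2 i j)"
    and d1: "\<And>i. line_deriv F (axis i 1) (F1 i)" and d2: "\<And>i j. line_deriv (F1 i) (axis j 1) (F2 i j)"
  shows "weak_hessian F F2"
  unfolding weak_hessian_def
proof (intro allI impI)
  fix \<phi> i j assume t: "test_fun \<phi>"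
  let ?\<phi>j = "dirderiv \<phi> (axis j 1)"
  have t1: "test_fun ?\<phi>j" and t2: "test_fun (pd2 \<phi> i j)" unfolding pd2_def using t test_fun_dirderiv by auto
  obtain \<rho> where \<rho>: "\<And>x. norm x \<ge> \<rho> \<Longrightarrow> \<phi> x = 0" using test_fun_support[OF t] by blast
  obtain \<rho>1 where \<rho>1: "\<And>x. norm x \<ge> \<rho>1 \<Longrightarrow> ?\<phi>j x = 0" using test_fun_support[OF t1] by blast
  note a = integral_by_parts_line[OF F(1) F(2) d1[of i] test_fun_continuous[OF t1] test_fun_continuous[OF t2, unfolded pd2_def] test_fun_line_deriv[OF t1] \<rho>1]
  note b = integral_by_parts_line[OF F(2) F(3) d2[of i j] test_fun_continuous[OF t] test_fun_continuous[OF t1] test_fun_line_deriv[OF t] \<rho>]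
  show "integrable lborel (\<lambda>x. F x * pd2 \<phi> i j x) \<and> integrable lborel (\<lambda>x. F2 i j x * \<phi> x) \<and>
        (\<integral>x. F x * pd2 \<phi> i j x \<partial>lborel) = (\<integral>x. F2 i j x * \<phi> x \<partial>lborel)"
    using a b unfolding pd2_def by simp
qed

section \<open>Convolution\<close>

definition cv :: "('a::euclidean_space \<Rightarrow> real) \<Rightarrow> ('a \<Rightarrow> real) \<Rightarrow> 'a \<Rightarrow> real" where
  "cv u k x = (\<integral>w. u w * k (x - w) \<partial>lborel)"

lemma cv_integrable:
  assumes "locint u" "continuous_on UNIV k" "\<And>x. norm x \<ge> \<rho> \<Longrightarrow> k x = 0"
  shows "integrable lborel (\<lambda>w. u w * k (x - w))"
proof -
  obtain B where B: "\<And>x. \<bar>k x\<bar> \<le> B" using continuous_bounded_support[OF assms(2,3)] by blast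
  have "continuous_on UNIV (\<lambda>w. k (x - w))" by (rule continuous_on_compose2[OF assms(2)]) (auto intro!: continuous_intros)
  then show ?thesis
  proof (intro locint_integrable_mult[OF assms(1), where \<rho>="norm x + \<rho>" and B=B])
    fix w :: 'a assume "norm x + \<rho> \<le> norm w"
    then have "norm (x - w) \<ge> \<rho>" using norm_triangle_ineq2[of w x] by (simp add: norm_minus_commute)
    then show "k (x - w) = 0" by (rule assms(3))
  qed (use B borel_measurable_continuous_onI in auto)
qed

text \<open>All derivatives fall on the kernel, so \<open>u\<close> may be rough: it will be a
  continuous function, but also the indicator of a Voronoi cell.\<close>

lemma line_deriv_cv:
  assumes u: "locint u" and k: "continuous_on UNIV k" "continuous_on UNIV k'" "line_deriv k v k'"
    and supp: "\<And>x. norm x \<ge> \<rho> \<Longrightarrow> k x = 0"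
  shows "line_deriv (cv u k) v (cv u k')"
  unfolding line_deriv_def cv_def
proof
  fix x
  obtain B0 where B0: "\<And>x. \<bar>k x\<bar> \<le> B0" using continuous_bounded_support[OF k(1) supp] by blast
  have "k' x = 0" if "norm x \<ge> \<rho> + 1" for x
    using line_deriv_support[OF k(3) supp] that by auto
  then obtain B where B: "\<And>x. \<bar>k' x\<bar> \<le> B" using continuous_bounded_support[OF k(2), of "\<rho> + 1"] by blast
  have eq: "x + t *\<^sub>R v - w = (x - w) + t *\<^sub>R v" for t w by simp
  have "((\<lambda>t. \<integral>w. u w * k (x + t *\<^sub>R v - w) \<partial>lborel) has_real_derivative (\<integral>w. u w * k' (x + 0 *\<^sub>R v - w) \<partial>lborel)) (at 0)"
  proof (rule derivative_under_integral[OF u, where e=1 and B=B and ?B0.0=B0 and \<rho>="norm x + norm v + \<rho>"])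
    fix t w show "((\<lambda>t. k (x + t *\<^sub>R v - w)) has_real_derivative k' (x + t *\<^sub>R v - w)) (at t)"
      unfolding eq by (rule line_deriv_at[OF k(3)])
  next
    fix t :: real and w :: 'a assume "\<bar>t - 0\<bar> < (1::real)" and w: "norm x + norm v + \<rho> \<le> norm w"
    then have "norm (t *\<^sub>R v) \<le> norm v" by (simp add: mult_left_le_one_le)
    then have "norm (x + t *\<^sub>R v) \<le> norm x + norm v" using norm_triangle_ineq[of x "t *\<^sub>R v"] by linarith
    then have "norm (x + t *\<^sub>R v - w) \<ge> \<rho>" using w norm_triangle_ineq2[of w "x + t *\<^sub>R v"] by (simp add: norm_minus_commute)
    then show "k (x + t *\<^sub>R v - w) = 0" by (rule supp)
  next
    fix t :: real
    have "continuous_on UNIV (\<lambda>w. k (x + t *\<^sub>R v - w))" by (rule continuous_on_compose2[OF k(1)]) (auto intro!: continuous_intros)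
    then show "(\<lambda>w. k (x + t *\<^sub>R v - w)) \<in> borel_measurable borel" by (rule borel_measurable_continuous_onI)
  qed (use B B0 in auto)
  then show "((\<lambda>t. \<integral>w. u w * k (x + t *\<^sub>R v - w) \<partial>lborel) has_real_derivative (\<integral>w. u w * k' (x - w) \<partial>lborel)) (at 0)"
    by simp
qed

lemma continuous_cv:
  assumes u: "locint u" and k: "continuous_on UNIV k" and supp: "\<And>x. norm x \<ge> \<rho> \<Longrightarrow> k x = 0"
  shows "continuous_on UNIV (cv u k)"
  unfolding continuous_on_sequentially
proof (intro allI ballI impI, elim conjE)
  fix X :: "nat \<Rightarrow> 'a" and a assume X: "X \<longlonglongrightarrow> a"
  obtain B where B: "B \<ge> 0" "\<And>x. \<bar>k x\<bar> \<le> B" using continuous_bounded_support[OF k supp] by blast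
  obtain R where R: "\<And>n. norm (X n) \<le> R" using X convergent_imp_bounded bounded_iff by (metis rangeI convergent_def)
  have lim: "(\<lambda>n. u w * k (X n - w)) \<longlonglongrightarrow> u w * k (a - w)" for w
  proof -
    have "isCont k (a - w)" using k by (simp add: continuous_on_eq_continuous_at)
    moreover have "(\<lambda>n. X n - w) \<longlonglongrightarrow> a - w" using X by (intro tendsto_intros)
    ultimately have "(\<lambda>n. k (X n - w)) \<longlonglongrightarrow> k (a - w)" by (rule isCont_tendsto_compose)
    then show ?thesis by (rule tendsto_mult_left)
  qed
  have "(\<lambda>n. \<integral>w. u w * k (X n - w) \<partial>lborel) \<longlonglongrightarrow> (\<integral>w. u w * k (a - w) \<partial>lborel)"
  proof (rule integral_dominated_convergence[where w="\<lambda>w. \<bar>B * (indicator (ball 0 (R + \<rho>)) w * u w)\<bar>"])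
    show "integrable lborel (\<lambda>w. \<bar>B * (indicator (ball 0 (R + \<rho>)) w * u w)\<bar>)" using locintD[OF u] by simp
    show "(\<lambda>w. u w * k (a - w)) \<in> borel_measurable lborel" 
      using cv_integrable[OF u k supp] by (rule borel_measurable_integrable)
    show "(\<lambda>w. u w * k (X n - w)) \<in> borel_measurable lborel" for n
      using cv_integrable[OF u k supp] by (rule borel_measurable_integrable)
    fix n
    have "norm (u w * k (X n - w)) \<le> \<bar>B * (indicator (ball 0 (R + \<rho>)) w * u w)\<bar>" for w
    proof (cases "norm w < R + \<rho>")
      case True
      then show ?thesis using mult_right_mono[OF B(2)[of "X n - w"], of "\<bar>u w\<bar>"] B(1) by (simp add: abs_mult mult.commute)
    next
      case False
      then have "norm (X n - w) \<ge> \<rho>" using R[of n] norm_triangle_ineq2[of w "X n"] by (simp add: norm_minus_commute)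
      then show ?thesis using supp by simp
    qed
    then show "AE w in lborel. norm (u w * k (X n - w)) \<le> \<bar>B * (indicator (ball 0 (R + \<rho>)) w * u w)\<bar>" by simp
  qed (use lim in auto)
  then show "(cv u k \<circ> X) \<longlonglongrightarrow> cv u k a" unfolding o_def cv_def .
qed

section \<open>Mollifiers\<close>

definition bump :: "real^2 \<Rightarrow> real" where "bump x = expk 0 (1 - x \<bullet> x)"

definition mollif :: "real^2 \<Rightarrow> real" where "mollif x = inverse (integral\<^sup>L lborel bump) * bump x"

abbreviation mollif1 :: "2 \<Rightarrow> real^2 \<Rightarrow> real" where "mollif1 i \<equiv> dirderiv mollif (axis i 1)"

lemma bumplike_bump: "bumplike bump"
  unfolding bump_def[abs_def] by (rule bumplike.base)

lemma bumplike_mollif: "bumplike mollif"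
  unfolding mollif_def[abs_def] by (intro bumplike.intros bumplike_bump)

lemma bumplike_dirderiv: "bumplike f \<Longrightarrow> bumplike (dirderiv f v)"
  using bumplike_deriv by blast

lemma bumplike_support: "bumplike f \<Longrightarrow> norm x \<ge> 1 \<Longrightarrow> f x = 0"
  using bumplike_deriv by blast

lemma bumplike_continuous: "bumplike f \<Longrightarrow> continuous_on UNIV f"
  by (simp add: test_fun_continuous bumplike_test_fun)

lemma bumplike_nth: "bumplike f \<Longrightarrow> bumplike (\<lambda>x. x $ j * f x)"
  using bumplike.coord[of f "axis j 1"] by (simp add: inner_axis)

lemma bumplike_bounded:
  assumes "bumplike f" obtains B where "B > 0" "\<And>x. \<bar>f x\<bar> \<le> B"
proof -
  obtain B where "B \<ge> 0" and B: "\<And>x. \<bar>f x\<bar> \<le> B"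
    using continuous_bounded_support[OF bumplike_continuous[OF assms] bumplike_support[OF assms]] by blast
  have "\<bar>f x\<bar> \<le> B + 1" for x using B[of x] by simp
  then show ?thesis using that[of "B + 1"] \<open>B \<ge> 0\<close> by auto
qed

lemma bump_nonneg: "bump x \<ge> 0" by (simp add: bump_def expk_nonneg)

lemma integral_bump_pos: "integral\<^sup>L lborel bump > 0"
proof -
  obtain B where B: "\<And>x. \<bar>bump x\<bar> \<le> B" using bumplike_bounded[OF bumplike_bump] by blast
  have "integrable lborel (\<lambda>x. 1 * bump x)"
    by (rule locint_integrable_mult[OF locint_continuous[OF continuous_on_const]
          borel_measurable_continuous_onI[OF bumplike_continuous[OF bumplike_bump]] bumplike_support[OF bumplike_bump] B])
  then have int: "integrable lborel bump" by simp
  have "integral\<^sup>L lborel bump \<noteq> 0"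
  proof
    assume "integral\<^sup>L lborel bump = 0"
    then have "AE x in lborel. bump x = 0"
      using integral_nonneg_eq_0_iff_AE[OF int] bump_nonneg by simp
    then have "AE x in lborel. x \<notin> ball (0::real^2) 1"
    proof (rule AE_mp, intro AE_I2 impI)
      fix x :: "real^2" assume "bump x = 0"
      then have "1 \<le> x \<bullet> x" by (auto simp: bump_def expk_def split: if_splits)
      then have "1 \<le> (norm x)\<^sup>2" by (simp add: dot_square_norm)
      then have "1 \<le> norm x" by (metis abs_norm_cancel abs_square_less_1 linorder_not_less)
      then show "x \<notin> ball 0 1" by simp
    qed
    then have "ball (0::real^2) 1 \<in> null_sets lborel" by (subst AE_iff_null_sets) auto
    then have "emeasure lborel (ball (0::real^2) 1) = 0" by blast
    then show False using content_ball_gt_0_iff[of "0::real^2" 1] by (simp add: measure_def)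
  qed
  moreover have "integral\<^sup>L lborel bump \<ge> 0" using bump_nonneg by (intro integral_nonneg_AE) simp
  ultimately show ?thesis by simp
qed

lemma mollif_nonneg: "mollif x \<ge> 0"
  using integral_bump_pos bump_nonneg by (simp add: mollif_def less_imp_le)

lemma integral_mollif: "integral\<^sup>L lborel mollif = 1"
  unfolding mollif_def[abs_def] using integral_bump_pos by simp

lemma dirderiv_bump: "dirderiv bump v = (\<lambda>x. -2 * (x \<bullet> v) * expk 2 (1 - x \<bullet> x))"
proof
  fix x :: "real^2"
  have 1: "((\<lambda>x::real^2. 1 - x \<bullet> x) has_derivative (\<lambda>h. -(2 * (x \<bullet> h)))) (at x)"
    by (auto intro!: derivative_eq_intros simp: inner_commute)
  show "dirderiv bump v x = -2 * (x \<bullet> v) * expk 2 (1 - x \<bullet> x)"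
    unfolding bump_def[abs_def]
    using dirderiv_has_derivative[OF has_derivative_compose[OF 1 DERIV_expk[of 0, unfolded has_field_derivative_def]], of v] 
    by (simp add: numeral_2_eq_2)
qed

lemma dirderiv_scale: "f differentiable (at x) \<Longrightarrow> dirderiv (\<lambda>x. c * f x) v x = c * dirderiv f v x"
  unfolding differentiable_def
  using dirderiv_has_derivative dirderiv_has_derivative[OF has_derivative_mult_right] by metis

lemma dirderiv_add: "f differentiable (at x) \<Longrightarrow> g differentiable (at x) \<Longrightarrow> dirderiv (\<lambda>x. f x + g x) v x = dirderiv f v x + dirderiv g v x"
  unfolding differentiable_def
  using dirderiv_has_derivative dirderiv_has_derivative[OF has_derivative_add] by metis

lemma dirderiv_nth_mult:
  "f differentiable (at x) \<Longrightarrow> dirderiv (\<lambda>x. x $ j * f x) v x = v $ j * f x + x $ j * dirderiv f v x"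
proof -
  assume "f differentiable (at x)"
  then obtain f' where f': "(f has_derivative f') (at x)" unfolding differentiable_def by blast
  have "((\<lambda>x::real^2. x $ j) has_derivative (\<lambda>h. h $ j)) (at x)"
    by (rule bounded_linear_imp_has_derivative[OF bounded_linear_vec_nth])
  from dirderiv_has_derivative[OF has_derivative_mult[OF this f'], of v] dirderiv_has_derivative[OF f', of v]
  show ?thesis by simp
qed

lemma bumplike_differentiable: "bumplike f \<Longrightarrow> f differentiable (at x)"
  using bumplike_deriv by blast

lemma bumplike_linear_dirderiv:
  assumes "bumplike f" shows "dirderiv f v x = v $ 1 * dirderiv f (axis 1 1) x + v $ 2 * dirderiv f (axis 2 1) x"
proof -
  interpret bounded_linear "\<lambda>h. dirderiv f h x" 
    using test_fun_has_derivative[OF bumplike_test_fun[OF assms]] by (rule has_derivative_bounded_linear)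
  have "v = v $ 1 *\<^sub>R axis 1 1 + v $ 2 *\<^sub>R axis 2 1" by (simp add: vec_eq_iff axis_def forall_2)
  moreover have "dirderiv f (a *\<^sub>R axis 1 1 + b *\<^sub>R axis 2 1) x = a * dirderiv f (axis 1 1) x + b * dirderiv f (axis 2 1) x" for a b
    by (simp add: add scaleR)
  ultimately show ?thesis by metis
qed

text \<open>The symmetry is read off the explicit second derivative of \<open>bump\<close>, in which
  v and w enter only through \<open>w \<bullet> v\<close> and the product of
  \<open>x \<bullet> v\<close> and \<open>x \<bullet> w\<close>.\<close>

lemma mixed_dirderiv_mollif: "dirderiv (dirderiv mollif v) w x = dirderiv (dirderiv mollif w) v x"
proof -
  have 1: "((\<lambda>x::real^2. 1 - x \<bullet> x) has_derivative (\<lambda>h. -(2 * (x \<bullet> h)))) (at x)"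
    by (auto intro!: derivative_eq_intros simp: inner_commute)
  note e = has_derivative_compose[OF 1 DERIV_expk[of 2, unfolded has_field_derivative_def]]
  have "dirderiv (dirderiv bump v) w x = -2 * (w \<bullet> v) * expk 2 (1 - x \<bullet> x) - 2 * (x \<bullet> v) * ((expk 4 (1 - x \<bullet> x) - 2 * expk 3 (1 - x \<bullet> x)) * - (2 * (x \<bullet> w)))" for v w
  proof -
    have "((\<lambda>x::real^2. -2 * (x \<bullet> v)) has_derivative (\<lambda>h. -2 * (h \<bullet> v))) (at x)"
      by (auto intro!: derivative_eq_intros)
    from dirderiv_has_derivative[OF has_derivative_mult[OF this e], of w]
    show ?thesis unfolding dirderiv_bump by (simp add: algebra_simps eval_nat_numeral)
  qed
  then have b: "dirderiv (dirderiv bump v) w x = dirderiv (dirderiv bump w) v x" for v w by (simp add: inner_commute)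
  have m: "dirderiv mollif v = (\<lambda>x. inverse (integral\<^sup>L lborel bump) * dirderiv bump v x)" for v
    unfolding mollif_def[abs_def] by (rule ext, rule dirderiv_scale, rule bumplike_differentiable[OF bumplike_bump])
  show ?thesis unfolding m using b by (simp add: dirderiv_scale bumplike_differentiable bumplike_dirderiv bumplike_bump)
qed

text \<open>For \<open>m = 2\<close> and \<open>k = mollif\<close> this is the usual mollifier at
  scale r in the plane. A derivative in x raises \<open>m\<close> by one and replaces
  \<open>k\<close> by its derivative, so the notation carries the powers of r.\<close>

definition kern :: "nat \<Rightarrow> (real^2 \<Rightarrow> real) \<Rightarrow> real \<Rightarrow> real^2 \<Rightarrow> real" where
  "kern m k r x = k (x /\<^sub>R r) / r ^ m"

lemma kern_continuous: "bumplike k \<Longrightarrow> r > 0 \<Longrightarrow> continuous_on UNIV (kern m k r)"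
  unfolding kern_def[abs_def] 
  by (intro continuous_intros continuous_on_compose2[OF bumplike_continuous]) auto

lemma kern_support: "bumplike k \<Longrightarrow> r > 0 \<Longrightarrow> norm x \<ge> r \<Longrightarrow> kern m k r x = 0"
  using bumplike_support[of k "x /\<^sub>R r"] by (simp add: kern_def field_simps)

lemma kern_line_deriv:
  assumes "bumplike k" "r > 0" shows "line_deriv (kern m k r) v (kern (Suc m) (dirderiv k v) r)"
  unfolding line_deriv_def
proof
  fix x
  have "((\<lambda>t. k (x /\<^sub>R r + t *\<^sub>R v)) has_real_derivative dirderiv k v (x /\<^sub>R r + (0/r) *\<^sub>R v)) (at (0 / r))"
    using line_deriv_at[OF test_fun_line_deriv[OF bumplike_test_fun[OF assms(1)]]] .
  moreover have "((\<lambda>t. t / r) has_real_derivative 1 / r) (at 0)" using assms(2) by (auto intro!: derivative_eq_intros)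
  ultimately have "((\<lambda>t. k (x /\<^sub>R r + (t / r) *\<^sub>R v)) has_real_derivative dirderiv k v (x /\<^sub>R r) * (1 / r)) (at 0)"
    using DERIV_chain2[of "\<lambda>t. k (x /\<^sub>R r + t *\<^sub>R v)" _ "\<lambda>t. t / r" 0] by force
  then have "((\<lambda>t. k (x /\<^sub>R r + (t / r) *\<^sub>R v) / r ^ m) has_real_derivative dirderiv k v (x /\<^sub>R r) * (1 / r) / r ^ m) (at 0)"
    by (rule DERIV_cdivide)
  then show "((\<lambda>t. kern m k r (x + t *\<^sub>R v)) has_real_derivative kern (Suc m) (dirderiv k v) r x) (at 0)"
    by (simp add: kern_def scaleR_add_right divide_inverse mult_ac)
qed

text \<open>The kernel, as a function of the integration variable, is a reflected bump and hence a
  test function. The two signs from differentiating the reflection twice cancel.\<close>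

lemma weak_hessian_kern:
  assumes "weak_hessian F g" "bumplike k" "r > 0"
  shows "cv F (kern (Suc (Suc m)) (pd2 k i j) r) x = cv (g i j) (kern m k r) x" 
    and "integrable lborel (\<lambda>w. g i j w * kern m k r (x - w))"
proof -
  define \<phi> where "\<phi> = (\<lambda>w. (1 / r ^ m) * k ((x - w) /\<^sub>R r))"
  have t: "test_fun \<phi>" unfolding \<phi>_def using assms by (intro test_fun_reflect bumplike_test_fun) auto
  have p1: "dirderiv \<phi> v = (\<lambda>w. (- (1 / r ^ m) / r) * dirderiv k v ((x - w) /\<^sub>R r))" for v
    unfolding \<phi>_def by (rule ext, rule dirderiv_reflect, rule bumplike_differentiable[OF assms(2)])
  have p2: "pd2 \<phi> i j = (\<lambda>w. (- (- (1 / r ^ m) / r) / r) * pd2 k i j ((x - w) /\<^sub>R r))"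
    unfolding pd2_def p1 
    by (rule ext, rule dirderiv_reflect, rule bumplike_differentiable[OF bumplike_dirderiv[OF assms(2)]])
  have e2: "pd2 \<phi> i j w = kern (Suc (Suc m)) (pd2 k i j) r (x - w)" for w unfolding p2 using assms(3) by (simp add: kern_def)
  have e1: "kern m k r (x - w) = \<phi> w" for w unfolding \<phi>_def by (simp add: kern_def)
  show "cv F (kern (Suc (Suc m)) (pd2 k i j) r) x = cv (g i j) (kern m k r) x" 
    "integrable lborel (\<lambda>w. g i j w * kern m k r (x - w))"
    using assms(1) t unfolding weak_hessian_def cv_def e1 e2[symmetric] by auto
qed

lemma integral_kern: 
  assumes "r > 0" shows "(\<integral>w. kern 2 mollif r (x - w) \<partial>lborel) = 1"
proof -
  have m: "mollif \<in> borel_measurable borel" by (rule borel_measurable_continuous_onI[OF bumplike_continuous[OF bumplike_mollif]])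
  have "1 = integral\<^sup>L lborel mollif" by (simp add: integral_mollif)
  also have "\<dots> = integral\<^sup>L (density (distr lborel borel (\<lambda>w. x /\<^sub>R r + (- 1 / r) *\<^sub>R w)) (\<lambda>_. ennreal (\<bar>- 1 / r\<bar> ^ DIM(real^2)))) mollif"
    using lborel_affine[of "- 1 / r" "x /\<^sub>R r"] assms by simp
  also have "\<dots> = integral\<^sup>L (distr lborel borel (\<lambda>w. x /\<^sub>R r + (- 1 / r) *\<^sub>R w)) (\<lambda>w. (\<bar>- 1 / r\<bar> ^ DIM(real^2)) * mollif w)"
    by (subst integral_density) (use m in auto)
  also have "\<dots> = (\<integral>w. (\<bar>- 1 / r\<bar> ^ DIM(real^2)) * mollif (x /\<^sub>R r + (- 1 / r) *\<^sub>R w) \<partial>lborel)"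
    by (rule integral_distr) (use m in auto)
  also have "\<dots> = (\<integral>w. kern 2 mollif r (x - w) \<partial>lborel)"
    using assms by (intro Bochner_Integration.integral_cong) (auto simp: kern_def field_simps scaleR_diff_right power2_eq_square)
  finally show ?thesis by simp
qed

lemma cv_kern_tendsto:
  assumes F: "continuous_on UNIV F" 
  shows "((\<lambda>r. cv F (kern 2 mollif r) x) \<longlongrightarrow> F x) (at_right 0)"
proof (rule tendstoI)
  fix e :: real assume "e > 0"
  have "isCont F x" using F by (simp add: continuous_on_eq_continuous_at)
  then obtain d where d: "d > 0" "\<And>w. dist w x < d \<Longrightarrow> dist (F w) (F x) < e/2" 
    unfolding continuous_at_eps_delta using \<open>e > 0\<close> by (metis half_gt_zero)
  have "dist (cv F (kern 2 mollif r) x) (F x) < e" if r: "0 < r" "r < d" for r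
  proof -
    have c: "continuous_on UNIV (kern 2 mollif r)" and s: "norm x \<ge> r \<Longrightarrow> kern 2 mollif r x = 0" for x
      using kern_continuous kern_support bumplike_mollif r by auto
    have k0: "kern 2 mollif r y \<ge> 0" for y by (simp add: kern_def mollif_nonneg)
    have i1: "integrable lborel (\<lambda>w. F w * kern 2 mollif r (x - w))"
      by (rule cv_integrable[OF locint_continuous[OF F] c s])
    have i2: "integrable lborel (\<lambda>w. 1 * kern 2 mollif r (x - w))"
      by (rule cv_integrable[OF locint_continuous[OF continuous_on_const] c s])
    have "cv F (kern 2 mollif r) x - F x = (\<integral>w. F w * kern 2 mollif r (x - w) - F x * kern 2 mollif r (x - w) \<partial>lborel)"
      unfolding cv_def using i1 i2 integral_kern[OF r(1)] by simp
    also have "\<bar>\<dots>\<bar> \<le> (\<integral>w. (e/2) * kern 2 mollif r (x - w) \<partial>lborel)"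
    proof (rule integral_abs_bound_integral)
      show "integrable lborel (\<lambda>w. F w * kern 2 mollif r (x - w) - F x * kern 2 mollif r (x - w))" using i1 i2 by simp
      show "integrable lborel (\<lambda>w. (e/2) * kern 2 mollif r (x - w))" using i2 by simp
      fix w
      show "\<bar>F w * kern 2 mollif r (x - w) - F x * kern 2 mollif r (x - w)\<bar> \<le> e / 2 * kern 2 mollif r (x - w)"
      proof (cases "norm (x - w) < r")
        case True
        then have "\<bar>F w - F x\<bar> \<le> e/2" using d(2)[of w] r by (simp add: dist_norm norm_minus_commute)
        from mult_right_mono[OF this k0[of "x - w"]] show ?thesis using k0 by (simp add: left_diff_distrib[symmetric] abs_mult)
      qed (simp add: s)
    qed
    also have "\<dots> = e/2" using integral_kern[OF r(1)] by simp
    finally show ?thesis using \<open>e > 0\<close> by (simp add: dist_real_def)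
  qed
  then show "\<forall>\<^sub>F r in at_right 0. dist (cv F (kern 2 mollif r) x) (F x) < e"
    unfolding eventually_at_right_field using d(1) by blast
qed

text \<open>The scale r enters through the argument and through \<open>r ^ m\<close>; together they
  produce the operator \<open>m * k y + dirderiv k y y\<close>, an Euler operator shifted by the
  order \<open>m\<close>.\<close>

lemma kern_scale_deriv:
  assumes "bumplike k" "r > 0"
  shows "((\<lambda>r. kern m k r x) has_real_derivative - kern (Suc m) (\<lambda>y. m * k y + dirderiv k y y) r x) (at r)"
proof -
  have 1: "((\<lambda>r. x /\<^sub>R r) has_derivative (\<lambda>h. (- h / r\<^sup>2) *\<^sub>R x)) (at r)"
    using assms(2) by (auto intro!: derivative_eq_intros simp: field_simps power2_eq_square)
  from has_derivative_compose[OF this, of k] test_fun_has_derivative[OF bumplike_test_fun[OF assms(1)], of "x /\<^sub>R r"]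
  have d: "((\<lambda>r. k (x /\<^sub>R r)) has_derivative (\<lambda>h. dirderiv k ((- h / r\<^sup>2) *\<^sub>R x) (x /\<^sub>R r))) (at r)" by simp
  interpret bounded_linear "\<lambda>h. dirderiv k h (x /\<^sub>R r)" 
    using test_fun_has_derivative[OF bumplike_test_fun[OF assms(1)]] by (rule has_derivative_bounded_linear)
  have e: "(\<lambda>h. dirderiv k ((- h / r\<^sup>2) *\<^sub>R x) (x /\<^sub>R r)) = (*) (- (1 / r) * dirderiv k (x /\<^sub>R r) (x /\<^sub>R r))"
    unfolding scaleR using assms(2) by (auto simp: field_simps power2_eq_square)
  from d have "((\<lambda>r. k (x /\<^sub>R r)) has_real_derivative - (1 / r) * dirderiv k (x /\<^sub>R r) (x /\<^sub>R r)) (at r)"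
    unfolding has_field_derivative_def e .
  then have "((\<lambda>r. k (x /\<^sub>R r) / r ^ m) has_real_derivative 
     (- (1 / r) * dirderiv k (x /\<^sub>R r) (x /\<^sub>R r) * r ^ m - k (x /\<^sub>R r) * (m * r ^ (m - 1))) / (r ^ m * r ^ m)) (at r)"
    by (rule DERIV_divide) (use assms(2) in \<open>auto intro!: derivative_eq_intros\<close>)
  moreover have "(- (1 / r) * dirderiv k (x /\<^sub>R r) (x /\<^sub>R r) * r ^ m - k (x /\<^sub>R r) * (m * r ^ (m - 1))) / (r ^ m * r ^ m)
    = - kern (Suc m) (\<lambda>y. m * k y + dirderiv k y y) r x"
  proof (cases m)
    case (Suc n) then show ?thesis using assms(2) unfolding kern_def by (simp add: divide_simps) (simp add: algebra_simps)
  qed (use assms(2) in \<open>simp add: kern_def field_simps\<close>)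
  ultimately show ?thesis unfolding kern_def by simp
qed

text \<open>The radial derivative of the kernel of \<open>\<partial>\<^sub>i F\<close> is a pure second derivative: this is what lets
  the weak Hessian act on it.\<close>

lemma mollif_identity:
  "real 3 * mollif1 i y + dirderiv (mollif1 i) y y = (\<Sum>j\<in>UNIV. pd2 (\<lambda>y. y $ j * mollif y) i j y)"
proof -
  have d: "mollif differentiable (at x)" "dirderiv mollif v differentiable (at x)" 
    "(\<lambda>x. x $ j * dirderiv mollif v x) differentiable (at x)" "(\<lambda>x. c * mollif x) differentiable (at x)" for v x j c
    using bumplike_differentiable bumplike_dirderiv bumplike_mollif bumplike_nth bumplike.scale by auto
  have 1: "dirderiv (\<lambda>y. y $ j * mollif y) (axis j 1) = (\<lambda>y. 1 * mollif y + y $ j * dirderiv mollif (axis j 1) y)" for j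
    by (rule ext, subst dirderiv_nth_mult[OF d(1)]) simp
  have "pd2 (\<lambda>y. y $ j * mollif y) i j y = mollif1 i y + (axis i 1 $ j * mollif1 j y + y $ j * dirderiv (mollif1 j) (axis i 1) y)" for j
    unfolding pd2_def 1 using d by (simp add: dirderiv_add dirderiv_nth_mult)
  also have "\<dots> j = mollif1 i y + (axis i 1 $ j * mollif1 j y + y $ j * dirderiv (mollif1 i) (axis j 1) y)" for j
    by (subst mixed_dirderiv_mollif) simp
  finally show ?thesis
    using bumplike_linear_dirderiv[OF bumplike_dirderiv[OF bumplike_mollif, of "axis i 1"], of y y] exhaust_2[of i]
    by (auto simp: sum_2 axis_def)
qed

definition hnorm :: "(2 \<Rightarrow> 2 \<Rightarrow> real^2 \<Rightarrow> real) \<Rightarrow> real^2 \<Rightarrow> real" where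
  "hnorm g x = sqrt (\<Sum>i\<in>UNIV. \<Sum>j\<in>UNIV. (g i j x)\<^sup>2)"

lemma hnorm_nonneg: "hnorm g x \<ge> 0" by (simp add: hnorm_def sum_nonneg)

lemma abs_le_hnorm: "\<bar>g i j x\<bar> \<le> hnorm g x"
proof -
  have "(g i j x)\<^sup>2 \<le> (\<Sum>j\<in>UNIV. (g i j x)\<^sup>2)" by (rule member_le_sum) auto
  also have "\<dots> \<le> (\<Sum>i\<in>UNIV. \<Sum>j\<in>UNIV. (g i j x)\<^sup>2)" 
    by (rule member_le_sum[where f="\<lambda>i. \<Sum>j\<in>UNIV. (g i j x)\<^sup>2"]) (auto intro: sum_nonneg)
  finally have "sqrt ((g i j x)\<^sup>2) \<le> hnorm g x" unfolding hnorm_def by (rule real_sqrt_le_mono)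
  then show ?thesis by simp
qed

text \<open>Hoelder's inequality on a ball, from the elementary bound
  \<open>h \<le> l + h powr q * l powr (1 - q)\<close> with an optimal level \<open>l\<close>. The 5
  is 4 + 1, where 4 replaces pi in the area.\<close>

lemma mean_bound:
  fixes x :: "real^2"
  assumes q: "q > 1" and r: "r > 0" and h: "\<And>w. h w \<ge> 0" "h \<in> borel_measurable borel"
    and int: "set_integrable lborel (ball x r) (\<lambda>w. h w powr q)"
    and I: "(LINT w:ball x r|lborel. h w powr q) \<le> I"
  shows "set_integrable lborel (ball x r) h"
    "(LINT w:ball x r|lborel. h w) \<le> 5 * r powr (2 - 2/q) * I powr (1/q)"
proof -
  have cont: "measure lborel (ball x r) \<le> 4 * r\<^sup>2"
  proof -
    have "measure lborel (ball x r) = pi * r\<^sup>2" using content_ball[of r x] r by (simp add: unit_ball_vol_2)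
    then show ?thesis using pi_less_4 by (simp add: mult_right_mono)
  qed
  have young: "h w \<le> l + h w powr q * l powr (1 - q)" if "l > 0" for l w
  proof (cases "h w \<le> l")
    case False
    have "h w = h w powr q * h w powr (1 - q)" using False that by (simp add: powr_add[symmetric])
    also have "\<dots> \<le> h w powr q * l powr (1 - q)" using False that q by (intro mult_left_mono powr_mono2') auto
    finally show ?thesis using that by simp
  qed (simp add: add_increasing2)
  have ic: "set_integrable lborel (ball x r) (\<lambda>w. l)" for l :: real
    unfolding set_integrable_def using emeasure_bounded_finite[OF bounded_ball, of x r] 
    by (intro integrable_scaleR_left integrable_real_indicator) auto
  have ii: "set_integrable lborel (ball x r) (\<lambda>w. l + h w powr q * l powr (1 - q))" for l
    by (intro set_integral_add ic set_integrable_mult_left impI int)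
  show i: "set_integrable lborel (ball x r) h"
  proof (rule set_integrable_bound[OF ii[of 1]])
    show "set_borel_measurable lborel (ball x r) h" unfolding set_borel_measurable_def using h(2) by (intro borel_measurable_scaleR borel_measurable_indicator) auto
    show "AE w in lborel. w \<in> ball x r \<longrightarrow> norm (h w) \<le> norm (1 + h w powr q * 1 powr (1 - q))"
      using young[of 1] h(1) by (intro AE_I2) (simp add: abs_of_nonneg add_nonneg_nonneg)
  qed
  define I0 where "I0 = (LINT w:ball x r|lborel. h w powr q)"
  have I0n: "I0 \<ge> 0" unfolding I0_def set_lebesgue_integral_def by (intro integral_nonneg_AE) simp
  have "(LINT w:ball x r|lborel. h w) \<le> 5 * r powr (2 - 2/q) * I0 powr (1/q)"
  proof (cases "I0 = 0")
    case True
    have "AE w in lborel. indicator (ball x r) w *\<^sub>R (h w powr q) = 0"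
      using True int unfolding I0_def set_lebesgue_integral_def set_integrable_def
      by (subst (asm) integral_nonneg_eq_0_iff_AE) auto
    then have "AE w in lborel. indicator (ball x r) w *\<^sub>R h w = 0" by eventually_elim auto
    then have "(LINT w:ball x r|lborel. h w) = 0" unfolding set_lebesgue_integral_def by (rule integral_eq_zero_AE)
    then show ?thesis using True by simp
  next
    case False
    then have I0: "I0 > 0" using I0n by simp
    \<comment> \<open>This level balances the two terms: with it the second one equals
      \<open>l * r\<^sup>2\<close>.\<close>
    define l where "l = (I0 / r\<^sup>2) powr (1/q)"
    have l: "l > 0" using I0 r by (simp add: l_def)
    have "(LINT w:ball x r|lborel. h w) \<le> (LINT w:ball x r|lborel. l + h w powr q * l powr (1 - q))"
      by (rule set_integral_mono[OF i ii young[OF l]])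
    also have "\<dots> = (LINT w:ball x r|lborel. l) + (LINT w:ball x r|lborel. h w powr q * l powr (1 - q))"
      by (intro set_integral_add ic set_integrable_mult_left impI int)
    also have "\<dots> = l * measure lborel (ball x r) + I0 * l powr (1 - q)" 
      using emeasure_bounded_finite[OF bounded_ball, of x r] by (simp add: I0_def set_lebesgue_integral_def)
    also have "\<dots> \<le> l * (4 * r\<^sup>2) + I0 * l powr (1 - q)" using cont l by (intro add_right_mono mult_left_mono) auto
    also have "I0 * l powr (1 - q) = l * r\<^sup>2"
    proof -
      have "l powr (1 - q) = l * l powr (- q)" using l by (simp add: powr_diff powr_minus field_simps)
      moreover have "l powr (- q) = r\<^sup>2 / I0" using q I0 r unfolding l_def powr_powr by (simp add: powr_minus)
      ultimately show ?thesis using I0 by simp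
    qed
    also have "l * (4 * r\<^sup>2) + l * r\<^sup>2 = 5 * r powr (2 - 2/q) * I0 powr (1/q)"
    proof -
      have r2: "r\<^sup>2 = r powr 2" using r by simp
      have l': "l = I0 powr (1/q) / r powr (2/q)" unfolding l_def r2 using I0 r by (subst powr_divide) (simp_all add: powr_powr del: powr_numeral)
      have "l * (4 * r\<^sup>2) + l * r\<^sup>2 = 5 * r powr 2 * l" unfolding r2 by simp
      also have "\<dots> = 5 * (r powr 2 / r powr (2/q)) * I0 powr (1/q)" unfolding l' by simp
      also have "r powr 2 / r powr (2/q) = r powr (2 - 2/q)" by (simp only: powr_diff)
      finally show ?thesis .
    qed
    finally show ?thesis .
  qed
  also have "\<dots> \<le> 5 * r powr (2 - 2/q) * I powr (1/q)" using I I0n q unfolding I0_def[symmetric] 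
    by (intro mult_left_mono powr_mono2) auto
  finally show "(LINT w:ball x r|lborel. h w) \<le> 5 * r powr (2 - 2/q) * I powr (1/q)" .
qed

lemma cv_kern_bound:
  assumes k: "bumplike k" "\<And>y. \<bar>k y\<bar> \<le> B" and r: "r > 0"
    and int: "set_integrable lborel (ball x r) h" and h: "\<And>w. \<bar>u w\<bar> \<le> h w"
  shows "\<bar>cv u (kern m k r) x\<bar> \<le> B / r ^ m * (LINT w:ball x r|lborel. h w)"
proof -
  have B: "B \<ge> 0" using k(2)[of 0] by simp
  have ih: "integrable lborel (\<lambda>w. B / r ^ m * (indicator (ball x r) w *\<^sub>R h w))"
    using int unfolding set_integrable_def by simp
  have *: "\<bar>u w * kern m k r (x - w)\<bar> \<le> B / r ^ m * (indicator (ball x r) w *\<^sub>R h w)" for w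
    proof (cases "norm (x - w) < r")
      case True
      have "\<bar>u w * kern m k r (x - w)\<bar> \<le> h w * (B / r ^ m)"
        unfolding abs_mult using r k(2) h B by (intro mult_mono) (auto simp: kern_def divide_right_mono order_trans[OF abs_ge_zero h])
      then show ?thesis using True by (simp add: dist_norm mult.commute)
    next
      case False
      then show ?thesis using kern_support[OF k(1) r] by (simp add: dist_norm)
    qed
  have "\<bar>cv u (kern m k r) x\<bar> \<le> (\<integral>w. B / r ^ m * (indicator (ball x r) w *\<^sub>R h w) \<partial>lborel)"
  proof (cases "integrable lborel (\<lambda>w. u w * kern m k r (x - w))")
    case True
    then show ?thesis unfolding cv_def using * by (intro integral_abs_bound_integral ih) auto
  next
    \<comment> \<open>A function that is not integrable has Bochner integral 0, for which the bound
      is trivial.\<close>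
    case False
    then have "cv u (kern m k r) x = 0" unfolding cv_def by (rule not_integrable_integral_eq)
    moreover have "0 \<le> (\<integral>w. B / r ^ m * (indicator (ball x r) w *\<^sub>R h w) \<partial>lborel)"
      by (intro integral_nonneg_AE AE_I2 order_trans[OF abs_ge_zero *])
    ultimately show ?thesis by simp
  qed
  then show ?thesis unfolding set_lebesgue_integral_def by simp
qed

text \<open>By \<open>mollif_identity\<close> the derivative in the scale turns the kernel of a
  first derivative of \<open>F\<close> into a sum of second derivatives of kernels; two of the four
  powers of r are then used up by passing to the weak Hessian.\<close>

lemma radial_derivative:
  assumes F: "continuous_on UNIV F" "weak_hessian F g" and r: "r > 0"
  shows "((\<lambda>r. cv F (kern 3 (mollif1 i) r) x) has_real_derivative 
     - (\<Sum>j\<in>UNIV. cv (g i j) (kern 2 (\<lambda>y. y $ j * mollif y) r) x)) (at r)"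
proof -
  let ?k = "mollif1 i" and ?k' = "\<lambda>y. \<Sum>j\<in>UNIV. pd2 (\<lambda>y. y $ j * mollif y) i j y"
  have k: "bumplike ?k" by (rule bumplike_dirderiv[OF bumplike_mollif])
  have bj: "bumplike (\<lambda>y. y $ j * mollif y)" for j by (rule bumplike_nth[OF bumplike_mollif])
  have pj: "bumplike (pd2 (\<lambda>y. y $ j * mollif y) i j)" for j unfolding pd2_def by (intro bumplike_dirderiv bj)
  have k': "bumplike ?k'" unfolding sum_2 by (intro bumplike.add pj)
  obtain B where B: "B > 0" "\<And>y. \<bar>?k' y\<bar> \<le> B" using bumplike_bounded[OF k'] by blast
  obtain B0 where B0: "B0 > 0" "\<And>y. \<bar>?k y\<bar> \<le> B0" using bumplike_bounded[OF k] by blast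
  \<comment> \<open>Within distance \<open>r/2\<close> of r the scale stays away from 0, so the
    kernels and their scale derivatives are uniformly bounded.\<close>
  have pos: "t > r/2" if "\<bar>t - r\<bar> < r/2" for t using that by (auto simp: abs_if split: if_splits)
  have bk: "\<bar>kern m h t y\<bar> \<le> C / (r/2)^m" if "\<bar>t - r\<bar> < r/2" "\<And>y. \<bar>h y\<bar> \<le> C" for m h t y C
  proof -
    have "\<bar>kern m h t y\<bar> \<le> C / t ^ m" using pos[OF that(1)] r that(2) by (simp add: kern_def divide_right_mono)
    also have "\<dots> \<le> C / (r/2)^m" using pos[OF that(1)] r order_trans[OF abs_ge_zero that(2)[of 0]] 
      by (intro divide_left_mono power_mono mult_pos_pos) auto
    finally show ?thesis .
  qed
  have "((\<lambda>t. \<integral>w. F w * kern 3 ?k t (x - w) \<partial>lborel) has_real_derivative (\<integral>w. F w * (- kern 4 ?k' r (x - w)) \<partial>lborel)) (at r)"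
  proof (rule derivative_under_integral[where e="r/2" and B="B / (r/2)^4" and ?B0.0="B0 / (r/2)^3" and \<rho>="norm x + 2 * r"])
    show "locint F" by (rule locint_continuous[OF F(1)])
    fix t w assume t: "\<bar>t - r\<bar> < r/2"
    have eq: "(\<lambda>y. real 3 * ?k y + dirderiv ?k y y) = ?k'" by (rule ext, rule mollif_identity)
    show "((\<lambda>t. kern 3 ?k t (x - w)) has_real_derivative - kern 4 ?k' t (x - w)) (at t)"
      using kern_scale_deriv[OF k, of t 3 "x - w"] pos[OF t] r unfolding eq by simp
    show "\<bar>- kern 4 ?k' t (x - w)\<bar> \<le> B / (r/2)^4" using bk[OF t B(2)] by simp
    show "\<bar>kern 3 ?k t (x - w)\<bar> \<le> B0 / (r/2)^3" using bk[OF t B0(2)] by simp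
    show "kern 3 ?k t (x - w) = 0" if "norm x + 2 * r \<le> norm w"
    proof (rule kern_support[OF k])
      show "t > 0" using pos[OF t] r by simp
      have "t \<le> 2 * r" using t by (auto simp: abs_if split: if_splits)
      then show "t \<le> norm (x - w)" using that norm_triangle_ineq2[of w x] by (simp add: norm_minus_commute)
    qed
  next
    fix t assume t: "\<bar>t - r\<bar> < r/2"
    have "continuous_on UNIV (\<lambda>w. kern 3 ?k t (x - w))" 
      by (rule continuous_on_compose2[OF kern_continuous[OF k]]) (use pos[OF t] r in \<open>auto intro!: continuous_intros\<close>)
    then show "(\<lambda>w. kern 3 ?k t (x - w)) \<in> borel_measurable borel" by (rule borel_measurable_continuous_onI)
  qed (use r in auto)
  moreover have "(\<integral>w. F w * (- kern 4 ?k' r (x - w)) \<partial>lborel) = - (\<Sum>j\<in>UNIV. cv (g i j) (kern 2 (\<lambda>y. y $ j * mollif y) r) x)"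
  proof -
    have i: "integrable lborel (\<lambda>w. F w * kern 4 (pd2 (\<lambda>y. y $ j * mollif y) i j) r (x - w))" for j
      by (rule cv_integrable[OF locint_continuous[OF F(1)] kern_continuous[OF pj r] kern_support[OF pj r]])
    have "(\<integral>w. F w * (- kern 4 ?k' r (x - w)) \<partial>lborel) = (\<integral>w. - (\<Sum>j\<in>UNIV. F w * kern 4 (pd2 (\<lambda>y. y $ j * mollif y) i j) r (x - w)) \<partial>lborel)"
      by (rule Bochner_Integration.integral_cong) (auto simp: kern_def sum_divide_distrib sum_distrib_left)
    also have "\<dots> = - (\<Sum>j\<in>UNIV. cv F (kern 4 (pd2 (\<lambda>y. y $ j * mollif y) i j) r) x)"
      unfolding cv_def using i by simp
    also have "\<dots> = - (\<Sum>j\<in>UNIV. cv (g i j) (kern 2 (\<lambda>y. y $ j * mollif y) r) x)"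
      using weak_hessian_kern(1)[OF F(2) bj r, of 2] by (simp add: numeral_eq_Suc)
    finally show ?thesis .
  qed
  ultimately show ?thesis unfolding cv_def by simp
qed

lemma bump_bounds:
  obtains B where "B > 0" "\<And>y. \<bar>mollif y\<bar> \<le> B" "\<And>j y. \<bar>y $ j * mollif y\<bar> \<le> B"
proof -
  obtain B0 where B0: "B0 > 0" "\<And>y. \<bar>mollif y\<bar> \<le> B0" using bumplike_bounded[OF bumplike_mollif] by blast
  have "\<bar>y $ j * mollif y\<bar> \<le> B0" for j and y :: "real^2"
  proof (cases "norm y \<ge> 1")
    case False
    then have "\<bar>y $ j\<bar> \<le> 1" using component_le_norm_cart[of y j] by simp
    then have "\<bar>y $ j\<bar> * \<bar>mollif y\<bar> \<le> 1 * B0" using B0 by (intro mult_mono) auto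
    then show ?thesis by (simp add: abs_mult)
  qed (use B0 bumplike_support[OF bumplike_mollif] in auto)
  then show ?thesis using that B0 by blast
qed

lemma dirderiv_mollif_expand:
  "cv F (kern 4 (dirderiv (mollif1 i) v) r) x = v $ 1 * cv F (kern 4 (pd2 mollif 1 i) r) x + v $ 2 * cv F (kern 4 (pd2 mollif 2 i) r) x"
  "cv F (kern 3 (dirderiv mollif v) r) x = v $ 1 * cv F (kern 3 (mollif1 1) r) x + v $ 2 * cv F (kern 3 (mollif1 2) r) x"
  if F: "continuous_on UNIV F" and r: "r > 0"
proof -
  have gen: "cv F (kern m (dirderiv k v) r) x = v $ 1 * cv F (kern m (dirderiv k (axis 1 1)) r) x + v $ 2 * cv F (kern m (dirderiv k (axis 2 1)) r) x"
    if k: "bumplike k" for k m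
  proof -
    have i: "integrable lborel (\<lambda>w. F w * kern m (dirderiv k u) r (x - w))" for u
      by (rule cv_integrable[OF locint_continuous[OF F] kern_continuous[OF bumplike_dirderiv[OF k] r] kern_support[OF bumplike_dirderiv[OF k] r]])
    have "kern m (dirderiv k v) r y = v $ 1 * kern m (dirderiv k (axis 1 1)) r y + v $ 2 * kern m (dirderiv k (axis 2 1)) r y" for y
      unfolding kern_def bumplike_linear_dirderiv[OF k, of v] by (simp add: add_divide_distrib)
    then have "cv F (kern m (dirderiv k v) r) x = (\<integral>w. v $ 1 * (F w * kern m (dirderiv k (axis 1 1)) r (x - w)) + v $ 2 * (F w * kern m (dirderiv k (axis 2 1)) r (x - w)) \<partial>lborel)"
      unfolding cv_def by (intro Bochner_Integration.integral_cong) (auto simp: algebra_simps)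
    then show ?thesis using i unfolding cv_def by simp
  qed
  show "cv F (kern 4 (dirderiv (mollif1 i) v) r) x = v $ 1 * cv F (kern 4 (pd2 mollif 1 i) r) x + v $ 2 * cv F (kern 4 (pd2 mollif 2 i) r) x"
    "cv F (kern 3 (dirderiv mollif v) r) x = v $ 1 * cv F (kern 3 (mollif1 1) r) x + v $ 2 * cv F (kern 3 (mollif1 2) r) x"
    unfolding pd2_def using gen bumplike_dirderiv bumplike_mollif by blast+
qed

section \<open>Morrey's inequality\<close>

definition hint :: "real \<Rightarrow> (2 \<Rightarrow> 2 \<Rightarrow> real^2 \<Rightarrow> real) \<Rightarrow> real^2 \<Rightarrow> real \<Rightarrow> real" where
  "hint q g x r = (LINT w:ball x r|lborel. hnorm g w powr q)"

lemma hnorm_measurable: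
  assumes "\<And>i j. g i j \<in> borel_measurable borel" shows "hnorm g \<in> borel_measurable borel"
  unfolding hnorm_def[abs_def] using assms by measurable

lemma locint_set_integrable_ball:
  fixes x :: "'a::euclidean_space"
  assumes "locint h" shows "set_integrable lborel (ball x r) h"
proof (rule set_integrable_subset[of lborel "ball 0 (norm x + r)"])
  show "set_integrable lborel (ball 0 (norm x + r)) h" using locintD[OF assms] unfolding set_integrable_def by simp
  show "ball x r \<subseteq> ball 0 (norm x + r)"
  proof
    fix y assume "y \<in> ball x r"
    then show "y \<in> ball 0 (norm x + r)" using norm_triangle_ineq2[of y x] by (simp add: dist_norm norm_minus_commute)
  qed
qed auto

lemma hint_mono:
  assumes "locint (\<lambda>w. hnorm g w powr q)" "ball x r \<subseteq> ball z s" shows "hint q g x r \<le> hint q g z s"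
  unfolding hint_def
  using locint_set_integrable_ball[OF assms(1), of x r] locint_set_integrable_ball[OF assms(1), of z s] assms(2)
  unfolding set_lebesgue_integral_def set_integrable_def by (intro integral_mono) (auto simp: indicator_def)

lemma hint_nonneg: "hint q g x r \<ge> 0"
  unfolding hint_def set_lebesgue_integral_def by (intro integral_nonneg_AE) simp

lemma cv_weak_hessian_bound:
  assumes q: "q > 2" and r: "r > 0" and g: "\<And>i j. g i j \<in> borel_measurable borel" "locint (\<lambda>w. hnorm g w powr q)"
    and k: "bumplike k" "\<And>y. \<bar>k y\<bar> \<le> B" and I: "hint q g x r \<le> I"
  shows "\<bar>cv (g i j) (kern 2 k r) x\<bar> \<le> 5 * B * r powr (- 2/q) * I powr (1/q)"
proof -
  note m = mean_bound[of q r "hnorm g" x I, OF _ r hnorm_nonneg hnorm_measurable[OF g(1)] locint_set_integrable_ball[OF g(2)] I[unfolded hint_def]]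
  have B: "B \<ge> 0" using k(2)[of 0] by simp
  have "\<bar>cv (g i j) (kern 2 k r) x\<bar> \<le> B / r^2 * (LINT w:ball x r|lborel. hnorm g w)"
    by (rule cv_kern_bound[OF k r m(1) abs_le_hnorm]) (use q in auto)
  also have "\<dots> \<le> B / r^2 * (5 * r powr (2 - 2/q) * I powr (1/q))"
    using m(2) q B by (intro mult_left_mono) auto
  also have "\<dots> = 5 * B * (r powr (2 - 2/q) / r^2) * I powr (1/q)" by simp
  also have "r powr (2 - 2/q) / r^2 = r powr (-2/q)"
  proof -
    have "r powr (2 - 2/q) / r powr 2 = r powr (2 - 2/q - 2)" by (simp only: powr_diff)
    then show ?thesis using r by simp
  qed
  finally show ?thesis .
qed

section \<open>Mollified gradients at all scales and their limit\<close>

context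
  fixes q :: real and F g and B :: real
  assumes q: "q > 2" and F: "continuous_on UNIV F" "weak_hessian F g"
    and g: "\<And>i j. g i j \<in> borel_measurable borel" "locint (\<lambda>w. hnorm g w powr q)"
    and B: "B > 0" "\<And>y. \<bar>mollif y\<bar> \<le> B" "\<And>j y. \<bar>y $ j * mollif y\<bar> \<le> B"
begin

text \<open>The i-th partial derivative of the mollification of \<open>F\<close> at scale r.\<close>

definition "avg_grad r i x = cv F (kern 3 (mollif1 i) r) x"

text \<open>The radial derivative is at most a multiple of \<open>t powr (-2/q)\<close>, which is
  integrable at 0 exactly because \<open>q > 2\<close>. The 10 is 5 for each of the two
  coordinates.\<close>

lemma avg_grad_radial:
  assumes "0 < r" "r \<le> R"
  shows "\<bar>avg_grad R i x - avg_grad r i x\<bar> \<le> 10 * B / (1 - 2/q) * R powr (1 - 2/q) * hint q g x R powr (1/q)"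
proof -
  define J where "J = hint q g x R powr (1/q)"
  have J: "J \<ge> 0" by (simp add: J_def)
  define b' where "b' r = - (\<Sum>j\<in>UNIV. cv (g i j) (kern 2 (\<lambda>y. y $ j * mollif y) r) x)" for r
  \<comment> \<open>A primitive of the bound for the radial derivative. Both
    \<open>\<psi> + avg_grad\<close> and \<open>\<psi> - avg_grad\<close> are then nondecreasing in
    the scale, which replaces integration.\<close>
  define \<psi> where "\<psi> t = 10 * B / (1 - 2/q) * J * t powr (1 - 2/q)" for t
  have q1: "1 - 2/q > 0" using q by simp
  have d1: "(\<psi> has_real_derivative 10 * B * J * t powr (-2/q)) (at t)" if "t > 0" for t
  proof -
    have "((\<lambda>t. t powr (1 - 2/q)) has_real_derivative (1 - 2/q) * t powr (1 - 2/q - 1)) (at t)"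
      by (rule has_real_derivative_powr[OF that])
    from DERIV_cmult[OF this, of "10 * B / (1 - 2/q) * J"]
    moreover have "10 * B / (1 - 2/q) * J * ((1 - 2/q) * t powr (1 - 2/q - 1)) = 10 * B * J * t powr (-2/q)"
      using q1 q by simp
    ultimately show ?thesis unfolding \<psi>_def by metis
  qed
  have d2: "((\<lambda>t. avg_grad t i x) has_real_derivative b' t) (at t)" if "t > 0" for t
    unfolding avg_grad_def b'_def by (rule radial_derivative[OF F that])
  have b': "\<bar>b' t\<bar> \<le> 10 * B * J * t powr (-2/q)" if "0 < t" "t \<le> R" for t
  proof -
    have "\<bar>cv (g i j) (kern 2 (\<lambda>y. y $ j * mollif y) t) x\<bar> \<le> 5 * B * t powr (- 2/q) * J" for j
      unfolding J_def using that
      by (intro cv_weak_hessian_bound[OF q _ g bumplike_nth[OF bumplike_mollif] B(3)] hint_mono g) auto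
    then have "\<bar>b' t\<bar> \<le> (\<Sum>j\<in>(UNIV::2 set). 5 * B * t powr (- 2/q) * J)" unfolding b'_def abs_minus_cancel
      by (intro order_trans[OF sum_abs] sum_mono)
    then show ?thesis by (simp add: mult_ac)
  qed
  have "\<psi> r + avg_grad r i x \<le> \<psi> R + avg_grad R i x"
  proof (rule DERIV_nonneg_imp_nondecreasing[OF assms(2)])
    fix t assume "r \<le> t" "t \<le> R"
    then show "\<exists>y. ((\<lambda>r. \<psi> r + avg_grad r i x) has_real_derivative y) (at t) \<and> 0 \<le> y"
      using DERIV_add[OF d1[of t] d2[of t]] b'[of t] assms(1) by (intro exI[of _ "10 * B * J * t powr (-2/q) + b' t"]) (auto simp: abs_le_iff)
  qed
  moreover have "\<psi> r - avg_grad r i x \<le> \<psi> R - avg_grad R i x"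
  proof (rule DERIV_nonneg_imp_nondecreasing[OF assms(2)])
    fix t assume "r \<le> t" "t \<le> R"
    then show "\<exists>y. ((\<lambda>r. \<psi> r - avg_grad r i x) has_real_derivative y) (at t) \<and> 0 \<le> y"
      using DERIV_diff[OF d1[of t] d2[of t]] b'[of t] assms(1) by (intro exI[of _ "10 * B * J * t powr (-2/q) - b' t"]) (auto simp: abs_le_iff)
  qed
  moreover have "\<psi> r \<ge> 0" unfolding \<psi>_def using J B(1) q1 by (intro mult_nonneg_nonneg) auto
  ultimately have "\<bar>avg_grad R i x - avg_grad r i x\<bar> \<le> \<psi> R" by (auto simp: abs_le_iff)
  then show ?thesis unfolding \<psi>_def J_def by (simp add: mult_ac)
qed

text \<open>Mean value theorem along the segment from x to y; the derivative is a mollified Hessian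
  at scale R. The segment stays in \<open>ball z R\<close>, so its R-neighbourhood stays in
  \<open>ball z (2*R)\<close>, which is why the double ball appears from here on.\<close>

lemma avg_grad_same_scale:
  assumes "R > 0" "x \<in> ball z R" "y \<in> ball z R"
  shows "\<bar>avg_grad R i y - avg_grad R i x\<bar> \<le> 20 * B * R powr (1 - 2/q) * hint q g z (2*R) powr (1/q)"
proof -
  define v where "v = y - x"
  define J where "J = hint q g z (2*R) powr (1/q)"
  have m1: "bumplike (mollif1 i)" by (rule bumplike_dirderiv[OF bumplike_mollif])
  have "line_deriv (cv F (kern 3 (mollif1 i) R)) v (cv F (kern (Suc 3) (dirderiv (mollif1 i) v) R))"
    using m1 bumplike_dirderiv[OF m1] assms(1)
    by (intro line_deriv_cv[OF locint_continuous[OF F(1)] kern_continuous kern_continuous kern_line_deriv kern_support]) auto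
  from line_deriv_at[OF this, of x] 
  have der: "((\<lambda>t. avg_grad R i (x + t *\<^sub>R v)) has_real_derivative cv F (kern 4 (dirderiv (mollif1 i) v) R) (x + t *\<^sub>R v)) (at t)" for t
    unfolding avg_grad_def by (simp add: numeral_eq_Suc)
  obtain t where t: "0 < t" "t < 1" and
    e: "avg_grad R i (x + 1 *\<^sub>R v) - avg_grad R i (x + 0 *\<^sub>R v) = (1 - 0) * cv F (kern 4 (dirderiv (mollif1 i) v) R) (x + t *\<^sub>R v)"
    using MVT2[OF zero_less_one, of "\<lambda>t. avg_grad R i (x + t *\<^sub>R v)" "\<lambda>t. cv F (kern 4 (dirderiv (mollif1 i) v) R) (x + t *\<^sub>R v)"] der by auto
  define p where "p = x + t *\<^sub>R v"
  have "p = (1 - t) *\<^sub>R x + t *\<^sub>R y" unfolding p_def v_def by (simp add: algebra_simps)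
  then have p: "p \<in> ball z R" using convexD[OF convex_ball assms(2,3), of "1 - t" t] t by simp
  have sub: "ball p R \<subseteq> ball z (2*R)"
  proof
    fix w assume "w \<in> ball p R" then show "w \<in> ball z (2*R)" using p dist_triangle[of z w p] by (simp add: dist_commute)
  qed
  have c: "\<bar>cv F (kern 4 (pd2 mollif j i) R) p\<bar> \<le> 5 * B * R powr (- 2/q) * J" for j
  proof -
    have "cv F (kern 4 (pd2 mollif j i) R) p = cv (g j i) (kern 2 mollif R) p"
      using weak_hessian_kern(1)[OF F(2) bumplike_mollif assms(1), of 2] by (simp add: numeral_eq_Suc)
    then show ?thesis unfolding J_def using cv_weak_hessian_bound[OF q assms(1) g bumplike_mollif B(2) hint_mono[OF g(2) sub]] by simp
  qed
  have v: "\<bar>v $ j\<bar> \<le> 2 * R" for j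
  proof -
    have "\<bar>v $ j\<bar> \<le> norm v" by (rule component_le_norm_cart)
    also have "\<dots> \<le> 2 * R" unfolding v_def using assms(2,3) dist_triangle[of y x z] by (simp add: dist_norm[symmetric] dist_commute)
    finally show ?thesis .
  qed
  have vc: "\<bar>v $ j * cv F (kern 4 (pd2 mollif j i) R) p\<bar> \<le> 2 * R * (5 * B * R powr (- 2/q) * J)" for j
    unfolding abs_mult by (rule mult_mono[OF v c]) (use assms(1) in auto)
  have "\<bar>avg_grad R i y - avg_grad R i x\<bar> \<le> 2 * (2 * R * (5 * B * R powr (- 2/q) * J))"
    using e vc[of 1] vc[of 2] unfolding p_def[symmetric] dirderiv_mollif_expand(1)[OF F(1) assms(1)] by (simp add: v_def)
  also have "\<dots> = 20 * B * (R * R powr (- 2/q)) * J" by simp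
  also have "R * R powr (- 2/q) = R powr (1 - 2/q)" using assms(1) powr_add[of R 1 "-2/q"] by simp
  finally show ?thesis unfolding J_def .
qed

text \<open>The path goes up from scale r to scale R at x, across to y at scale R, and down again at
  y; the bound is uniform in r.\<close>

lemma avg_grad_close:
  assumes "0 < r" "r \<le> R" "x \<in> ball z R" "y \<in> ball z R"
  shows "\<bar>avg_grad r i y - avg_grad r i x\<bar> \<le> (20 * B / (1 - 2/q) + 20 * B) * R powr (1 - 2/q) * hint q g z (2*R) powr (1/q)"
proof -
  have "\<bar>avg_grad R i w - avg_grad r i w\<bar> \<le> 10 * B / (1 - 2/q) * R powr (1 - 2/q) * hint q g z (2*R) powr (1/q)" if "w \<in> ball z R" for w
  proof -
    have sub: "ball w R \<subseteq> ball z (2*R)"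
    proof
      fix u assume "u \<in> ball w R" then show "u \<in> ball z (2*R)" using that dist_triangle[of z u w] by (simp add: dist_commute)
    qed
    have "hint q g w R powr (1/q) \<le> hint q g z (2*R) powr (1/q)"
      using hint_mono[OF g(2) sub] hint_nonneg q by (intro powr_mono2) auto
    then have "10 * B / (1 - 2/q) * R powr (1 - 2/q) * hint q g w R powr (1/q) \<le> 10 * B / (1 - 2/q) * R powr (1 - 2/q) * hint q g z (2*R) powr (1/q)"
      using B(1) q by (intro mult_left_mono) auto
    then show ?thesis using avg_grad_radial[OF assms(1,2), of i w] by linarith
  qed
  from this[OF assms(3)] this[OF assms(4)] avg_grad_same_scale[OF _ assms(3,4), of i] assms(1,2)
  show ?thesis by (simp add: distrib_right abs_le_iff)
qed

lemma avg_grad_convergent: "convergent (\<lambda>n. avg_grad (inverse (real (Suc n))) i x)"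
proof (rule Cauchy_convergent, rule CauchyI)
  fix e :: real assume e: "e > 0"
  define K where "K = 10 * B / (1 - 2/q) * hint q g x 1 powr (1/q)"
  have K: "K \<ge> 0" unfolding K_def using B(1) q by auto
  have q1: "1 - 2/q > 0" using q by simp
  have "(\<lambda>n. inverse (real (Suc n)) powr (1 - 2/q)) \<longlonglongrightarrow> 0 powr (1 - 2/q)"
    by (rule tendsto_powr'[OF LIMSEQ_inverse_real_of_nat]) (use q1 in auto)
  then have "(\<lambda>n. K * inverse (real (Suc n)) powr (1 - 2/q)) \<longlonglongrightarrow> 0" using tendsto_mult_right_zero by force
  then obtain N where N: "K * inverse (real (Suc N)) powr (1 - 2/q) < e"
    using LIMSEQ_D[OF _ e] by (metis (no_types, lifting) abs_less_iff diff_zero order_refl real_norm_def)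
  have main: "norm (avg_grad (inverse (real (Suc m))) i x - avg_grad (inverse (real (Suc n))) i x) < e" if "N \<le> m" "m \<le> n" for m n
  proof -
    have "\<bar>avg_grad (inverse (real (Suc m))) i x - avg_grad (inverse (real (Suc n))) i x\<bar>
       \<le> 10 * B / (1 - 2/q) * inverse (real (Suc m)) powr (1 - 2/q) * hint q g x (inverse (real (Suc m))) powr (1/q)"
      by (rule avg_grad_radial) (use that in auto)
    also have "\<dots> \<le> 10 * B / (1 - 2/q) * inverse (real (Suc N)) powr (1 - 2/q) * hint q g x 1 powr (1/q)"
      using that q q1 B(1) hint_nonneg hint_mono[OF g(2), of x "inverse (real (Suc m))" x 1]
      by (intro mult_mono powr_mono2 mult_nonneg_nonneg) (auto simp: divide_simps subset_ball)
    also have "\<dots> < e" using N unfolding K_def by (simp add: mult_ac)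
    finally show ?thesis by simp
  qed
  show "\<exists>M. \<forall>m\<ge>M. \<forall>n\<ge>M. norm (avg_grad (inverse (real (Suc m))) i x - avg_grad (inverse (real (Suc n))) i x) < e"
  proof (intro exI[of _ N] allI impI)
    fix m n assume "N \<le> m" "N \<le> n"
    then show "norm (avg_grad (inverse (real (Suc m))) i x - avg_grad (inverse (real (Suc n))) i x) < e"
      using main[of m n] main[of n m] by (cases "m \<le> n") (auto simp: norm_minus_commute)
  qed
qed

text \<open>The limit of the mollified gradients as the scale tends to 0, coordinate by coordinate;
  it turns out to be the classical gradient.\<close>

definition "Dgrad x = (\<chi> i. lim (\<lambda>n. avg_grad (inverse (real (Suc n))) i x))"

lemma avg_grad_tendsto: "(\<lambda>n. avg_grad (inverse (real (Suc n))) i x) \<longlonglongrightarrow> Dgrad x $ i"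
  unfolding Dgrad_def using avg_grad_convergent by (simp add: convergent_LIMSEQ_iff)

abbreviation "morrey_const \<equiv> 2 * (20 * B / (1 - 2/q) + 20 * B)"

text \<open>The remainder is estimated for the mollification: the mean value theorem produces the
  gradient at an intermediate point, which \<open>avg_grad_close\<close> compares with the one at x
  uniformly in the scale. The factor 2 in the constant counts coordinates.\<close>

lemma Dgrad_close:
  assumes "R > 0" "x \<in> ball z R" "y \<in> ball z R"
  shows "norm (Dgrad y - Dgrad x) \<le> morrey_const * R powr (1 - 2/q) * hint q g z (2*R) powr (1/q)"
    "\<bar>F y - F x - Dgrad x \<bullet> (y - x)\<bar> \<le> morrey_const * norm (y - x) * R powr (1 - 2/q) * hint q g z (2*R) powr (1/q)"
proof -
  define K where "K = (20 * B / (1 - 2/q) + 20 * B) * R powr (1 - 2/q) * hint q g z (2*R) powr (1/q)"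
  let ?r = "\<lambda>n. inverse (real (Suc n))"
  have ev: "\<forall>\<^sub>F n in sequentially. ?r n \<le> R"
    using LIMSEQ_inverse_real_of_nat order_tendstoD(2)[of ?r 0 sequentially R] assms(1) by (force elim: eventually_mono)
  have "\<bar>Dgrad y $ i - Dgrad x $ i\<bar> \<le> K" for i
  proof (rule tendsto_upperbound)
    show "(\<lambda>n. \<bar>avg_grad (?r n) i y - avg_grad (?r n) i x\<bar>) \<longlonglongrightarrow> \<bar>Dgrad y $ i - Dgrad x $ i\<bar>"
      by (intro tendsto_intros avg_grad_tendsto)
    show "\<forall>\<^sub>F n in sequentially. \<bar>avg_grad (?r n) i y - avg_grad (?r n) i x\<bar> \<le> K"
      using ev by eventually_elim (use avg_grad_close[OF _ _ assms(2,3)] in \<open>auto simp: K_def\<close>)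
  qed auto
  then have "(\<Sum>i\<in>UNIV. \<bar>(Dgrad y - Dgrad x) $ i\<bar>) \<le> (\<Sum>i\<in>(UNIV::2 set). K)" by (intro sum_mono) simp
  then have "norm (Dgrad y - Dgrad x) \<le> 2 * K" using norm_le_l1_cart[of "Dgrad y - Dgrad x"] by simp
  then show "norm (Dgrad y - Dgrad x) \<le> morrey_const * R powr (1 - 2/q) * hint q g z (2*R) powr (1/q)"
    unfolding K_def by (simp only: mult.assoc)
  define v where "v = y - x"
  have key: "\<bar>cv F (kern 2 mollif r) y - cv F (kern 2 mollif r) x - (v $ 1 * avg_grad r 1 x + v $ 2 * avg_grad r 2 x)\<bar> \<le> 2 * norm v * K"
    if r: "0 < r" "r \<le> R" for r
  proof -
    have "line_deriv (cv F (kern 2 mollif r)) v (cv F (kern (Suc 2) (dirderiv mollif v) r))"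
      using bumplike_mollif bumplike_dirderiv[OF bumplike_mollif] r
      by (intro line_deriv_cv[OF locint_continuous[OF F(1)] kern_continuous kern_continuous kern_line_deriv kern_support]) auto
    from line_deriv_at[OF this, of x] 
    have der: "((\<lambda>t. cv F (kern 2 mollif r) (x + t *\<^sub>R v)) has_real_derivative cv F (kern 3 (dirderiv mollif v) r) (x + t *\<^sub>R v)) (at t)" for t
      by (simp add: numeral_eq_Suc)
    obtain t where t: "0 < t" "t < 1" and
      e: "cv F (kern 2 mollif r) (x + 1 *\<^sub>R v) - cv F (kern 2 mollif r) (x + 0 *\<^sub>R v) = (1 - 0) * cv F (kern 3 (dirderiv mollif v) r) (x + t *\<^sub>R v)"
      using MVT2[OF zero_less_one, of "\<lambda>t. cv F (kern 2 mollif r) (x + t *\<^sub>R v)" "\<lambda>t. cv F (kern 3 (dirderiv mollif v) r) (x + t *\<^sub>R v)"] der by auto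
    define p where "p = x + t *\<^sub>R v"
    have "p = (1 - t) *\<^sub>R x + t *\<^sub>R y" unfolding p_def v_def by (simp add: algebra_simps)
    then have p: "p \<in> ball z R" using convexD[OF convex_ball assms(2,3), of "1 - t" t] t by simp
    have e': "cv F (kern 2 mollif r) y - cv F (kern 2 mollif r) x = v $ 1 * avg_grad r 1 p + v $ 2 * avg_grad r 2 p"
    proof -
      have "cv F (kern 3 (dirderiv mollif v) r) p = v $ 1 * avg_grad r 1 p + v $ 2 * avg_grad r 2 p"
        unfolding avg_grad_def by (rule dirderiv_mollif_expand(2)[OF F(1) r(1)])
      then show ?thesis using e unfolding p_def[symmetric] by (simp add: v_def)
    qed
    have c: "\<bar>v $ i * (avg_grad r i p - avg_grad r i x)\<bar> \<le> norm v * K" for i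
      unfolding abs_mult K_def by (rule mult_mono[OF component_le_norm_cart avg_grad_close[OF r assms(2) p]]) auto
    have "cv F (kern 2 mollif r) y - cv F (kern 2 mollif r) x - (v $ 1 * avg_grad r 1 x + v $ 2 * avg_grad r 2 x)
      = v $ 1 * (avg_grad r 1 p - avg_grad r 1 x) + v $ 2 * (avg_grad r 2 p - avg_grad r 2 x)" 
      unfolding e' by (simp add: algebra_simps)
    then show ?thesis using c[of 1] c[of 2] by (simp add: abs_le_iff)
  qed
  have r0: "filterlim ?r (at_right 0) sequentially"
    using LIMSEQ_inverse_real_of_nat by (simp add: filterlim_at)
  have "\<bar>F y - F x - (v $ 1 * Dgrad x $ 1 + v $ 2 * Dgrad x $ 2)\<bar> \<le> 2 * norm v * K"
  proof (rule tendsto_upperbound)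
    show "(\<lambda>n. \<bar>cv F (kern 2 mollif (?r n)) y - cv F (kern 2 mollif (?r n)) x - (v $ 1 * avg_grad (?r n) 1 x + v $ 2 * avg_grad (?r n) 2 x)\<bar>) 
       \<longlonglongrightarrow> \<bar>F y - F x - (v $ 1 * Dgrad x $ 1 + v $ 2 * Dgrad x $ 2)\<bar>"
      by (intro tendsto_intros avg_grad_tendsto filterlim_compose[OF cv_kern_tendsto[OF F(1)] r0])
    show "\<forall>\<^sub>F n in sequentially. \<bar>cv F (kern 2 mollif (?r n)) y - cv F (kern 2 mollif (?r n)) x - (v $ 1 * avg_grad (?r n) 1 x + v $ 2 * avg_grad (?r n) 2 x)\<bar> \<le> 2 * norm v * K"
      using ev by eventually_elim (use key in auto)
  qed auto
  moreover have "Dgrad x \<bullet> v = v $ 1 * Dgrad x $ 1 + v $ 2 * Dgrad x $ 2" by (simp add: inner_vec_def sum_2 mult.commute)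
  ultimately show "\<bar>F y - F x - Dgrad x \<bullet> (y - x)\<bar> \<le> morrey_const * norm (y - x) * R powr (1 - 2/q) * hint q g z (2*R) powr (1/q)"
    unfolding K_def v_def by (simp only: mult_ac)
qed

text \<open>The remainder bound with a radius twice \<open>norm (y - x)\<close> gains the power
  \<open>1 - 2/q > 0\<close>, so the remainder is of smaller order than
  \<open>norm (y - x)\<close>.\<close>

lemma has_derivative_Dgrad: "(F has_derivative (\<lambda>h. Dgrad x \<bullet> h)) (at x)"
proof -
  have q1: "1 - 2/q > 0" using q by simp
  define L where "L = morrey_const * hint q g x 4 powr (1/q)"
  have L: "L \<ge> 0" unfolding L_def using B(1) q by auto
  have "((\<lambda>y. \<bar>F y - F x - Dgrad x \<bullet> (y - x)\<bar> / norm (y - x)) \<longlongrightarrow> 0) (at x)"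
  proof (rule Lim_null_comparison)
    have "((\<lambda>y. (2 * norm (y - x)) powr (1 - 2/q)) \<longlongrightarrow> (2 * norm (x - x)) powr (1 - 2/q)) (at x)"
      by (intro tendsto_powr' tendsto_intros) (use q1 in auto)
    then show "((\<lambda>y. L * (2 * norm (y - x)) powr (1 - 2/q)) \<longlongrightarrow> 0) (at x)"
      using tendsto_mult_right_zero by force
    have "\<forall>\<^sub>F y in at x. dist y x < 1" unfolding eventually_at by (intro exI[of _ 1]) auto
    moreover have "\<forall>\<^sub>F y in at x. y \<noteq> x" by (simp add: eventually_at_filter)
    ultimately show "\<forall>\<^sub>F y in at x. norm (\<bar>F y - F x - Dgrad x \<bullet> (y - x)\<bar> / norm (y - x)) \<le> L * (2 * norm (y - x)) powr (1 - 2/q)"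
    proof eventually_elim
      case (elim y)
      define R where "R = 2 * norm (y - x)"
      have R: "R > 0" "R \<le> 2" using elim by (auto simp: R_def dist_norm)
      have "\<bar>F y - F x - Dgrad x \<bullet> (y - x)\<bar> \<le> morrey_const * norm (y - x) * R powr (1 - 2/q) * hint q g x (2*R) powr (1/q)"
        by (rule Dgrad_close(2)) (use R elim in \<open>auto simp: R_def dist_norm norm_minus_commute\<close>)
      also have "\<dots> \<le> morrey_const * norm (y - x) * R powr (1 - 2/q) * hint q g x 4 powr (1/q)"
        using R B(1) q by (intro mult_left_mono powr_mono2 hint_mono g hint_nonneg subset_ball) auto
      finally have "\<bar>F y - F x - Dgrad x \<bullet> (y - x)\<bar> \<le> L * R powr (1 - 2/q) * norm (y - x)" by (simp add: L_def mult_ac)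
      then show ?case using elim unfolding R_def by (simp add: divide_le_eq)
    qed
  qed
  then have "((\<lambda>y. (F y - (F x + Dgrad x \<bullet> (y - x))) /\<^sub>R norm (y - x)) \<longlongrightarrow> 0) (at x)"
    by (subst tendsto_norm_zero_iff[symmetric]) (simp add: divide_inverse mult.commute diff_diff_eq abs_mult)
  then show ?thesis unfolding has_derivative_def
    by (auto intro: bounded_linear_inner_right simp: netlimit_at diff_diff_eq)
qed

end

text \<open>The exponent is free and integrability only local, because the inequality is used at p
  itself and at an exponent below p.\<close>

theorem morrey:
  assumes q: "q > 2"
  obtains C where "C > 0" 
    "\<And>F g. continuous_on UNIV F \<Longrightarrow> weak_hessian F g \<Longrightarrow> (\<And>i j. g i j \<in> borel_measurable borel) \<Longrightarrow> locint (\<lambda>w. hnorm g w powr q) \<Longrightarrow>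
      \<exists>D. (\<forall>x. (F has_derivative (\<lambda>h. D x \<bullet> h)) (at x)) \<and>
        (\<forall>z R x y. R > 0 \<longrightarrow> x \<in> ball z R \<longrightarrow> y \<in> ball z R \<longrightarrow> 
          norm (D y - D x) \<le> C * R powr (1 - 2/q) * hint q g z (2*R) powr (1/q) \<and>
          \<bar>F y - F x - D x \<bullet> (y - x)\<bar> \<le> C * norm (y - x) * R powr (1 - 2/q) * hint q g z (2*R) powr (1/q))"
proof -
  obtain B where B: "B > 0" "\<And>y. \<bar>mollif y\<bar> \<le> B" "\<And>j y. \<bar>y $ j * mollif y\<bar> \<le> B" using bump_bounds by blast
  show ?thesis
  proof (rule that[of "2 * (20 * B / (1 - 2/q) + 20 * B)"])
    show "0 < 2 * (20 * B / (1 - 2/q) + 20 * B)" using B(1) q by (simp add: add_pos_pos)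
    fix F g assume *: "continuous_on UNIV F" "weak_hessian F g" "\<And>i j. g i j \<in> borel_measurable borel" "locint (\<lambda>w. hnorm g w powr q)"
    note a = has_derivative_Dgrad[OF q * B] Dgrad_close[OF q * B]
    show "\<exists>D. (\<forall>x. (F has_derivative (\<lambda>h. D x \<bullet> h)) (at x)) \<and>
        (\<forall>z R x y. R > 0 \<longrightarrow> x \<in> ball z R \<longrightarrow> y \<in> ball z R \<longrightarrow> 
          norm (D y - D x) \<le> 2 * (20 * B / (1 - 2/q) + 20 * B) * R powr (1 - 2/q) * hint q g z (2*R) powr (1/q) \<and>
          \<bar>F y - F x - D x \<bullet> (y - x)\<bar> \<le> 2 * (20 * B / (1 - 2/q) + 20 * B) * norm (y - x) * R powr (1 - 2/q) * hint q g z (2*R) powr (1/q))"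
      by (rule exI[of _ "Dgrad F"]) (use a in blast)
  qed
qed

section \<open>The maximal function\<close>

text \<open>The Hardy--Littlewood maximal function with \<open>r\<^sup>2\<close> for the area. The
  balls need not be centred at z, which makes superlevel sets unions of open balls and measurability
  immediate.\<close>

definition maxfun :: "(real^2 \<Rightarrow> ennreal) \<Rightarrow> real^2 \<Rightarrow> ennreal" where
  "maxfun h z = (SUP (c,r)\<in>{(c,r). 0 < r \<and> z \<in> ball c r}. (\<integral>\<^sup>+w. h w * indicator (ball c r) w \<partial>lborel) / ennreal (r\<^sup>2))"

lemma less_maxfun_iff:
  "a < maxfun h z \<longleftrightarrow> (\<exists>c r. 0 < r \<and> z \<in> ball c r \<and> a < (\<integral>\<^sup>+w. h w * indicator (ball c r) w \<partial>lborel) / ennreal (r\<^sup>2))"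
  unfolding maxfun_def by (subst less_SUP_iff) auto

lemma open_maxfun: "open {z. a < maxfun h z}"
proof -
  have "{z. a < maxfun h z} = \<Union>{ball c r | c r. 0 < r \<and> a < (\<integral>\<^sup>+w. h w * indicator (ball c r) w \<partial>lborel) / ennreal (r\<^sup>2)}"
    unfolding less_maxfun_iff by blast
  then show ?thesis by auto
qed

lemma measurable_maxfun: "maxfun h \<in> borel_measurable borel"
  by (rule borel_measurableI_greater) (use open_maxfun in auto)

lemma less_div_ennreal_iff: "0 < r \<Longrightarrow> a < b / ennreal r \<longleftrightarrow> a * ennreal r < b"
proof -
  assume r: "0 < r"
  have 1: "x * ennreal r / ennreal r = x" "x / ennreal r * ennreal r = x" for x
    using r by (auto simp: ennreal_divide_times ennreal_mult_divide_eq)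
  show ?thesis using 1[of a] 1[of b] divide_right_mono_ennreal[of b "a * ennreal r" "ennreal r"] mult_right_mono[of "b / ennreal r" a "ennreal r"]
    by (metis linorder_not_less zero_le)
qed

text \<open>Vitali covering: disjoint balls on which the average of \<open>h\<close> exceeds l,
  whose fivefold enlargements cover the superlevel set. The 100 is 4 * 25, with 4 in place of
  pi.\<close>

lemma maxfun_weak_type:
  assumes h: "h \<in> borel_measurable borel" and l: "l > 0"
  shows "emeasure lborel {z. ennreal l < maxfun h z} \<le> ennreal (100 / l) * (\<integral>\<^sup>+w. h w \<partial>lborel)"
proof (cases "(\<integral>\<^sup>+w. h w \<partial>lborel) = \<infinity>")
  case True then show ?thesis using l by (simp add: ennreal_mult_top)
next
  case False
  define A where "A = enn2real (\<integral>\<^sup>+w. h w \<partial>lborel)"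
  have A: "(\<integral>\<^sup>+w. h w \<partial>lborel) = ennreal A" "A \<ge> 0" unfolding A_def using False by (auto simp: less_top)
  define K where "K = {(c,r). 0 < r \<and> ennreal (l * r\<^sup>2) < (\<integral>\<^sup>+w. h w * indicator (ball (c::real^2) r) w \<partial>lborel)}"
  define U where "U = {z. ennreal l < maxfun h z}"
  have le: "(\<integral>\<^sup>+w. h w * indicator S w \<partial>lborel) \<le> ennreal A" for S
    unfolding A(1)[symmetric] by (rule nn_integral_mono) (auto simp: indicator_def)
  have sub: "U \<subseteq> (\<Union>i\<in>K. ball (fst i) (snd i))"
  proof
    fix z assume "z \<in> U"
    then obtain c r where cr: "0 < r" "z \<in> ball c r" "ennreal l < (\<integral>\<^sup>+w. h w * indicator (ball c r) w \<partial>lborel) / ennreal (r\<^sup>2)"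
      unfolding U_def less_maxfun_iff by blast
    have "(c, r) \<in> K" unfolding K_def
      using cr(1,3) l by (auto simp: less_div_ennreal_iff ennreal_mult)
    then show "z \<in> (\<Union>i\<in>K. ball (fst i) (snd i))" using cr(2) by force
  qed
  \<comment> \<open>Vitali's lemma needs bounded radii; they are bounded because the total integral
    of \<open>h\<close> is finite.\<close>
  have rad: "0 < snd i \<and> snd i \<le> sqrt (A / l)" if i: "i \<in> K" for i
  proof -
    obtain c r where [simp]: "i = (c, r)" by (cases i)
    have r: "0 < r" and "ennreal (l * r\<^sup>2) < ennreal A" using i le unfolding K_def by (auto intro: less_le_trans)
    then have "l * r\<^sup>2 < A" using l ennreal_less_iff[of "l * r\<^sup>2" A] by simp
    then have "r\<^sup>2 \<le> A / l" using l by (simp add: field_simps)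
    then show ?thesis using r by (simp add: real_le_rsqrt)
  qed
  obtain C where C: "countable C" "C \<subseteq> K" "pairwise (\<lambda>i j. disjnt (ball (fst i) (snd i)) (ball (fst j) (snd j))) C"
     "U \<subseteq> (\<Union>i\<in>C. ball (fst i) (5 * snd i))"
    using Vitali_covering_lemma_balls[OF sub rad] by blast
  have b1: "emeasure lborel (ball (fst i) (5 * snd i)) \<le> ennreal (100/l) * (\<integral>\<^sup>+w. h w * indicator (ball (fst i) (snd i)) w \<partial>lborel)" if "i \<in> C" for i
  proof -
    have i: "i \<in> K" using that C(2) by blast
    have "emeasure lborel (ball (fst i) (5 * snd i)) = ennreal (pi * (5 * snd i)\<^sup>2)"
      using rad[OF i] by (subst emeasure_ball) (auto simp: unit_ball_vol_2)
    also have "\<dots> \<le> ennreal (100 / l * (l * (snd i)\<^sup>2))"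
      using pi_less_4 l by (intro ennreal_leI) (simp add: power_mult_distrib mult_right_mono)
    also have "\<dots> = ennreal (100 / l) * ennreal (l * (snd i)\<^sup>2)" using l by (intro ennreal_mult) auto
    also have "\<dots> \<le> ennreal (100/l) * (\<integral>\<^sup>+w. h w * indicator (ball (fst i) (snd i)) w \<partial>lborel)"
      using i unfolding K_def by (intro mult_left_mono) (auto simp: less_imp_le)
    finally show ?thesis .
  qed
  define B where "B n = (if n \<in> to_nat_on C ` C then ball (fst (from_nat_into C n)) (5 * snd (from_nat_into C n)) else {})" for n
  define S where "S n = (if n \<in> to_nat_on C ` C then ball (fst (from_nat_into C n)) (snd (from_nat_into C n)) else {})" for n
  let ?D = "density lborel h"
  have m: "(\<integral>\<^sup>+w. h w * indicator T w \<partial>lborel) = emeasure ?D T" if "T \<in> sets borel" for T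
    using h that by (simp add: emeasure_density)
  have BU: "U \<subseteq> (\<Union>n. B n)"
  proof
    fix z assume "z \<in> U"
    then obtain i where "i \<in> C" "z \<in> ball (fst i) (5 * snd i)" using C(4) by blast
    then have "z \<in> B (to_nat_on C i)" using C(1) by (simp add: B_def)
    then show "z \<in> (\<Union>n. B n)" by blast
  qed
  have dis: "disjoint_family S" unfolding disjoint_family_on_def
  proof (intro ballI impI)
    fix m n :: nat assume "m \<noteq> n"
    show "S m \<inter> S n = {}"
    proof (cases "m \<in> to_nat_on C ` C \<and> n \<in> to_nat_on C ` C")
      case True
      then obtain i j where "i \<in> C" "j \<in> C" "m = to_nat_on C i" "n = to_nat_on C j" by blast
      then show ?thesis using C(1,3) \<open>m \<noteq> n\<close> by (auto simp: S_def pairwise_def disjnt_def)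
    qed (auto simp: S_def)
  qed
  have B_open: "open (B n)" for n by (simp add: B_def)
  have BS: "emeasure lborel (B n) \<le> ennreal (100/l) * emeasure ?D (S n)" for n
    using b1 C(1) m by (auto simp: B_def S_def)
  have "emeasure lborel U \<le> emeasure lborel (\<Union>n. B n)"
    using BU by (intro emeasure_mono) (auto intro!: borel_open open_UN simp: B_open)
  also have "\<dots> \<le> (\<Sum>n. emeasure lborel (B n))"
    by (rule emeasure_subadditive_countably) (auto simp: B_def)
  also have "\<dots> \<le> (\<Sum>n. ennreal (100/l) * emeasure ?D (S n))"
    by (intro suminf_le BS) auto
  also have "\<dots> = ennreal (100/l) * emeasure ?D (\<Union>n. S n)"
    using dis by (subst ennreal_suminf_cmult, subst suminf_emeasure) (auto simp: S_def)
  also have "\<dots> \<le> ennreal (100/l) * emeasure ?D UNIV"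
    by (intro mult_left_mono emeasure_mono) auto
  also have "emeasure ?D UNIV = (\<integral>\<^sup>+w. h w \<partial>lborel)" using m[of UNIV] by simp
  finally show ?thesis unfolding U_def .
qed

text \<open>The part of \<open>h\<close> below \<open>l/8\<close> contributes at most half of what
  the level l demands on any ball, since pi is below 4. The remaining part therefore exceeds the
  level \<open>l/2\<close>, to which the weak type bound applies.\<close>

lemma maxfun_layer:
  assumes h: "h \<in> borel_measurable borel" "\<And>w. h w \<ge> 0" and l: "l > 0"
  shows "emeasure lborel {z. ennreal l < maxfun h z} \<le> ennreal (200 / l) * (\<integral>\<^sup>+w. ennreal (h w) * indicator {w. l / 8 < h w} w \<partial>lborel)"
proof -
  define h' where "h' w = ennreal (h w) * indicator {w. l / 8 < h w} w" for w
  have h': "h' \<in> borel_measurable borel" unfolding h'_def using h(1) by measurable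
  have "{z. ennreal l < maxfun h z} \<subseteq> {z. ennreal (l/2) < maxfun h' z}"
  proof clarify
    fix z assume "ennreal l < maxfun h z"
    then obtain c r where cr: "0 < r" "z \<in> ball c r" and lt: "ennreal l * ennreal (r\<^sup>2) < (\<integral>\<^sup>+w. ennreal (h w) * indicator (ball c r) w \<partial>lborel)"
      unfolding less_maxfun_iff by (auto simp: less_div_ennreal_iff)
    have "(\<integral>\<^sup>+w. ennreal (h w) * indicator (ball c r) w \<partial>lborel) \<le> (\<integral>\<^sup>+w. h' w * indicator (ball c r) w + ennreal (l/8) * indicator (ball c r) w \<partial>lborel)"
      by (rule nn_integral_mono) (auto simp: h'_def indicator_def intro!: ennreal_leI)
    also have "\<dots> = (\<integral>\<^sup>+w. h' w * indicator (ball c r) w \<partial>lborel) + ennreal (l/8) * emeasure lborel (ball c r)"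
      using h' by (subst nn_integral_add) (auto intro!: borel_measurable_times_ennreal borel_measurable_indicator simp: nn_integral_cmult_indicator)
    also have "ennreal (l/8) * emeasure lborel (ball c r) \<le> ennreal (l/2 * r\<^sup>2)"
    proof -
      have em: "emeasure lborel (ball c r) = ennreal (pi * r\<^sup>2)" using cr by (subst emeasure_ball) (auto simp: unit_ball_vol_2)
      have "ennreal (l/8) * emeasure lborel (ball c r) = ennreal (l/8 * (pi * r\<^sup>2))" unfolding em
        by (rule ennreal_mult[symmetric]) (use l in auto)
      also have "\<dots> \<le> ennreal (l/8 * (4 * r\<^sup>2))" using l pi_less_4 by (intro ennreal_leI mult_left_mono mult_right_mono) auto
      finally show ?thesis by simp
    qed
    finally have "(\<integral>\<^sup>+w. ennreal (h w) * indicator (ball c r) w \<partial>lborel) \<le> (\<integral>\<^sup>+w. h' w * indicator (ball c r) w \<partial>lborel) + ennreal (l/2 * r\<^sup>2)"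
      by (simp add: add_left_mono)
    with lt have lt2: "ennreal (l * r\<^sup>2) < (\<integral>\<^sup>+w. h' w * indicator (ball c r) w \<partial>lborel) + ennreal (l/2 * r\<^sup>2)"
      using l by (simp add: ennreal_mult)
    have "ennreal (l/2 * r\<^sup>2) < (\<integral>\<^sup>+w. h' w * indicator (ball c r) w \<partial>lborel)"
    proof (rule ccontr)
      assume "\<not> ?thesis"
      then have "(\<integral>\<^sup>+w. h' w * indicator (ball c r) w \<partial>lborel) + ennreal (l/2 * r\<^sup>2) \<le> ennreal (l/2 * r\<^sup>2) + ennreal (l/2 * r\<^sup>2)"
        by (intro add_right_mono) simp
      also have "\<dots> = ennreal (l * r\<^sup>2)" using l by (subst ennreal_plus[symmetric]) auto
      finally show False using lt2 by simp
    qed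
    then show "ennreal (l/2) < maxfun h' z"
      unfolding less_maxfun_iff using cr l by (intro exI[of _ c] exI[of _ r]) (auto simp: less_div_ennreal_iff ennreal_mult[symmetric])
  qed
  then have "emeasure lborel {z. ennreal l < maxfun h z} \<le> emeasure lborel {z. ennreal (l/2) < maxfun h' z}"
    using open_maxfun by (intro emeasure_mono) auto
  also have "\<dots> \<le> ennreal (100 / (l/2)) * (\<integral>\<^sup>+w. h' w \<partial>lborel)"
    by (rule maxfun_weak_type[OF h']) (use l in auto)
  finally show ?thesis unfolding h'_def by simp
qed

lemma nn_integral_powr_0:
  assumes "a > -1" "c \<ge> 0"
  shows "(\<integral>\<^sup>+x. ennreal (x powr a) * indicator {0..c} x \<partial>lborel) = ennreal (c powr (a+1) / (a+1))"
  by (rule nn_integral_has_integral_lebesgue'[OF _ has_integral_powr_from_0[OF assms]]) simp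

text \<open>Layer cake formula, then the layer bound, then Fubini: at fixed w only levels up to
  \<open>16 * h w\<close> contribute, and integrating \<open>x powr (s-2)\<close> over them
  converges because \<open>s > 1\<close>.\<close>

lemma maxfun_strong_type:
  assumes h: "h \<in> borel_measurable borel" "\<And>w. h w \<ge> 0" and s: "s > 1"
    and fin: "(\<integral>\<^sup>+w. ennreal (h w powr s) \<partial>lborel) < \<infinity>"
  shows "AE z in lborel. maxfun h z < \<infinity>"
    "(\<integral>\<^sup>+z. ennreal (enn2real (maxfun h z) powr s) \<partial>lborel) \<le> ennreal (400 * s * 16 powr (s-1) / (s-1)) * (\<integral>\<^sup>+w. ennreal (h w powr s) \<partial>lborel)"
proof -
  let ?I = "(\<integral>\<^sup>+w. ennreal (h w powr s) \<partial>lborel)"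
  have mh [measurable]: "maxfun h \<in> borel_measurable borel" by (rule measurable_maxfun)
  note [measurable] = h(1)
  \<comment> \<open>Serves only to show that the maximal function is finite almost everywhere, so
    that \<open>enn2real\<close> changes it on a null set only.\<close>
  have tail: "emeasure lborel {z. ennreal l < maxfun h z} \<le> ennreal (200 * 8 powr (s-1) / l powr s) * ?I" if l: "l > 0" for l
  proof -
    have "emeasure lborel {z. ennreal l < maxfun h z} \<le> ennreal (200 / l) * (\<integral>\<^sup>+w. ennreal (h w) * indicator {w. l / 8 < h w} w \<partial>lborel)"
      by (rule maxfun_layer[OF h l])
    also have "\<dots> \<le> ennreal (200 / l) * (\<integral>\<^sup>+w. ennreal ((8/l) powr (s-1)) * ennreal (h w powr s) \<partial>lborel)"
    proof (intro mult_left_mono nn_integral_mono)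
      fix w
      show "ennreal (h w) * indicator {w. l / 8 < h w} w \<le> ennreal ((8/l) powr (s-1)) * ennreal (h w powr s)"
      proof (cases "l / 8 < h w")
        case True
        have "1 \<le> (8/l * h w) powr (s-1)" using True l s by (intro ge_one_powr_ge_zero) (auto simp: field_simps)
        then have "h w * 1 \<le> h w * (8/l * h w) powr (s-1)" using h(2) by (intro mult_left_mono)
        also have "\<dots> = (8/l) powr (s-1) * h w powr s" 
          using True l h(2)[of w] powr_add[of "h w" 1 "s-1"] by (subst powr_mult) (auto simp: mult_ac)
        finally show ?thesis using True by (simp add: ennreal_mult[symmetric] ennreal_leI)
      qed simp
    qed auto
    also have "\<dots> = ennreal (200/l) * (ennreal ((8/l) powr (s-1)) * ?I)"
      by (subst nn_integral_cmult) auto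
    also have "\<dots> = ennreal (200/l * (8/l) powr (s-1)) * ?I" by (subst ennreal_mult) (use l in \<open>auto simp: mult.assoc\<close>)
    also have "200/l * (8/l) powr (s-1) = 200 * 8 powr (s-1) / l powr s"
      using l powr_add[of l 1 "s-1"] by (simp add: powr_divide)
    finally show ?thesis .
  qed
  define N where "N = {z. maxfun h z = \<infinity>}"
  have Nm: "N \<in> sets borel" unfolding N_def by measurable
  have "emeasure lborel N = 0"
  proof (rule ccontr)
    assume "emeasure lborel N \<noteq> 0"
    obtain I where I: "?I = ennreal I" "I \<ge> 0" using fin by (metis ennreal_cases infinity_ennreal_def less_irrefl)
    have b: "emeasure lborel N \<le> ennreal (200 * 8 powr (s-1) / l powr s * I)" if "l > 0" for l
    proof -
      have "emeasure lborel N \<le> emeasure lborel {z. ennreal l < maxfun h z}"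
        using open_maxfun by (intro emeasure_mono) (auto simp: N_def)
      then show ?thesis using tail[OF that] I by (simp add: ennreal_mult[symmetric])
    qed
    have "((\<lambda>l. ennreal (200 * 8 powr (s-1) / l powr s * I)) \<longlongrightarrow> ennreal (200 * 8 powr (s-1) * 0 * I)) at_top"
    proof -
      have "((\<lambda>l::real. l powr (-s)) \<longlongrightarrow> 0) at_top" using s by (intro tendsto_neg_powr filterlim_ident) auto
      then have "((\<lambda>l::real. 200 * 8 powr (s-1) * l powr (-s) * I) \<longlongrightarrow> 200 * 8 powr (s-1) * 0 * I) at_top"
        by (intro tendsto_intros)
      then show ?thesis by (intro tendsto_ennrealI) (simp add: powr_minus divide_inverse)
    qed
    then have "emeasure lborel N \<le> ennreal (200 * 8 powr (s-1) * 0 * I)"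
    proof (rule tendsto_lowerbound)
      show "\<forall>\<^sub>F l in at_top. emeasure lborel N \<le> ennreal (200 * 8 powr (s-1) / l powr s * I)"
        using eventually_gt_at_top[of 0] by eventually_elim (rule b)
    qed simp
    then show False using \<open>emeasure lborel N \<noteq> 0\<close> by simp
  qed
  then show "AE z in lborel. maxfun h z < \<infinity>"
    by (intro AE_I[of _ _ N]) (use Nm in \<open>auto simp: N_def top.not_eq_extremum[symmetric]\<close>)
  define m where "m z = enn2real (maxfun h z)" for z
  have mm [measurable]: "m \<in> borel_measurable borel" unfolding m_def by measurable
  have m0: "m z \<ge> 0" for z by (simp add: m_def)
  have "(\<integral>\<^sup>+z. ennreal (m z powr s) \<partial>lborel) = (\<integral>\<^sup>+z. (\<integral>\<^sup>+x. ennreal (s * x powr (s-1)) * indicator {0..m z} x \<partial>lborel) \<partial>lborel)"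
  proof (rule nn_integral_cong)
    fix z
    have "(\<integral>\<^sup>+x. ennreal (s * x powr (s-1)) * indicator {0..m z} x \<partial>lborel) = (\<integral>\<^sup>+x. ennreal s * (ennreal (x powr (s-1)) * indicator {0..m z} x) \<partial>lborel)"
      using s by (intro nn_integral_cong) (simp add: ennreal_mult mult.assoc)
    also have "\<dots> = ennreal s * ennreal (m z powr s / s)"
      using nn_integral_powr_0[of "s-1" "m z"] s m0 by (subst nn_integral_cmult) auto
    also have "\<dots> = ennreal (m z powr s)" using s by (simp add: ennreal_mult[symmetric])
    finally show "ennreal (m z powr s) = (\<integral>\<^sup>+x. ennreal (s * x powr (s-1)) * indicator {0..m z} x \<partial>lborel)" ..
  qed
  also have "\<dots> = (\<integral>\<^sup>+x. (\<integral>\<^sup>+z. ennreal (s * x powr (s-1)) * indicator {0..m z} x \<partial>lborel) \<partial>lborel)"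
    by (rule lborel_pair.Fubini') (simp add: case_prod_unfold indicator_def, measurable)
  also have "\<dots> \<le> (\<integral>\<^sup>+x. (\<integral>\<^sup>+w. ennreal (400 * s * h w) * (ennreal (x powr (s-2)) * indicator {0..16 * h w} x) \<partial>lborel) \<partial>lborel)"
  proof (rule nn_integral_mono)
    fix x :: real
    show "(\<integral>\<^sup>+z. ennreal (s * x powr (s-1)) * indicator {0..m z} x \<partial>lborel) \<le> (\<integral>\<^sup>+w. ennreal (400 * s * h w) * (ennreal (x powr (s-2)) * indicator {0..16 * h w} x) \<partial>lborel)"
    proof (cases "x > 0")
      case False
      then have "(\<integral>\<^sup>+z. ennreal (s * x powr (s-1)) * indicator {0..m z} x \<partial>lborel) = (\<integral>\<^sup>+z. 0 \<partial>(lborel :: (real^2) measure))"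
        by (intro nn_integral_cong) (auto simp: indicator_def)
      then show ?thesis by simp
    next
      case True
      have "(\<integral>\<^sup>+z. ennreal (s * x powr (s-1)) * indicator {0..m z} x \<partial>lborel) = ennreal (s * x powr (s-1)) * emeasure lborel {z. x \<le> m z}"
        using True by (subst nn_integral_cmult_indicator[symmetric]) (auto intro!: nn_integral_cong simp: indicator_def)
      \<comment> \<open>Halving the level turns the closed condition \<open>x \<le> m z\<close> into
        a strict inequality and excludes points where \<open>m\<close> is 0 because
        \<open>maxfun\<close> is infinite.\<close>
      also have "\<dots> \<le> ennreal (s * x powr (s-1)) * emeasure lborel {z. ennreal (x/2) < maxfun h z}"
      proof (intro mult_left_mono emeasure_mono)
        show "{z. x \<le> m z} \<subseteq> {z. ennreal (x/2) < maxfun h z}"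
        proof clarify
          fix z assume "x \<le> m z"
          then have "maxfun h z \<noteq> \<infinity>" using True by (auto simp: m_def)
          then have "maxfun h z = ennreal (m z)" by (simp add: m_def less_top)
          then show "ennreal (x/2) < maxfun h z" using \<open>x \<le> m z\<close> True by (simp add: ennreal_less_iff)
        qed
      qed (use open_maxfun in auto)
      also have "\<dots> \<le> ennreal (s * x powr (s-1)) * (ennreal (200 / (x/2)) * (\<integral>\<^sup>+w. ennreal (h w) * indicator {w. (x/2) / 8 < h w} w \<partial>lborel))"
        using True by (intro mult_left_mono maxfun_layer h) auto
      also have "\<dots> = (\<integral>\<^sup>+w. ennreal (s * x powr (s-1)) * (ennreal (200 / (x/2)) * (ennreal (h w) * indicator {w. (x/2) / 8 < h w} w)) \<partial>lborel)"
        by (simp add: nn_integral_cmult)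
      also have "\<dots> \<le> (\<integral>\<^sup>+w. ennreal (400 * s * h w) * (ennreal (x powr (s-2)) * indicator {0..16 * h w} x) \<partial>lborel)"
      proof (rule nn_integral_mono)
        fix w
        have e: "s * x powr (s-1) * (200 / (x/2) * h w) = 400 * s * h w * x powr (s-2)"
          using True powr_add[of x 1 "s-2"] by simp
        show "ennreal (s * x powr (s-1)) * (ennreal (200 / (x/2)) * (ennreal (h w) * indicator {w. (x/2) / 8 < h w} w)) 
          \<le> ennreal (400 * s * h w) * (ennreal (x powr (s-2)) * indicator {0..16 * h w} x)"
        proof (cases "x / 16 < h w")
          case t: True
          have "ennreal (s * x powr (s-1)) * (ennreal (200 / (x/2)) * ennreal (h w)) = ennreal (s * x powr (s-1) * (200 / (x/2) * h w))"
          proof -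
            have "ennreal (s * x powr (s-1) * (200 / (x/2) * h w)) = ennreal (s * x powr (s-1)) * ennreal (200 / (x/2) * h w)"
              by (rule ennreal_mult) (use True s h(2)[of w] in auto)
            also have "ennreal (200 / (x/2) * h w) = ennreal (200 / (x/2)) * ennreal (h w)"
              by (rule ennreal_mult) (use True h(2)[of w] in auto)
            finally show ?thesis ..
          qed
          also have "\<dots> = ennreal (400 * s * h w) * ennreal (x powr (s-2))"
            unfolding e using s h(2)[of w] by (intro ennreal_mult) auto
          finally show ?thesis using t True by simp
        qed simp
      qed
      finally show ?thesis .
    qed
  qed
  also have "\<dots> = (\<integral>\<^sup>+w. (\<integral>\<^sup>+x. ennreal (400 * s * h w) * (ennreal (x powr (s-2)) * indicator {0..16 * h w} x) \<partial>lborel) \<partial>lborel)"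
    by (rule lborel_pair.Fubini'[symmetric]) (simp add: case_prod_unfold indicator_def, measurable)
  also have "\<dots> = (\<integral>\<^sup>+w. ennreal (400 * s * 16 powr (s-1) / (s-1)) * ennreal (h w powr s) \<partial>lborel)"
  proof (rule nn_integral_cong)
    fix w
    have "(\<integral>\<^sup>+x. ennreal (400 * s * h w) * (ennreal (x powr (s-2)) * indicator {0..16 * h w} x) \<partial>lborel) = ennreal (400 * s * h w) * ennreal ((16 * h w) powr (s-1) / (s-1))"
      using nn_integral_powr_0[of "s-2" "16 * h w"] s h(2)[of w] by (subst nn_integral_cmult) auto
    also have "\<dots> = ennreal (400 * s * h w * ((16 * h w) powr (s-1) / (s-1)))"
      using s h(2)[of w] by (intro ennreal_mult[symmetric]) auto
    also have "400 * s * h w * ((16 * h w) powr (s-1) / (s-1)) = 400 * s * 16 powr (s-1) / (s-1) * h w powr s"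
    proof (cases "h w = 0")
      case False
      then have "h w powr s = h w * h w powr (s-1)" using h(2)[of w] powr_add[of "h w" 1 "s-1"] by simp
      then show ?thesis using h(2)[of w] by (simp add: powr_mult)
    qed simp
    also have "ennreal \<dots> = ennreal (400 * s * 16 powr (s-1) / (s-1)) * ennreal (h w powr s)" using s by (intro ennreal_mult) auto
    finally show "(\<integral>\<^sup>+x. ennreal (400 * s * h w) * (ennreal (x powr (s-2)) * indicator {0..16 * h w} x) \<partial>lborel) = ennreal (400 * s * 16 powr (s-1) / (s-1)) * ennreal (h w powr s)" .
  qed
  also have "\<dots> = ennreal (400 * s * 16 powr (s-1) / (s-1)) * ?I" by (subst nn_integral_cmult) auto
  finally show "(\<integral>\<^sup>+z. ennreal (enn2real (maxfun h z) powr s) \<partial>lborel) \<le> ennreal (400 * s * 16 powr (s-1) / (s-1)) * ?I" unfolding m_def .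
qed

section \<open>Sobolev functions\<close>

definition sob :: "real \<Rightarrow> (real^2 \<Rightarrow> real) \<Rightarrow> (2 \<Rightarrow> 2 \<Rightarrow> real^2 \<Rightarrow> real) \<Rightarrow> bool" where
  "sob p F g \<longleftrightarrow> continuous_on UNIV F \<and> weak_hessian F g \<and> Lp_hessian p g"

text \<open>A choice, so that the gradient depends on the function alone and not on a weak Hessian;
  \<open>grad_unique\<close> identifies it wherever a derivative exists.\<close>

definition grad :: "(real^2 \<Rightarrow> real) \<Rightarrow> real^2 \<Rightarrow> real^2" where
  "grad F x = (SOME D. (F has_derivative (\<lambda>h. D \<bullet> h)) (at x))"

lemma grad_unique:
  assumes "(F has_derivative (\<lambda>h. D \<bullet> h)) (at x)" shows "grad F x = D"
proof -
  have "(F has_derivative (\<lambda>h. grad F x \<bullet> h)) (at x)" unfolding grad_def by (rule someI[of "\<lambda>D. (F has_derivative (\<lambda>h. D \<bullet> h)) (at x)", OF assms])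
  from has_derivative_unique[OF this assms] have "grad F x \<bullet> h = D \<bullet> h" for h by metis
  then show ?thesis by (metis inner_commute vector_eq_rdot)
qed

lemma powr_sum_le:
  fixes a b p :: real
  assumes "a \<ge> 0" "b \<ge> 0" "p \<ge> 0"
  shows "(a + b) powr p \<le> 2 powr p * (a powr p + b powr p)"
proof -
  have "(a + b) powr p \<le> (2 * max a b) powr p" using assms by (intro powr_mono2) auto
  also have "\<dots> = 2 powr p * max a b powr p" using assms by (subst powr_mult) auto
  also have "\<dots> \<le> 2 powr p * (a powr p + b powr p)" by (intro mult_left_mono) (auto simp: max_def)
  finally show ?thesis .
qed

lemma hnorm_le_sum: "hnorm g x \<le> (\<Sum>i\<in>UNIV. \<Sum>j\<in>UNIV. \<bar>g i j x\<bar>)"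
proof -
  have "hnorm g x = L2_set (\<lambda>(i,j). g i j x) UNIV"
    unfolding hnorm_def L2_set_def UNIV_Times_UNIV[symmetric] sum.cartesian_product by (simp add: case_prod_unfold)
  also have "\<dots> \<le> (\<Sum>s\<in>UNIV. \<bar>(\<lambda>(i,j). g i j x) s\<bar>)" by (rule L2_set_le_sum_abs)
  also have "\<dots> = (\<Sum>i\<in>UNIV. \<Sum>j\<in>UNIV. \<bar>g i j x\<bar>)"
    unfolding UNIV_Times_UNIV[symmetric] sum.cartesian_product by (simp add: case_prod_unfold)
  finally show ?thesis .
qed

lemma hnorm_triangle: "hnorm (\<lambda>i j x. g i j x + h i j x) x \<le> hnorm g x + hnorm h x"
proof -
  have e: "hnorm g x = L2_set (\<lambda>(i,j). g i j x) UNIV" for g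
    unfolding hnorm_def L2_set_def UNIV_Times_UNIV[symmetric] sum.cartesian_product by (simp add: case_prod_unfold)
  show ?thesis unfolding e using L2_set_triangle_ineq[of "\<lambda>(i,j). g i j x" "\<lambda>(i,j). h i j x" UNIV]
    by (simp add: case_prod_unfold)
qed

lemma hnorm_scale: "hnorm (\<lambda>i j x. c * g i j x) x = \<bar>c\<bar> * hnorm g x"
  unfolding hnorm_def by (simp add: power_mult_distrib sum_distrib_left[symmetric] real_sqrt_mult)

lemma sob_measurable: "sob p F g \<Longrightarrow> g i j \<in> borel_measurable borel"
  unfolding sob_def Lp_hessian_def by auto

lemma sob_hnorm_measurable: "sob p F g \<Longrightarrow> hnorm g \<in> borel_measurable borel"
  by (rule hnorm_measurable) (rule sob_measurable)

lemma sob_integrable: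
  assumes "sob p F g" "p > 0" shows "integrable lborel (\<lambda>x. hnorm g x powr p)"
proof (rule Bochner_Integration.integrable_bound)
  let ?s = "\<lambda>x. \<bar>g 1 1 x\<bar> powr p + \<bar>g 1 2 x\<bar> powr p + \<bar>g 2 1 x\<bar> powr p + \<bar>g 2 2 x\<bar> powr p"
  show "integrable lborel (\<lambda>x. 2 powr p * (2 powr p * ?s x))"
    using assms unfolding sob_def Lp_hessian_def by (intro integrable_mult_right Bochner_Integration.integrable_add) auto
  show "(\<lambda>x. hnorm g x powr p) \<in> borel_measurable lborel" using sob_hnorm_measurable[OF assms(1)] by measurable
  have "hnorm g x powr p \<le> 2 powr p * (2 powr p * ?s x)" for x
  proof -
    have "hnorm g x powr p \<le> ((\<bar>g 1 1 x\<bar> + \<bar>g 1 2 x\<bar>) + (\<bar>g 2 1 x\<bar> + \<bar>g 2 2 x\<bar>)) powr p"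
      using hnorm_le_sum[of g x] assms(2) hnorm_nonneg by (intro powr_mono2) (auto simp: sum_2)
    also have "\<dots> \<le> 2 powr p * ((\<bar>g 1 1 x\<bar> + \<bar>g 1 2 x\<bar>) powr p + (\<bar>g 2 1 x\<bar> + \<bar>g 2 2 x\<bar>) powr p)"
      using assms(2) by (intro powr_sum_le) auto
    also have "\<dots> \<le> 2 powr p * (2 powr p * (\<bar>g 1 1 x\<bar> powr p + \<bar>g 1 2 x\<bar> powr p) + 2 powr p * (\<bar>g 2 1 x\<bar> powr p + \<bar>g 2 2 x\<bar> powr p))"
      using assms(2) by (intro mult_left_mono add_mono powr_sum_le) auto
    finally show ?thesis by (simp add: algebra_simps)
  qed
  then show "AE x in lborel. norm (hnorm g x powr p) \<le> norm (2 powr p * (2 powr p * ?s x))"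
    by (intro AE_I2) (simp add: add_nonneg_nonneg)
qed

lemma sob_locint:
  assumes "sob p F g" "0 < q" "q \<le> p" shows "locint (\<lambda>x. hnorm g x powr q)"
  unfolding locint_def
proof
  fix r
  have c: "integrable lborel (\<lambda>x. indicator (ball (0::real^2) r) x * (1::real))"
    using locintD[OF locint_continuous[of "\<lambda>_. 1"]] by simp
  show "integrable lborel (\<lambda>x. indicator (ball 0 r) x * hnorm g x powr q)"
  proof (rule Bochner_Integration.integrable_bound)
    show "integrable lborel (\<lambda>x. indicator (ball 0 r) x * 1 + hnorm g x powr p)"
      using c sob_integrable[OF assms(1)] assms(2,3) by (intro Bochner_Integration.integrable_add) auto
    show "(\<lambda>x. indicator (ball 0 r) x * hnorm g x powr q) \<in> borel_measurable lborel"
      using sob_hnorm_measurable[OF assms(1)] by (intro borel_measurable_times borel_measurable_indicator) auto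
    have "hnorm g x powr q \<le> 1 + hnorm g x powr p" for x
    proof (cases "hnorm g x \<le> 1")
      case True
      then have "hnorm g x powr q \<le> 1 powr q" using assms(2) hnorm_nonneg by (intro powr_mono2) auto
      then show ?thesis by (simp add: add_increasing2)
    next
      case False
      then have "hnorm g x powr q \<le> hnorm g x powr p" using assms(3) by (intro powr_mono) auto
      then show ?thesis by simp
    qed
    then show "AE x in lborel. norm (indicator (ball 0 r) x * hnorm g x powr q) \<le> norm (indicator (ball 0 r) x * 1 + hnorm g x powr p)"
      by (intro AE_I2) (auto simp: indicator_def)
  qed
qed

lemma weak_hessian_add:
  "weak_hessian F g \<Longrightarrow> weak_hessian G h \<Longrightarrow> weak_hessian (\<lambda>x. F x + G x) (\<lambda>i j x. g i j x + h i j x)"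
  unfolding weak_hessian_def by (simp add: distrib_right)

lemma weak_hessian_scale:
  "weak_hessian F g \<Longrightarrow> weak_hessian (\<lambda>x. c * F x) (\<lambda>i j x. c * g i j x)"
  unfolding weak_hessian_def by (simp add: mult.assoc)

lemma Lp_hessian_add:
  assumes "p \<ge> 0" "Lp_hessian p g" "Lp_hessian p h" shows "Lp_hessian p (\<lambda>i j x. g i j x + h i j x)"
  unfolding Lp_hessian_def
proof (intro allI conjI)
  fix i j
  note m [measurable] = assms(2,3)[unfolded Lp_hessian_def, rule_format, of i j, THEN conjunct1]
  show "(\<lambda>x. g i j x + h i j x) \<in> borel_measurable lborel" by measurable
  show "integrable lborel (\<lambda>x. \<bar>g i j x + h i j x\<bar> powr p)"
  proof (rule Bochner_Integration.integrable_bound)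
    show "integrable lborel (\<lambda>x. 2 powr p * (\<bar>g i j x\<bar> powr p + \<bar>h i j x\<bar> powr p))"
      using assms(2,3) unfolding Lp_hessian_def by (intro integrable_mult_right Bochner_Integration.integrable_add) auto
    have "\<bar>g i j x + h i j x\<bar> powr p \<le> 2 powr p * (\<bar>g i j x\<bar> powr p + \<bar>h i j x\<bar> powr p)" for x
      using powr_sum_le[of "\<bar>g i j x\<bar>" "\<bar>h i j x\<bar>" p] assms(1) powr_mono2[of p "\<bar>g i j x + h i j x\<bar>" "\<bar>g i j x\<bar> + \<bar>h i j x\<bar>"]
      by (simp add: abs_triangle_ineq)
    then show "AE x in lborel. norm (\<bar>g i j x + h i j x\<bar> powr p) \<le> norm (2 powr p * (\<bar>g i j x\<bar> powr p + \<bar>h i j x\<bar> powr p))"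
      by (intro AE_I2) (simp add: add_nonneg_nonneg)
  qed measurable
qed

lemma Lp_hessian_scale:
  assumes "Lp_hessian p g" shows "Lp_hessian p (\<lambda>i j x. c * g i j x)"
  using assms unfolding Lp_hessian_def by (auto simp: abs_mult powr_mult intro!: borel_measurable_times)

lemma sob_add: "p \<ge> 0 \<Longrightarrow> sob p F g \<Longrightarrow> sob p G h \<Longrightarrow> sob p (\<lambda>x. F x + G x) (\<lambda>i j x. g i j x + h i j x)"
  unfolding sob_def by (auto intro!: continuous_intros weak_hessian_add Lp_hessian_add)

lemma sob_scale: "sob p F g \<Longrightarrow> sob p (\<lambda>x. c * F x) (\<lambda>i j x. c * g i j x)"
  unfolding sob_def by (auto intro!: continuous_intros weak_hessian_scale Lp_hessian_scale)

lemma sob_diff: "p \<ge> 0 \<Longrightarrow> sob p F g \<Longrightarrow> sob p G h \<Longrightarrow> sob p (\<lambda>x. F x - G x) (\<lambda>i j x. g i j x - h i j x)"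
  using sob_add[of p F g "\<lambda>x. (-1) * G x" "\<lambda>i j x. (-1) * h i j x"] sob_scale[of p G h "-1"] by simp

lemma sob_affine: "sob p (\<lambda>x. c + a \<bullet> x) (\<lambda>i j x. 0)"
proof -
  have "weak_hessian (\<lambda>x. c + a \<bullet> x) (\<lambda>i j x. 0)"
  proof (rule weak_hessian_classical[of _ "\<lambda>i x. a $ i"])
    show "line_deriv (\<lambda>x. c + a \<bullet> x) (axis i 1) (\<lambda>x. a $ i)" for i
      using line_deriv_add[OF line_deriv_const line_deriv_inner[of a "axis i 1"], of c] by (simp add: inner_commute inner_axis)
    show "line_deriv (\<lambda>x. a $ i) (axis j 1) (\<lambda>x. 0)" for i j by (rule line_deriv_const)
  qed (auto intro!: continuous_intros)
  then show ?thesis unfolding sob_def Lp_hessian_def by (auto intro!: continuous_intros)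
qed

lemma powr_convex_nonneg:
  assumes "p \<ge> 1" shows "convex_on {0..} (\<lambda>x::real. x powr p)"
proof (rule convex_onI)
  fix t x y :: real assume t: "0 < t" "t < 1" and xy: "x \<in> {0..}" "y \<in> {0..}"
  have 1: "(t * c) powr p \<le> t * c powr p" if "0 < t" "t < 1" "c \<ge> 0" for t c :: real
  proof -
    have "t powr p \<le> t powr 1" using that assms by (intro powr_mono') auto
    then show ?thesis using that by (simp add: powr_mult mult_right_mono)
  qed
  consider "x = 0" | "y = 0" | "x > 0" "y > 0" using xy by force
  then show "((1 - t) *\<^sub>R x + t *\<^sub>R y) powr p \<le> (1 - t) * x powr p + t * y powr p"
  proof cases
    case 3
    then show ?thesis using convex_onD[OF powr_convex[OF assms], of t x y] t by simp
  qed (use 1[of t y] 1[of "1-t" x] t xy in auto)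
qed simp

text \<open>Convexity of the p-th power applied to \<open>f\<close> and \<open>g\<close> divided by
  their norms, the weights being the shares of the two norms in their sum.\<close>

lemma minkowski:
  fixes f g :: "'a \<Rightarrow> real"
  assumes p: "p > 1" and f: "\<And>x. f x \<ge> 0" "integrable M (\<lambda>x. f x powr p)" and g: "\<And>x. g x \<ge> 0" "integrable M (\<lambda>x. g x powr p)"
    and h: "\<And>x. h x \<ge> 0" "\<And>x. h x \<le> f x + g x"
  shows "(\<integral>x. h x powr p \<partial>M) powr (1/p) \<le> (\<integral>x. f x powr p \<partial>M) powr (1/p) + (\<integral>x. g x powr p \<partial>M) powr (1/p)"
proof (rule field_le_epsilon)
  fix e :: real assume e: "e > 0"
  \<comment> \<open>The added \<open>e/2\<close> makes the normalising constant positive even when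
    the norm is 0.\<close>
  define A where "A = (\<integral>x. f x powr p \<partial>M) powr (1/p) + e/2"
  define B where "B = (\<integral>x. g x powr p \<partial>M) powr (1/p) + e/2"
  have AB: "A > 0" "B > 0" unfolding A_def B_def using e by (auto intro: add_nonneg_pos)
  have If: "(\<integral>x. f x powr p \<partial>M) \<ge> 0" and Ig: "(\<integral>x. g x powr p \<partial>M) \<ge> 0" by (auto intro!: integral_nonneg_AE)
  have "(\<integral>x. f x powr p \<partial>M) = ((\<integral>x. f x powr p \<partial>M) powr (1/p)) powr p" using If p by (simp add: powr_powr)
  also have "\<dots> \<le> A powr p" unfolding A_def using e p by (intro powr_mono2) auto
  finally have fA: "(\<integral>x. f x powr p \<partial>M) \<le> A powr p" .
  have "(\<integral>x. g x powr p \<partial>M) = ((\<integral>x. g x powr p \<partial>M) powr (1/p)) powr p" using Ig p by (simp add: powr_powr)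
  also have "\<dots> \<le> B powr p" unfolding B_def using e p by (intro powr_mono2) auto
  finally have gB: "(\<integral>x. g x powr p \<partial>M) \<le> B powr p" .
  define u where "u = A / (A + B)"
  have u: "0 < u" "u < 1" "1 - u = B / (A + B)" using AB by (auto simp: u_def field_simps)
  have cx: "(u * a + (1 - u) * b) powr p \<le> u * a powr p + (1 - u) * b powr p" if "a \<ge> 0" "b \<ge> 0" for a b :: real
    using convex_onD[OF powr_convex_nonneg[of p], of "1 - u" a b] u(1,2) p that by simp
  have pt: "h x powr p \<le> (A + B) powr p * (u / A powr p * f x powr p + (1 - u) / B powr p * g x powr p)" for x
  proof -
    have "h x powr p \<le> (f x + g x) powr p" using h p by (intro powr_mono2) auto
    also have "f x + g x = (A + B) * (u * (f x / A) + (1 - u) * (g x / B))"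
    proof -
      have e: "(A + B) * u = A" "(A + B) * (1 - u) = B" unfolding u(3) unfolding u_def using AB by auto
      have "(A + B) * (u * (f x / A) + (1 - u) * (g x / B)) = ((A + B) * u) * (f x / A) + ((A + B) * (1 - u)) * (g x / B)"
        by (simp only: distrib_left mult.assoc)
      also have "\<dots> = f x + g x" unfolding e using AB by simp
      finally show ?thesis ..
    qed
    also have "\<dots> powr p = (A + B) powr p * (u * (f x / A) + (1 - u) * (g x / B)) powr p"
      using AB u f(1) g(1) by (subst powr_mult) auto
    also have "\<dots> \<le> (A + B) powr p * (u * (f x / A) powr p + (1 - u) * (g x / B) powr p)"
      using AB f(1) g(1) by (intro mult_left_mono cx) auto
    finally show ?thesis using AB f(1) g(1) by (simp add: powr_divide)
  qed
  have "(\<integral>x. h x powr p \<partial>M) \<le> (\<integral>x. (A + B) powr p * (u / A powr p * f x powr p + (1 - u) / B powr p * g x powr p) \<partial>M)"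
  proof (rule integral_mono_AE')
    show "integrable M (\<lambda>x. (A + B) powr p * (u / A powr p * f x powr p + (1 - u) / B powr p * g x powr p))"
      using f(2) g(2) by (intro integrable_mult_right Bochner_Integration.integrable_add) auto
    show "AE x in M. h x powr p \<le> (A + B) powr p * (u / A powr p * f x powr p + (1 - u) / B powr p * g x powr p)"
      using pt by (intro AE_I2)
    show "AE x in M. 0 \<le> (A + B) powr p * (u / A powr p * f x powr p + (1 - u) / B powr p * g x powr p)"
      using order_trans[OF powr_ge_zero pt] by (intro AE_I2)
  qed
  also have "\<dots> = (A + B) powr p * (u / A powr p * (\<integral>x. f x powr p \<partial>M) + (1 - u) / B powr p * (\<integral>x. g x powr p \<partial>M))"
    using f(2) g(2) by simp
  also have "\<dots> \<le> (A + B) powr p * (u / A powr p * A powr p + (1 - u) / B powr p * B powr p)"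
    using fA gB u AB by (intro mult_left_mono add_mono) auto
  also have "\<dots> = (A + B) powr p" using AB by simp
  finally have "(\<integral>x. h x powr p \<partial>M) powr (1/p) \<le> ((A + B) powr p) powr (1/p)"
    using p by (intro powr_mono2) (auto intro!: integral_nonneg_AE)
  also have "\<dots> = A + B" using AB p by (simp add: powr_powr)
  finally show "(\<integral>x. h x powr p \<partial>M) powr (1/p) \<le> (\<integral>x. f x powr p \<partial>M) powr (1/p) + (\<integral>x. g x powr p \<partial>M) powr (1/p) + e"
    unfolding A_def B_def by simp
qed

abbreviation taylor_ctrl :: "(real^2 \<Rightarrow> real) \<Rightarrow> real^2 \<Rightarrow> real \<Rightarrow> real \<Rightarrow> bool" where
  "taylor_ctrl F z R c \<equiv> \<forall>x\<in>ball z R. \<forall>y\<in>ball z R. norm (grad F y - grad F x) \<le> R * c \<and> \<bar>F y - F x - grad F x \<bullet> (y - x)\<bar> \<le> norm (y - x) * R * c"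

text \<open>One function \<open>m\<close> controls the Taylor expansions around z at all radii at
  once. The set S localises the estimate: near one point only the energy within a single ball is
  available.\<close>

abbreviation taylor_majorant :: "real \<Rightarrow> real \<Rightarrow> (real^2 \<Rightarrow> real) \<Rightarrow> (2 \<Rightarrow> 2 \<Rightarrow> real^2 \<Rightarrow> real) \<Rightarrow> (real^2) set \<Rightarrow> (real^2 \<Rightarrow> real) \<Rightarrow> bool" where
  "taylor_majorant C p F g S m \<equiv> m \<in> borel_measurable borel \<and> (\<forall>z. m z \<ge> 0) \<and>
     (\<integral>\<^sup>+z. ennreal (m z powr p) \<partial>lborel) \<le> ennreal C * (\<integral>\<^sup>+z. ennreal (hnorm g z powr p) * indicator S z \<partial>lborel) \<and>
     (AE z in lborel. \<forall>R>0. ball z (2*R) \<subseteq> S \<longrightarrow> taylor_ctrl F z R (m z))"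

text \<open>For the last conclusion Morrey's inequality is used at an exponent q below p: the mean
  of the q-th power of the Hessian is at most the maximal function of an L^(p/q) function with
  \<open>p/q > 1\<close>, so the maximal theorem returns a bound in terms of the p-th power.\<close>

theorem sob_morrey:
  assumes p: "p > 2"
  obtains C where "C > 0"
    "\<And>F g x. sob p F g \<Longrightarrow> (F has_derivative (\<lambda>h. grad F x \<bullet> h)) (at x)"
    "\<And>F g z R x y. sob p F g \<Longrightarrow> R > 0 \<Longrightarrow> x \<in> ball z R \<Longrightarrow> y \<in> ball z R \<Longrightarrow>
       norm (grad F y - grad F x) \<le> C * R powr (1 - 2/p) * hint p g z (2*R) powr (1/p) \<and>
       \<bar>F y - F x - grad F x \<bullet> (y - x)\<bar> \<le> C * norm (y - x) * R powr (1 - 2/p) * hint p g z (2*R) powr (1/p)"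
    "\<And>F g S. sob p F g \<Longrightarrow> S \<in> sets borel \<Longrightarrow> \<exists>m. taylor_majorant C p F g S m"
proof -
  \<comment> \<open>Any exponent strictly between 2 and p would serve; Morrey's inequality needs
    \<open>q > 2\<close> and the maximal theorem \<open>p/q > 1\<close>.\<close>
  define q where "q = (p + 2) / 2"
  have q: "q > 2" "q < p" using p by (auto simp: q_def)
  define s where "s = p / q"
  have s: "s > 1" using q by (simp add: s_def)
  obtain Cp where Cp: "Cp > 0" and mp: "\<And>F g. continuous_on UNIV F \<Longrightarrow> weak_hessian F g \<Longrightarrow> (\<And>i j. g i j \<in> borel_measurable borel) \<Longrightarrow> locint (\<lambda>w. hnorm g w powr p) \<Longrightarrow>
      \<exists>D. (\<forall>x. (F has_derivative (\<lambda>h. D x \<bullet> h)) (at x)) \<and>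
        (\<forall>z R x y. R > 0 \<longrightarrow> x \<in> ball z R \<longrightarrow> y \<in> ball z R \<longrightarrow> 
          norm (D y - D x) \<le> Cp * R powr (1 - 2/p) * hint p g z (2*R) powr (1/p) \<and>
          \<bar>F y - F x - D x \<bullet> (y - x)\<bar> \<le> Cp * norm (y - x) * R powr (1 - 2/p) * hint p g z (2*R) powr (1/p))"
    using morrey[OF p] by blast
  obtain Cq where Cq: "Cq > 0" and mq: "\<And>F g. continuous_on UNIV F \<Longrightarrow> weak_hessian F g \<Longrightarrow> (\<And>i j. g i j \<in> borel_measurable borel) \<Longrightarrow> locint (\<lambda>w. hnorm g w powr q) \<Longrightarrow>
      \<exists>D. (\<forall>x. (F has_derivative (\<lambda>h. D x \<bullet> h)) (at x)) \<and>
        (\<forall>z R x y. R > 0 \<longrightarrow> x \<in> ball z R \<longrightarrow> y \<in> ball z R \<longrightarrow> 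
          norm (D y - D x) \<le> Cq * R powr (1 - 2/q) * hint q g z (2*R) powr (1/q) \<and>
          \<bar>F y - F x - D x \<bullet> (y - x)\<bar> \<le> Cq * norm (y - x) * R powr (1 - 2/q) * hint q g z (2*R) powr (1/q))"
    using morrey[OF q(1)] by blast
  define K where "K = (4 * Cq) powr p * (400 * s * 16 powr (s-1) / (s-1))"
  have K: "K > 0" unfolding K_def using Cq s by auto
  have cp: "(F has_derivative (\<lambda>h. grad F x \<bullet> h)) (at x) \<and>
        (R > 0 \<longrightarrow> x \<in> ball z R \<longrightarrow> y \<in> ball z R \<longrightarrow> 
          norm (grad F y - grad F x) \<le> Cp * R powr (1 - 2/p) * hint p g z (2*R) powr (1/p) \<and>
          \<bar>F y - F x - grad F x \<bullet> (y - x)\<bar> \<le> Cp * norm (y - x) * R powr (1 - 2/p) * hint p g z (2*R) powr (1/p))"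
    if so: "sob p F g" for F g z R x y
  proof -
    have l: "locint (\<lambda>w. hnorm g w powr p)" using sob_locint[OF so, of p] p q by simp
    obtain D where D: "(\<forall>x. (F has_derivative (\<lambda>h. D x \<bullet> h)) (at x)) \<and>
        (\<forall>z R x y. R > 0 \<longrightarrow> x \<in> ball z R \<longrightarrow> y \<in> ball z R \<longrightarrow> 
          norm (D y - D x) \<le> Cp * R powr (1 - 2/p) * hint p g z (2*R) powr (1/p) \<and>
          \<bar>F y - F x - D x \<bullet> (y - x)\<bar> \<le> Cp * norm (y - x) * R powr (1 - 2/p) * hint p g z (2*R) powr (1/p))"
      using mp[OF _ _ sob_measurable[OF so] l] so unfolding sob_def by (elim conjE exE) (blast intro: that)
    have "grad F = D" using D grad_unique by blast
    then show ?thesis using D by blast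
  qed
  have cq: "R > 0 \<longrightarrow> x \<in> ball z R \<longrightarrow> y \<in> ball z R \<longrightarrow> 
          norm (grad F y - grad F x) \<le> Cq * R powr (1 - 2/q) * hint q g z (2*R) powr (1/q) \<and>
          \<bar>F y - F x - grad F x \<bullet> (y - x)\<bar> \<le> Cq * norm (y - x) * R powr (1 - 2/q) * hint q g z (2*R) powr (1/q)"
    if so: "sob p F g" for F g z R x y
  proof -
    have l: "locint (\<lambda>w. hnorm g w powr q)" using sob_locint[OF so, of q] p q by simp
    obtain D where D: "(\<forall>x. (F has_derivative (\<lambda>h. D x \<bullet> h)) (at x)) \<and>
        (\<forall>z R x y. R > 0 \<longrightarrow> x \<in> ball z R \<longrightarrow> y \<in> ball z R \<longrightarrow> 
          norm (D y - D x) \<le> Cq * R powr (1 - 2/q) * hint q g z (2*R) powr (1/q) \<and>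
          \<bar>F y - F x - D x \<bullet> (y - x)\<bar> \<le> Cq * norm (y - x) * R powr (1 - 2/q) * hint q g z (2*R) powr (1/q))"
      using mq[OF _ _ sob_measurable[OF so] l] so unfolding sob_def by (elim conjE exE) (blast intro: that)
    have "grad F = D" using D grad_unique by blast
    then show ?thesis using D by blast
  qed
  show ?thesis
  proof (rule that[of "max Cp K"])
    show "0 < max Cp K" using Cp by simp
    show "(F has_derivative (\<lambda>h. grad F x \<bullet> h)) (at x)" if "sob p F g" for F g x using cp[OF that] by blast
    show "norm (grad F y - grad F x) \<le> max Cp K * R powr (1 - 2/p) * hint p g z (2*R) powr (1/p) \<and>
       \<bar>F y - F x - grad F x \<bullet> (y - x)\<bar> \<le> max Cp K * norm (y - x) * R powr (1 - 2/p) * hint p g z (2*R) powr (1/p)"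
      if "sob p F g" "R > 0" "x \<in> ball z R" "y \<in> ball z R" for F g z R x y
    proof -
      have "Cp * R powr (1 - 2/p) * hint p g z (2*R) powr (1/p) \<le> max Cp K * R powr (1 - 2/p) * hint p g z (2*R) powr (1/p)"
        "Cp * norm (y - x) * R powr (1 - 2/p) * hint p g z (2*R) powr (1/p) \<le> max Cp K * norm (y - x) * R powr (1 - 2/p) * hint p g z (2*R) powr (1/p)"
        by (intro mult_right_mono; simp)+
      then show ?thesis using cp[OF that(1), of x R z y] that(2-4) by linarith
    qed
    fix F g and S :: "(real^2) set" assume sob: "sob p F g" and S: "S \<in> sets borel"
    define h where "h w = hnorm g w powr q * indicator S w" for w
    have hm: "h \<in> borel_measurable borel" unfolding h_def using sob_hnorm_measurable[OF sob] S by measurable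
    have h0: "h w \<ge> 0" for w by (simp add: h_def)
    have hs: "ennreal (h w powr s) = ennreal (hnorm g w powr p) * indicator S w" for w
      using q by (auto simp: h_def s_def powr_powr indicator_def)
    have fin: "(\<integral>\<^sup>+w. ennreal (h w powr s) \<partial>lborel) < \<infinity>"
    proof -
      have "(\<integral>\<^sup>+w. ennreal (h w powr s) \<partial>lborel) \<le> (\<integral>\<^sup>+w. ennreal (hnorm g w powr p) \<partial>lborel)"
        unfolding hs by (rule nn_integral_mono) (auto simp: indicator_def)
      also have "\<dots> < \<infinity>" using sob_integrable[OF sob] p by (simp add: integrable_iff_bounded)
      finally show ?thesis .
    qed
    define m0 where "m0 z = enn2real (maxfun h z)" for z
    \<comment> \<open>The powers of R combine to R itself, whatever q is; the 4 absorbs the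
      \<open>2 powr (2/q)\<close> from the doubled radius.\<close>
    define m where "m z = 4 * Cq * m0 z powr (1/q)" for z
    note [measurable] = measurable_maxfun[of h]
    have "m \<in> borel_measurable borel" unfolding m_def m0_def by measurable
    moreover have "m z \<ge> 0" for z unfolding m_def using Cq by simp
    moreover have "(\<integral>\<^sup>+z. ennreal (m z powr p) \<partial>lborel) \<le> ennreal (max Cp K) * (\<integral>\<^sup>+z. ennreal (hnorm g z powr p) * indicator S z \<partial>lborel)"
    proof -
      have e: "ennreal (m z powr p) = ennreal ((4 * Cq) powr p) * ennreal (m0 z powr s)" for z
        unfolding m_def s_def using Cq by (simp add: powr_mult powr_powr ennreal_mult)
      have "(\<integral>\<^sup>+z. ennreal (m z powr p) \<partial>lborel) = ennreal ((4 * Cq) powr p) * (\<integral>\<^sup>+z. ennreal (m0 z powr s) \<partial>lborel)"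
        unfolding e by (rule nn_integral_cmult) (simp add: m0_def)
      also have "\<dots> \<le> ennreal ((4 * Cq) powr p) * (ennreal (400 * s * 16 powr (s-1) / (s-1)) * (\<integral>\<^sup>+w. ennreal (h w powr s) \<partial>lborel))"
        unfolding m0_def by (intro mult_left_mono maxfun_strong_type(2)[OF hm h0 s fin]) auto
      also have "\<dots> = ennreal K * (\<integral>\<^sup>+w. ennreal (h w powr s) \<partial>lborel)"
        unfolding K_def mult.assoc[symmetric] using s by (subst ennreal_mult) auto
      also have "\<dots> \<le> ennreal (max Cp K) * (\<integral>\<^sup>+w. ennreal (h w powr s) \<partial>lborel)"
        by (intro mult_right_mono ennreal_leI) auto
      finally show ?thesis unfolding hs .
    qed
    moreover have "AE z in lborel. \<forall>R>0. ball z (2*R) \<subseteq> S \<longrightarrow> taylor_ctrl F z R (m z)"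
      using maxfun_strong_type(1)[OF hm h0 s fin]
    proof eventually_elim
      case (elim z)
      show ?case
      proof (intro allI impI ballI)
        fix R x y assume R: "(R::real) > 0" and sub: "ball z (2*R) \<subseteq> S" and xy: "x \<in> ball z R" "y \<in> ball z R"
        have hi: "hint q g z (2*R) \<le> m0 z * (2*R)\<^sup>2"
        proof -
          have n1: "\<not> maxfun h z < (\<integral>\<^sup>+w. ennreal (h w) * indicator (ball z (2*R)) w \<partial>lborel) / ennreal ((2*R)\<^sup>2)"
          proof
            assume "maxfun h z < (\<integral>\<^sup>+w. ennreal (h w) * indicator (ball z (2*R)) w \<partial>lborel) / ennreal ((2*R)\<^sup>2)"
            then have "\<exists>c r. 0 < r \<and> z \<in> ball c r \<and> maxfun h z < (\<integral>\<^sup>+w. ennreal (h w) * indicator (ball c r) w \<partial>lborel) / ennreal (r\<^sup>2)"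
              using R by (intro exI[of _ z] exI[of _ "2*R"]) auto
            then have "maxfun h z < maxfun h z" by (simp only: less_maxfun_iff)
            then show False by simp
          qed
          have "\<not> maxfun h z * ennreal ((2*R)\<^sup>2) < (\<integral>\<^sup>+w. ennreal (h w) * indicator (ball z (2*R)) w \<partial>lborel)"
            using n1 R less_div_ennreal_iff[of "(2*R)\<^sup>2"] by simp
          then have le: "(\<integral>\<^sup>+w. ennreal (h w) * indicator (ball z (2*R)) w \<partial>lborel) \<le> maxfun h z * ennreal ((2*R)\<^sup>2)" by simp
          have mf: "maxfun h z = ennreal (m0 z)" unfolding m0_def using elim by simp
          have "ennreal (hint q g z (2*R)) = (\<integral>\<^sup>+w. ennreal (indicator (ball z (2*R)) w *\<^sub>R hnorm g w powr q) \<partial>lborel)"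
            unfolding hint_def set_lebesgue_integral_def
            using locint_set_integrable_ball[OF sob_locint[OF sob, of q]] q unfolding set_integrable_def
            by (intro nn_integral_eq_integral[symmetric]) auto
          also have "\<dots> = (\<integral>\<^sup>+w. ennreal (h w) * indicator (ball z (2*R)) w \<partial>lborel)"
            using sub by (intro nn_integral_cong) (auto simp: h_def indicator_def)
          also have "\<dots> \<le> ennreal (m0 z * (2*R)\<^sup>2)" using le unfolding mf by (simp add: ennreal_mult m0_def)
          finally show ?thesis by (simp add: m0_def)
        qed
        have "hint q g z (2*R) powr (1/q) \<le> (m0 z * (2*R)\<^sup>2) powr (1/q)"
          using hi hint_nonneg q by (intro powr_mono2) auto
        also have "\<dots> = m0 z powr (1/q) * (2 * R) powr (2/q)"
        proof -
          have "(2*R)\<^sup>2 = (2*R) powr 2" using R by simp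
          then show ?thesis using R by (simp only: powr_mult powr_powr) (simp add: powr_mult powr_powr m0_def del: powr_numeral)
        qed
        also have "(2 * R) powr (2/q) \<le> 4 * R powr (2/q)"
        proof -
          have "2/q \<le> 2" using q by (simp add: divide_le_eq)
          then have "(2::real) powr (2/q) \<le> 2 powr 2" by (intro powr_mono) auto
          then show ?thesis using R by (simp add: powr_mult)
        qed
        finally have "hint q g z (2*R) powr (1/q) \<le> m0 z powr (1/q) * (4 * R powr (2/q))"
          by (simp add: mult_left_mono)
        then have "Cq * R powr (1 - 2/q) * hint q g z (2*R) powr (1/q) \<le> Cq * R powr (1 - 2/q) * (m0 z powr (1/q) * (4 * R powr (2/q)))"
          using Cq by (intro mult_left_mono) auto
        also have "\<dots> = (R powr (1 - 2/q) * R powr (2/q)) * m z" unfolding m_def by simp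
        also have "R powr (1 - 2/q) * R powr (2/q) = R" using R by (simp add: powr_add[symmetric])
        finally have a: "Cq * R powr (1 - 2/q) * hint q g z (2*R) powr (1/q) \<le> R * m z" .
        from mult_left_mono[OF this norm_ge_zero[of "y - x"]] a cq[OF sob, of R x z y] R xy
        show "norm (grad F y - grad F x) \<le> R * m z \<and> \<bar>F y - F x - grad F x \<bullet> (y - x)\<bar> \<le> norm (y - x) * R * m z"
          by (simp add: mult_ac)
      qed
    qed
    ultimately show "\<exists>m. m \<in> borel_measurable borel \<and> (\<forall>z. m z \<ge> 0) \<and> 
       (\<integral>\<^sup>+z. ennreal (m z powr p) \<partial>lborel) \<le> ennreal (max Cp K) * (\<integral>\<^sup>+z. ennreal (hnorm g z powr p) * indicator S z \<partial>lborel) \<and>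
       (AE z in lborel. \<forall>R>0. ball z (2*R) \<subseteq> S \<longrightarrow> taylor_ctrl F z R (m z))"
      by blast
  qed
qed

section \<open>Voronoi cells and the partition of unity\<close>

lemma measure_ball_le: "measure lborel (ball (x::real^2) r) \<le> 4 * r\<^sup>2"
proof (cases "r \<ge> 0")
  case True
  then have "measure lborel (ball x r) = pi * r\<^sup>2" using content_ball[of r x] by (simp add: unit_ball_vol_2)
  then show ?thesis using pi_less_4 by (simp add: mult_right_mono)
qed (simp add: ball_empty)

lemma emeasure_ball_eq: "r \<ge> 0 \<Longrightarrow> emeasure lborel (ball (x::real^2) r) = ennreal (pi * r\<^sup>2)"
  by (subst emeasure_ball) (auto simp: unit_ball_vol_2)

text \<open>Dyadic rings around x: the k-th one contributes \<open>2 powr (2 - p)\<close> to the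
  power k, a convergent geometric series since \<open>p > 2\<close>.\<close>

lemma tail_integral:
  assumes p: "p > 2"
  obtains C where "C > 0" 
    "\<And>(x::real^2) r. r > 0 \<Longrightarrow> (\<integral>\<^sup>+z. ennreal (max r (dist z x) powr (-p)) \<partial>lborel) \<le> ennreal (C * r powr (2 - p))"
proof -
  define c where "c = (2::real) powr (2 - p)"
  have c: "0 < c" "c < 1" using p powr_less_mono[of "2 - p" 0 2] by (auto simp: c_def)
  show ?thesis
  proof (rule that[of "16 / (1 - c)"])
    show "0 < 16 / (1 - c)" using c by simp
    fix x :: "real^2" and r :: real assume r: "r > 0"
    define f where "f k z = ennreal ((2^k * r) powr (-p)) * indicator (ball x (2^(Suc k) * r)) z" for k :: nat and z
    have pt: "ennreal (max r (dist z x) powr (-p)) \<le> (\<Sum>k. f k z)" for z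
    proof -
      obtain n where n: "dist z x / r < 2 ^ n" using real_arch_pow[of 2 "dist z x / r"] by auto
      \<comment> \<open>The first ring containing z. The least index makes \<open>2 ^ k * r\<close>
        a lower bound for \<open>max r (dist z x)\<close>, also for the innermost disc.\<close>
      define k where "k = (LEAST n. dist z x / r < 2 ^ Suc n)"
      have ex: "dist z x / r < 2 ^ Suc n" using n by (rule less_le_trans) simp
      have k1: "dist z x / r < 2 ^ Suc k" unfolding k_def by (rule LeastI[of _ n]) (rule ex)
      have k2: "2 ^ k * r \<le> max r (dist z x)"
      proof (cases k)
        case (Suc m)
        then have "\<not> dist z x / r < 2 ^ Suc m" using not_less_Least[of m "\<lambda>n. dist z x / r < 2 ^ Suc n"] unfolding k_def by simp
        then show ?thesis using Suc r by (simp add: le_divide_eq not_less)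
      qed simp
      have "max r (dist z x) powr (-p) \<le> (2 ^ k * r) powr (-p)" using k2 r p by (intro powr_mono2') auto
      then have "ennreal (max r (dist z x) powr (-p)) \<le> f k z" unfolding f_def using k1 r
        by (simp add: ennreal_leI divide_less_eq dist_commute)
      also have "\<dots> \<le> (\<Sum>k. f k z)" using sum_le_suminf[of "\<lambda>k. f k z" "{k}"] by simp
      finally show ?thesis .
    qed
    have fk: "(\<integral>\<^sup>+z. f k z \<partial>lborel) \<le> ennreal (16 * r powr (2 - p) * c ^ k)" for k
    proof -
      have "(\<integral>\<^sup>+z. f k z \<partial>lborel) = ennreal ((2^k * r) powr (-p)) * ennreal (pi * (2^(Suc k) * r)\<^sup>2)"
        unfolding f_def using r by (subst nn_integral_cmult_indicator) (auto simp: emeasure_ball_eq simp del: power_Suc)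
      also have "\<dots> \<le> ennreal ((2^k * r) powr (-p)) * ennreal (4 * (2^(Suc k) * r)\<^sup>2)"
        using pi_less_4 by (intro mult_left_mono ennreal_leI mult_right_mono) auto
      also have "\<dots> = ennreal ((2^k * r) powr (-p) * (4 * (2^(Suc k) * r)\<^sup>2))" by (rule ennreal_mult[symmetric]) auto
      also have "(2^k * r) powr (-p) * (4 * (2^(Suc k) * r)\<^sup>2) = 16 * ((2^k * r) powr (-p) * (2^k * r) powr 2)"
        using r by (simp add: power_mult_distrib)
      also have "\<dots> = 16 * (2^k * r) powr (2 - p)" using powr_add[of "2^k * r" "-p" 2] by simp
      also have "\<dots> = 16 * r powr (2 - p) * c ^ k"
      proof -
        have "(2 ^ k) powr (2 - p) = c ^ k" unfolding c_def 
          by (simp add: powr_realpow[symmetric] powr_powr mult.commute del: powr_realpow)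
        then show ?thesis using r by (simp add: powr_mult)
      qed
      finally show ?thesis .
    qed
    have fm: "f k \<in> borel_measurable lborel" for k unfolding f_def[abs_def]
      by (intro borel_measurable_times_ennreal borel_measurable_const borel_measurable_indicator) simp
    have "(\<integral>\<^sup>+z. ennreal (max r (dist z x) powr (-p)) \<partial>lborel) \<le> (\<integral>\<^sup>+z. (\<Sum>k. f k z) \<partial>lborel)"
      by (rule nn_integral_mono) (rule pt)
    also have "\<dots> = (\<Sum>k. \<integral>\<^sup>+z. f k z \<partial>lborel)"
      by (rule nn_integral_suminf[OF fm])
    also have "\<dots> \<le> (\<Sum>k. ennreal (16 * r powr (2 - p) * c ^ k))"
      by (intro suminf_le fk) auto
    also have "\<dots> = ennreal (\<Sum>k. 16 * r powr (2 - p) * c ^ k)"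
      using c by (intro suminf_ennreal2 summable_mult summable_geometric) auto
    also have "(\<Sum>k. 16 * r powr (2 - p) * c ^ k) = 16 / (1 - c) * r powr (2 - p)"
      using c by (subst suminf_mult) (auto intro!: summable_geometric simp: suminf_geometric)
    finally show "(\<integral>\<^sup>+z. ennreal (max r (dist z x) powr (-p)) \<partial>lborel) \<le> ennreal (16 / (1 - c) * r powr (2 - p))" .
  qed
qed

lemma cv_indicator_bound:
  assumes k: "bumplike k" "\<And>y. \<bar>k y\<bar> \<le> B" and r: "r > 0" and V: "V \<in> sets borel"
  shows "\<bar>cv (indicator V) (kern m k r) z\<bar> \<le> B / r ^ m * measure lborel (V \<inter> ball z r)"
proof -
  have fin: "emeasure lborel (V \<inter> ball z r) < \<infinity>" 
    by (rule le_less_trans[OF emeasure_mono emeasure_bounded_finite[OF bounded_ball]]) auto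
  have B: "B \<ge> 0" using k(2)[of 0] by simp
  have *: "\<bar>indicator V w * kern m k r (z - w)\<bar> \<le> B / r ^ m * indicator (V \<inter> ball z r) w" for w :: "real^2"
  proof (cases "norm (z - w) < r")
    case True
    have "\<bar>kern m k r (z - w)\<bar> \<le> B / r ^ m" using r k(2) by (simp add: kern_def divide_right_mono)
    then show ?thesis using True by (auto simp: indicator_def dist_norm)
  next
    case False
    then show ?thesis using kern_support[OF k(1) r] B r by (simp add: dist_norm)
  qed
  have "\<bar>cv (indicator V) (kern m k r) z\<bar> \<le> (\<integral>w. B / r ^ m * indicator (V \<inter> ball z r) w \<partial>lborel)"
    unfolding cv_def
  proof (rule integral_abs_bound_integral)
    show "integrable lborel (\<lambda>w. indicator V w * kern m k r (z - w))"
      by (rule cv_integrable[OF locint_indicator[OF V] kern_continuous[OF k(1) r] kern_support[OF k(1) r]])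
    show "integrable lborel (\<lambda>w. B / r ^ m * indicator (V \<inter> ball z r) w)"
      using fin V by (intro integrable_mult_right integrable_real_indicator) auto
  qed (use * in auto)
  then show ?thesis by simp
qed

lemma cv_cong_ball:
  assumes k: "bumplike k" and r: "r > 0" and eq: "\<And>w. w \<in> ball z r \<Longrightarrow> u w = u' w"
  shows "cv u (kern m k r) z = cv u' (kern m k r) z"
  unfolding cv_def
proof (rule Bochner_Integration.integral_cong)
  fix w
  show "u w * kern m k r (z - w) = u' w * kern m k r (z - w)"
    using eq[of w] kern_support[OF k r, of "z - w"] by (cases "norm (z - w) < r") (auto simp: dist_norm)
qed simp

text \<open>The kernels of the derivatives have mean 0, because they are derivatives of a
  convolution that is constant. Hence a mollified indicator is flat wherever a whole mollification
  ball lies inside or outside the set.\<close>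

lemma cv_const:
  assumes r: "r > 0"
  shows "cv (\<lambda>_. c) (kern 2 mollif r) z = c" "cv (\<lambda>_. c) (kern 3 (mollif1 i) r) z = 0"
    "cv (\<lambda>_. c) (kern 4 (dirderiv (mollif1 i) v) r) z = 0"
proof -
  have a: "cv (\<lambda>_. c) (kern 2 mollif r) = (\<lambda>_. c)" unfolding cv_def by (rule ext) (simp add: integral_kern[OF r])
  then show "cv (\<lambda>_. c) (kern 2 mollif r) z = c" by simp
  have l: "locint (\<lambda>_::real^2. c)" by (rule locint_continuous) auto
  have m1: "bumplike (mollif1 i)" and m2: "bumplike (dirderiv (mollif1 i) v)"
    by (auto intro: bumplike_dirderiv bumplike_mollif)
  have "line_deriv (cv (\<lambda>_. c) (kern 2 mollif r)) (axis i 1) (cv (\<lambda>_. c) (kern (Suc 2) (mollif1 i) r))"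
    using bumplike_mollif m1 r by (intro line_deriv_cv[OF l kern_continuous kern_continuous kern_line_deriv kern_support]) auto
  then have b: "cv (\<lambda>_. c) (kern 3 (mollif1 i) r) z = 0" for z 
    using line_deriv_local_zero[of "\<lambda>_. c" "axis i 1" _ UNIV z c] unfolding a by (simp add: numeral_eq_Suc)
  then show "cv (\<lambda>_. c) (kern 3 (mollif1 i) r) z = 0" .
  have "line_deriv (cv (\<lambda>_. c) (kern 3 (mollif1 i) r)) v (cv (\<lambda>_. c) (kern (Suc 3) (dirderiv (mollif1 i) v) r))"
    using m1 m2 r by (intro line_deriv_cv[OF l kern_continuous kern_continuous kern_line_deriv kern_support]) auto
  then show "cv (\<lambda>_. c) (kern 4 (dirderiv (mollif1 i) v) r) z = 0"
    using line_deriv_local_zero[of "cv (\<lambda>_. c) (kern 3 (mollif1 i) r)" v _ UNIV z 0] b by (simp add: numeral_eq_Suc)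
qed

definition smear :: "(real^2) set \<Rightarrow> real \<Rightarrow> real^2 \<Rightarrow> real" where
  "smear A r = cv (indicator A) (kern 2 mollif r)"

definition smear1 :: "(real^2) set \<Rightarrow> real \<Rightarrow> 2 \<Rightarrow> real^2 \<Rightarrow> real" where
  "smear1 A r i = cv (indicator A) (kern 3 (mollif1 i) r)"

definition smear2 :: "(real^2) set \<Rightarrow> real \<Rightarrow> 2 \<Rightarrow> 2 \<Rightarrow> real^2 \<Rightarrow> real" where
  "smear2 A r i j = cv (indicator A) (kern 4 (dirderiv (mollif1 i) (axis j 1)) r)"

lemma smear_regular:
  assumes A: "A \<in> sets borel" and r: "r > 0"
  shows "continuous_on UNIV (smear A r)" "continuous_on UNIV (smear1 A r i)" "continuous_on UNIV (smear2 A r i j)"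
    "line_deriv (smear A r) (axis i 1) (smear1 A r i)" "line_deriv (smear1 A r i) (axis j 1) (smear2 A r i j)"
proof -
  note l = locint_indicator[OF A]
  have m: "bumplike (mollif1 i)" "bumplike (dirderiv (mollif1 i) (axis j 1))" "bumplike mollif"
    by (auto intro: bumplike_dirderiv bumplike_mollif)
  show "continuous_on UNIV (smear A r)" "continuous_on UNIV (smear1 A r i)" "continuous_on UNIV (smear2 A r i j)"
    unfolding smear_def smear1_def smear2_def using m r by (intro continuous_cv[OF l kern_continuous kern_support]; blast)+
  have "line_deriv (cv (indicator A) (kern 2 mollif r)) (axis i 1) (cv (indicator A) (kern (Suc 2) (mollif1 i) r))"
    using m r by (intro line_deriv_cv[OF l kern_continuous kern_continuous kern_line_deriv kern_support]) auto
  then show "line_deriv (smear A r) (axis i 1) (smear1 A r i)" unfolding smear_def smear1_def by (simp add: numeral_eq_Suc)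
  have "line_deriv (cv (indicator A) (kern 3 (mollif1 i) r)) (axis j 1) (cv (indicator A) (kern (Suc 3) (dirderiv (mollif1 i) (axis j 1)) r))"
    using m r by (intro line_deriv_cv[OF l kern_continuous kern_continuous kern_line_deriv kern_support]) auto
  then show "line_deriv (smear1 A r i) (axis j 1) (smear2 A r i j)" unfolding smear1_def smear2_def by (simp add: numeral_eq_Suc)
qed

lemma smear_inside:
  assumes "r > 0" "ball z r \<subseteq> A"
  shows "smear A r z = 1" "smear1 A r i z = 0" "smear2 A r i j z = 0"
proof -
  have e: "cv (indicator A) (kern m k r) z = cv (\<lambda>_. 1) (kern m k r) z" if "bumplike k" for m k
    by (rule cv_cong_ball[OF that assms(1)]) (use assms(2) in auto)
  show "smear A r z = 1" "smear1 A r i z = 0" "smear2 A r i j z = 0"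
    unfolding smear_def smear1_def smear2_def using cv_const[OF assms(1)] 
    by (simp_all add: e bumplike_dirderiv bumplike_mollif)
qed

lemma smear_outside:
  assumes "r > 0" "ball z r \<inter> A = {}"
  shows "smear A r z = 0" "smear1 A r i z = 0" "smear2 A r i j z = 0"
proof -
  have e: "cv (indicator A) (kern m k r) z = cv (\<lambda>_. 0) (kern m k r) z" if "bumplike k" for m k
    by (rule cv_cong_ball[OF that assms(1)]) (use assms(2) in \<open>auto simp: indicator_def\<close>)
  show "smear A r z = 0" "smear1 A r i z = 0" "smear2 A r i j z = 0"
    unfolding smear_def smear1_def smear2_def using cv_const[OF assms(1)] 
    by (simp_all add: e bumplike_dirderiv bumplike_mollif)
qed

text \<open>The measure of the intersection is kept instead of the cruder area of the ball: summed
  over disjoint cells these measures give the area of one ball, so no bound on the number of cells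
  near z is needed.\<close>

lemma smear_bounds:
  obtains B where "B \<ge> 1"
    "\<And>A r z. A \<in> sets borel \<Longrightarrow> r > 0 \<Longrightarrow> \<bar>smear A r z\<bar> \<le> B / r^2 * measure lborel (A \<inter> ball z r)"
    "\<And>A r i z. A \<in> sets borel \<Longrightarrow> r > 0 \<Longrightarrow> \<bar>smear1 A r i z\<bar> \<le> B / r^3 * measure lborel (A \<inter> ball z r)"
    "\<And>A r i j z. A \<in> sets borel \<Longrightarrow> r > 0 \<Longrightarrow> \<bar>smear2 A r i j z\<bar> \<le> B / r^4 * measure lborel (A \<inter> ball z r)"
proof -
  have ex: "\<exists>B. \<forall>y. \<bar>k y\<bar> \<le> B" if "bumplike k" for k using bumplike_bounded[OF that] by metis
  have "\<exists>b. \<forall>i. \<forall>y. \<bar>mollif1 i y\<bar> \<le> b i" 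
    by (intro choice allI ex bumplike_dirderiv bumplike_mollif)
  then obtain b1 where b1: "\<And>i y. \<bar>mollif1 i y\<bar> \<le> b1 i" by blast
  have "\<exists>b. \<forall>s. \<forall>y. \<bar>dirderiv (mollif1 (fst s)) (axis (snd s) 1) y\<bar> \<le> b s" 
    by (intro choice allI ex bumplike_dirderiv bumplike_mollif)
  then obtain b where b: "\<forall>s y. \<bar>dirderiv (mollif1 (fst s)) (axis (snd s) 1) y\<bar> \<le> b s" by blast
  define b2 where "b2 i j = b (i, j)" for i j
  have b2: "\<And>i j y. \<bar>dirderiv (mollif1 i) (axis j 1) y\<bar> \<le> b2 i j" unfolding b2_def using b by force
  obtain b0 where b0: "\<And>y. \<bar>mollif y\<bar> \<le> b0" using ex[OF bumplike_mollif] by blast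
  define B where "B = 1 + \<bar>b0\<bar> + (\<Sum>i\<in>UNIV. \<bar>b1 i\<bar>) + (\<Sum>i\<in>UNIV. \<Sum>j\<in>UNIV. \<bar>b2 i j\<bar>)"
  have s1: "b1 i \<le> (\<Sum>i\<in>UNIV. \<bar>b1 i\<bar>)" for i
    by (rule order_trans[OF abs_ge_self member_le_sum[where f="\<lambda>i. \<bar>b1 i\<bar>"]]) auto
  have s2: "b2 i j \<le> (\<Sum>i\<in>UNIV. \<Sum>j\<in>UNIV. \<bar>b2 i j\<bar>)" for i j
  proof -
    have "b2 i j \<le> (\<Sum>j\<in>UNIV. \<bar>b2 i j\<bar>)" by (rule order_trans[OF abs_ge_self member_le_sum[where f="\<lambda>j. \<bar>b2 i j\<bar>"]]) auto
    also have "\<dots> \<le> (\<Sum>i\<in>UNIV. \<Sum>j\<in>UNIV. \<bar>b2 i j\<bar>)"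
      by (rule member_le_sum[where f="\<lambda>i. \<Sum>j\<in>UNIV. \<bar>b2 i j\<bar>"]) (auto intro: sum_nonneg)
    finally show ?thesis .
  qed
  have nn: "0 \<le> (\<Sum>i\<in>UNIV. \<bar>b1 i\<bar>)" "0 \<le> (\<Sum>i\<in>UNIV. \<Sum>j\<in>UNIV. \<bar>b2 i j\<bar>)"
    by (auto intro!: sum_nonneg)
  have B: "B \<ge> 1" "b0 \<le> B" "b1 i \<le> B" "b2 i j \<le> B" for i j 
    unfolding B_def using s1[of i] s2[of i j] nn by linarith+
  show ?thesis
    by (rule that[OF B(1)]; unfold smear_def smear1_def smear2_def; rule cv_indicator_bound)
       (auto intro: bumplike_dirderiv bumplike_mollif order_trans[OF b0 B(2)] order_trans[OF b1 B(3)] order_trans[OF b2 B(4)])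
qed

lemma infdist_attained:
  fixes E :: "'a::metric_space set"
  assumes "finite E" "E \<noteq> {}" obtains y where "y \<in> E" "dist z y = infdist z E"
proof -
  have "infdist z E = Min ((\<lambda>y. dist z y) ` E)"
    unfolding infdist_def using assms by (simp add: cInf_eq_Min)
  moreover have "Min ((\<lambda>y. dist z y) ` E) \<in> (\<lambda>y. dist z y) ` E" using assms by (intro Min_in) auto
  ultimately show ?thesis using that by auto
qed

text \<open>Ties between nearest points are broken by an enumeration of \<open>E\<close>, so that
  the cells partition the plane exactly.\<close>

definition vor :: "(real^2) set \<Rightarrow> real^2 \<Rightarrow> (real^2) set" where
  "vor E x = {z. dist z x = infdist z E \<and> (\<forall>y\<in>E. dist z y = infdist z E \<longrightarrow> to_nat_on E x \<le> to_nat_on E y)}"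

lemma vor_measurable: assumes "finite E" shows "vor E x \<in> sets borel"
proof -
  let ?A = "\<lambda>y. {z. dist z y = infdist z E}"
  have c: "?A y \<in> sets borel" for y by (intro borel_closed closed_Collect_eq continuous_intros)
  have "vor E x = ?A x \<inter> (\<Inter>y\<in>E. if to_nat_on E x \<le> to_nat_on E y then UNIV else - ?A y)"
    by (auto simp: vor_def)
  moreover have "(\<Inter>y\<in>E. if to_nat_on E x \<le> to_nat_on E y then UNIV else - ?A y) \<in> sets borel"
    
  proof (cases "E = {}")
    case False
    then show ?thesis using assms by (intro sets.finite_INT) (use c in auto)
  qed simp
  ultimately show ?thesis using c by auto
qed

lemma vor_cover:
  assumes "finite E" "E \<noteq> {}" shows "\<exists>x\<in>E. z \<in> vor E x"
proof -
  define Y where "Y = {y \<in> E. dist z y = infdist z E}"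
  obtain y where "y \<in> Y" using infdist_attained[OF assms, of z] unfolding Y_def by blast
  then have "Y \<noteq> {}" "finite Y" using assms by (auto simp: Y_def)
  then obtain x where x: "x \<in> Y" "\<And>y. y \<in> Y \<Longrightarrow> to_nat_on E x \<le> to_nat_on E y"
    using ex_is_arg_min_if_finite[of Y "to_nat_on E"] unfolding is_arg_min_linorder by auto
  then show ?thesis unfolding Y_def vor_def by auto
qed

lemma vor_disjoint:
  assumes "finite E" "x \<in> E" "y \<in> E" "z \<in> vor E x" "z \<in> vor E y" shows "x = y"
proof -
  have "to_nat_on E x = to_nat_on E y" using assms(2-5) unfolding vor_def by (auto intro: antisym)
  moreover have "inj_on (to_nat_on E) E" using assms(1) by (intro inj_on_to_nat_on countable_finite)
  ultimately show ?thesis using assms by (auto dest: inj_onD)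
qed

lemma sum_measure_vor:
  assumes "finite E" "E \<noteq> {}" shows "(\<Sum>x\<in>E. measure lborel (vor E x \<inter> ball z r)) = measure lborel (ball z r)"
proof -
  have "measure lborel (\<Union>x\<in>E. vor E x \<inter> ball z r) = (\<Sum>x\<in>E. measure lborel (vor E x \<inter> ball z r))"
  proof (rule measure_finite_Union)
    show "(\<lambda>x. vor E x \<inter> ball z r) ` E \<subseteq> sets lborel" using vor_measurable[OF assms(1)] by auto
    show "disjoint_family_on (\<lambda>x. vor E x \<inter> ball z r) E"
      using vor_disjoint[OF assms(1)] unfolding disjoint_family_on_def by blast
    show "emeasure lborel (vor E x \<inter> ball z r) \<noteq> \<infinity>" for x
      using le_less_trans[OF emeasure_mono emeasure_bounded_finite[OF bounded_ball], of "vor E x \<inter> ball z r" z r] by auto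
  qed (rule assms(1))
  moreover have "(\<Union>x\<in>E. vor E x \<inter> ball z r) = ball z r" using vor_cover[OF assms] by blast
  ultimately show ?thesis by simp
qed

section \<open>The partition of unity of one finite set, from its separation to its diameter\<close>

context
  fixes E :: "(real^2) set" and x0 :: "real^2" and \<tau> :: real and L :: nat
  assumes E: "finite E" "x0 \<in> E" and \<tau>: "\<tau> > 0"
    and sep: "\<And>x y. x \<in> E \<Longrightarrow> y \<in> E \<Longrightarrow> x \<noteq> y \<Longrightarrow> 8 * \<tau> \<le> dist x y"
    and diam: "\<And>x y. x \<in> E \<Longrightarrow> y \<in> E \<Longrightarrow> dist x y \<le> 2 ^ L * \<tau>"
begin

definition "scl n = 2 ^ n * \<tau>"
definition "rad n = scl n / 8"
text \<open>Beyond the index \<open>L\<close>, where the scale has reached the diameter of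
  \<open>E\<close>, a single last neighbourhood takes in the whole plane.\<close>

definition "nbhd n = (if n \<le> L then {w. infdist w E < scl n} else UNIV)"
text \<open>Mollified rings around \<open>E\<close> at distance comparable to \<open>scl n\<close>;
  they telescope to 1.\<close>

definition "bumpPhi n z = (if n = 0 then smear (nbhd 0) (rad 0) z else smear (nbhd n) (rad n) z - smear (nbhd (n-1)) (rad (n-1)) z)"
definition "bumpPhi1 n i z = (if n = 0 then smear1 (nbhd 0) (rad 0) i z else smear1 (nbhd n) (rad n) i z - smear1 (nbhd (n-1)) (rad (n-1)) i z)"
definition "bumpPhi2 n i j z = (if n = 0 then smear2 (nbhd 0) (rad 0) i j z else smear2 (nbhd n) (rad n) i j z - smear2 (nbhd (n-1)) (rad (n-1)) i j z)"
text \<open>At the last index \<open>E\<close> is far away and looks like one point, so the jet at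
  the fixed point \<open>x0\<close> takes all the weight.\<close>

definition "cellS n x z = (if n \<le> L then smear (vor E x) (rad n) z else if x = x0 then 1 else 0)"
definition "cellS1 n x i z = (if n \<le> L then smear1 (vor E x) (rad n) i z else 0)"
definition "cellS2 n x i j z = (if n \<le> L then smear2 (vor E x) (rad n) i j z else 0)"
text \<open>First and, on the next line, second derivatives of the single term
  \<open>bumpPhi n z * cellS n x z\<close>, by the product rule.\<close>

definition "T1 n x i z = bumpPhi1 n i z * cellS n x z + bumpPhi n z * cellS1 n x i z"
definition "T2 n x i j z = (bumpPhi2 n i j z * cellS n x z + bumpPhi1 n i z * cellS1 n x j z) + (bumpPhi1 n j z * cellS1 n x i z + bumpPhi n z * cellS2 n x i j z)"
definition "PU x z = (\<Sum>n\<le>Suc L. bumpPhi n z * cellS n x z)"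
definition "PU1 x i z = (\<Sum>n\<le>Suc L. T1 n x i z)"
definition "PU2 x i j z = (\<Sum>n\<le>Suc L. T2 n x i j z)"

lemma E_ne: "E \<noteq> {}" using E by auto

lemma scl_pos: "scl n > 0" "rad n > 0" using \<tau> by (auto simp: scl_def rad_def)

lemma scl_Suc: "scl (Suc n) = 2 * scl n" by (simp add: scl_def)

lemma nbhd_measurable: "nbhd n \<in> sets borel"
  by (auto simp: nbhd_def intro!: borel_open open_Collect_less continuous_intros)

lemmas nbhd_regular = smear_regular[OF nbhd_measurable scl_pos(2)]
lemmas vor_regular = smear_regular[OF vor_measurable[OF E(1)] scl_pos(2)]

lemma PU_regular:
  "continuous_on UNIV (PU x)" "continuous_on UNIV (PU1 x i)" "continuous_on UNIV (PU2 x i j)"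
  "line_deriv (PU x) (axis i 1) (PU1 x i)" "line_deriv (PU1 x i) (axis j 1) (PU2 x i j)"
proof -
  have c: "continuous_on UNIV (bumpPhi n)" "continuous_on UNIV (bumpPhi1 n i)" "continuous_on UNIV (bumpPhi2 n i j)"
    "continuous_on UNIV (cellS n x)" "continuous_on UNIV (cellS1 n x i)" "continuous_on UNIV (cellS2 n x i j)" for n i j
    unfolding bumpPhi_def[abs_def] bumpPhi1_def[abs_def] bumpPhi2_def[abs_def] cellS_def[abs_def] cellS1_def[abs_def] cellS2_def[abs_def]
    by (cases "n = 0"; cases "n \<le> L"; auto intro!: continuous_intros nbhd_regular vor_regular)+
  show "continuous_on UNIV (PU x)" "continuous_on UNIV (PU1 x i)" "continuous_on UNIV (PU2 x i j)"
    unfolding PU_def[abs_def] PU1_def[abs_def] PU2_def[abs_def] T1_def[abs_def] T2_def[abs_def] by (auto intro!: continuous_intros c)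
  have d: "line_deriv (bumpPhi n) (axis i 1) (bumpPhi1 n i)" "line_deriv (bumpPhi1 n i) (axis j 1) (bumpPhi2 n i j)" for n i j
    unfolding bumpPhi_def[abs_def] bumpPhi1_def[abs_def] bumpPhi2_def[abs_def] 
    by (cases "n = 0"; auto intro!: line_deriv_diff nbhd_regular)+
  have e: "line_deriv (cellS n x) (axis i 1) (cellS1 n x i)" "line_deriv (cellS1 n x i) (axis j 1) (cellS2 n x i j)" for n i j
    unfolding cellS_def[abs_def] cellS1_def[abs_def] cellS2_def[abs_def]
    by (cases "n \<le> L"; auto intro!: line_deriv_const vor_regular)+
  show "line_deriv (PU x) (axis i 1) (PU1 x i)" unfolding PU_def[abs_def] PU1_def[abs_def] T1_def
    by (intro line_deriv_sum line_deriv_mult d e)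
  show "line_deriv (PU1 x i) (axis j 1) (PU2 x i j)" unfolding PU1_def[abs_def] PU2_def[abs_def] T1_def[abs_def] T2_def
    by (intro line_deriv_sum line_deriv_add line_deriv_mult d e)
qed

lemma infdist_ball: "w \<in> ball z r \<Longrightarrow> infdist w E < infdist z E + r"
  using infdist_triangle[of w E z] by (simp add: dist_commute)

lemma infdist_ball': "w \<in> ball z r \<Longrightarrow> infdist z E < infdist w E + r"
  using infdist_triangle[of z E w] by simp

lemma nbhd_inside:
  assumes "infdist z E \<le> 7/8 * scl n \<or> n > L" shows "ball z (rad n) \<subseteq> nbhd n"
  using infdist_ball[of _ z "rad n"] assms by (auto simp: nbhd_def rad_def) force

lemma nbhd_outside:
  assumes "infdist z E > 9/8 * scl n" "n \<le> L" shows "ball z (rad n) \<inter> nbhd n = {}"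
  using infdist_ball'[of _ z "rad n"] assms by (auto simp: nbhd_def rad_def) force

text \<open>Points of \<open>E\<close> are \<open>8 * \<tau>\<close> apart, so a point within
  \<open>9/16 * \<tau>\<close> of y has y as its only nearest point; 9/16 is 7/16 plus the
  mollification radius 1/8.\<close>

lemma vor_near:
  assumes z: "infdist z E < 7/16 * \<tau>" and y: "y \<in> E" "dist z y = infdist z E" and x: "x \<in> E"
  shows "if x = y then ball z (rad 0) \<subseteq> vor E x else ball z (rad 0) \<inter> vor E x = {}"
proof -
  have *: "dist w y < 9/16 * \<tau>" "dist w y = infdist w E" "\<And>u. u \<in> E \<Longrightarrow> dist w u = infdist w E \<Longrightarrow> u = y" if w: "w \<in> ball z (rad 0)" for w
  proof -
    show 1: "dist w y < 9/16 * \<tau>" using w z y dist_triangle[of w y z] by (simp add: rad_def scl_def dist_commute)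
    have 2: "dist w y < dist w u" if "u \<in> E" "u \<noteq> y" for u
      using sep[OF that(1) y(1) that(2)] 1 dist_triangle[of u y w] \<tau> by (simp add: dist_commute)
    obtain v where v: "v \<in> E" "dist w v = infdist w E" using infdist_attained[OF E(1) E_ne] by blast
    have "v = y" using 2[OF v(1)] v infdist_le[OF y(1), of w] by force
    then show 3: "dist w y = infdist w E" using v by simp
    show "u = y" if "u \<in> E" "dist w u = infdist w E" for u using 2[OF that(1)] that 3 by force
  qed
  show ?thesis
  proof (cases "x = y")
    case True
    have "w \<in> vor E y" if "w \<in> ball z (rad 0)" for w
      using *(2)[OF that] *(3)[OF that] unfolding vor_def by auto
    then show ?thesis using True by auto
  next
    case False
    have "w \<notin> vor E x" if "w \<in> ball z (rad 0)" for w
      using *(3)[OF that x] False unfolding vor_def by auto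
    then show ?thesis using False by auto
  qed
qed

lemma bumpPhi_zero:
  assumes "n \<ge> 1" "infdist z E < 7/16 * scl n \<or> (n \<le> L \<and> infdist z E > 9/8 * scl n)"
  shows "bumpPhi n z = 0" "bumpPhi1 n i z = 0" "bumpPhi2 n i j z = 0"
proof -
  obtain m where m: "n = Suc m" using assms(1) by (cases n) auto
  have "bumpPhi n z = 0 \<and> bumpPhi1 n i z = 0 \<and> bumpPhi2 n i j z = 0"
    using assms(2)
  proof
    assume a: "infdist z E < 7/16 * scl n"
    have "ball z (rad n) \<subseteq> nbhd n" "ball z (rad m) \<subseteq> nbhd m"
      using a scl_pos[of m] by (intro nbhd_inside; simp add: m scl_Suc)+
    then show ?thesis unfolding bumpPhi_def bumpPhi1_def bumpPhi2_def m by (simp add: smear_inside scl_pos)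
  next
    assume a: "n \<le> L \<and> infdist z E > 9/8 * scl n"
    have "ball z (rad n) \<inter> nbhd n = {}" "ball z (rad m) \<inter> nbhd m = {}"
      using a scl_pos[of m] by (intro nbhd_outside; simp add: m scl_Suc)+
    then show ?thesis unfolding bumpPhi_def bumpPhi1_def bumpPhi2_def m by (simp add: smear_outside scl_pos)
  qed
  then show "bumpPhi n z = 0" "bumpPhi1 n i z = 0" "bumpPhi2 n i j z = 0" by auto
qed

text \<open>For intermediate indices the ring function vanishes away from its ring. At both ends the
  term is constant instead: near a point of \<open>E\<close> the ball lies in one cell, and far out
  everything belongs to \<open>x0\<close>.\<close>

lemma T_zero:
  assumes x: "x \<in> E" and n: "n \<le> Suc L" and a: "\<not> (7/16 * scl n \<le> infdist z E \<and> infdist z E \<le> 9/8 * scl n)"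
  shows "T1 n x i z = 0 \<and> T2 n x i j z = 0"
proof (cases "n = 0")
  case True
  show ?thesis
  proof (cases "infdist z E < 7/16 * \<tau>")
    case near: True
    obtain y where y: "y \<in> E" "dist z y = infdist z E" using infdist_attained[OF E(1) E_ne] by blast
    have "ball z (rad 0) \<subseteq> nbhd 0" using near \<tau> by (intro nbhd_inside) (simp add: scl_def)
    moreover have "smear1 (vor E x) (rad 0) i z = 0" "smear1 (vor E x) (rad 0) j z = 0" "smear2 (vor E x) (rad 0) i j z = 0"
      using vor_near[OF near y x] smear_inside[OF scl_pos(2), of z 0 "vor E x"] smear_outside[OF scl_pos(2), of z 0 "vor E x"] by (auto split: if_splits)
    ultimately show ?thesis unfolding True T1_def T2_def bumpPhi_def bumpPhi1_def bumpPhi2_def cellS1_def cellS2_def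
      by (simp add: smear_inside scl_pos)
  next
    case False
    then have "infdist z E > 9/8 * scl 0" using a True by (auto simp: scl_def)
    then have "ball z (rad 0) \<inter> nbhd 0 = {}" by (intro nbhd_outside) auto
    then show ?thesis unfolding True T1_def T2_def bumpPhi_def bumpPhi1_def bumpPhi2_def
      by (simp add: smear_outside scl_pos)
  qed
next
  case False
  then have n1: "n \<ge> 1" by simp
  show ?thesis
  proof (cases "infdist z E < 7/16 * scl n \<or> (n \<le> L \<and> infdist z E > 9/8 * scl n)")
    case True
    then show ?thesis using bumpPhi_zero[OF n1 True] unfolding T1_def T2_def by simp
  next
    case False
    \<comment> \<open>Only the unbounded last ring is left; beyond it the term is the constant
      weight of \<open>x0\<close>.\<close>
    then have nL: "n = Suc L" and far: "infdist z E > 9/8 * scl n" using a n by auto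
    have "ball z (rad n) \<subseteq> nbhd n" by (intro nbhd_inside) (simp add: nL)
    moreover have "ball z (rad L) \<inter> nbhd L = {}" using far scl_pos[of L] by (intro nbhd_outside) (auto simp: nL scl_Suc)
    ultimately show ?thesis unfolding T1_def T2_def bumpPhi1_def bumpPhi2_def cellS1_def cellS2_def nL 
      by (simp add: smear_inside smear_outside scl_pos)
  qed
qed

text \<open>On the ring the mollification radius is comparable to the distance d from
  \<open>E\<close>, so a cell seen from z belongs to a point at distance O(d). In the last ring d
  dominates the diameter. The constant 8 is generous.\<close>

lemma T_support:
  assumes x: "x \<in> E" and n: "n \<le> Suc L" and nz: "T1 n x i z \<noteq> 0 \<or> T2 n x i j z \<noteq> 0"
  shows "dist z x \<le> 8 * infdist z E"
proof -
  have a: "7/16 * scl n \<le> infdist z E" using T_zero[OF x n, of z i j] nz by auto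
  show ?thesis
  proof (cases "n \<le> L")
    case True
    have "ball z (rad n) \<inter> vor E x \<noteq> {}"
    proof
      assume "ball z (rad n) \<inter> vor E x = {}"
      then have "cellS n x z = 0" "cellS1 n x i z = 0" "cellS1 n x j z = 0" "cellS2 n x i j z = 0"
        unfolding cellS_def cellS1_def cellS2_def by (simp_all add: smear_outside scl_pos True)
      then show False using nz by (simp add: T1_def T2_def)
    qed
    then obtain w where w: "w \<in> ball z (rad n)" "w \<in> vor E x" by blast
    have "dist z x \<le> dist z w + dist w x" by (rule dist_triangle)
    also have "\<dots> \<le> rad n + (infdist z E + rad n)" using w infdist_ball[OF w(1)] unfolding vor_def by auto
    finally show ?thesis using a scl_pos[of n] unfolding rad_def by simp
  next
    case False
    then have nL: "n = Suc L" using n by simp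
    have "x = x0" using nz unfolding T1_def T2_def cellS_def cellS1_def cellS2_def nL by (auto split: if_splits)
    obtain y where y: "y \<in> E" "dist z y = infdist z E" using infdist_attained[OF E(1) E_ne] by blast
    have "dist z x \<le> infdist z E + scl L"
      using dist_triangle[of z x y] y diam[OF y(1) x] by (simp add: scl_def)
    then show ?thesis using a scl_pos[of L] unfolding nL scl_Suc by simp
  qed
qed

lemma PU_sum: "(\<Sum>x\<in>E. PU x z) = 1"
proof -
  have s: "(\<Sum>x\<in>E. cellS n x z) = 1" for n
  proof (cases "n \<le> L")
    case True
    have k: "continuous_on UNIV (kern 2 mollif (rad n))" and k0: "\<And>y. rad n \<le> norm y \<Longrightarrow> kern 2 mollif (rad n) y = 0"
      using kern_continuous kern_support bumplike_mollif scl_pos by auto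
    have "(\<Sum>x\<in>E. cellS n x z) = (\<Sum>x\<in>E. \<integral>w. indicator (vor E x) w * kern 2 mollif (rad n) (z - w) \<partial>lborel)"
      unfolding cellS_def smear_def cv_def using True by simp
    also have "\<dots> = (\<integral>w. (\<Sum>x\<in>E. indicator (vor E x) w * kern 2 mollif (rad n) (z - w)) \<partial>lborel)"
      by (rule Bochner_Integration.integral_sum[symmetric]) (rule cv_integrable[OF locint_indicator[OF vor_measurable[OF E(1)]] k k0])
    also have "\<dots> = (\<integral>w. kern 2 mollif (rad n) (z - w) \<partial>lborel)"
    proof (rule Bochner_Integration.integral_cong)
      fix w
      obtain y where y: "y \<in> E" "w \<in> vor E y" using vor_cover[OF E(1) E_ne] by blast
      have n: "w \<notin> vor E x" if "x \<in> E" "x \<noteq> y" for x using vor_disjoint[OF E(1) that(1) y(1) _ y(2)] that(2) by blast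
      have "(\<Sum>x\<in>E. indicator (vor E x) w) = (\<Sum>x\<in>E. if x = y then 1 else (0::real))"
        by (intro sum.cong refl) (simp add: indicator_def y(2) n)
      also have "\<dots> = 1" using y E(1) by simp
      finally show "(\<Sum>x\<in>E. indicator (vor E x) w * kern 2 mollif (rad n) (z - w)) = kern 2 mollif (rad n) (z - w)"
        unfolding sum_distrib_right[symmetric] by simp
    qed simp
    also have "\<dots> = 1" by (rule integral_kern[OF scl_pos(2)])
    finally show ?thesis .
  qed (use E in \<open>simp add: cellS_def\<close>)
  have t: "(\<Sum>n\<le>m. bumpPhi n z) = smear (nbhd m) (rad m) z" for m
    by (induction m) (auto simp: bumpPhi_def)
  have "(\<Sum>x\<in>E. PU x z) = (\<Sum>n\<le>Suc L. bumpPhi n z * (\<Sum>x\<in>E. cellS n x z))"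
    unfolding PU_def by (subst sum.swap) (simp only: sum_distrib_left)
  also have "\<dots> = smear (nbhd (Suc L)) (rad (Suc L)) z" unfolding s using t[of "Suc L"] by simp
  also have "\<dots> = 1" by (rule smear_inside(1)[OF scl_pos(2) nbhd_inside]) simp
  finally show ?thesis .
qed

text \<open>Near a point of \<open>E\<close> its own function is identically 1, so an extension
  built from the partition coincides there with the jet and inherits its value and gradient.\<close>

lemma PU_near:
  assumes z: "dist z y < 7/16 * \<tau>" and y: "y \<in> E" and x: "x \<in> E"
  shows "PU x z = (if x = y then 1 else 0)"
proof -
  have d: "infdist z E < 7/16 * \<tau>" using infdist_le[OF y, of z] z by simp
  obtain v where v: "v \<in> E" "dist z v = infdist z E" using infdist_attained[OF E(1) E_ne] by blast
  have "v = y" using sep[OF v(1) y] dist_triangle[of v y z] v(2) z d \<tau> by (auto simp: dist_commute)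
  then have yd: "dist z y = infdist z E" using v by simp
  have "bumpPhi n z = 0" if "n \<ge> 1" for n
  proof (rule bumpPhi_zero(1)[OF that])
    have "1 * \<tau> \<le> scl n" unfolding scl_def using \<tau> by (intro mult_right_mono) auto
    then show "infdist z E < 7/16 * scl n \<or> (n \<le> L \<and> infdist z E > 9/8 * scl n)" using d by linarith
  qed
  then have "PU x z = (\<Sum>n\<in>{0}. bumpPhi n z * cellS n x z)"
    unfolding PU_def by (intro sum.mono_neutral_right) (auto simp: Suc_le_eq)
  also have "\<dots> = smear (vor E x) (rad 0) z"
    using nbhd_inside[of z 0] d \<tau> smear_inside(1)[OF scl_pos(2), of z 0] by (simp add: bumpPhi_def cellS_def scl_def)
  also have "\<dots> = (if x = y then 1 else 0)"
    using vor_near[OF d y yd x] smear_inside(1)[OF scl_pos(2), of z 0 "vor E x"] smear_outside(1)[OF scl_pos(2), of z 0 "vor E x"]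
    by (auto split: if_splits)
  finally show ?thesis .
qed

definition "active z = {n. n \<le> Suc L \<and> 7/16 * scl n \<le> infdist z E \<and> infdist z E \<le> 9/8 * scl n}"

text \<open>The rings reach from 7/16 to 9/8 of their scale. Two steps further the scale is four
  times as large, and 4 * 7/16 exceeds 9/8.\<close>

lemma card_active: "finite (active z)" "card (active z) \<le> 2"
proof -
  show f: "finite (active z)" unfolding active_def by simp
  show "card (active z) \<le> 2"
  proof (cases "active z = {}")
    case False
    define m where "m = Min (active z)"
    have m: "m \<in> active z" unfolding m_def using f False by simp
    have "active z \<subseteq> {m, Suc m}"
    proof
      fix n assume n: "n \<in> active z"
      have mn: "m \<le> n" unfolding m_def using f n by simp
      show "n \<in> {m, Suc m}"
      proof (rule ccontr)
        assume "n \<notin> {m, Suc m}"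
        then have "m + 2 \<le> n" using mn by auto
        then have "(2::real) ^ (m + 2) \<le> 2 ^ n" by (intro power_increasing) auto
        then have "2 ^ (m + 2) * \<tau> \<le> 2 ^ n * \<tau>" using \<tau> by (intro mult_right_mono) auto
        then have "4 * scl m \<le> scl n" by (simp add: scl_def)
        then show False using m n scl_pos[of m] unfolding active_def by simp
      qed
    qed
    then have "card (active z) \<le> card {m, Suc m}" by (intro card_mono) auto
    then show ?thesis by simp
  qed simp
qed

lemma PU_active:
  assumes "x \<in> E"
  shows "PU1 x i z = (\<Sum>n\<in>active z. T1 n x i z)" "PU2 x i j z = (\<Sum>n\<in>active z. T2 n x i j z)"
  unfolding PU1_def PU2_def
  by (rule sum.mono_neutral_right; use T_zero[OF assms, of _ z i] T_zero[OF assms, of _ z i j] in \<open>auto simp: active_def\<close>)+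

lemma PU_support:
  assumes x: "x \<in> E" and nz: "PU1 x i z \<noteq> 0 \<or> PU2 x i j z \<noteq> 0" shows "dist z x \<le> 8 * infdist z E"
proof -
  have "\<exists>n\<le>Suc L. T1 n x i z \<noteq> 0 \<or> T2 n x i j z \<noteq> 0"
    using nz unfolding PU1_def PU2_def by (metis (no_types, lifting) atMost_iff sum.neutral)
  then show ?thesis using T_support[OF x] by blast
qed

lemma PU_flat:
  assumes x: "x \<in> E" and z: "infdist z E < 7/16 * \<tau>" shows "PU1 x i z = 0 \<and> PU2 x i j z = 0"
proof -
  have "T1 n x i z = 0 \<and> T2 n x i j z = 0" if "n \<le> Suc L" for n
  proof (rule T_zero[OF x that])
    have "1 * \<tau> \<le> scl n" unfolding scl_def using \<tau> by (intro mult_right_mono) auto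
    then show "\<not> (7/16 * scl n \<le> infdist z E \<and> infdist z E \<le> 9/8 * scl n)" using z by linarith
  qed
  then show ?thesis unfolding PU1_def PU2_def by simp
qed

section \<open>Derivative bounds independent of the set\<close>

context
  fixes B :: real
  assumes B: "B \<ge> 1"
    and B0: "\<And>A r z. A \<in> sets borel \<Longrightarrow> r > 0 \<Longrightarrow> \<bar>smear A r z\<bar> \<le> B / r^2 * measure lborel (A \<inter> ball z r)"
    and B1: "\<And>A r i z. A \<in> sets borel \<Longrightarrow> r > 0 \<Longrightarrow> \<bar>smear1 A r i z\<bar> \<le> B / r^3 * measure lborel (A \<inter> ball z r)"
    and B2: "\<And>A r i j z. A \<in> sets borel \<Longrightarrow> r > 0 \<Longrightarrow> \<bar>smear2 A r i j z\<bar> \<le> B / r^4 * measure lborel (A \<inter> ball z r)"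
begin

lemma measure_frac:
  assumes "r > 0" "m \<le> 4 * r\<^sup>2" shows "B / r^2 * m \<le> 4 * B" "B / r^3 * m \<le> 4 * B / r" "B / r^4 * m \<le> 4 * B / r^2"
proof -
  have "B / r^2 * m \<le> B / r^2 * (4 * r\<^sup>2)" "B / r^3 * m \<le> B / r^3 * (4 * r\<^sup>2)" "B / r^4 * m \<le> B / r^4 * (4 * r\<^sup>2)"
    using assms B by (intro mult_left_mono; simp)+
  then show "B / r^2 * m \<le> 4 * B" "B / r^3 * m \<le> 4 * B / r" "B / r^4 * m \<le> 4 * B / r^2"
    using assms(1) by (simp_all add: power_numeral_reduce power2_eq_square field_simps)
qed

lemma smear_abs:
  assumes "A \<in> sets borel" "r > 0"
  shows "\<bar>smear A r z\<bar> \<le> 4 * B" "\<bar>smear1 A r i z\<bar> \<le> 4 * B / r" "\<bar>smear2 A r i j z\<bar> \<le> 4 * B / r\<^sup>2"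
proof -
  have "measure lborel (A \<inter> ball z r) \<le> measure lborel (ball z r)"
    using assms(1) emeasure_bounded_finite[OF bounded_ball] by (intro measure_mono_fmeasurable) (auto simp: fmeasurable_def)
  then have m: "measure lborel (A \<inter> ball z r) \<le> 4 * r\<^sup>2" using measure_ball_le[of z r] by linarith
  show "\<bar>smear A r z\<bar> \<le> 4 * B" "\<bar>smear1 A r i z\<bar> \<le> 4 * B / r" "\<bar>smear2 A r i j z\<bar> \<le> 4 * B / r\<^sup>2"
    using order_trans[OF B0[OF assms] measure_frac(1)[OF assms(2) m]] order_trans[OF B1[OF assms] measure_frac(2)[OF assms(2) m]]
      order_trans[OF B2[OF assms] measure_frac(3)[OF assms(2) m]] by auto
qed

text \<open>The 20 is 4 + 16: the previous scale has half the radius, which multiplies a second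
  derivative by 4.\<close>

lemma bumpPhi_abs:
  "\<bar>bumpPhi n z\<bar> \<le> 20 * B" "\<bar>bumpPhi1 n i z\<bar> \<le> 20 * B / rad n" "\<bar>bumpPhi2 n i j z\<bar> \<le> 20 * B / (rad n)\<^sup>2"
proof -
  note s = smear_abs[OF nbhd_measurable scl_pos(2)]
  have r: "rad n > 0" by (rule scl_pos)
  have "\<bar>bumpPhi n z\<bar> \<le> 20 * B \<and> \<bar>bumpPhi1 n i z\<bar> \<le> 20 * B / rad n \<and> \<bar>bumpPhi2 n i j z\<bar> \<le> 20 * B / (rad n)\<^sup>2"
  proof (cases n)
    case 0
    have "4 * B \<le> 20 * B" "4 * B / rad 0 \<le> 20 * B / rad 0" "4 * B / (rad 0)\<^sup>2 \<le> 20 * B / (rad 0)\<^sup>2"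
      using B scl_pos[of 0] by (auto intro!: divide_right_mono)
    then show ?thesis using s(1)[of 0 0 z] s(2)[of 0 0 i z] s(3)[of 0 0 i j z] unfolding 0 bumpPhi_def bumpPhi1_def bumpPhi2_def by simp
  next
    case (Suc m)
    have rm: "rad m = rad n / 2" by (simp add: rad_def Suc scl_Suc)
    have "\<bar>bumpPhi n z\<bar> \<le> 4 * B + 4 * B" using s(1)[of n n z] s(1)[of m m z] unfolding Suc bumpPhi_def by simp
    moreover have "\<bar>bumpPhi1 n i z\<bar> \<le> 4 * B / rad n + 4 * B / rad m" using s(2)[of n n i z] s(2)[of m m i z] unfolding Suc bumpPhi1_def by simp
    moreover have "\<bar>bumpPhi2 n i j z\<bar> \<le> 4 * B / (rad n)\<^sup>2 + 4 * B / (rad m)\<^sup>2" using s(3)[of n n i j z] s(3)[of m m i j z] unfolding Suc bumpPhi2_def by simp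
    moreover have "4 * B / rad n + 4 * B / rad m \<le> 20 * B / rad n" "4 * B / (rad n)\<^sup>2 + 4 * B / (rad m)\<^sup>2 \<le> 20 * B / (rad n)\<^sup>2"
      unfolding rm using B r by (simp_all add: power2_eq_square field_simps)
    ultimately show ?thesis using B by linarith
  qed
  then show "\<bar>bumpPhi n z\<bar> \<le> 20 * B" "\<bar>bumpPhi1 n i z\<bar> \<le> 20 * B / rad n" "\<bar>bumpPhi2 n i j z\<bar> \<le> 20 * B / (rad n)\<^sup>2" by auto
qed

text \<open>Each summand is proportional to the area of its cell in one ball, and the cells are
  disjoint. This makes the sum over all of \<open>E\<close> as good as a single term.\<close>

lemma cellS_sum_abs:
  "(\<Sum>x\<in>E. \<bar>cellS n x z\<bar>) \<le> 4 * B" "(\<Sum>x\<in>E. \<bar>cellS1 n x i z\<bar>) \<le> 4 * B / rad n" "(\<Sum>x\<in>E. \<bar>cellS2 n x i j z\<bar>) \<le> 4 * B / (rad n)\<^sup>2"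
proof -
  have r: "rad n > 0" by (rule scl_pos)
  have m: "(\<Sum>x\<in>E. measure lborel (vor E x \<inter> ball z (rad n))) \<le> 4 * (rad n)\<^sup>2"
    using sum_measure_vor[OF E(1) E_ne] measure_ball_le by simp
  note v = vor_measurable[OF E(1)]
  have "(\<Sum>x\<in>E. \<bar>cellS n x z\<bar>) \<le> 4 * B \<and> (\<Sum>x\<in>E. \<bar>cellS1 n x i z\<bar>) \<le> 4 * B / rad n \<and> (\<Sum>x\<in>E. \<bar>cellS2 n x i j z\<bar>) \<le> 4 * B / (rad n)\<^sup>2"
  proof (cases "n \<le> L")
    case True
    have "(\<Sum>x\<in>E. \<bar>cellS n x z\<bar>) \<le> B / (rad n)^2 * (\<Sum>x\<in>E. measure lborel (vor E x \<inter> ball z (rad n)))"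
      "(\<Sum>x\<in>E. \<bar>cellS1 n x i z\<bar>) \<le> B / (rad n)^3 * (\<Sum>x\<in>E. measure lborel (vor E x \<inter> ball z (rad n)))"
      "(\<Sum>x\<in>E. \<bar>cellS2 n x i j z\<bar>) \<le> B / (rad n)^4 * (\<Sum>x\<in>E. measure lborel (vor E x \<inter> ball z (rad n)))"
      unfolding sum_distrib_left cellS_def cellS1_def cellS2_def using True B0[OF v r] B1[OF v r] B2[OF v r] by (auto intro!: sum_mono)
    then show ?thesis using measure_frac[OF r m] by linarith
  next
    case False
    have "(\<Sum>x\<in>E. \<bar>cellS n x z\<bar>) = 1" using False E by (simp add: cellS_def if_distrib[of abs] cong: if_cong)
    then show ?thesis using False B r by (simp add: cellS1_def cellS2_def)
  qed
  then show "(\<Sum>x\<in>E. \<bar>cellS n x z\<bar>) \<le> 4 * B" "(\<Sum>x\<in>E. \<bar>cellS1 n x i z\<bar>) \<le> 4 * B / rad n" "(\<Sum>x\<in>E. \<bar>cellS2 n x i j z\<bar>) \<le> 4 * B / (rad n)\<^sup>2" by auto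
qed

lemma sum_prod_abs:
  assumes "\<bar>a\<bar> \<le> A" "(\<Sum>x\<in>E. \<bar>f x\<bar>) \<le> F" shows "(\<Sum>x\<in>E. \<bar>a * f x\<bar>) \<le> A * (F::real)"
proof -
  have "(\<Sum>x\<in>E. \<bar>a * f x\<bar>) = \<bar>a\<bar> * (\<Sum>x\<in>E. \<bar>f x\<bar>)" by (simp add: abs_mult sum_distrib_left)
  also have "\<dots> \<le> A * F" using assms by (intro mult_mono) (auto intro: sum_nonneg)
  finally show ?thesis .
qed

lemma T_sum_abs:
  "(\<Sum>x\<in>E. \<bar>T1 n x i z\<bar>) \<le> 160 * B\<^sup>2 / rad n" "(\<Sum>x\<in>E. \<bar>T2 n x i j z\<bar>) \<le> 320 * B\<^sup>2 / (rad n)\<^sup>2"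
proof -
  have r: "rad n > 0" by (rule scl_pos)
  have "(\<Sum>x\<in>E. \<bar>T1 n x i z\<bar>) \<le> (\<Sum>x\<in>E. \<bar>bumpPhi1 n i z * cellS n x z\<bar>) + (\<Sum>x\<in>E. \<bar>bumpPhi n z * cellS1 n x i z\<bar>)"
    unfolding sum.distrib[symmetric] T1_def by (intro sum_mono abs_triangle_ineq)
  also have "\<dots> \<le> (20 * B / rad n) * (4 * B) + (20 * B) * (4 * B / rad n)"
    by (intro add_mono sum_prod_abs bumpPhi_abs cellS_sum_abs)
  also have "\<dots> = 160 * B\<^sup>2 / rad n" by (simp add: power2_eq_square)
  finally show "(\<Sum>x\<in>E. \<bar>T1 n x i z\<bar>) \<le> 160 * B\<^sup>2 / rad n" .
  have "(\<Sum>x\<in>E. \<bar>T2 n x i j z\<bar>) \<le> ((\<Sum>x\<in>E. \<bar>bumpPhi2 n i j z * cellS n x z\<bar>) + (\<Sum>x\<in>E. \<bar>bumpPhi1 n i z * cellS1 n x j z\<bar>)) +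
     ((\<Sum>x\<in>E. \<bar>bumpPhi1 n j z * cellS1 n x i z\<bar>) + (\<Sum>x\<in>E. \<bar>bumpPhi n z * cellS2 n x i j z\<bar>))"
    unfolding sum.distrib[symmetric] T2_def by (intro sum_mono order_trans[OF abs_triangle_ineq] add_mono abs_triangle_ineq)
  also have "\<dots> \<le> ((20 * B / (rad n)\<^sup>2) * (4 * B) + (20 * B / rad n) * (4 * B / rad n)) + ((20 * B / rad n) * (4 * B / rad n) + (20 * B) * (4 * B / (rad n)\<^sup>2))"
    by (intro add_mono sum_prod_abs bumpPhi_abs cellS_sum_abs)
  also have "\<dots> = 320 * B\<^sup>2 / (rad n)\<^sup>2" using r by (simp add: power2_eq_square)
  finally show "(\<Sum>x\<in>E. \<bar>T2 n x i j z\<bar>) \<le> 320 * B\<^sup>2 / (rad n)\<^sup>2" .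
qed

text \<open>At most two scales are active at z, and on them the distance to \<open>E\<close> is at
  most 9 mollification radii. The larger constant is 2 * 81 * 320.\<close>

lemma PU_sum_abs:
  "infdist z E * (\<Sum>x\<in>E. \<bar>PU1 x i z\<bar>) \<le> 51840 * B\<^sup>2" "(infdist z E)\<^sup>2 * (\<Sum>x\<in>E. \<bar>PU2 x i j z\<bar>) \<le> 51840 * B\<^sup>2"
proof -
  have d0: "infdist z E \<ge> 0" by (rule infdist_nonneg)
  have n1: "infdist z E * (160 * B\<^sup>2 / rad n) \<le> 1440 * B\<^sup>2" "(infdist z E)\<^sup>2 * (320 * B\<^sup>2 / (rad n)\<^sup>2) \<le> 25920 * B\<^sup>2" if "n \<in> active z" for n
  proof -
    have d: "infdist z E \<le> 9 * rad n" using that by (simp add: active_def rad_def)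
    have r: "rad n > 0" by (rule scl_pos)
    have q: "infdist z E / rad n \<le> 9" using d r by (simp add: divide_le_eq)
    then have "160 * B\<^sup>2 * (infdist z E / rad n) \<le> 160 * B\<^sup>2 * 9" by (intro mult_left_mono) auto
    then show "infdist z E * (160 * B\<^sup>2 / rad n) \<le> 1440 * B\<^sup>2" by (simp add: mult_ac)
    have "(infdist z E / rad n)\<^sup>2 \<le> 9\<^sup>2" using q d0 r by (intro power_mono) auto
    then have "320 * B\<^sup>2 * (infdist z E / rad n)\<^sup>2 \<le> 320 * B\<^sup>2 * 81" by (intro mult_left_mono) auto
    then show "(infdist z E)\<^sup>2 * (320 * B\<^sup>2 / (rad n)\<^sup>2) \<le> 25920 * B\<^sup>2" by (simp add: mult_ac power_divide)
  qed
  have "(\<Sum>x\<in>E. \<bar>PU1 x i z\<bar>) \<le> (\<Sum>x\<in>E. \<Sum>n\<in>active z. \<bar>T1 n x i z\<bar>)"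
    by (intro sum_mono) (simp add: PU_active(1) sum_abs)
  also have "\<dots> = (\<Sum>n\<in>active z. \<Sum>x\<in>E. \<bar>T1 n x i z\<bar>)" by (rule sum.swap)
  also have "\<dots> \<le> (\<Sum>n\<in>active z. 160 * B\<^sup>2 / rad n)" by (intro sum_mono T_sum_abs)
  finally have "infdist z E * (\<Sum>x\<in>E. \<bar>PU1 x i z\<bar>) \<le> infdist z E * (\<Sum>n\<in>active z. 160 * B\<^sup>2 / rad n)"
    using d0 by (rule mult_left_mono)
  also have "\<dots> = (\<Sum>n\<in>active z. infdist z E * (160 * B\<^sup>2 / rad n))" by (rule sum_distrib_left)
  also have "\<dots> \<le> real (card (active z)) * (1440 * B\<^sup>2)" using n1 by (intro sum_bounded_above) auto
  also have "\<dots> \<le> 2 * (1440 * B\<^sup>2)" using card_active by (intro mult_right_mono) auto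
  also have "\<dots> \<le> 51840 * B\<^sup>2" by simp
  finally show "infdist z E * (\<Sum>x\<in>E. \<bar>PU1 x i z\<bar>) \<le> 51840 * B\<^sup>2" .
  have "(\<Sum>x\<in>E. \<bar>PU2 x i j z\<bar>) \<le> (\<Sum>x\<in>E. \<Sum>n\<in>active z. \<bar>T2 n x i j z\<bar>)"
    by (intro sum_mono) (simp add: PU_active(2) sum_abs)
  also have "\<dots> = (\<Sum>n\<in>active z. \<Sum>x\<in>E. \<bar>T2 n x i j z\<bar>)" by (rule sum.swap)
  also have "\<dots> \<le> (\<Sum>n\<in>active z. 320 * B\<^sup>2 / (rad n)\<^sup>2)" by (intro sum_mono T_sum_abs)
  finally have "(infdist z E)\<^sup>2 * (\<Sum>x\<in>E. \<bar>PU2 x i j z\<bar>) \<le> (infdist z E)\<^sup>2 * (\<Sum>n\<in>active z. 320 * B\<^sup>2 / (rad n)\<^sup>2)"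
    by (rule mult_left_mono) simp
  also have "\<dots> = (\<Sum>n\<in>active z. (infdist z E)\<^sup>2 * (320 * B\<^sup>2 / (rad n)\<^sup>2))" by (rule sum_distrib_left)
  also have "\<dots> \<le> real (card (active z)) * (25920 * B\<^sup>2)" using n1 by (intro sum_bounded_above) auto
  also have "\<dots> \<le> 2 * (25920 * B\<^sup>2)" using card_active by (intro mult_right_mono) auto
  finally show "(infdist z E)\<^sup>2 * (\<Sum>x\<in>E. \<bar>PU2 x i j z\<bar>) \<le> 51840 * B\<^sup>2" by simp
qed

end

end

abbreviation pu_sys :: "(real^2) set \<Rightarrow> real \<Rightarrow> (real^2 \<Rightarrow> real^2 \<Rightarrow> real) \<Rightarrow> (real^2 \<Rightarrow> 2 \<Rightarrow> real^2 \<Rightarrow> real) \<Rightarrow>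
    (real^2 \<Rightarrow> 2 \<Rightarrow> 2 \<Rightarrow> real^2 \<Rightarrow> real) \<Rightarrow> real \<Rightarrow> bool" where
  "pu_sys E C \<Psi> \<Psi>1 \<Psi>2 \<rho> \<equiv> \<rho> > 0 \<and>
      (\<forall>x. continuous_on UNIV (\<Psi> x)) \<and> (\<forall>x i. continuous_on UNIV (\<Psi>1 x i)) \<and> (\<forall>x i j. continuous_on UNIV (\<Psi>2 x i j)) \<and>
      (\<forall>x i. line_deriv (\<Psi> x) (axis i 1) (\<Psi>1 x i)) \<and> (\<forall>x i j. line_deriv (\<Psi>1 x i) (axis j 1) (\<Psi>2 x i j)) \<and>
      (\<forall>z. (\<Sum>x\<in>E. \<Psi> x z) = 1) \<and>
      (\<forall>x\<in>E. \<forall>y\<in>E. \<forall>z\<in>ball y \<rho>. \<Psi> x z = (if x = y then 1 else 0)) \<and>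
      (\<forall>x\<in>E. \<forall>z i j. infdist z E < \<rho> \<longrightarrow> \<Psi>1 x i z = 0 \<and> \<Psi>2 x i j z = 0) \<and>
      (\<forall>z i. infdist z E * (\<Sum>x\<in>E. \<bar>\<Psi>1 x i z\<bar>) \<le> C) \<and> (\<forall>z i j. (infdist z E)\<^sup>2 * (\<Sum>x\<in>E. \<bar>\<Psi>2 x i j z\<bar>) \<le> C) \<and>
      (\<forall>x\<in>E. \<forall>z i j. \<Psi>1 x i z \<noteq> 0 \<or> \<Psi>2 x i j z \<noteq> 0 \<longrightarrow> dist z x \<le> 8 * infdist z E)"

theorem partition_of_unity:
  "\<exists>C>0. \<forall>E :: (real^2) set. finite E \<longrightarrow> E \<noteq> {} \<longrightarrow> (\<exists>\<Psi> \<Psi>1 \<Psi>2 \<rho>. pu_sys E C \<Psi> \<Psi>1 \<Psi>2 \<rho>)"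
proof -
  obtain B where B: "B \<ge> 1"
    "\<And>A r z. A \<in> sets borel \<Longrightarrow> r > 0 \<Longrightarrow> \<bar>smear A r z\<bar> \<le> B / r^2 * measure lborel (A \<inter> ball z r)"
    "\<And>A r i z. A \<in> sets borel \<Longrightarrow> r > 0 \<Longrightarrow> \<bar>smear1 A r i z\<bar> \<le> B / r^3 * measure lborel (A \<inter> ball z r)"
    "\<And>A r i j z. A \<in> sets borel \<Longrightarrow> r > 0 \<Longrightarrow> \<bar>smear2 A r i j z\<bar> \<le> B / r^4 * measure lborel (A \<inter> ball z r)"
    by (rule smear_bounds) (rule that; assumption)
  show ?thesis
  proof (intro exI[of _ "51840 * B\<^sup>2"] conjI allI impI)
    show "0 < 51840 * B\<^sup>2" using B(1) by simp
    fix E :: "(real^2) set" assume E: "finite E" "E \<noteq> {}"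
    obtain x0 where x0: "x0 \<in> E" using E by blast
    \<comment> \<open>The 1 keeps the set of distances nonempty when \<open>E\<close> has a single
      point.\<close>
    define D where "D = insert 1 ((\<lambda>(x,y). dist x y) ` {(x,y). x \<in> E \<and> y \<in> E \<and> x \<noteq> y})"
    have "finite {(x,y). x \<in> E \<and> y \<in> E \<and> x \<noteq> y}" by (rule finite_subset[OF _ finite_cartesian_product[OF E(1) E(1)]]) auto
    then have D: "finite D" "D \<noteq> {}" unfolding D_def by auto
    define \<tau> where "\<tau> = Min D / 8"
    have "Min D \<in> D" using D by (rule Min_in)
    then have \<tau>: "\<tau> > 0" unfolding \<tau>_def D_def by auto
    have inD: "dist x y \<in> D" if "x \<in> E" "y \<in> E" "x \<noteq> y" for x y unfolding D_def using that by force
    have sep: "8 * \<tau> \<le> dist x y" if "x \<in> E" "y \<in> E" "x \<noteq> y" for x y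
      using Min_le[OF D(1) inD[OF that]] unfolding \<tau>_def by simp
    obtain L where "Max D / \<tau> < 2 ^ L" using real_arch_pow[of 2 "Max D / \<tau>"] by auto
    then have L: "Max D < 2 ^ L * \<tau>" using \<tau> by (simp add: divide_less_eq)
    have diam: "dist x y \<le> 2 ^ L * \<tau>" if "x \<in> E" "y \<in> E" for x y
      using Max_ge[OF D(1) inD[OF that]] L \<tau> by (cases "x = y") auto
    note ctx = E(1) x0 \<tau> sep diam
    let ?P = "PU E x0 \<tau> L" and ?P1 = "PU1 E x0 \<tau> L" and ?P2 = "PU2 E x0 \<tau> L"
    show "\<exists>\<Psi> \<Psi>1 \<Psi>2 \<rho>. \<rho> > 0 \<and>
      (\<forall>x. continuous_on UNIV (\<Psi> x)) \<and> (\<forall>x i. continuous_on UNIV (\<Psi>1 x i)) \<and> (\<forall>x i j. continuous_on UNIV (\<Psi>2 x i j)) \<and>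
      (\<forall>x i. line_deriv (\<Psi> x) (axis i 1) (\<Psi>1 x i)) \<and> (\<forall>x i j. line_deriv (\<Psi>1 x i) (axis j 1) (\<Psi>2 x i j)) \<and>
      (\<forall>z. (\<Sum>x\<in>E. \<Psi> x z) = 1) \<and>
      (\<forall>x\<in>E. \<forall>y\<in>E. \<forall>z\<in>ball y \<rho>. \<Psi> x z = (if x = y then 1 else 0)) \<and>
      (\<forall>x\<in>E. \<forall>z i j. infdist z E < \<rho> \<longrightarrow> \<Psi>1 x i z = 0 \<and> \<Psi>2 x i j z = 0) \<and>
      (\<forall>z i. infdist z E * (\<Sum>x\<in>E. \<bar>\<Psi>1 x i z\<bar>) \<le> 51840 * B\<^sup>2) \<and> (\<forall>z i j. (infdist z E)\<^sup>2 * (\<Sum>x\<in>E. \<bar>\<Psi>2 x i j z\<bar>) \<le> 51840 * B\<^sup>2) \<and>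
      (\<forall>x\<in>E. \<forall>z i j. \<Psi>1 x i z \<noteq> 0 \<or> \<Psi>2 x i j z \<noteq> 0 \<longrightarrow> dist z x \<le> 8 * infdist z E)"
    proof (intro exI[of _ ?P] exI[of _ ?P1] exI[of _ ?P2] exI[of _ "7/16 * \<tau>"] conjI allI ballI impI)
      show "PU E x0 \<tau> L x z = (if x = y then 1 else 0)" if "x \<in> E" "y \<in> E" "z \<in> ball y (7/16 * \<tau>)" for x y z
        using PU_near[OF ctx, of z y x] that by (simp add: dist_commute)
      show "0 < 7/16 * \<tau>" using \<tau> by simp
      fix x z i j
      show "continuous_on UNIV (?P x)" "continuous_on UNIV (?P1 x i)" "continuous_on UNIV (?P2 x i j)"
        "line_deriv (?P x) (axis i 1) (?P1 x i)" "line_deriv (?P1 x i) (axis j 1) (?P2 x i j)"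
        using PU_regular[OF ctx] by auto
      show "(\<Sum>x\<in>E. ?P x z) = 1" by (rule PU_sum[OF ctx])
      show "infdist z E * (\<Sum>x\<in>E. \<bar>?P1 x i z\<bar>) \<le> 51840 * B\<^sup>2" by (rule PU_sum_abs(1)[OF ctx B])
      show "(infdist z E)\<^sup>2 * (\<Sum>x\<in>E. \<bar>?P2 x i j z\<bar>) \<le> 51840 * B\<^sup>2" by (rule PU_sum_abs(2)[OF ctx B])
      show "dist z x \<le> 8 * infdist z E" if "x \<in> E" "?P1 x i z \<noteq> 0 \<or> ?P2 x i j z \<noteq> 0"
        by (rule PU_support[OF ctx that])
      show "?P1 x i z = 0" if "x \<in> E" "infdist z E < 7/16 * \<tau>" by (rule conjunct1[OF PU_flat[OF ctx that]])
      show "?P2 x i j z = 0" if "x \<in> E" "infdist z E < 7/16 * \<tau>" by (rule conjunct2[OF PU_flat[OF ctx that]])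
    qed
  qed
qed

section \<open>Whitney extension of jets\<close>

text \<open>Jensen's inequality for the normalised weights. Only an upper bound for their sum enters
  the result, so the number of terms does not.\<close>

lemma weighted_power_mean:
  fixes w a :: "'a \<Rightarrow> real"
  assumes p: "p \<ge> 1" and E: "finite E" and w: "\<And>x. x \<in> E \<Longrightarrow> w x \<ge> 0" "(\<Sum>x\<in>E. w x) \<le> W" and a: "\<And>x. x \<in> E \<Longrightarrow> a x \<ge> 0"
  shows "(\<Sum>x\<in>E. w x * a x) powr p \<le> W powr (p - 1) * (\<Sum>x\<in>E. w x * a x powr p)"
proof (cases "(\<Sum>x\<in>E. w x) = 0")
  case True
  then have "w x = 0" if "x \<in> E" for x using sum_nonneg_eq_0_iff[OF E, of w] w(1) that by simp
  then show ?thesis by simp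
next
  case False
  define S where "S = (\<Sum>x\<in>E. w x)"
  have S: "S > 0" using False sum_nonneg[of E w] w(1) unfolding S_def by force
  have "(\<Sum>x\<in>E. (w x / S) *\<^sub>R a x) powr p \<le> (\<Sum>x\<in>E. (w x / S) * a x powr p)"
  proof (rule convex_on_sum[OF E _ powr_convex_nonneg[OF p]])
    show "E \<noteq> {}" using False by auto
    show "(\<Sum>x\<in>E. w x / S) = 1" using S unfolding sum_divide_distrib[symmetric] S_def by simp
  qed (use w a S in auto)
  moreover have "(\<Sum>x\<in>E. w x * a x) = S * (\<Sum>x\<in>E. (w x / S) *\<^sub>R a x)" using S by (simp add: sum_distrib_left)
  moreover have "(\<Sum>x\<in>E. (w x / S) *\<^sub>R a x) \<ge> 0" using w a S by (intro sum_nonneg) auto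
  ultimately have "(\<Sum>x\<in>E. w x * a x) powr p \<le> S powr p * (\<Sum>x\<in>E. (w x / S) * a x powr p)"
    using S by (simp add: powr_mult mult_left_mono)
  also have "\<dots> = S powr (p - 1) * (\<Sum>x\<in>E. w x * a x powr p)"
    using S by (simp add: sum_distrib_left powr_diff)
  also have "\<dots> \<le> W powr (p - 1) * (\<Sum>x\<in>E. w x * a x powr p)"
    using w S p unfolding S_def by (intro mult_right_mono powr_mono2 sum_nonneg) auto
  finally show ?thesis .
qed

definition jet_gap :: "(real^2 \<Rightarrow> real) \<Rightarrow> (real^2 \<Rightarrow> real^2) \<Rightarrow> real^2 \<Rightarrow> real^2 \<Rightarrow> real" where
  "jet_gap f \<xi> x y = f x + \<xi> x \<bullet> (y - x) - f y"

text \<open>Gradient differences enter coordinate by coordinate, so that each summand is the p-th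
  power of a functional linear in the jet; a Euclidean norm would not be.\<close>

definition jet_energy :: "real \<Rightarrow> (real^2) set \<Rightarrow> (real^2 \<Rightarrow> real^2 \<Rightarrow> real) \<Rightarrow> (real^2 \<Rightarrow> real^2 \<Rightarrow> real) \<Rightarrow> (real^2 \<Rightarrow> real) \<Rightarrow> (real^2 \<Rightarrow> real^2) \<Rightarrow> real" where
  "jet_energy p E \<alpha> \<beta> f \<xi> = (\<Sum>x\<in>E. \<Sum>y\<in>E. \<alpha> x y * (\<bar>(\<xi> x - \<xi> y) $ 1\<bar> powr p + \<bar>(\<xi> x - \<xi> y) $ 2\<bar> powr p) + \<beta> x y * \<bar>jet_gap f \<xi> x y\<bar> powr p)"

text \<open>The comparison demanded at z: y is nearest to z, x is within the range of the partition
  functions, and the powers of the distance make both differences comparable to a Hessian.\<close>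

abbreviation jets_dominated :: "real \<Rightarrow> (real^2) set \<Rightarrow> (real^2 \<Rightarrow> real) \<Rightarrow> (real^2 \<Rightarrow> real^2) \<Rightarrow> real^2 \<Rightarrow> real \<Rightarrow> bool" where
  "jets_dominated p E f \<xi> z c \<equiv> \<forall>x\<in>E. \<forall>y\<in>E. x \<noteq> y \<longrightarrow> dist z y = infdist z E \<longrightarrow> dist z x \<le> 8 * infdist z E \<longrightarrow>
     norm (\<xi> x - \<xi> y) powr p \<le> infdist z E powr p * c \<and> \<bar>jet_gap f \<xi> x y\<bar> powr p \<le> infdist z E powr (2*p) * c"

lemma Lp_hessian_of_hnorm:
  assumes m: "\<And>i j. g i j \<in> borel_measurable borel" and p: "p > 0" and fin: "(\<integral>\<^sup>+z. ennreal (hnorm g z powr p) \<partial>lborel) < \<infinity>"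
  shows "Lp_hessian p g"
  unfolding Lp_hessian_def
proof (intro allI conjI)
  fix i j
  note [measurable] = m hnorm_measurable[OF m]
  show "g i j \<in> borel_measurable lborel" by simp
  have "integrable lborel (\<lambda>z. hnorm g z powr p)" using fin by (intro integrableI_bounded) auto
  then show "integrable lborel (\<lambda>x. \<bar>g i j x\<bar> powr p)"
  proof (rule Bochner_Integration.integrable_bound)
    show "AE x in lborel. norm (\<bar>g i j x\<bar> powr p) \<le> norm (hnorm g x powr p)"
      using abs_le_hnorm[of g i j] p by (intro AE_I2) (auto intro!: powr_mono2)
  qed measurable
qed

lemma nn_integral_vor:
  assumes E: "finite E" "E \<noteq> {}" and h: "h \<in> borel_measurable borel"
  shows "(\<integral>\<^sup>+z. h z \<partial>lborel) = (\<Sum>y\<in>E. \<integral>\<^sup>+z. h z * indicator (vor E y) z \<partial>lborel)"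
proof -
  have "(\<integral>\<^sup>+z. h z \<partial>lborel) = (\<integral>\<^sup>+z. (\<Sum>y\<in>E. h z * indicator (vor E y) z) \<partial>lborel)"
  proof (rule nn_integral_cong)
    fix z
    obtain y where y: "y \<in> E" "z \<in> vor E y" using vor_cover[OF E] by blast
    have n: "z \<notin> vor E x" if "x \<in> E" "x \<noteq> y" for x using vor_disjoint[OF E(1) that(1) y(1) _ y(2)] that(2) by blast
    have "(\<Sum>x\<in>E. h z * indicator (vor E x) z) = (\<Sum>x\<in>E. if x = y then h z else 0)"
      by (intro sum.cong refl) (simp add: indicator_def y(2) n)
    then show "h z = (\<Sum>x\<in>E. h z * indicator (vor E x) z)" using y E(1) by simp
  qed
  also have "\<dots> = (\<Sum>y\<in>E. \<integral>\<^sup>+z. h z * indicator (vor E y) z \<partial>lborel)"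
    by (rule nn_integral_sum) (use h vor_measurable[OF E(1)] in \<open>auto intro!: borel_measurable_times_ennreal borel_measurable_indicator\<close>)
  finally show ?thesis .
qed

section \<open>Whitney extension for a given partition of unity\<close>

context
  fixes p :: real and E :: "(real^2) set" and C0 Ct \<rho> :: real
    and \<Psi> :: "real^2 \<Rightarrow> real^2 \<Rightarrow> real" and \<Psi>1 :: "real^2 \<Rightarrow> 2 \<Rightarrow> real^2 \<Rightarrow> real" and \<Psi>2 :: "real^2 \<Rightarrow> 2 \<Rightarrow> 2 \<Rightarrow> real^2 \<Rightarrow> real"
  assumes p: "p > 2" and E: "finite E" "E \<noteq> {}" and C0: "C0 > 0" and \<rho>: "\<rho> > 0"
    and tail: "\<And>(x::real^2) r. r > 0 \<Longrightarrow> (\<integral>\<^sup>+z. ennreal (max r (dist z x) powr (-p)) \<partial>lborel) \<le> ennreal (Ct * r powr (2 - p))"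
    and cont: "\<And>x. continuous_on UNIV (\<Psi> x)" "\<And>x i. continuous_on UNIV (\<Psi>1 x i)" "\<And>x i j. continuous_on UNIV (\<Psi>2 x i j)"
    and ld: "\<And>x i. line_deriv (\<Psi> x) (axis i 1) (\<Psi>1 x i)" "\<And>x i j. line_deriv (\<Psi>1 x i) (axis j 1) (\<Psi>2 x i j)"
    and sum1: "\<And>z. (\<Sum>x\<in>E. \<Psi> x z) = 1"
    and near: "\<And>x y z. x \<in> E \<Longrightarrow> y \<in> E \<Longrightarrow> z \<in> ball y \<rho> \<Longrightarrow> \<Psi> x z = (if x = y then 1 else 0)"
    and flat: "\<And>x z i j. x \<in> E \<Longrightarrow> infdist z E < \<rho> \<Longrightarrow> \<Psi>1 x i z = 0 \<and> \<Psi>2 x i j z = 0"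
    and bd1: "\<And>z i. infdist z E * (\<Sum>x\<in>E. \<bar>\<Psi>1 x i z\<bar>) \<le> C0"
    and bd2: "\<And>z i j. (infdist z E)\<^sup>2 * (\<Sum>x\<in>E. \<bar>\<Psi>2 x i j z\<bar>) \<le> C0"
    and supp: "\<And>x z i j. x \<in> E \<Longrightarrow> \<Psi>1 x i z \<noteq> 0 \<or> \<Psi>2 x i j z \<noteq> 0 \<Longrightarrow> dist z x \<le> 8 * infdist z E"
begin

text \<open>The size of the derivatives of the partition function of x, made scale invariant by
  powers of the distance to \<open>E\<close>; these weights have bounded sum over x.\<close>

definition "wt x z = infdist z E * (\<Sum>i\<in>UNIV. \<bar>\<Psi>1 x i z\<bar>) + (infdist z E)\<^sup>2 * (\<Sum>i\<in>UNIV. \<Sum>j\<in>UNIV. \<bar>\<Psi>2 x i j z\<bar>)"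
text \<open>Since y is the nearest point for all z in its cell, the jet difference between x and y
  is constant there and z can be integrated out. One coefficient per pair remains, which is the
  reason for a quadratic number of functionals.\<close>

definition "wa x y = enn2real (\<integral>\<^sup>+z. ennreal (wt x z * infdist z E powr (-p)) * indicator (vor E y) z \<partial>lborel)"
definition "wb x y = enn2real (\<integral>\<^sup>+z. ennreal (wt x z * infdist z E powr (-(2*p))) * indicator (vor E y) z \<partial>lborel)"
definition "wh f \<xi> z = (\<Sum>x\<in>E. \<Psi> x z * (f x + \<xi> x \<bullet> (z - x)))"
definition "wh2 f \<xi> i j z = (\<Sum>x\<in>E. (\<Psi>2 x i j z * (f x + \<xi> x \<bullet> (z - x)) + \<Psi>1 x i z * \<xi> x $ j) + (\<Psi>1 x j z * \<xi> x $ i + \<Psi> x z * 0))"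

lemma wa_nonneg: "wa x y \<ge> 0" "wb x y \<ge> 0" by (simp_all add: wa_def wb_def)

lemma wh_eq: "(\<lambda>z. \<Sum>x\<in>E. \<Psi> x z * (f x + \<xi> x \<bullet> (z - x))) = wh f \<xi>"
  by (rule ext) (simp add: wh_def)

lemma wt_nonneg: "wt x z \<ge> 0"
  unfolding wt_def by (intro add_nonneg_nonneg mult_nonneg_nonneg sum_nonneg) (auto simp: infdist_nonneg)

lemma wt_measurable: "wt x \<in> borel_measurable borel"
  unfolding wt_def[abs_def] by (intro borel_measurable_continuous_onI continuous_intros cont)

lemma infdist_measurable [measurable]: "(\<lambda>z. infdist z E) \<in> borel_measurable borel"
  by (intro borel_measurable_continuous_onI continuous_intros)

lemma wt_sum: "(\<Sum>x\<in>E. wt x z) \<le> 6 * C0"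
proof -
  have "(\<Sum>x\<in>E. wt x z) = (\<Sum>i\<in>UNIV. infdist z E * (\<Sum>x\<in>E. \<bar>\<Psi>1 x i z\<bar>)) + (\<Sum>i\<in>UNIV. \<Sum>j\<in>UNIV. (infdist z E)\<^sup>2 * (\<Sum>x\<in>E. \<bar>\<Psi>2 x i j z\<bar>))"
    unfolding wt_def by (simp add: sum.distrib sum_distrib_left sum_2 distrib_left)
  also have "\<dots> \<le> (\<Sum>i\<in>(UNIV::2 set). C0) + (\<Sum>i\<in>(UNIV::2 set). \<Sum>j\<in>(UNIV::2 set). C0)"
    by (intro add_mono sum_mono bd1 bd2)
  finally show ?thesis by simp
qed

lemma wt_le: "x \<in> E \<Longrightarrow> wt x z \<le> 6 * C0"
  using member_le_sum[of x E "\<lambda>x. wt x z"] wt_nonneg E(1) wt_sum[of z] by force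

lemma wt_support:
  assumes "x \<in> E" "wt x z \<noteq> 0" shows "dist z x \<le> 8 * infdist z E" "infdist z E \<ge> \<rho>"
proof -
  have "\<exists>i j. \<Psi>1 x i z \<noteq> 0 \<or> \<Psi>2 x i j z \<noteq> 0"
  proof (rule ccontr)
    assume "\<not> ?thesis"
    then have "wt x z = 0" unfolding wt_def by simp
    then show False using assms by simp
  qed
  then show "dist z x \<le> 8 * infdist z E" "infdist z E \<ge> \<rho>"
    using supp[OF assms(1)] flat[OF assms(1), of z] by (auto simp: not_less[symmetric])
qed

text \<open>Within \<rho> of \<open>E\<close> the weight vanishes because the partition functions
  are flat there; further out the power -p of the distance to y is integrable in the plane since
  \<open>p > 2\<close>.\<close>

lemma wa_finite:
  assumes x: "x \<in> E"
  shows "(\<integral>\<^sup>+z. ennreal (wt x z * infdist z E powr (-p)) * indicator (vor E y) z \<partial>lborel) = ennreal (wa x y)" (is "?A = _")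
    "(\<integral>\<^sup>+z. ennreal (wt x z * infdist z E powr (-(2*p))) * indicator (vor E y) z \<partial>lborel) = ennreal (wb x y)" (is "?B = _")
proof -
  have t: "(\<integral>\<^sup>+z. ennreal c * ennreal (max \<rho> (dist z y) powr (-p)) \<partial>lborel) < \<infinity>" for c
    using tail[OF \<rho>, of y] by (subst nn_integral_cmult) (auto simp: ennreal_mult_less_top intro: le_less_trans)
  have w: "wt x z * infdist z E powr (-p) \<le> 6 * C0 * max \<rho> (dist z y) powr (-p)" if "z \<in> vor E y" for z
  proof (cases "wt x z = 0")
    case False
    have "infdist z E = max \<rho> (dist z y)" using wt_support(2)[OF x False] that unfolding vor_def by simp
    then show ?thesis using wt_le[OF x, of z] by (simp add: mult_right_mono)
  qed (use C0 in simp)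
  have "?A \<le> (\<integral>\<^sup>+z. ennreal (6 * C0) * ennreal (max \<rho> (dist z y) powr (-p)) \<partial>lborel)"
    using w C0 by (intro nn_integral_mono) (auto simp: indicator_def ennreal_mult[symmetric] intro!: ennreal_leI)
  then have "?A < \<infinity>" using t by (rule le_less_trans)
  then show "?A = ennreal (wa x y)" unfolding wa_def by simp
  have w2: "wt x z * infdist z E powr (-(2*p)) \<le> \<rho> powr (-p) * (6 * C0) * max \<rho> (dist z y) powr (-p)" if "z \<in> vor E y" for z
  proof (cases "wt x z = 0")
    case False
    note d = wt_support(2)[OF x False]
    have "infdist z E powr (-(2*p)) = infdist z E powr (-p) * infdist z E powr (-p)" by (simp add: powr_add[symmetric])
    also have "\<dots> \<le> \<rho> powr (-p) * infdist z E powr (-p)" using d \<rho> p by (intro mult_right_mono powr_mono2') auto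
    finally have "wt x z * infdist z E powr (-(2*p)) \<le> wt x z * (\<rho> powr (-p) * infdist z E powr (-p))"
      by (rule mult_left_mono) (rule wt_nonneg)
    also have "\<dots> = \<rho> powr (-p) * (wt x z * infdist z E powr (-p))" by simp
    also have "\<dots> \<le> \<rho> powr (-p) * (6 * C0 * max \<rho> (dist z y) powr (-p))" by (rule mult_left_mono[OF w[OF that]]) simp
    finally show ?thesis by (simp only: mult.assoc)
  qed (use C0 in simp)
  have "?B \<le> (\<integral>\<^sup>+z. ennreal (\<rho> powr (-p) * (6 * C0)) * ennreal (max \<rho> (dist z y) powr (-p)) \<partial>lborel)"
    using w2 C0 by (intro nn_integral_mono) (auto simp: indicator_def ennreal_mult[symmetric] intro!: ennreal_leI)
  then have "?B < \<infinity>" using t by (rule le_less_trans)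
  then show "?B = ennreal (wb x y)" unfolding wb_def by simp
qed

definition "pairdens f \<xi> x y z = wt x z * (infdist z E powr (-p) * (\<bar>(\<xi> x - \<xi> y) $ 1\<bar> powr p + \<bar>(\<xi> x - \<xi> y) $ 2\<bar> powr p) + infdist z E powr (-(2*p)) * \<bar>jet_gap f \<xi> x y\<bar> powr p)"

lemma pairdens_nonneg: "pairdens f \<xi> x y z \<ge> 0"
  unfolding pairdens_def using wt_nonneg by simp

lemma pairdens_measurable [measurable]: "pairdens f \<xi> x y \<in> borel_measurable borel"
proof -
  note [measurable] = wt_measurable
  show ?thesis unfolding pairdens_def[abs_def] by measurable
qed

lemma pairdens_integral:
  assumes "x \<in> E"
  shows "(\<integral>\<^sup>+z. ennreal (pairdens f \<xi> x y z) * indicator (vor E y) z \<partial>lborel) = 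
    ennreal (wa x y * (\<bar>(\<xi> x - \<xi> y) $ 1\<bar> powr p + \<bar>(\<xi> x - \<xi> y) $ 2\<bar> powr p) + wb x y * \<bar>jet_gap f \<xi> x y\<bar> powr p)"
proof -
  define A where "A = \<bar>(\<xi> x - \<xi> y) $ 1\<bar> powr p + \<bar>(\<xi> x - \<xi> y) $ 2\<bar> powr p"
  define B where "B = \<bar>jet_gap f \<xi> x y\<bar> powr p"
  have AB: "A \<ge> 0" "B \<ge> 0" unfolding A_def B_def by auto
  note [measurable] = wt_measurable vor_measurable[OF E(1)]
  have "(\<integral>\<^sup>+z. ennreal (pairdens f \<xi> x y z) * indicator (vor E y) z \<partial>lborel) = 
    (\<integral>\<^sup>+z. ennreal A * (ennreal (wt x z * infdist z E powr (-p)) * indicator (vor E y) z) + ennreal B * (ennreal (wt x z * infdist z E powr (-(2*p))) * indicator (vor E y) z) \<partial>lborel)"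
  proof (rule nn_integral_cong)
    fix z
    have "pairdens f \<xi> x y z = A * (wt x z * infdist z E powr (-p)) + B * (wt x z * infdist z E powr (-(2*p)))"
      unfolding pairdens_def A_def B_def by (simp add: algebra_simps)
    moreover have "wt x z * infdist z E powr (-p) \<ge> 0" "wt x z * infdist z E powr (-(2*p)) \<ge> 0" using wt_nonneg by auto
    ultimately have "ennreal (pairdens f \<xi> x y z) = ennreal A * ennreal (wt x z * infdist z E powr (-p)) + ennreal B * ennreal (wt x z * infdist z E powr (-(2*p)))"
      using AB by (simp only: ennreal_plus ennreal_mult mult_nonneg_nonneg)
    then show "ennreal (pairdens f \<xi> x y z) * indicator (vor E y) z = ennreal A * (ennreal (wt x z * infdist z E powr (-p)) * indicator (vor E y) z) + ennreal B * (ennreal (wt x z * infdist z E powr (-(2*p))) * indicator (vor E y) z)"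
      by (simp add: indicator_def)
  qed
  also have "\<dots> = ennreal A * ennreal (wa x y) + ennreal B * ennreal (wb x y)"
    unfolding wa_finite[OF assms, symmetric] by (subst nn_integral_add; (subst nn_integral_cmult)?; measurable?; simp add: nn_integral_cmult)
  also have "\<dots> = ennreal (A * wa x y + B * wb x y)"
    using AB by (subst ennreal_plus) (auto simp: wa_def wb_def ennreal_mult)
  finally show ?thesis unfolding A_def B_def by (simp add: mult.commute)
qed

lemma jet_energy_integral:
  "ennreal (jet_energy p E wa wb f \<xi>) = (\<Sum>y\<in>E. \<integral>\<^sup>+z. (\<Sum>x\<in>E. ennreal (pairdens f \<xi> x y z)) * indicator (vor E y) z \<partial>lborel)"
proof -
  note [measurable] = vor_measurable[OF E(1)]
  have "(\<Sum>y\<in>E. \<integral>\<^sup>+z. (\<Sum>x\<in>E. ennreal (pairdens f \<xi> x y z)) * indicator (vor E y) z \<partial>lborel)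
    = (\<Sum>y\<in>E. \<Sum>x\<in>E. \<integral>\<^sup>+z. ennreal (pairdens f \<xi> x y z) * indicator (vor E y) z \<partial>lborel)"
    unfolding sum_distrib_right by (intro sum.cong refl nn_integral_sum) measurable
  also have "\<dots> = (\<Sum>x\<in>E. \<Sum>y\<in>E. \<integral>\<^sup>+z. ennreal (pairdens f \<xi> x y z) * indicator (vor E y) z \<partial>lborel)" by (rule sum.swap)
  also have "\<dots> = (\<Sum>x\<in>E. \<Sum>y\<in>E. ennreal (wa x y * (\<bar>(\<xi> x - \<xi> y) $ 1\<bar> powr p + \<bar>(\<xi> x - \<xi> y) $ 2\<bar> powr p) + wb x y * \<bar>jet_gap f \<xi> x y\<bar> powr p))"
    by (intro sum.cong refl pairdens_integral)
  also have "\<dots> = ennreal (jet_energy p E wa wb f \<xi>)" unfolding jet_energy_def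
    by (subst sum_ennreal; (subst sum_ennreal)?) (auto intro!: sum_nonneg add_nonneg_nonneg simp: wa_def wb_def)
  finally show ?thesis ..
qed

lemma wh_regular:
  "continuous_on UNIV (wh f \<xi>)" "continuous_on UNIV (wh2 f \<xi> i j)" "weak_hessian (wh f \<xi>) (\<lambda>i j. wh2 f \<xi> i j)"
proof -
  define w1 where "w1 i z = (\<Sum>x\<in>E. \<Psi>1 x i z * (f x + \<xi> x \<bullet> (z - x)) + \<Psi> x z * \<xi> x $ i)" for i z
  show c: "continuous_on UNIV (wh f \<xi>)" "continuous_on UNIV (wh2 f \<xi> i j)" for i j
    unfolding wh_def[abs_def] wh2_def[abs_def] by (intro continuous_intros cont)+
  have cw: "continuous_on UNIV (w1 i)" for i unfolding w1_def[abs_def] by (intro continuous_intros cont)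
  have a: "line_deriv (\<lambda>z. f x + \<xi> x \<bullet> (z - x)) (axis i 1) (\<lambda>z. \<xi> x $ i)" for x i
  proof -
    have "line_deriv (\<lambda>z. (f x - \<xi> x \<bullet> x) + z \<bullet> \<xi> x) (axis i 1) (\<lambda>z. 0 + axis i 1 \<bullet> \<xi> x)"
      by (intro line_deriv_add line_deriv_const line_deriv_inner)
    moreover have "(\<lambda>z. (f x - \<xi> x \<bullet> x) + z \<bullet> \<xi> x) = (\<lambda>z. f x + \<xi> x \<bullet> (z - x))" by (auto simp: inner_diff_right inner_commute)
    ultimately show ?thesis by (simp add: inner_axis' )
  qed
  have d1: "line_deriv (wh f \<xi>) (axis i 1) (w1 i)" for i
    unfolding wh_def[abs_def] w1_def[abs_def] by (intro line_deriv_sum line_deriv_mult ld a)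
  have d2: "line_deriv (w1 i) (axis j 1) (wh2 f \<xi> i j)" for i j
    unfolding wh2_def[abs_def] w1_def[abs_def] by (intro line_deriv_sum line_deriv_add line_deriv_mult ld a line_deriv_const)
  show "weak_hessian (wh f \<xi>) (\<lambda>i j. wh2 f \<xi> i j)" by (rule weak_hessian_classical[OF c(1) cw c(2) d1 d2])
qed

lemma PU_deriv_sums: "(\<Sum>x\<in>E. \<Psi>1 x i z) = 0" "(\<Sum>x\<in>E. \<Psi>2 x i j z) = 0"
proof -
  have "line_deriv (\<lambda>z. \<Sum>x\<in>E. \<Psi> x z) (axis i 1) (\<lambda>z. \<Sum>x\<in>E. \<Psi>1 x i z)" by (intro line_deriv_sum ld)
  from line_deriv_local_zero[OF this, of UNIV _ 1] show a: "(\<Sum>x\<in>E. \<Psi>1 x i z) = 0" for z using sum1 by simp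
  have "line_deriv (\<lambda>z. \<Sum>x\<in>E. \<Psi>1 x i z) (axis j 1) (\<lambda>z. \<Sum>x\<in>E. \<Psi>2 x i j z)" by (intro line_deriv_sum ld)
  from line_deriv_local_zero[OF this, of UNIV z 0] show "(\<Sum>x\<in>E. \<Psi>2 x i j z) = 0" using a by simp
qed

definition "whC = 12 powr p * (6 * C0) powr (p - 1) * 4 powr p"

text \<open>The derivatives of the partition functions sum to 0, so the affine function of the
  nearest point y can be subtracted from every term. The constant collects 4 entries with 3 terms
  each, Jensen's inequality for the weights, and the p-th power of a sum.\<close>

lemma wh2_bound:
  assumes y: "y \<in> E" "z \<in> vor E y"
  shows "hnorm (\<lambda>i j. wh2 f \<xi> i j) z powr p \<le> whC * (\<Sum>x\<in>E. pairdens f \<xi> x y z)"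
proof (cases "infdist z E < \<rho>")
  case True
  then have "wh2 f \<xi> i j z = 0" for i j unfolding wh2_def using flat by (intro sum.neutral) simp
  then have "hnorm (\<lambda>i j. wh2 f \<xi> i j) z = 0" unfolding hnorm_def by simp
  then show ?thesis using p pairdens_nonneg unfolding whC_def by (simp add: sum_nonneg)
next
  case False
  define d where "d = infdist z E"
  have d: "d > 0" using False \<rho> unfolding d_def by simp
  have dy: "norm (z - y) = d" using y(2) unfolding vor_def d_def by (simp add: dist_norm)
  define e where "e x = \<bar>jet_gap f \<xi> x y\<bar>" for x
  define D1 where "D1 x = \<bar>(\<xi> x - \<xi> y) $ 1\<bar>" for x
  define D2 where "D2 x = \<bar>(\<xi> x - \<xi> y) $ 2\<bar>" for x
  define Q where "Q x = e x / d\<^sup>2 + (D1 x / d + D2 x / d)" for x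
  have nn: "e x \<ge> 0" "D1 x \<ge> 0" "D2 x \<ge> 0" for x unfolding e_def D1_def D2_def by auto
  have comp: "\<bar>(\<xi> x - \<xi> y) $ i\<bar> \<le> D1 x + D2 x" for x i using exhaust_2[of i] by (auto simp: D1_def D2_def)
  have val: "\<bar>(f x + \<xi> x \<bullet> (z - x)) - (f y + \<xi> y \<bullet> (z - y))\<bar> \<le> e x + d * (D1 x + D2 x)" for x
  proof -
    have eq: "(f x + \<xi> x \<bullet> (z - x)) - (f y + \<xi> y \<bullet> (z - y)) = jet_gap f \<xi> x y + (\<xi> x - \<xi> y) \<bullet> (z - y)"
      unfolding jet_gap_def by (simp add: algebra_simps inner_diff_left inner_diff_right)
    have "norm (\<xi> x - \<xi> y) \<le> D1 x + D2 x" using norm_le_l1_cart[of "\<xi> x - \<xi> y"] by (simp add: sum_2 D1_def D2_def)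
    then have "\<bar>(\<xi> x - \<xi> y) \<bullet> (z - y)\<bar> \<le> (D1 x + D2 x) * d" 
      using Cauchy_Schwarz_ineq2[of "\<xi> x - \<xi> y" "z - y", unfolded dy] d by (meson mult_right_mono less_imp_le order_trans)
    then show ?thesis unfolding eq e_def by (simp only: mult.commute[of d])
  qed
  have ent: "\<bar>wh2 f \<xi> i j z\<bar> \<le> 3 * (\<Sum>x\<in>E. wt x z * Q x)" for i j
  proof -
    \<comment> \<open>The subtracted sums are all 0; they insert the jet at y.\<close>
    have "wh2 f \<xi> i j z = (\<Sum>x\<in>E. (\<Psi>2 x i j z * (f x + \<xi> x \<bullet> (z - x)) + \<Psi>1 x i z * \<xi> x $ j) + \<Psi>1 x j z * \<xi> x $ i)
        - ((\<Sum>x\<in>E. \<Psi>2 x i j z) * (f y + \<xi> y \<bullet> (z - y)) + (\<Sum>x\<in>E. \<Psi>1 x i z) * \<xi> y $ j + (\<Sum>x\<in>E. \<Psi>1 x j z) * \<xi> y $ i)"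
      unfolding PU_deriv_sums wh2_def by simp
    also have "\<dots> = (\<Sum>x\<in>E. \<Psi>2 x i j z * ((f x + \<xi> x \<bullet> (z - x)) - (f y + \<xi> y \<bullet> (z - y))) + \<Psi>1 x i z * (\<xi> x - \<xi> y) $ j + \<Psi>1 x j z * (\<xi> x - \<xi> y) $ i)"
      unfolding sum_distrib_right sum.distrib[symmetric] sum_subtractf[symmetric] by (intro sum.cong) (auto simp: algebra_simps)
    finally have w: "wh2 f \<xi> i j z = (\<Sum>x\<in>E. \<Psi>2 x i j z * ((f x + \<xi> x \<bullet> (z - x)) - (f y + \<xi> y \<bullet> (z - y))) + \<Psi>1 x i z * (\<xi> x - \<xi> y) $ j + \<Psi>1 x j z * (\<xi> x - \<xi> y) $ i)" .
    have "\<bar>\<Psi>2 x i j z * ((f x + \<xi> x \<bullet> (z - x)) - (f y + \<xi> y \<bullet> (z - y))) + \<Psi>1 x i z * (\<xi> x - \<xi> y) $ j + \<Psi>1 x j z * (\<xi> x - \<xi> y) $ i\<bar> \<le> 3 * (wt x z * Q x)" for x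
    proof -
      have w1: "d * \<bar>\<Psi>1 x i z\<bar> \<le> wt x z" for i
      proof -
        have "\<bar>\<Psi>1 x i z\<bar> \<le> (\<Sum>i\<in>UNIV. \<bar>\<Psi>1 x i z\<bar>)" by (rule member_le_sum[where f="\<lambda>i. \<bar>\<Psi>1 x i z\<bar>"]) auto
        then have "d * \<bar>\<Psi>1 x i z\<bar> \<le> d * (\<Sum>i\<in>UNIV. \<bar>\<Psi>1 x i z\<bar>)" using d by (intro mult_left_mono) auto
        moreover have "0 \<le> d\<^sup>2 * (\<Sum>i\<in>UNIV. \<Sum>j\<in>UNIV. \<bar>\<Psi>2 x i j z\<bar>)" by (intro mult_nonneg_nonneg sum_nonneg) auto
        ultimately show ?thesis unfolding wt_def d_def[symmetric] by linarith
      qed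
      have w2: "d\<^sup>2 * \<bar>\<Psi>2 x i j z\<bar> \<le> wt x z"
      proof -
        have "\<bar>\<Psi>2 x i j z\<bar> \<le> (\<Sum>j\<in>UNIV. \<bar>\<Psi>2 x i j z\<bar>)" by (rule member_le_sum[where f="\<lambda>j. \<bar>\<Psi>2 x i j z\<bar>"]) auto
        also have "\<dots> \<le> (\<Sum>i\<in>UNIV. \<Sum>j\<in>UNIV. \<bar>\<Psi>2 x i j z\<bar>)" by (rule member_le_sum[where f="\<lambda>i. \<Sum>j\<in>UNIV. \<bar>\<Psi>2 x i j z\<bar>"]) (auto intro: sum_nonneg)
        finally have "d\<^sup>2 * \<bar>\<Psi>2 x i j z\<bar> \<le> d\<^sup>2 * (\<Sum>i\<in>UNIV. \<Sum>j\<in>UNIV. \<bar>\<Psi>2 x i j z\<bar>)" by (intro mult_left_mono) auto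
        moreover have "0 \<le> d * (\<Sum>i\<in>UNIV. \<bar>\<Psi>1 x i z\<bar>)" using d by (intro mult_nonneg_nonneg sum_nonneg) auto
        ultimately show ?thesis unfolding wt_def d_def[symmetric] by linarith
      qed
      have q: "(D1 x + D2 x) / d \<le> Q x" "(e x + d * (D1 x + D2 x)) / d\<^sup>2 = Q x"
        using d nn unfolding Q_def by (auto simp: field_simps power2_eq_square)
      have p1: "\<bar>\<Psi>1 x k z * (\<xi> x - \<xi> y) $ l\<bar> \<le> wt x z * Q x" for k l
      proof -
        have "\<bar>\<Psi>1 x k z * (\<xi> x - \<xi> y) $ l\<bar> \<le> \<bar>\<Psi>1 x k z\<bar> * (D1 x + D2 x)" unfolding abs_mult by (intro mult_left_mono comp) auto
        also have "\<dots> = (d * \<bar>\<Psi>1 x k z\<bar>) * ((D1 x + D2 x) / d)" using d by simp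
        also have "\<dots> \<le> wt x z * Q x" using w1 q(1) nn d wt_nonneg by (intro mult_mono) auto
        finally show ?thesis .
      qed
      have p2: "\<bar>\<Psi>2 x i j z * ((f x + \<xi> x \<bullet> (z - x)) - (f y + \<xi> y \<bullet> (z - y)))\<bar> \<le> wt x z * Q x"
      proof -
        have "\<bar>\<Psi>2 x i j z * ((f x + \<xi> x \<bullet> (z - x)) - (f y + \<xi> y \<bullet> (z - y)))\<bar> \<le> \<bar>\<Psi>2 x i j z\<bar> * (e x + d * (D1 x + D2 x))"
          unfolding abs_mult by (intro mult_left_mono val) auto
        also have "\<dots> = (d\<^sup>2 * \<bar>\<Psi>2 x i j z\<bar>) * ((e x + d * (D1 x + D2 x)) / d\<^sup>2)" using d by simp
        also have "\<dots> \<le> wt x z * Q x" unfolding q(2) using w2 nn d unfolding Q_def by (intro mult_right_mono) auto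
        finally show ?thesis .
      qed
      show ?thesis using p2 p1[of i j] p1[of j i] by linarith
    qed
    then have "\<bar>wh2 f \<xi> i j z\<bar> \<le> (\<Sum>x\<in>E. 3 * (wt x z * Q x))" unfolding w by (intro order_trans[OF sum_abs] sum_mono)
    then show ?thesis by (simp add: sum_distrib_left)
  qed
  have Q0: "Q x \<ge> 0" for x unfolding Q_def using nn d by simp
  have S0: "(\<Sum>x\<in>E. wt x z * Q x) \<ge> 0" using wt_nonneg Q0 by (intro sum_nonneg) auto
  have "hnorm (\<lambda>i j. wh2 f \<xi> i j) z \<le> (\<Sum>i\<in>(UNIV::2 set). \<Sum>j\<in>(UNIV::2 set). 3 * (\<Sum>x\<in>E. wt x z * Q x))"
    by (rule order_trans[OF hnorm_le_sum]) (intro sum_mono ent)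
  then have "hnorm (\<lambda>i j. wh2 f \<xi> i j) z \<le> 12 * (\<Sum>x\<in>E. wt x z * Q x)" by simp
  then have "hnorm (\<lambda>i j. wh2 f \<xi> i j) z powr p \<le> (12 * (\<Sum>x\<in>E. wt x z * Q x)) powr p"
    using hnorm_nonneg p by (intro powr_mono2) auto
  also have "\<dots> = 12 powr p * (\<Sum>x\<in>E. wt x z * Q x) powr p" using S0 by (simp add: powr_mult)
  also have "\<dots> \<le> 12 powr p * ((6 * C0) powr (p - 1) * (\<Sum>x\<in>E. wt x z * Q x powr p))"
    using p wt_nonneg wt_sum Q0 E(1) by (intro mult_left_mono weighted_power_mean) auto
  also have "(\<Sum>x\<in>E. wt x z * Q x powr p) \<le> (\<Sum>x\<in>E. 4 powr p * pairdens f \<xi> x y z)"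
  proof (rule sum_mono)
    fix x
    have "Q x powr p \<le> 2 powr p * ((e x / d\<^sup>2) powr p + (D1 x / d + D2 x / d) powr p)"
      unfolding Q_def using nn d p by (intro powr_sum_le) auto
    also have "\<dots> \<le> 2 powr p * (2 powr p * (e x / d\<^sup>2) powr p + 2 powr p * ((D1 x / d) powr p + (D2 x / d) powr p))"
      using nn d p by (intro mult_left_mono add_mono powr_sum_le) (auto simp: mult_le_cancel_right1 ge_one_powr_ge_zero)
    also have "\<dots> = 4 powr p * ((e x / d\<^sup>2) powr p + ((D1 x / d) powr p + (D2 x / d) powr p))"
    proof -
      have "(4::real) powr p = 2 powr p * 2 powr p" by (subst powr_mult[symmetric]) auto
      then show ?thesis by (simp add: algebra_simps)
    qed
    also have "(e x / d\<^sup>2) powr p = d powr (-(2*p)) * e x powr p"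
    proof -
      have "d\<^sup>2 = d powr 2" using d by simp
      then have "(d\<^sup>2) powr p = d powr (2*p)" by (simp only: powr_powr)
      then show ?thesis using nn d by (simp add: powr_divide powr_minus_divide)
    qed
    also have "(D1 x / d) powr p = d powr (-p) * D1 x powr p" using nn d by (simp add: powr_divide powr_minus_divide)
    also have "(D2 x / d) powr p = d powr (-p) * D2 x powr p" using nn d by (simp add: powr_divide powr_minus_divide)
    finally have "wt x z * Q x powr p \<le> wt x z * (4 powr p * (d powr (-(2*p)) * e x powr p + (d powr (-p) * D1 x powr p + d powr (-p) * D2 x powr p)))"
      by (rule mult_left_mono) (rule wt_nonneg)
    then show "wt x z * Q x powr p \<le> 4 powr p * pairdens f \<xi> x y z"
      unfolding pairdens_def d_def[symmetric] e_def D1_def D2_def by (simp add: algebra_simps)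
  qed
  finally show ?thesis unfolding whC_def by (simp add: sum_distrib_left[symmetric] mult.assoc mult_left_mono)
qed

lemma wh_energy:
  "(\<integral>\<^sup>+z. ennreal (hnorm (\<lambda>i j. wh2 f \<xi> i j) z powr p) \<partial>lborel) \<le> ennreal (whC * jet_energy p E wa wb f \<xi>)"
proof -
  have wc: "whC \<ge> 0" unfolding whC_def by simp
  note [measurable] = borel_measurable_continuous_onI[OF wh_regular(2)] vor_measurable[OF E(1)]
  have hm [measurable]: "hnorm (\<lambda>i j. wh2 f \<xi> i j) \<in> borel_measurable borel" by (rule hnorm_measurable) measurable
  have "(\<integral>\<^sup>+z. ennreal (hnorm (\<lambda>i j. wh2 f \<xi> i j) z powr p) \<partial>lborel) = (\<Sum>y\<in>E. \<integral>\<^sup>+z. ennreal (hnorm (\<lambda>i j. wh2 f \<xi> i j) z powr p) * indicator (vor E y) z \<partial>lborel)"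
    by (rule nn_integral_vor[OF E]) measurable
  also have "\<dots> \<le> (\<Sum>y\<in>E. \<integral>\<^sup>+z. ennreal whC * ((\<Sum>x\<in>E. ennreal (pairdens f \<xi> x y z)) * indicator (vor E y) z) \<partial>lborel)"
  proof (intro sum_mono nn_integral_mono)
    fix y z assume y: "y \<in> E"
    show "ennreal (hnorm (\<lambda>i j. wh2 f \<xi> i j) z powr p) * indicator (vor E y) z \<le> ennreal whC * ((\<Sum>x\<in>E. ennreal (pairdens f \<xi> x y z)) * indicator (vor E y) z)"
    proof (cases "z \<in> vor E y")
      case True
      have "ennreal (hnorm (\<lambda>i j. wh2 f \<xi> i j) z powr p) \<le> ennreal (whC * (\<Sum>x\<in>E. pairdens f \<xi> x y z))"
        by (intro ennreal_leI wh2_bound y True)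
      also have "\<dots> = ennreal whC * (\<Sum>x\<in>E. ennreal (pairdens f \<xi> x y z))"
        using wc pairdens_nonneg by (subst ennreal_mult) (auto intro: sum_nonneg)
      finally show ?thesis using True by simp
    qed simp
  qed
  also have "\<dots> = (\<Sum>y\<in>E. ennreal whC * (\<integral>\<^sup>+z. (\<Sum>x\<in>E. ennreal (pairdens f \<xi> x y z)) * indicator (vor E y) z \<partial>lborel))"
    by (intro sum.cong refl nn_integral_cmult) measurable
  also have "\<dots> = ennreal whC * ennreal (jet_energy p E wa wb f \<xi>)" unfolding jet_energy_integral by (simp add: sum_distrib_left)
  also have "\<dots> = ennreal (whC * jet_energy p E wa wb f \<xi>)" using wc
    by (intro ennreal_mult[symmetric]) (auto simp: jet_energy_def wa_def wb_def intro!: sum_nonneg)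
  finally show ?thesis .
qed

text \<open>A density dominating the jet differences at almost every z can replace them under the
  integral, where the weights sum to at most \<open>6 * C0\<close>. The 18 is 6 * 3: two gradient
  coordinates and one gap.\<close>

lemma jet_energy_bound:
  assumes \<nu>: "\<nu> \<in> borel_measurable borel" "\<And>z. \<nu> z \<ge> 0" "(\<integral>\<^sup>+z. ennreal (\<nu> z) \<partial>lborel) \<le> ennreal B" "B \<ge> 0"
    and ae: "AE z in lborel. jets_dominated p E f \<xi> z (\<nu> z)"
  shows "jet_energy p E wa wb f \<xi> \<le> 18 * C0 * B"
proof -
  note [measurable] = vor_measurable[OF E(1)] \<nu>(1)
  have "ennreal (jet_energy p E wa wb f \<xi>) = (\<Sum>y\<in>E. \<integral>\<^sup>+z. (\<Sum>x\<in>E. ennreal (pairdens f \<xi> x y z)) * indicator (vor E y) z \<partial>lborel)"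
    by (rule jet_energy_integral)
  also have "\<dots> \<le> (\<Sum>y\<in>E. \<integral>\<^sup>+z. ennreal (18 * C0) * (ennreal (\<nu> z) * indicator (vor E y) z) \<partial>lborel)"
  proof (intro sum_mono nn_integral_mono_AE)
    fix y assume y: "y \<in> E"
    show "AE z in lborel. (\<Sum>x\<in>E. ennreal (pairdens f \<xi> x y z)) * indicator (vor E y) z \<le> ennreal (18 * C0) * (ennreal (\<nu> z) * indicator (vor E y) z)"
      using ae
    proof eventually_elim
      case (elim z)
      show ?case
      proof (cases "z \<in> vor E y")
        case True
        define d where "d = infdist z E"
        have dy: "dist z y = d" using True unfolding vor_def d_def by simp
        have pd: "pairdens f \<xi> x y z \<le> wt x z * (3 * \<nu> z)" if x: "x \<in> E" for x
        proof (cases "x = y \<or> wt x z = 0")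
          \<comment> \<open>The diagonal pair has vanishing differences, and points outside the
            range of z have weight 0.\<close>
          case True
          then show ?thesis using \<nu>(2) wt_nonneg p by (auto simp: pairdens_def jet_gap_def)
        next
          case False
          then have dx: "dist z x \<le> 8 * d" and d: "d > 0" using wt_support[OF x, of z] \<rho> unfolding d_def by auto
          have b: "norm (\<xi> x - \<xi> y) powr p \<le> d powr p * \<nu> z" "\<bar>jet_gap f \<xi> x y\<bar> powr p \<le> d powr (2*p) * \<nu> z"
            using elim x y False dx dy unfolding d_def by auto
          have c: "\<bar>(\<xi> x - \<xi> y) $ i\<bar> powr p \<le> d powr p * \<nu> z" for i
            by (rule order_trans[OF powr_mono2 b(1)]) (use p component_le_norm_cart[of "\<xi> x - \<xi> y" i] in auto)
          have i: "d powr (-p) * (d powr p * \<nu> z) = \<nu> z" "d powr (-(2*p)) * (d powr (2*p) * \<nu> z) = \<nu> z"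
            using d by (simp_all add: powr_minus)
          have "d powr (-p) * (\<bar>(\<xi> x - \<xi> y) $ 1\<bar> powr p + \<bar>(\<xi> x - \<xi> y) $ 2\<bar> powr p) + d powr (-(2*p)) * \<bar>jet_gap f \<xi> x y\<bar> powr p
            \<le> d powr (-p) * (d powr p * \<nu> z + d powr p * \<nu> z) + d powr (-(2*p)) * (d powr (2*p) * \<nu> z)"
            by (intro add_mono mult_left_mono b c) auto
          also have "\<dots> = 3 * \<nu> z" unfolding distrib_left i by simp
          finally show ?thesis unfolding pairdens_def d_def[symmetric] by (rule mult_left_mono) (rule wt_nonneg)
        qed
        have "(\<Sum>x\<in>E. ennreal (pairdens f \<xi> x y z)) = ennreal (\<Sum>x\<in>E. pairdens f \<xi> x y z)" using pairdens_nonneg by (intro sum_ennreal)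
        also have "\<dots> \<le> ennreal (18 * C0 * \<nu> z)"
        proof (rule ennreal_leI)
          have "(\<Sum>x\<in>E. pairdens f \<xi> x y z) \<le> (\<Sum>x\<in>E. wt x z * (3 * \<nu> z))" by (intro sum_mono pd)
          also have "\<dots> = (\<Sum>x\<in>E. wt x z) * (3 * \<nu> z)" by (simp add: sum_distrib_right)
          also have "\<dots> \<le> (6 * C0) * (3 * \<nu> z)" using \<nu>(2) by (intro mult_right_mono wt_sum) auto
          finally show "(\<Sum>x\<in>E. pairdens f \<xi> x y z) \<le> 18 * C0 * \<nu> z" by simp
        qed
        also have "\<dots> = ennreal (18 * C0) * ennreal (\<nu> z)" using C0 \<nu>(2) by (intro ennreal_mult) auto
        finally show ?thesis using True by simp
      qed simp
    qed
  qed
  also have "\<dots> = (\<Sum>y\<in>E. ennreal (18 * C0) * (\<integral>\<^sup>+z. ennreal (\<nu> z) * indicator (vor E y) z \<partial>lborel))"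
    by (intro sum.cong refl nn_integral_cmult) measurable
  also have "\<dots> = ennreal (18 * C0) * (\<integral>\<^sup>+z. ennreal (\<nu> z) \<partial>lborel)"
    unfolding sum_distrib_left[symmetric] by (subst nn_integral_vor[OF E, of "\<lambda>z. ennreal (\<nu> z)"]) auto
  also have "\<dots> \<le> ennreal (18 * C0) * ennreal B" by (intro mult_left_mono \<nu>(3)) auto
  also have "\<dots> = ennreal (18 * C0 * B)" using C0 \<nu>(4) by (intro ennreal_mult[symmetric]) auto
  finally show ?thesis using C0 \<nu>(4) by (subst (asm) ennreal_le_iff) auto
qed

lemma wh_near:
  assumes "x \<in> E"
  shows "wh f \<xi> x = f x" "(wh f \<xi> has_derivative (\<lambda>h. \<xi> x \<bullet> h)) (at x)"
proof -
  have e: "wh f \<xi> z = f x + \<xi> x \<bullet> (z - x)" if "z \<in> ball x \<rho>" for z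
  proof -
    have "wh f \<xi> z = (\<Sum>u\<in>E. if u = x then f x + \<xi> x \<bullet> (z - x) else 0)" 
      unfolding wh_def using near[OF _ assms that] by (intro sum.cong) auto
    then show ?thesis using assms E(1) by simp
  qed
  show "wh f \<xi> x = f x" using e[of x] \<rho> by simp
  have "((\<lambda>z. f x + \<xi> x \<bullet> (z - x)) has_derivative (\<lambda>h. \<xi> x \<bullet> h)) (at x)" by (auto intro!: derivative_eq_intros)
  then show "(wh f \<xi> has_derivative (\<lambda>h. \<xi> x \<bullet> h)) (at x)"
    by (rule has_derivative_transform_within_open[of _ _ _ _ "ball x \<rho>"]) (use e \<rho> in auto)
qed

lemma wh_sob: "sob p (wh f \<xi>) (\<lambda>i j. wh2 f \<xi> i j)"
proof -
  have "Lp_hessian p (\<lambda>i j. wh2 f \<xi> i j)"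
  proof (rule Lp_hessian_of_hnorm)
    show "wh2 f \<xi> i j \<in> borel_measurable borel" for i j by (intro borel_measurable_continuous_onI wh_regular)
    show "(\<integral>\<^sup>+z. ennreal (hnorm (\<lambda>i j. wh2 f \<xi> i j) z powr p) \<partial>lborel) < \<infinity>" 
      using wh_energy by (rule le_less_trans) simp
  qed (use p in simp)
  then show ?thesis unfolding sob_def using wh_regular by auto
qed

end

definition tot :: "real \<Rightarrow> (2 \<Rightarrow> 2 \<Rightarrow> real^2 \<Rightarrow> real) \<Rightarrow> real" where
  "tot p g = (\<integral>z. hnorm g z powr p \<partial>lborel)"

lemma tot_nonneg: "tot p g \<ge> 0" unfolding tot_def by (intro integral_nonneg_AE) simp

lemma nn_tot: 
  assumes "sob p F g" "p > 0" shows "(\<integral>\<^sup>+z. ennreal (hnorm g z powr p) \<partial>lborel) = ennreal (tot p g)"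
  unfolding tot_def using sob_integrable[OF assms] by (intro nn_integral_eq_integral) auto

lemma tot_le_of_nn: "sob p F g \<Longrightarrow> p > 0 \<Longrightarrow> B \<ge> 0 \<Longrightarrow> (\<integral>\<^sup>+z. ennreal (hnorm g z powr p) \<partial>lborel) \<le> ennreal B \<Longrightarrow> tot p g \<le> B"
  using nn_tot[of p F g] by simp

definition wext :: "(real^2 \<Rightarrow> real^2 \<Rightarrow> real) \<Rightarrow> (real^2) set \<Rightarrow> (real^2 \<Rightarrow> real) \<Rightarrow> (real^2 \<Rightarrow> real^2) \<Rightarrow> real^2 \<Rightarrow> real" where
  "wext \<Psi> E f \<xi> z = (\<Sum>x\<in>E. \<Psi> x z * (f x + \<xi> x \<bullet> (z - x)))"

text \<open>The interface to the extension, with the partition of unity hidden. The last clause is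
  the only way in which energies are bounded from above later.\<close>

definition whitney_sys :: "real \<Rightarrow> real \<Rightarrow> (real^2) set \<Rightarrow> (real^2 \<Rightarrow> real^2 \<Rightarrow> real) \<Rightarrow> (real^2 \<Rightarrow> real^2 \<Rightarrow> real) \<Rightarrow> (real^2 \<Rightarrow> real^2 \<Rightarrow> real) \<Rightarrow> bool" where
  "whitney_sys p C E \<Psi> \<alpha> \<beta> \<longleftrightarrow> (\<forall>x y. \<alpha> x y \<ge> 0 \<and> \<beta> x y \<ge> 0) \<and>
      (\<forall>f \<xi>. \<exists>g. sob p (wext \<Psi> E f \<xi>) g \<and> tot p g \<le> C * jet_energy p E \<alpha> \<beta> f \<xi>) \<and>
      (\<forall>f \<xi>. \<forall>x\<in>E. wext \<Psi> E f \<xi> x = f x \<and> grad (wext \<Psi> E f \<xi>) x = \<xi> x) \<and>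
      (\<forall>f \<xi> \<nu> B. \<nu> \<in> borel_measurable borel \<longrightarrow> (\<forall>z. \<nu> z \<ge> 0) \<longrightarrow> (\<integral>\<^sup>+z. ennreal (\<nu> z) \<partial>lborel) \<le> ennreal B \<longrightarrow> B \<ge> 0 \<longrightarrow>
        (AE z in lborel. jets_dominated p E f \<xi> z (\<nu> z)) \<longrightarrow>
        jet_energy p E \<alpha> \<beta> f \<xi> \<le> C * B)"

lemma jet_energy_nonneg: "\<forall>x y. \<alpha> x y \<ge> 0 \<and> \<beta> x y \<ge> 0 \<Longrightarrow> jet_energy p E \<alpha> \<beta> f \<xi> \<ge> 0"
  unfolding jet_energy_def by (intro sum_nonneg add_nonneg_nonneg mult_nonneg_nonneg) auto

lemma whitney_sysD:
  assumes "whitney_sys p C E \<Psi> \<alpha> \<beta>"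
  shows "\<And>x y. \<alpha> x y \<ge> 0" "\<And>x y. \<beta> x y \<ge> 0" "\<And>f \<xi>. \<exists>g. sob p (wext \<Psi> E f \<xi>) g \<and> tot p g \<le> C * jet_energy p E \<alpha> \<beta> f \<xi>"
    "\<And>f \<xi> x. x \<in> E \<Longrightarrow> wext \<Psi> E f \<xi> x = f x" "\<And>f \<xi> x. x \<in> E \<Longrightarrow> grad (wext \<Psi> E f \<xi>) x = \<xi> x"
  using assms unfolding whitney_sys_def by simp_all

lemma whitney_sys_energy:
  assumes "whitney_sys p C E \<Psi> \<alpha> \<beta>" "\<nu> \<in> borel_measurable borel" "\<And>z. \<nu> z \<ge> 0" "(\<integral>\<^sup>+z. ennreal (\<nu> z) \<partial>lborel) \<le> ennreal B" "B \<ge> 0"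
    "AE z in lborel. jets_dominated p E f \<xi> z (\<nu> z)"
  shows "jet_energy p E \<alpha> \<beta> f \<xi> \<le> C * B"
  using assms unfolding whitney_sys_def by simp

theorem whitney_extension:
  assumes p: "p > 2"
  shows "\<exists>C>0. \<forall>E. finite E \<longrightarrow> E \<noteq> {} \<longrightarrow> (\<exists>\<Psi> \<alpha> \<beta>. whitney_sys p C E \<Psi> \<alpha> \<beta>)"
proof -
  obtain C0 where C0: "C0 > 0" and pu: "\<forall>E :: (real^2) set. finite E \<longrightarrow> E \<noteq> {} \<longrightarrow> (\<exists>\<Psi> \<Psi>1 \<Psi>2 \<rho>. pu_sys E C0 \<Psi> \<Psi>1 \<Psi>2 \<rho>)"
    using partition_of_unity by (elim exE conjE) (rule that)
  obtain Ct where Ct: "\<And>(x::real^2) r. r > 0 \<Longrightarrow> (\<integral>\<^sup>+z. ennreal (max r (dist z x) powr (-p)) \<partial>lborel) \<le> ennreal (Ct * r powr (2 - p))"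
    by (rule tail_integral[OF p]) (erule that)
  define C where "C = max (whC p C0) (18 * C0)"
  have C: "C > 0" "whC p C0 \<le> C" "18 * C0 \<le> C" using C0 unfolding C_def by auto
  show ?thesis
  proof (intro exI[of _ C] conjI allI impI)
    show "C > 0" by (rule C(1))
  next
    fix E :: "(real^2) set" assume E: "finite E" "E \<noteq> {}"
    obtain \<Psi> \<Psi>1 \<Psi>2 \<rho> where a: "pu_sys E C0 \<Psi> \<Psi>1 \<Psi>2 \<rho>"
      using pu[rule_format, OF E] by (elim exE) (rule that)
    note r0 = a
    note \<rho> = conjunct1[OF r0, rule_format] and r1 = conjunct2[OF r0]
    note cA = conjunct1[OF r1, rule_format] and r2 = conjunct2[OF r1]
    note cB = conjunct1[OF r2, rule_format] and r3 = conjunct2[OF r2]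
    note cC = conjunct1[OF r3, rule_format] and r4 = conjunct2[OF r3]
    note lA = conjunct1[OF r4, rule_format] and r5 = conjunct2[OF r4]
    note lB = conjunct1[OF r5, rule_format] and r6 = conjunct2[OF r5]
    note s = conjunct1[OF r6, rule_format] and r7 = conjunct2[OF r6]
    note n = conjunct1[OF r7, rule_format] and r8 = conjunct2[OF r7]
    note fl = conjunct1[OF r8, rule_format] and r9 = conjunct2[OF r8]
    note bA = conjunct1[OF r9, rule_format] and r10 = conjunct2[OF r9]
    note bB = conjunct1[OF r10, rule_format] and r11 = conjunct2[OF r10]
    note su = r11[rule_format]
    note ctx = p E C0 \<rho> Ct cA cB cC lA lB s n fl bA bB su
    let ?a = "wa p E \<Psi>1 \<Psi>2" and ?b = "wb p E \<Psi>1 \<Psi>2"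
    have je: "jet_energy p E ?a ?b f \<xi> \<ge> 0" for f \<xi>
      unfolding jet_energy_def using wa_nonneg[OF ctx] by (intro sum_nonneg add_nonneg_nonneg mult_nonneg_nonneg) auto
    have W: "wext \<Psi> E f \<xi> = wh E \<Psi> f \<xi>" for f \<xi> unfolding wext_def[abs_def] by (rule wh_eq[OF ctx])
    have "whitney_sys p C E \<Psi> ?a ?b" unfolding whitney_sys_def
    proof (intro conjI allI ballI impI)
      fix x y show "?a x y \<ge> 0" "?b x y \<ge> 0" using wa_nonneg[OF ctx] by simp_all
    next
      fix f \<xi>
      have S: "sob p (wh E \<Psi> f \<xi>) (wh2 E \<Psi> \<Psi>1 \<Psi>2 f \<xi>)" by (rule wh_sob[OF ctx])
      have "tot p (wh2 E \<Psi> \<Psi>1 \<Psi>2 f \<xi>) \<le> C * jet_energy p E ?a ?b f \<xi>"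
        by (rule tot_le_of_nn[OF S _ _ order_trans[OF wh_energy[OF ctx] ennreal_leI[OF mult_right_mono[OF C(2) je]]]]) (use p C(1) je in auto)
      then show "\<exists>g. sob p (wext \<Psi> E f \<xi>) g \<and> tot p g \<le> C * jet_energy p E ?a ?b f \<xi>" using S unfolding W by (intro exI conjI)
    next
      fix f \<xi> x assume x: "x \<in> E"
      show "wext \<Psi> E f \<xi> x = f x" unfolding W by (rule wh_near(1)[OF ctx x])
      show "grad (wext \<Psi> E f \<xi>) x = \<xi> x" unfolding W by (rule grad_unique[OF wh_near(2)[OF ctx x]])
    next
      fix f \<xi> \<nu> B assume n: "\<nu> \<in> borel_measurable borel" "\<forall>z. (\<nu> z::real) \<ge> 0" "(\<integral>\<^sup>+z. ennreal (\<nu> z) \<partial>lborel) \<le> ennreal B" "(B::real) \<ge> 0"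
        and ae: "AE z in lborel. jets_dominated p E f \<xi> z (\<nu> z)"
      have "jet_energy p E ?a ?b f \<xi> \<le> 18 * C0 * B"
        by (rule jet_energy_bound[OF ctx n(1) spec[OF n(2)] n(3,4) ae])
      also have "\<dots> \<le> C * B" using C(3) n(4) by (rule mult_right_mono)
      finally show "jet_energy p E ?a ?b f \<xi> \<le> C * B" .
    qed
    then show "\<exists>\<Psi> \<alpha> \<beta>. whitney_sys p C E \<Psi> \<alpha> \<beta>" by (intro exI)
  qed
qed

section \<open>Linear choice of gradients\<close>

text \<open>The functional is extended by one coordinate at a time, as in the usual proof; on a
  finite set ordinary induction suffices.\<close>

lemma hahn_banach_finite:
  fixes s :: "('a \<Rightarrow> real) \<Rightarrow> real"
  assumes sub: "\<And>f g. s (\<lambda>x. f x + g x) \<le> s f + s g" and hom: "\<And>c f. c > 0 \<Longrightarrow> s (\<lambda>x. c * f x) = c * s f" and s0: "s (\<lambda>x. 0) = 0"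
    and E: "finite E"
  shows "\<exists>a. \<forall>f. (\<forall>x. x \<notin> E \<longrightarrow> f x = 0) \<longrightarrow> (\<Sum>x\<in>E. a x * f x) \<le> s f"
  using E
proof induction
  case empty
  have "f = (\<lambda>x. 0)" if "\<forall>x. f x = 0" for f :: "'a \<Rightarrow> real" using that by auto
  then show ?case using s0 by (metis empty_iff order_refl sum.empty)
next
  case (insert e E)
  then obtain a where a: "\<And>f. (\<forall>x. x \<notin> E \<longrightarrow> f x = 0) \<Longrightarrow> (\<Sum>x\<in>E. a x * f x) \<le> s f" by blast
  define V where "V = {f :: 'a \<Rightarrow> real. \<forall>x. x \<notin> E \<longrightarrow> f x = 0}"
  define \<delta> where "\<delta> x = (if x = e then 1 else (0::real))" for x
  define l where "l f = (\<Sum>x\<in>E. a x * f x)" for f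
  have lin: "l (\<lambda>x. f x + g x) = l f + l g" "l (\<lambda>x. c * f x) = c * l f" for f g c
    unfolding l_def by (auto simp: algebra_simps sum.distrib sum_distrib_left)
  have key: "l f - s (\<lambda>x. f x - \<delta> x) \<le> s (\<lambda>x. g x + \<delta> x) - l g" if "f \<in> V" "g \<in> V" for f g
  proof -
    have "l f + l g \<le> s (\<lambda>x. f x + g x)" unfolding lin(1)[symmetric] using a[of "\<lambda>x. f x + g x"] that by (simp add: l_def V_def)
    also have "(\<lambda>x. f x + g x) = (\<lambda>x. (f x - \<delta> x) + (g x + \<delta> x))" by auto
    also have "s \<dots> \<le> s (\<lambda>x. f x - \<delta> x) + s (\<lambda>x. g x + \<delta> x)" by (rule sub)
    finally show ?thesis by simp
  qed
  \<comment> \<open>The largest value compatible with the constraints from above; by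
    \<open>key\<close> it also meets those from below.\<close>
  define t where "t = (INF g\<in>V. s (\<lambda>x. g x + \<delta> x) - l g)"
  have V0: "(\<lambda>x. 0) \<in> V" by (simp add: V_def)
  have bdd: "bdd_below ((\<lambda>g. s (\<lambda>x. g x + \<delta> x) - l g) ` V)" using key[OF V0] by (intro bdd_belowI2) auto
  have up: "l g + t \<le> s (\<lambda>x. g x + \<delta> x)" if "g \<in> V" for g
    using cINF_lower[OF bdd that] unfolding t_def by simp
  have lo: "l f - t \<le> s (\<lambda>x. f x - \<delta> x)" if "f \<in> V" for f
  proof -
    have "l f - s (\<lambda>x. f x - \<delta> x) \<le> t" unfolding t_def using V0 key[OF that] by (intro cINF_greatest) auto
    then show ?thesis by simp
  qed
  show ?case
  proof (intro exI[of _ "a(e := t)"] allI impI)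
    fix f :: "'a \<Rightarrow> real" assume f: "\<forall>x. x \<notin> insert e E \<longrightarrow> f x = 0"
    define g where "g = f(e := 0)"
    define c where "c = f e"
    have gV: "g \<in> V" and gcV: "(\<lambda>x. d * g x) \<in> V" for d using f by (auto simp: g_def V_def)
    have "(\<Sum>x\<in>E. (a(e := t)) x * f x) = l g" unfolding l_def g_def using insert(2) by (intro sum.cong) auto
    then have L: "(\<Sum>x\<in>insert e E. (a(e := t)) x * f x) = l g + t * c" using insert(1,2) by (simp add: c_def)
    have fe: "f = (\<lambda>x. g x + c * \<delta> x)" by (auto simp: g_def c_def \<delta>_def)
    consider "c = 0" | "c > 0" | "c < 0" by linarith
    then show "(\<Sum>x\<in>insert e E. (a(e := t)) x * f x) \<le> s f"
    proof cases
      case 1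
      then have "f = g" using fe by auto
      moreover have "l g \<le> s g" using a[of g] gV by (simp add: l_def V_def)
      ultimately show ?thesis using L 1 by simp
    next
      case 2
      have "(l (\<lambda>x. (1/c) * g x) + t) * c \<le> s (\<lambda>x. (1/c) * g x + \<delta> x) * c" by (rule mult_right_mono[OF up[OF gcV]]) (use 2 in simp)
      also have "\<dots> = s (\<lambda>x. c * ((1/c) * g x + \<delta> x))" unfolding hom[OF 2] by (rule mult.commute)
      also have "(\<lambda>x. c * ((1/c) * g x + \<delta> x)) = f" unfolding fe using 2 by (auto simp: algebra_simps)
      finally show ?thesis unfolding L lin(2) using 2 by (simp add: algebra_simps)
    next
      case 3
      have "(l (\<lambda>x. (1/(-c)) * g x) - t) * (-c) \<le> s (\<lambda>x. (1/(-c)) * g x - \<delta> x) * (-c)" by (rule mult_right_mono[OF lo[OF gcV]]) (use 3 in simp)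
      also have "\<dots> = s (\<lambda>x. (-c) * ((1/(-c)) * g x - \<delta> x))" by (subst hom) (use 3 in auto)
      also have "(\<lambda>x. (-c) * ((1/(-c)) * g x - \<delta> x)) = f" unfolding fe using 3 by (auto simp: algebra_simps)
      finally show ?thesis unfolding L lin(2) using 3 by (simp add: algebra_simps)
    qed
  qed
qed

text \<open>Points are inserted in order of increasing \<open>key\<close>, and a point is kept if it
  is separated from those kept before. A rejected point is close to a kept one, whose key is no
  larger because it came earlier.\<close>

lemma greedy_separated:
  fixes E :: "'a::metric_space set" and \<rho> key :: "'a \<Rightarrow> real"
  assumes "finite E"
  shows "\<exists>K\<subseteq>E. (\<forall>k\<in>K. \<forall>k'\<in>K. k \<noteq> k' \<longrightarrow> \<rho> k + \<rho> k' < dist k k') \<and> (\<forall>x\<in>E. \<exists>k\<in>K. key k \<le> key x \<and> (x = k \<or> dist x k \<le> \<rho> x + \<rho> k))"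
  using assms
proof (induction rule: finite_ranking_induct[where f = key])
  case (insert x S)
  then obtain K where K: "K \<subseteq> S" "\<forall>k\<in>K. \<forall>k'\<in>K. k \<noteq> k' \<longrightarrow> \<rho> k + \<rho> k' < dist k k'" "\<forall>x\<in>S. \<exists>k\<in>K. key k \<le> key x \<and> (x = k \<or> dist x k \<le> \<rho> x + \<rho> k)" by blast
  show ?case
  proof (cases "\<exists>k\<in>K. dist x k \<le> \<rho> x + \<rho> k")
    case True
    then obtain k0 where k0: "k0 \<in> K" "dist x k0 \<le> \<rho> x + \<rho> k0" by blast
    have "key k0 \<le> key x" using insert(2) K(1) k0(1) by blast
    then have "\<exists>k\<in>K. key k \<le> key y \<and> (y = k \<or> dist y k \<le> \<rho> y + \<rho> k)" if "y \<in> insert x S" for y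
      using that K(3) k0 by (cases "y = x") auto
    moreover have "K \<subseteq> insert x S" using K(1) by auto
    ultimately show ?thesis using K(2) by (intro exI[of _ K] conjI ballI) auto
  next
    case False
    then have n: "\<And>k. k \<in> K \<Longrightarrow> \<rho> x + \<rho> k < dist x k" by force
    have "\<exists>k\<in>insert x K. key k \<le> key y \<and> (y = k \<or> dist y k \<le> \<rho> y + \<rho> k)" if "y \<in> insert x S" for y
      using that K(3) by (cases "y = x") auto
    moreover have "insert x K \<subseteq> insert x S" using K(1) by auto
    moreover have "\<rho> k + \<rho> k' < dist k k'" if "k \<in> insert x K" "k' \<in> insert x K" "k \<noteq> k'" for k k'
      using that K(2) n[of k] n[of k'] by (auto simp: dist_commute add.commute)
    ultimately show ?thesis by (intro exI[of _ "insert x K"] conjI ballI impI) auto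
  qed
qed simp

lemma sob_has_derivative:
  assumes "p > 2" "sob p F g" shows "(F has_derivative (\<lambda>h. grad F x \<bullet> h)) (at x)"
proof (rule sob_morrey[OF assms(1)])
  assume "\<And>F g x. sob p F g \<Longrightarrow> (F has_derivative (\<lambda>h. grad F x \<bullet> h)) (at x)"
  then show ?thesis using assms(2) .
qed

lemma grad_linear:
  assumes "(F has_derivative (\<lambda>h. grad F x \<bullet> h)) (at x)" "(G has_derivative (\<lambda>h. grad G x \<bullet> h)) (at x)"
  shows "grad (\<lambda>z. F z + G z) x = grad F x + grad G x" "grad (\<lambda>z. F z - G z) x = grad F x - grad G x" "grad (\<lambda>z. c * F z) x = c *\<^sub>R grad F x"
proof -
  show "grad (\<lambda>z. F z + G z) x = grad F x + grad G x"
    using has_derivative_add[OF assms] by (intro grad_unique) (simp add: inner_add_left)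
  show "grad (\<lambda>z. F z - G z) x = grad F x - grad G x"
    using has_derivative_diff[OF assms] by (intro grad_unique) (simp add: inner_diff_left)
  show "grad (\<lambda>z. c * F z) x = c *\<^sub>R grad F x"
    using has_derivative_mult_right[OF assms(1), of c] by (intro grad_unique) simp
qed

lemma grad_affine: "grad (\<lambda>x. c + a \<bullet> x) x = a"
  by (rule grad_unique) (auto intro!: derivative_eq_intros)

lemma hint_scale: "hint p (\<lambda>i j x. c * g i j x) x r = \<bar>c\<bar> powr p * hint p g x r"
  unfolding hint_def hnorm_scale set_lebesgue_integral_def
  by (simp add: powr_mult hnorm_nonneg mult.left_commute[of _ "\<bar>c\<bar> powr p"])

lemma hint_triangle:
  assumes p: "p > 2" and F: "sob p F g" and G: "sob p G h"
  shows "hint p (\<lambda>i j x. g i j x + h i j x) x r powr (1/p) \<le> hint p g x r powr (1/p) + hint p h x r powr (1/p)"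
proof -
  have e: "hint p g x r = (\<integral>z. (indicator (ball x r) z * hnorm g z) powr p \<partial>lborel)" for g
    unfolding hint_def set_lebesgue_integral_def using p by (intro Bochner_Integration.integral_cong) (auto simp: indicator_def)
  have i: "integrable lborel (\<lambda>z. (indicator (ball x r) z * hnorm g z) powr p)" if "sob p F g" for F g
  proof -
    have "set_integrable lborel (ball x r) (\<lambda>w. hnorm g w powr p)" by (rule locint_set_integrable_ball[OF sob_locint[OF that]]) (use p in auto)
    moreover have "(\<lambda>z. indicator (ball x r) z *\<^sub>R hnorm g z powr p) = (\<lambda>z. (indicator (ball x r) z * hnorm g z) powr p)"
      using p by (auto simp: indicator_def)
    ultimately show ?thesis unfolding set_integrable_def by simp
  qed
  show ?thesis unfolding e
    by (rule minkowski) (use p i[OF F] i[OF G] hnorm_nonneg hnorm_triangle[of g h] in \<open>auto simp: indicator_def\<close>)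
qed

text \<open>The bound on functions with vanishing trace makes the set of admissible values a bounded interval,
  to which Hahn--Banach applies.\<close>

lemma linear_selection:
  assumes p: "p > 2" and E: "finite E" "E \<noteq> {}" and A: "A \<ge> 0"
    and bound: "\<And>F g. sob p F g \<Longrightarrow> (\<forall>x\<in>E. F x = 0) \<Longrightarrow> \<bar>grad F k \<bullet> v\<bar> \<le> A * hint p g k r powr (1/p)"
  shows "\<exists>a. \<forall>F g. sob p F g \<longrightarrow> \<bar>(\<Sum>x\<in>E. a x * F x) - grad F k \<bullet> v\<bar> \<le> A * hint p g k r powr (1/p)"
proof -
  note der = sob_has_derivative[OF p]
  define R where "R g = A * hint p g k r powr (1/p)" for g
  \<comment> \<open>Pairs of an extension and one of its weak Hessians, because the radius of the
    interval of admissible values is computed from the Hessian.\<close>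
  define X where "X f = {(F, g). sob p F g \<and> (\<forall>x\<in>E. F x = f x)}" for f
  define val where "val = (\<lambda>(F, g). R g + grad F k \<bullet> v)"
  \<comment> \<open>Each extension of \<open>f\<close> confines the value to an interval of radius
    \<open>R g\<close> about its own directional derivative; this is the infimum of the upper
    ends.\<close>
  define s where "s f = Inf (val ` X f)" for f
  have R_add: "R (\<lambda>i j x. g i j x + h i j x) \<le> R g + R h" if "sob p F g" "sob p G h" for F g G h
    unfolding R_def distrib_left[symmetric] by (intro mult_left_mono hint_triangle[OF p that] A)
  have R_scale: "R (\<lambda>i j x. c * g i j x) = \<bar>c\<bar> * R g" for c g
  proof -
    have "(\<bar>c\<bar> powr p * hint p g k r) powr (1/p) = \<bar>c\<bar> * hint p g k r powr (1/p)"
      using p hint_nonneg by (simp add: powr_mult powr_powr)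
    then show ?thesis unfolding R_def hint_scale by simp
  qed
  have R_diff: "R (\<lambda>i j x. g i j x - h i j x) \<le> R g + R h" if "sob p F g" "sob p G h" for F g G h
    using R_add[OF that(1) sob_scale[OF that(2), of "-1"]] R_scale[of "-1" h] by simp
  have Xne: "X f \<noteq> {}" for f
  proof -
    obtain C \<Psi> \<alpha> \<beta> where W: "whitney_sys p C E \<Psi> \<alpha> \<beta>"
      using whitney_extension[OF p] E by (elim exE conjE allE[of _ E]) (drule (1) mp, drule (1) mp, elim exE, rule that)
    obtain g where "sob p (wext \<Psi> E f (\<lambda>_. 0)) g" using whitney_sysD(3)[OF W, of f "\<lambda>_. 0"] by (elim exE conjE) (rule that)
    then have "(wext \<Psi> E f (\<lambda>_. 0), g) \<in> X f" using whitney_sysD(4)[OF W] unfolding X_def by simp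
    then show ?thesis by blast
  qed
  \<comment> \<open>The intervals of two extensions of the same data meet: their difference has
    vanishing trace, so the assumed bound applies to it.\<close>
  have lower: "grad F0 k \<bullet> v - R g0 \<le> val y" if "sob p F0 g0" "\<forall>x\<in>E. F0 x = f x" "y \<in> X f" for F0 g0 f y
  proof -
    obtain F g where y: "y = (F, g)" "sob p F g" "\<forall>x\<in>E. F x = f x" using \<open>y \<in> X f\<close> unfolding X_def by auto
    have "\<bar>grad (\<lambda>x. F0 x - F x) k \<bullet> v\<bar> \<le> R (\<lambda>i j x. g0 i j x - g i j x)"
      unfolding R_def by (rule bound[OF sob_diff]) (use p that y in auto)
    also have "\<dots> \<le> R g0 + R g" by (rule R_diff[OF that(1) y(2)])
    finally show ?thesis unfolding y(1) val_def using grad_linear(2)[OF der[OF that(1)] der[OF y(2)], of k] by (simp add: inner_diff_left)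
  qed
  have bdd: "bdd_below (val ` X f)" for f
  proof -
    obtain y where "y \<in> X f" using Xne by blast
    then obtain F g where "sob p F g" "\<forall>x\<in>E. F x = f x" unfolding X_def by auto
    then show ?thesis using lower by (intro bdd_belowI2) blast
  qed
  have le: "s f \<le> R g + grad F k \<bullet> v" if "sob p F g" "\<forall>x\<in>E. F x = f x" for F g f
    unfolding s_def using that by (intro cInf_lower2[OF _ _ bdd]) (auto simp: X_def val_def intro!: image_eqI[of _ _ "(F, g)"])
  have sub: "s (\<lambda>x. f x + f' x) \<le> s f + s f'" for f f'
  proof -
    have "s (\<lambda>x. f x + f' x) - s f' \<le> val y" if "y \<in> X f" for y
    proof -
      obtain F g where y: "y = (F, g)" "sob p F g" "\<forall>x\<in>E. F x = f x" using \<open>y \<in> X f\<close> unfolding X_def by auto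
      have "s (\<lambda>x. f x + f' x) - val y \<le> val y'" if "y' \<in> X f'" for y'
      proof -
        obtain F' g' where y': "y' = (F', g')" "sob p F' g'" "\<forall>x\<in>E. F' x = f' x" using \<open>y' \<in> X f'\<close> unfolding X_def by auto
        have "s (\<lambda>x. f x + f' x) \<le> R (\<lambda>i j x. g i j x + g' i j x) + grad (\<lambda>x. F x + F' x) k \<bullet> v"
          by (rule le[OF sob_add]) (use p y y' in auto)
        also have "\<dots> \<le> val y + val y'" unfolding y(1) y'(1) val_def
          using R_add[OF y(2) y'(2)] grad_linear(1)[OF der[OF y(2)] der[OF y'(2)], of k] by (simp add: inner_add_left)
        finally show ?thesis by simp
      qed
      then have "s (\<lambda>x. f x + f' x) - val y \<le> s f'" unfolding s_def[of f'] using Xne by (intro cInf_greatest) auto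
      then show ?thesis by simp
    qed
    then have "s (\<lambda>x. f x + f' x) - s f' \<le> s f" unfolding s_def[of f] using Xne by (intro cInf_greatest) auto
    then show ?thesis by simp
  qed
  have hom_le: "s (\<lambda>x. c * f x) \<le> c * s f" if c: "c > 0" for c f
  proof -
    have "s (\<lambda>x. c * f x) / c \<le> val y" if "y \<in> X f" for y
    proof -
      obtain F g where y: "y = (F, g)" "sob p F g" "\<forall>x\<in>E. F x = f x" using \<open>y \<in> X f\<close> unfolding X_def by auto
      have "s (\<lambda>x. c * f x) \<le> R (\<lambda>i j x. c * g i j x) + grad (\<lambda>x. c * F x) k \<bullet> v"
        by (rule le[OF sob_scale]) (use y in auto)
      also have "\<dots> = c * val y" unfolding y(1) val_def R_scale using c grad_linear(3)[OF der[OF y(2)] der[OF y(2)], of c k] by (simp add: distrib_left)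
      finally show ?thesis using c by (simp add: divide_le_eq mult.commute)
    qed
    then have "s (\<lambda>x. c * f x) / c \<le> s f" unfolding s_def[of f] using Xne by (intro cInf_greatest) auto
    then show ?thesis using c by (simp add: divide_le_eq mult.commute)
  qed
  have hom: "s (\<lambda>x. c * f x) = c * s f" if c: "c > 0" for c f
  proof (rule antisym[OF hom_le[OF c]])
    have "s (\<lambda>x. (1/c) * (c * f x)) \<le> (1/c) * s (\<lambda>x. c * f x)" by (rule hom_le) (use c in simp)
    then show "c * s f \<le> s (\<lambda>x. c * f x)" using c by (simp add: field_simps)
  qed
  have s0: "s (\<lambda>x. 0) = 0"
  proof -
    have h: "s (\<lambda>x. 0) = 2 * s (\<lambda>x. 0)" using hom[of 2 "\<lambda>x. 0"] by simp
    then show ?thesis by simp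
  qed
  obtain a where a: "\<And>f. (\<forall>x. x \<notin> E \<longrightarrow> f x = 0) \<Longrightarrow> (\<Sum>x\<in>E. a x * f x) \<le> s f"
    using hahn_banach_finite[of s E, OF sub hom s0 E(1)] by blast
  have up: "(\<Sum>x\<in>E. a x * F x) \<le> R g + grad F k \<bullet> v" if "sob p F g" for F g
  proof -
    define f where "f x = (if x \<in> E then F x else 0)" for x
    have "(\<Sum>x\<in>E. a x * F x) = (\<Sum>x\<in>E. a x * f x)" by (intro sum.cong) (auto simp: f_def)
    also have "\<dots> \<le> s f" by (rule a) (simp add: f_def)
    also have "\<dots> \<le> R g + grad F k \<bullet> v" by (rule le[OF that]) (simp add: f_def)
    finally show ?thesis .
  qed
  show ?thesis
  proof (intro exI[of _ a] allI impI)
    fix F g assume F: "sob p F g"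
    \<comment> \<open>The upper bound for \<open>- F\<close> is the lower bound for
      \<open>F\<close>.\<close>
    have "(\<Sum>x\<in>E. a x * ((-1) * F x)) \<le> R (\<lambda>i j x. (-1) * g i j x) + grad (\<lambda>x. (-1) * F x) k \<bullet> v" by (rule up[OF sob_scale[OF F]])
    then have "- (\<Sum>x\<in>E. a x * F x) \<le> R g - grad F k \<bullet> v"
      unfolding R_scale grad_linear(3)[OF der[OF F] der[OF F]] by (simp add: sum_negf)
    then show "\<bar>(\<Sum>x\<in>E. a x * F x) - grad F k \<bullet> v\<bar> \<le> A * hint p g k r powr (1/p)" using up[OF F] unfolding R_def by (simp add: abs_le_iff)
  qed
qed

text \<open>Up to the scale \<open>r\<close>, the set \<open>E\<close> near \<open>x\<close> lies in the zero set of a function with unit gradient at \<open>x\<close> and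
  small Hessian, that is, on an almost straight curve. The largest such scale is where the trace starts to determine the gradient.\<close>

definition curved_ok :: "real \<Rightarrow> real \<Rightarrow> (real^2) set \<Rightarrow> real^2 \<Rightarrow> real \<Rightarrow> bool" where
  "curved_ok \<kappa> p E x r \<longleftrightarrow> (\<exists>F g. sob p F g \<and> (\<forall>y\<in>E \<inter> ball x r. F y = 0) \<and> norm (grad F x) = 1 \<and> hint p g x r \<le> \<kappa> * r powr (2 - p))"

text \<open>Divided by the length of its gradient at x, a function vanishing on \<open>E\<close>
  would be a witness for \<open>curved_ok\<close> if its Hessian were small; hence the Hessian
  controls the gradient.\<close>

lemma not_curved_ok_bound:
  assumes p: "p > 2" and k: "\<kappa> > 0" and r: "r > 0" and nok: "\<not> curved_ok \<kappa> p E x r" and F: "sob p F g" "\<forall>y\<in>E. F y = 0"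
  shows "norm (grad F x) \<le> (inverse \<kappa> * r powr (p - 2)) powr (1/p) * hint p g x r powr (1/p)"
proof (cases "grad F x = 0")
  case False
  note der = sob_has_derivative[OF p]
  define c where "c = inverse (norm (grad F x))"
  have c: "c > 0" using False by (simp add: c_def)
  have "norm (grad (\<lambda>z. c * F z) x) = 1" unfolding grad_linear(3)[OF der[OF F(1)] der[OF F(1)]] using False by (simp add: c_def)
  then have "\<not> hint p (\<lambda>i j x. c * g i j x) x r \<le> \<kappa> * r powr (2 - p)"
    using nok sob_scale[OF F(1), of c] F(2) unfolding curved_ok_def by auto
  then have "\<kappa> * r powr (2 - p) \<le> c powr p * hint p g x r" unfolding hint_scale using c by simp
  then have "\<kappa> * r powr (2 - p) * norm (grad F x) powr p \<le> c powr p * hint p g x r * norm (grad F x) powr p" by (intro mult_right_mono) auto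
  also have "\<dots> = (c * norm (grad F x)) powr p * hint p g x r" using c by (simp add: powr_mult)
  also have "\<dots> = hint p g x r" using False by (simp add: c_def)
  finally have "norm (grad F x) powr p \<le> inverse \<kappa> * r powr (p - 2) * hint p g x r"
    using k r by (simp add: field_simps powr_diff)
  then have "(norm (grad F x) powr p) powr (1/p) \<le> (inverse \<kappa> * r powr (p - 2) * hint p g x r) powr (1/p)" using p by (intro powr_mono2) auto
  then show ?thesis using p k hint_nonneg by (simp add: powr_powr powr_mult)
qed simp

definition collinear_pts :: "(real^2) set \<Rightarrow> bool" where
  "collinear_pts E \<longleftrightarrow> (\<exists>u. norm u = 1 \<and> (\<forall>x\<in>E. \<forall>y\<in>E. u \<bullet> (y - x) = 0))"

text \<open>In a ball that contains no other point of \<open>E\<close>, an affine function vanishing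
  at x is a witness with Hessian 0.\<close>

lemma curved_ok_small:
  assumes E: "finite E" and k: "\<kappa> > 0" shows "\<exists>r>0. curved_ok \<kappa> p E x r"
proof -
  obtain d where d: "d > 0" "\<And>y. y \<in> E \<Longrightarrow> y \<noteq> x \<Longrightarrow> d \<le> dist x y" using finite_set_avoid[OF E, of x] by blast
  define u :: "real^2" where "u = axis 1 1"
  have "curved_ok \<kappa> p E x d" unfolding curved_ok_def
  proof (intro exI conjI)
    show "sob p (\<lambda>z. - (u \<bullet> x) + u \<bullet> z) (\<lambda>i j x. 0)" by (rule sob_affine)
    show "\<forall>y\<in>E \<inter> ball x d. - (u \<bullet> x) + u \<bullet> y = 0"
    proof
      fix y assume "y \<in> E \<inter> ball x d"
      then have "y = x" using d(2)[of y] by force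
      then show "- (u \<bullet> x) + u \<bullet> y = 0" by simp
    qed
    show "norm (grad (\<lambda>z. - (u \<bullet> x) + u \<bullet> z) x) = 1" unfolding grad_affine by (simp add: u_def)
    show "hint p (\<lambda>i j x. 0) x d \<le> \<kappa> * d powr (2 - p)" unfolding hint_def hnorm_def using k by simp
  qed
  then show ?thesis using d by blast
qed

text \<open>Otherwise the property passes from \<open>r\<close> to \<open>2 ^ n * r\<close> for all
  n. The energy allowed at that scale tends to 0, so \<open>E\<close> satisfies ever better
  approximations of a linear equation with unit normal, and by compactness an exact one: it would be
  collinear.\<close>

lemma curved_ok_radius:
  assumes p: "p > 2" and E: "finite E" "x \<in> E" and k: "\<kappa> > 0" and nc: "\<not> collinear_pts E"
  shows "\<exists>r>0. curved_ok \<kappa> p E x r \<and> \<not> curved_ok \<kappa> p E x (2 * r)"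
proof (rule ccontr)
  assume con: "\<not> ?thesis"
  obtain r where r: "r > 0" "curved_ok \<kappa> p E x r" using curved_ok_small[OF E(1) k] by blast
  have all: "curved_ok \<kappa> p E x (2 ^ n * r)" for n
  proof (induction n)
    case (Suc n)
    have "\<not> (2 ^ n * r > 0 \<and> curved_ok \<kappa> p E x (2 ^ n * r) \<and> \<not> curved_ok \<kappa> p E x (2 * (2 ^ n * r)))" using con by blast
    then show ?case using Suc r by (simp add: mult.assoc)
  qed (use r in simp)
  obtain C where C: "C > 0" "\<And>F g z R x y. sob p F g \<Longrightarrow> R > 0 \<Longrightarrow> x \<in> ball z R \<Longrightarrow> y \<in> ball z R \<Longrightarrow>
       norm (grad F y - grad F x) \<le> C * R powr (1 - 2/p) * hint p g z (2*R) powr (1/p) \<and>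
       \<bar>F y - F x - grad F x \<bullet> (y - x)\<bar> \<le> C * norm (y - x) * R powr (1 - 2/p) * hint p g z (2*R) powr (1/p)"
    by (rule sob_morrey[OF p]) (erule that)
  have "\<exists>D. 0 < D \<and> (\<forall>y\<in>E. dist x y < D)"
  proof -
    obtain D where "\<forall>y\<in>E. dist x y \<le> D" using finite_imp_bounded[OF E(1)] unfolding bounded_any_center[of E x] by blast
    then show ?thesis by (intro exI[of _ "\<bar>D\<bar> + 1"]) force
  qed
  then obtain D where D: "D > 0" "\<And>y. y \<in> E \<Longrightarrow> dist x y < D" by blast
  define A where "A = C * D * D powr (1 - 2/p)"
  \<comment> \<open>By Morrey's inequality on the fixed ball of radius \<open>D\<close> around x,
    the deviation of \<open>E\<close> from the line orthogonal to the gradient of the n-th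
    witness.\<close>
  define e where "e n = A * (\<kappa> * (2 ^ n * r) powr (2 - p)) powr (1/p)" for n :: nat
  have step: "\<exists>u. norm u = 1 \<and> (\<forall>y\<in>E. \<bar>u \<bullet> (y - x)\<bar> \<le> e n)" if n: "2 * D \<le> 2 ^ n * r" for n
  proof -
    obtain F g where F: "sob p F g" "\<forall>y\<in>E \<inter> ball x (2 ^ n * r). F y = 0" "norm (grad F x) = 1" "hint p g x (2 ^ n * r) \<le> \<kappa> * (2 ^ n * r) powr (2 - p)"
      using all[of n] unfolding curved_ok_def by blast
    have "\<bar>grad F x \<bullet> (y - x)\<bar> \<le> e n" if y: "y \<in> E" for y
    proof -
      have "y \<in> E \<inter> ball x (2 ^ n * r)" "x \<in> E \<inter> ball x (2 ^ n * r)" using E(2) y D(1) D(2)[OF y] n by auto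
      then have z: "F y = 0" "F x = 0" using F(2) by auto
      have "hint p g x (2*D) \<le> hint p g x (2 ^ n * r)" by (rule hint_mono[OF sob_locint[OF F(1)]]) (use p n in \<open>auto intro: subset_ball\<close>)
      then have h: "hint p g x (2*D) powr (1/p) \<le> (\<kappa> * (2 ^ n * r) powr (2 - p)) powr (1/p)" using F(4) p hint_nonneg by (intro powr_mono2) auto
      have "\<bar>F y - F x - grad F x \<bullet> (y - x)\<bar> \<le> C * norm (y - x) * D powr (1 - 2/p) * hint p g x (2*D) powr (1/p)"
        using C(2)[OF F(1) D(1), of x x y] D(1) D(2)[OF y] by simp
      also have "\<dots> \<le> C * D * D powr (1 - 2/p) * (\<kappa> * (2 ^ n * r) powr (2 - p)) powr (1/p)"
        using C(1) D(1) D(2)[OF y] h by (intro mult_mono) (auto simp: dist_norm norm_minus_commute)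
      finally show ?thesis using z by (simp add: e_def A_def)
    qed
    then show ?thesis using F(3) by blast
  qed
  obtain n0 where n0: "2 * D / r < 2 ^ n0" using real_arch_pow[of 2 "2 * D / r"] by auto
  have big: "2 * D \<le> 2 ^ (n0 + n) * r" for n
  proof -
    have "2 * D / r < 2 ^ (n0 + n)" using n0 by (rule less_le_trans) (simp add: power_increasing)
    then show ?thesis using r(1) by (simp add: divide_less_eq)
  qed
  have "\<exists>u. \<forall>n. norm (u n) = 1 \<and> (\<forall>y\<in>E. \<bar>u n \<bullet> (y - x)\<bar> \<le> e (n0 + n))" using step[OF big] by (intro choice) blast
  then obtain u :: "nat \<Rightarrow> real^2" where u: "\<And>n. norm (u n) = 1" "\<And>n y. y \<in> E \<Longrightarrow> \<bar>u n \<bullet> (y - x)\<bar> \<le> e (n0 + n)" by blast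
  \<comment> \<open>The unit normals of the approximating lines accumulate; the limit is a normal of
    a line containing \<open>E\<close>.\<close>
  have "compact (sphere (0::real^2) 1)" by simp
  then obtain l s where l: "l \<in> sphere 0 1" "strict_mono s" "(u \<circ> s) \<longlonglongrightarrow> l"
    unfolding compact_def using u(1) by (metis (no_types, lifting) mem_sphere_0)
  have e0: "(\<lambda>n. e (n0 + s n)) \<longlonglongrightarrow> 0"
  proof -
    have "(\<lambda>n. (2::real) ^ (n0 + s n)) = (\<lambda>n. 2 ^ n0 * 2 ^ s n)" by (simp add: power_add)
    have f: "filterlim (\<lambda>n. (2::real) ^ n) at_top sequentially" 
      by (rule filterlim_at_infinity_imp_filterlim_at_top[OF filterlim_realpow_sequentially_gt1]) auto
    have "filterlim (\<lambda>n. n0 + s n) sequentially sequentially"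
      using l(2) by (intro filterlim_subseq) (auto simp: strict_mono_def)
    from filterlim_compose[OF f this] have "filterlim (\<lambda>n. (2::real) ^ (n0 + s n) * r) at_top sequentially"
      using r(1) by (intro filterlim_at_top_mult_tendsto_pos[OF tendsto_const]) auto
    then have "(\<lambda>n. ((2::real) ^ (n0 + s n) * r) powr (2 - p)) \<longlonglongrightarrow> 0" using p by (intro tendsto_neg_powr) auto
    then have "(\<lambda>n. \<kappa> * ((2::real) ^ (n0 + s n) * r) powr (2 - p)) \<longlonglongrightarrow> 0" by (rule tendsto_mult_right_zero)
    then have "(\<lambda>n. (\<kappa> * ((2::real) ^ (n0 + s n) * r) powr (2 - p)) powr (1/p)) \<longlonglongrightarrow> 0 powr (1/p)"
      using k p by (intro tendsto_powr' tendsto_const) auto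
    then show ?thesis unfolding e_def using tendsto_mult_right_zero by force
  qed
  have "l \<bullet> (y - x) = 0" if y: "y \<in> E" for y
  proof -
    have "(\<lambda>n. \<bar>(u \<circ> s) n \<bullet> (y - x)\<bar>) \<longlonglongrightarrow> \<bar>l \<bullet> (y - x)\<bar>" using l(3) by (intro tendsto_intros)
    then have "\<bar>l \<bullet> (y - x)\<bar> \<le> 0" using u(2)[OF y] by (intro LIMSEQ_le[OF _ e0]) auto
    then show ?thesis by simp
  qed
  then have "l \<bullet> (y - z) = 0" if "y \<in> E" "z \<in> E" for y z 
  proof -
    have "l \<bullet> (y - z) = l \<bullet> (y - x) - l \<bullet> (z - x)" by (simp add: inner_diff_right)
    then show ?thesis using \<open>\<And>y. y \<in> E \<Longrightarrow> l \<bullet> (y - x) = 0\<close> that by simp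
  qed
  then have "collinear_pts E" unfolding collinear_pts_def using l(1) by auto
  then show False using nc by simp
qed

section \<open>Energy estimates for the chosen jets\<close>

lemma nn_hint:
  assumes "sob p F g" "p > 0" shows "(\<integral>\<^sup>+z. ennreal (hnorm g z powr p) * indicator (ball x r) z \<partial>lborel) = ennreal (hint p g x r)"
proof -
  have i: "integrable lborel (\<lambda>z. indicator (ball x r) z *\<^sub>R hnorm g z powr p)"
    using locint_set_integrable_ball[OF sob_locint[OF assms(1)], of p] assms(2) unfolding set_integrable_def by auto
  have "(\<integral>\<^sup>+z. ennreal (hnorm g z powr p) * indicator (ball x r) z \<partial>lborel) = (\<integral>\<^sup>+z. ennreal (indicator (ball x r) z *\<^sub>R hnorm g z powr p) \<partial>lborel)"
    by (intro nn_integral_cong) (auto simp: indicator_def)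
  also have "\<dots> = ennreal (hint p g x r)" unfolding hint_def set_lebesgue_integral_def by (rule nn_integral_eq_integral[OF i]) simp
  finally show ?thesis .
qed

lemma tot_add:
  assumes "sob p F g" "sob p G h" "p > 0"
  shows "tot p (\<lambda>i j x. g i j x + h i j x) \<le> 2 powr p * (tot p g + tot p h)"
proof -
  have "tot p (\<lambda>i j x. g i j x + h i j x) \<le> (\<integral>z. 2 powr p * (hnorm g z powr p + hnorm h z powr p) \<partial>lborel)"
    unfolding tot_def
  proof (rule integral_mono)
    show "integrable lborel (\<lambda>z. hnorm (\<lambda>i j x. g i j x + h i j x) z powr p)" by (rule sob_integrable[OF sob_add]) (use assms in auto)
    show "integrable lborel (\<lambda>z. 2 powr p * (hnorm g z powr p + hnorm h z powr p))" using sob_integrable assms by auto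
    fix z
    have "hnorm (\<lambda>i j x. g i j x + h i j x) z powr p \<le> (hnorm g z + hnorm h z) powr p"
      using hnorm_triangle hnorm_nonneg assms(3) by (intro powr_mono2) auto
    also have "\<dots> \<le> 2 powr p * (hnorm g z powr p + hnorm h z powr p)" using hnorm_nonneg assms(3) by (intro powr_sum_le) auto
    finally show "hnorm (\<lambda>i j x. g i j x + h i j x) z powr p \<le> 2 powr p * (hnorm g z powr p + hnorm h z powr p)" .
  qed
  also have "\<dots> = 2 powr p * (tot p g + tot p h)" unfolding tot_def using sob_integrable assms by auto
  finally show ?thesis .
qed

lemma tot_diff:
  assumes "sob p F g" "sob p G h" "p > 0"
  shows "tot p (\<lambda>i j x. g i j x - h i j x) \<le> 2 powr p * (tot p g + tot p h)"
  using tot_add[OF assms(1) sob_scale[OF assms(2), of "-1"] assms(3)] unfolding tot_def hnorm_scale by simp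

lemma powr_sum3_le:
  fixes a b c p :: real
  assumes "a \<ge> 0" "b \<ge> 0" "c \<ge> 0" "p \<ge> 0"
  shows "(a + b + c) powr p \<le> 4 powr p * (a powr p + b powr p + c powr p)"
proof -
  have "(a + b + c) powr p \<le> 2 powr p * ((a + b) powr p + c powr p)" using assms by (intro powr_sum_le) auto
  also have "\<dots> \<le> 2 powr p * (2 powr p * (a powr p + b powr p) + 2 powr p * c powr p)"
    using assms by (intro mult_left_mono add_mono powr_sum_le) (auto simp: mult_le_cancel_right1 ge_one_powr_ge_zero)
  also have "\<dots> = (2 powr p * 2 powr p) * (a powr p + b powr p + c powr p)" by (simp add: algebra_simps)
  also have "(2::real) powr p * 2 powr p = 4 powr p" by (subst powr_mult[symmetric]) auto
  finally show ?thesis .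
qed

lemma sob_max:
  assumes "p > 2"
  shows "\<exists>C>0. \<forall>F g S. sob p F g \<longrightarrow> S \<in> sets borel \<longrightarrow> (\<exists>m. taylor_majorant C p F g S m)"
proof (rule sob_morrey[OF assms])
  fix C assume "C > 0"
    "\<And>F g S. sob p F g \<Longrightarrow> S \<in> sets borel \<Longrightarrow> \<exists>m. taylor_majorant C p F g S m"
  then show ?thesis by (intro exI[of _ C] conjI allI impI)
qed

lemma sob_grad_holder:
  assumes "p > 2"
  shows "\<exists>C>0. \<forall>F g z R x y. sob p F g \<longrightarrow> R > 0 \<longrightarrow> x \<in> ball z R \<longrightarrow> y \<in> ball z R \<longrightarrow>
       norm (grad F y - grad F x) \<le> C * R powr (1 - 2/p) * hint p g z (2*R) powr (1/p)"
proof (rule sob_morrey[OF assms])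
  fix C assume "C > 0"
    "\<And>F g z R x y. sob p F g \<Longrightarrow> R > 0 \<Longrightarrow> x \<in> ball z R \<Longrightarrow> y \<in> ball z R \<Longrightarrow>
       norm (grad F y - grad F x) \<le> C * R powr (1 - 2/p) * hint p g z (2*R) powr (1/p) \<and>
       \<bar>F y - F x - grad F x \<bullet> (y - x)\<bar> \<le> C * norm (y - x) * R powr (1 - 2/p) * hint p g z (2*R) powr (1/p)"
  then show ?thesis by (intro exI[of _ C] conjI allI impI) auto
qed

text \<open>\<open>H k\<close> will be the error of the gradient chosen at \<open>k\<close>; the decay of each summand makes the
  density see this error from every distance \<open>\<ge> r k\<close> while keeping it integrable.\<close>

definition errdens :: "real \<Rightarrow> (real^2) set \<Rightarrow> (real^2 \<Rightarrow> real) \<Rightarrow> (real^2 \<Rightarrow> real) \<Rightarrow> real^2 \<Rightarrow> real" where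
  "errdens p K r H z = (\<Sum>k\<in>K. H k powr p * max (r k) (dist z k) powr (-p))"

lemma errdens_nonneg: "errdens p K r H z \<ge> 0"
  unfolding errdens_def by (intro sum_nonneg) auto

lemma errdens_measurable [measurable]: "errdens p K r H \<in> borel_measurable borel"
  unfolding errdens_def[abs_def] by measurable

text \<open>The error at k is recovered from the density at any z, at the price of a power of the
  distance to k or of the scale \<open>r k\<close>, whichever is larger.\<close>

lemma errdens_ge:
  assumes p: "p > 0" and K: "finite K" "k \<in> K" and H: "H k \<ge> 0" and r: "r k > 0" and b: "max (r k) (dist z k) \<le> b"
  shows "H k powr p \<le> b powr p * errdens p K r H z"
proof -
  let ?m = "max (r k) (dist z k)"
  have m: "?m > 0" using r by simp
  have "H k powr p = ?m powr p * (H k powr p * ?m powr (-p))" using m by (simp add: powr_minus)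
  also have "\<dots> \<le> b powr p * (H k powr p * ?m powr (-p))" using m b p by (intro mult_right_mono powr_mono2) auto
  also have "H k powr p * ?m powr (-p) \<le> errdens p K r H z"
    unfolding errdens_def by (rule member_le_sum[where f="\<lambda>k. H k powr p * max (r k) (dist z k) powr (-p)"]) (use K in auto)
  finally show ?thesis by (simp add: mult_left_mono)
qed

lemma sum_disjoint_balls:
  fixes K :: "(real^2) set" and \<rho> :: "real^2 \<Rightarrow> real"
  assumes p: "p > 0" and K: "finite K" and F: "h \<in> borel_measurable borel"
    and sep: "\<And>k k'. k \<in> K \<Longrightarrow> k' \<in> K \<Longrightarrow> k \<noteq> k' \<Longrightarrow> \<rho> k + \<rho> k' < dist k k'"
  shows "(\<Sum>k\<in>K. \<integral>\<^sup>+z. h z * indicator (ball k (\<rho> k)) z \<partial>lborel) \<le> (\<integral>\<^sup>+z. h z \<partial>lborel)"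
proof -
  have "(\<Sum>k\<in>K. \<integral>\<^sup>+z. h z * indicator (ball (k::real^2) (\<rho> k)) z \<partial>lborel) = (\<integral>\<^sup>+z. (\<Sum>k\<in>K. h z * indicator (ball k (\<rho> k)) z) \<partial>lborel)"
    using F by (intro nn_integral_sum[symmetric] borel_measurable_times_ennreal borel_measurable_indicator) auto
  also have "\<dots> \<le> (\<integral>\<^sup>+z. h z \<partial>lborel)"
  proof (rule nn_integral_mono)
    fix z
    show "(\<Sum>k\<in>K. h z * indicator (ball k (\<rho> k)) z) \<le> h z"
    proof (cases "\<exists>k\<in>K. z \<in> ball k (\<rho> k)")
      case True
      then obtain k where k: "k \<in> K" "z \<in> ball k (\<rho> k)" by blast
      have n: "z \<notin> ball k' (\<rho> k')" if "k' \<in> K" "k' \<noteq> k" for k'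
        using sep[OF that(1) k(1) that(2)] k(2) dist_triangle[of k' k z] by (simp add: dist_commute)
      have "(\<Sum>k'\<in>K. h z * indicator (ball k' (\<rho> k')) z) = (\<Sum>k'\<in>K. if k' = k then h z else 0)"
        by (intro sum.cong refl) (use k(2) n in \<open>simp add: indicator_def\<close>)
      then show ?thesis using K k by simp
    next
      case False
      then have "(\<Sum>k\<in>K. h z * indicator (ball k (\<rho> k)) z) = 0" by (intro sum.neutral) auto
      then show ?thesis by simp
    qed
  qed
  finally show ?thesis .
qed

text \<open>The tail integral gives the power \<open>2 - p\<close> of \<open>r k\<close>, which
  cancels the power \<open>p - 2\<close> in the bound for the error. What remains are the energies
  in the disjoint balls of radius \<open>2 * r k\<close>.\<close>

lemma errdens_integral:
  assumes p: "p > 2" and K: "finite K" and H: "\<And>k. H k \<ge> 0" and r: "\<And>k. k \<in> K \<Longrightarrow> r k > 0" and F: "sob p F g" and A: "A \<ge> 0" "Ct > 0"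
    and tail: "\<And>(x::real^2) r. r > 0 \<Longrightarrow> (\<integral>\<^sup>+z. ennreal (max r (dist z x) powr (-p)) \<partial>lborel) \<le> ennreal (Ct * r powr (2 - p))"
    and sep: "\<And>k k'. k \<in> K \<Longrightarrow> k' \<in> K \<Longrightarrow> k \<noteq> k' \<Longrightarrow> 2 * r k + 2 * r k' < dist k k'"
    and bd: "\<And>k. k \<in> K \<Longrightarrow> H k powr p \<le> A * r k powr (p - 2) * hint p g k (2 * r k)"
  shows "(\<integral>\<^sup>+z. ennreal (errdens p K r H z) \<partial>lborel) \<le> ennreal (A * Ct * tot p g)"
proof -
  note [measurable] = sob_hnorm_measurable[OF F]
  have "(\<integral>\<^sup>+z. ennreal (errdens p K r H z) \<partial>lborel) = (\<integral>\<^sup>+z. (\<Sum>k\<in>K. ennreal (H k powr p) * ennreal (max (r k) (dist z k) powr (-p))) \<partial>lborel)"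
    unfolding errdens_def by (intro nn_integral_cong) (simp add: sum_ennreal[symmetric] ennreal_mult)
  also have "\<dots> = (\<Sum>k\<in>K. ennreal (H k powr p) * (\<integral>\<^sup>+z. ennreal (max (r k) (dist z k) powr (-p)) \<partial>lborel))"
    by (subst nn_integral_sum) (auto intro!: sum.cong nn_integral_cmult)
  also have "\<dots> \<le> (\<Sum>k\<in>K. ennreal (A * Ct) * ennreal (hint p g k (2 * r k)))"
  proof (rule sum_mono)
    fix k assume k: "k \<in> K"
    have "ennreal (H k powr p) * (\<integral>\<^sup>+z. ennreal (max (r k) (dist z k) powr (-p)) \<partial>lborel) \<le> ennreal (A * r k powr (p - 2) * hint p g k (2 * r k)) * ennreal (Ct * r k powr (2 - p))"
      by (intro mult_mono ennreal_leI bd k tail r) auto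
    also have "\<dots> = ennreal (A * r k powr (p - 2) * hint p g k (2 * r k) * (Ct * r k powr (2 - p)))"
      using A hint_nonneg by (intro ennreal_mult[symmetric]) auto
    also have "A * r k powr (p - 2) * hint p g k (2 * r k) * (Ct * r k powr (2 - p)) = A * Ct * hint p g k (2 * r k) * (r k powr (p - 2) * r k powr (2 - p))" by simp
    also have "r k powr (p - 2) * r k powr (2 - p) = 1" using r[OF k] by (simp add: powr_add[symmetric])
    also have "ennreal (A * Ct * hint p g k (2 * r k) * 1) = ennreal (A * Ct) * ennreal (hint p g k (2 * r k))" using A hint_nonneg by (simp add: ennreal_mult)
    finally show "ennreal (H k powr p) * (\<integral>\<^sup>+z. ennreal (max (r k) (dist z k) powr (-p)) \<partial>lborel) \<le> ennreal (A * Ct) * ennreal (hint p g k (2 * r k))" .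
  qed
  also have "\<dots> = ennreal (A * Ct) * (\<Sum>k\<in>K. \<integral>\<^sup>+z. ennreal (hnorm g z powr p) * indicator (ball k (2 * r k)) z \<partial>lborel)"
    using p by (simp add: sum_distrib_left nn_hint[OF F])
  also have "\<dots> \<le> ennreal (A * Ct) * (\<integral>\<^sup>+z. ennreal (hnorm g z powr p) \<partial>lborel)"
    using p K sep by (intro mult_left_mono sum_disjoint_balls) auto
  also have "\<dots> = ennreal (A * Ct * tot p g)" using nn_tot[OF F] p A tot_nonneg by (simp add: ennreal_mult)
  finally show ?thesis .
qed

text \<open>The chosen jets differ from those of \<open>F\<close> by \<open>H\<close>. Separation
  makes the scales of x and y at most of the order of their mutual distance, hence of the distance
  from z to \<open>K\<close>, so the density at z sees both errors. The constant 400 is not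
  optimised.\<close>

lemma separated_jets_density:
  assumes p: "p > 2" and K: "finite K" and H: "\<And>k. H k = norm (grad F k - L k)" and r: "\<And>k. k \<in> K \<Longrightarrow> r k > 0"
    and sep: "\<And>k k'. k \<in> K \<Longrightarrow> k' \<in> K \<Longrightarrow> k \<noteq> k' \<Longrightarrow> 2 * r k + 2 * r k' < dist k k'"
    and m: "m \<ge> 0" and loc: "\<forall>R>0. taylor_ctrl F z R m"
    and xy: "x \<in> K" "y \<in> K" "x \<noteq> y" "dist z y = infdist z K" "dist z x \<le> 8 * infdist z K"
  shows "norm (L x - L y) powr p \<le> infdist z K powr p * (2 * 400 powr p * (m powr p + errdens p K r H z))"
    "\<bar>jet_gap F L x y\<bar> powr p \<le> infdist z K powr (2*p) * (2 * 400 powr p * (m powr p + errdens p K r H z))"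
proof -
  define R where "R = infdist z K"
  define D where "D = errdens p K r H z"
  have D0: "D \<ge> 0" unfolding D_def by (rule errdens_nonneg)
  have R: "R > 0"
  proof (rule ccontr)
    assume "\<not> R > 0"
    then have "R = 0" using infdist_nonneg[of z K] unfolding R_def by simp
    then show False using xy unfolding R_def by simp
  qed
  have dxy: "dist x y \<le> 9 * R" using xy dist_triangle[of x y z] unfolding R_def by (simp add: dist_commute)
  have in9: "x \<in> ball z (10 * R)" "y \<in> ball z (10 * R)" using xy R unfolding R_def by auto
  have l1: "norm (grad F x - grad F y) \<le> 10 * R * m" "\<bar>F y - F x - grad F x \<bullet> (y - x)\<bar> \<le> norm (y - x) * (10 * R) * m"
    using loc[rule_format, of "10 * R", OF _ in9] loc[rule_format, of "10 * R", OF _ in9(2,1)] R by auto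
  \<comment> \<open>This is where separation enters: distinct points of \<open>K\<close> within
    \<open>9 * R\<close> of each other have scales of order R.\<close>
  have rx: "r x \<le> 9 * R" "r y \<le> 9 * R" using sep[OF xy(1-3)] r[OF xy(1)] r[OF xy(2)] dxy by linarith+
  have Hx: "H x powr p \<le> (10 * R) powr p * D"
    unfolding D_def by (rule errdens_ge[where k=x and H=H and r=r and z=z, OF _ K xy(1) _ r[OF xy(1)]]) (use p H rx xy R in \<open>auto simp: R_def\<close>)
  have Hy: "H y powr p \<le> (10 * R) powr p * D"
    unfolding D_def by (rule errdens_ge[where k=y and H=H and r=r and z=z, OF _ K xy(2) _ r[OF xy(2)]]) (use p H rx xy R in \<open>auto simp: R_def\<close>)
  have n: "norm (L x - L y) \<le> norm (grad F x - grad F y) + H x + H y"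
  proof -
    have "L x - L y = (grad F x - grad F y) - (grad F x - L x) + (grad F y - L y)" by simp
    then show ?thesis unfolding H using norm_triangle_ineq[of "(grad F x - grad F y) - (grad F x - L x)" "grad F y - L y"] norm_triangle_ineq4[of "grad F x - grad F y" "grad F x - L x"] by simp
  qed
  have c40: "4 powr p * 10 powr p = (40::real) powr p" by (subst powr_mult[symmetric]) auto
  have c400: "(40::real) powr p \<le> 400 powr p" using p by (intro powr_mono2) auto
  have "norm (L x - L y) powr p \<le> (norm (grad F x - grad F y) + H x + H y) powr p" using n p by (intro powr_mono2) auto
  also have "\<dots> \<le> 4 powr p * (norm (grad F x - grad F y) powr p + H x powr p + H y powr p)" using p by (intro powr_sum3_le) (auto simp: H)
  also have "\<dots> \<le> 4 powr p * ((10 * R * m) powr p + (10 * R) powr p * D + (10 * R) powr p * D)"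
    using l1 p Hx Hy by (intro mult_left_mono add_mono powr_mono2) auto
  also have "\<dots> = R powr p * ((4 powr p * 10 powr p) * (m powr p + 2 * D))" using R m by (simp add: powr_mult algebra_simps)
  also have "\<dots> \<le> R powr p * (400 powr p * (2 * (m powr p + D)))" unfolding c40 using c400 D0 by (intro mult_left_mono mult_mono) auto
  finally show "norm (L x - L y) powr p \<le> infdist z K powr p * (2 * 400 powr p * (m powr p + errdens p K r H z))"
    unfolding R_def D_def by (simp add: algebra_simps)
  have ny: "norm (y - x) \<le> 10 * R" using dxy R by (simp add: dist_norm norm_minus_commute)
  have "\<bar>jet_gap F L x y\<bar> \<le> \<bar>F y - F x - grad F x \<bullet> (y - x)\<bar> + \<bar>(grad F x - L x) \<bullet> (y - x)\<bar>"
    unfolding jet_gap_def by (simp add: inner_diff_left)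
  also have "\<dots> \<le> norm (y - x) * (10 * R) * m + H x * norm (y - x)"
    using l1(2) Cauchy_Schwarz_ineq2[of "grad F x - L x" "y - x"] unfolding H by linarith
  also have "\<dots> \<le> (10 * R) * (10 * R) * m + H x * (10 * R)" using ny m R by (intro add_mono mult_right_mono mult_left_mono) (auto simp: H)
  finally have "\<bar>jet_gap F L x y\<bar> powr p \<le> ((10 * R) * (10 * R) * m + H x * (10 * R)) powr p" using p by (intro powr_mono2) auto
  also have "\<dots> \<le> 2 powr p * (((10 * R) * (10 * R) * m) powr p + (H x * (10 * R)) powr p)" using p R m by (intro powr_sum_le) (auto simp: H)
  also have "\<dots> \<le> 2 powr p * ((10 * R) powr p * (10 * R) powr p * m powr p + ((10 * R) powr p * D) * (10 * R) powr p)"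
  proof -
    have "(H x * (10 * R)) powr p = H x powr p * (10 * R) powr p" using R by (simp add: powr_mult H)
    also have "\<dots> \<le> ((10 * R) powr p * D) * (10 * R) powr p" by (rule mult_right_mono[OF Hx]) simp
    finally have a: "(H x * (10 * R)) powr p \<le> ((10 * R) powr p * D) * (10 * R) powr p" .
    have b: "((10 * R) * (10 * R) * m) powr p = (10 * R) powr p * (10 * R) powr p * m powr p"
      using R m by (simp only: powr_mult mult_nonneg_nonneg)
    show ?thesis unfolding b using a by (intro mult_left_mono add_left_mono) auto
  qed
  also have "\<dots> = (R powr p * R powr p) * ((2 powr p * 10 powr p * 10 powr p) * (m powr p + D))" using R by (simp add: powr_mult algebra_simps)
  also have "R powr p * R powr p = R powr (2*p)" by (simp add: powr_add[symmetric])
  also have "2 powr p * 10 powr p * 10 powr p = (200::real) powr p" by (simp add: powr_mult[symmetric])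
  also have "R powr (2*p) * (200 powr p * (m powr p + D)) \<le> R powr (2*p) * ((2 * 400 powr p) * (m powr p + D))"
  proof -
    have "(200::real) powr p \<le> 400 powr p" using p by (intro powr_mono2) auto
    then have "(200::real) powr p \<le> 2 * 400 powr p" using powr_ge_zero[of 400 p] by linarith
    then show ?thesis using D0 by (intro mult_left_mono mult_right_mono) auto
  qed
  finally show "\<bar>jet_gap F L x y\<bar> powr p \<le> infdist z K powr (2*p) * (2 * 400 powr p * (m powr p + errdens p K r H z))"
    unfolding R_def D_def .
qed

text \<open>The tangential part of the jet at \<open>x\<close> is the difference quotient to the nearest neighbour \<open>nb x\<close>,
  the normal part is zero. A point without neighbour has \<open>nb x = x\<close>, hence the jet \<open>0\<close>.\<close>

definition nproj :: "real^2 \<Rightarrow> real^2 \<Rightarrow> real^2" where "nproj u v = v - (u \<bullet> v) *\<^sub>R u"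

definition dirv :: "(real^2 \<Rightarrow> real^2) \<Rightarrow> real^2 \<Rightarrow> real^2" where "dirv nb x = (nb x - x) /\<^sub>R norm (nb x - x)"

definition tjet :: "(real^2 \<Rightarrow> real^2) \<Rightarrow> (real^2 \<Rightarrow> real) \<Rightarrow> real^2 \<Rightarrow> real^2" where
  "tjet nb f x = ((f (nb x) - f x) / norm (nb x - x)) *\<^sub>R dirv nb x"

text \<open>The condition on \<open>nb x\<close> is void if x is the only point, which keeps the
  definition meaningful for singletons.\<close>

definition nearest_nb :: "(real^2) set \<Rightarrow> (real^2 \<Rightarrow> real^2) \<Rightarrow> bool" where
  "nearest_nb E nb \<longleftrightarrow> (\<forall>x\<in>E. \<forall>y\<in>E. x \<noteq> y \<longrightarrow> nb x \<in> E \<and> nb x \<noteq> x \<and> dist x (nb x) \<le> dist x y)"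

lemma nearest_nb_exists: assumes "finite E" shows "\<exists>nb. nearest_nb E nb"
proof -
  have "\<exists>v. \<forall>y\<in>E. x \<noteq> y \<longrightarrow> v \<in> E \<and> v \<noteq> x \<and> dist x v \<le> dist x y" for x
  proof (cases "E - {x} = {}")
    case False
    then obtain v where "v \<in> E - {x}" "dist x v = infdist x (E - {x})" using infdist_attained[of "E - {x}" x] assms by blast
    then show ?thesis using infdist_le[of _ "E - {x}" x] by (intro exI[of _ v]) auto
  qed auto
  then have "\<exists>nb. \<forall>x. \<forall>y\<in>E. x \<noteq> y \<longrightarrow> nb x \<in> E \<and> nb x \<noteq> x \<and> dist x (nb x) \<le> dist x y" by (intro choice allI)
  then show ?thesis unfolding nearest_nb_def by blast
qed

lemma norm_dirv: "nb x \<noteq> x \<Longrightarrow> norm (dirv nb x) = 1" by (simp add: dirv_def)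

lemma nproj_diff: "nproj u (v - w) = nproj u v - nproj u w"
  by (simp add: nproj_def inner_diff_right scaleR_diff_left)

lemma norm_nproj_le: assumes "norm u = 1" shows "norm (nproj u v) \<le> norm v"
proof -
  have uu: "u \<bullet> u = 1" using assms by (simp add: dot_square_norm)
  have "nproj u v \<bullet> nproj u v = v \<bullet> v - (u \<bullet> v)\<^sup>2"
    unfolding nproj_def by (simp add: inner_diff_left inner_diff_right uu inner_commute power2_eq_square)
  then have "(norm (nproj u v))\<^sup>2 \<le> (norm v)\<^sup>2" by (simp add: dot_square_norm[symmetric])
  then show ?thesis by (simp add: power2_le_iff_abs_le)
qed

text \<open>The difference quotient to a neighbour is the tangential derivative up to a Taylor
  remainder, which \<open>m\<close> controls. Only the omitted normal parts are not controlled in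
  this way; the two hypotheses about \<open>nproj\<close> isolate exactly what has to be known of
  them.\<close>

lemma tangential_jets_density:
  assumes p: "p > 2" and nb: "nearest_nb E nb"
    and m: "m \<ge> 0" and loc: "\<forall>R>0. taylor_ctrl F z R m"
    and xy: "x \<in> E" "y \<in> E" "x \<noteq> y" "dist z y = infdist z E" "dist z x \<le> 8 * infdist z E" and n0: "n0 \<ge> 0"
    and T1: "norm (nproj (dirv nb x) (grad F y) - nproj (dirv nb y) (grad F y)) powr p \<le> infdist z E powr p * n0"
    and T2: "\<bar>nproj (dirv nb x) (grad F y) \<bullet> (y - x)\<bar> powr p \<le> infdist z E powr (2*p) * n0"
  shows "norm (tjet nb F x - tjet nb F y) powr p \<le> infdist z E powr p * (2000 powr p * (m powr p + n0))"
    "\<bar>jet_gap F (tjet nb F) x y\<bar> powr p \<le> infdist z E powr (2*p) * (2000 powr p * (m powr p + n0))"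
proof -
  define R where "R = infdist z E"
  have R: "R > 0"
  proof (rule ccontr)
    assume "\<not> R > 0"
    then have "R = 0" using infdist_nonneg[of z E] unfolding R_def by simp
    then show False using xy unfolding R_def by simp
  qed
  have dxy: "dist x y \<le> 9 * R" using xy dist_triangle[of x y z] unfolding R_def by (simp add: dist_commute)
  have nbx: "nb x \<noteq> x" "dist x (nb x) \<le> 9 * R" and nby: "nb y \<noteq> y" "dist y (nb y) \<le> 9 * R"
    using nb xy(1-3) dxy unfolding nearest_nb_def by (metis dist_commute order_trans)+
  have inb: "x \<in> ball z (20 * R)" "y \<in> ball z (20 * R)" "nb x \<in> ball z (20 * R)" "nb y \<in> ball z (20 * R)"
    using xy R nbx(2) nby(2) dist_triangle[of z "nb x" x] dist_triangle[of z "nb y" y] unfolding R_def by auto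
  have gr: "norm (grad F v - grad F w) \<le> 20 * R * m" if "v \<in> ball z (20 * R)" "w \<in> ball z (20 * R)" for v w
    using loc[rule_format, of "20 * R" w v] that R by auto
  have ta: "\<bar>F w - F v - grad F v \<bullet> (w - v)\<bar> \<le> norm (w - v) * (20 * R) * m" if "v \<in> ball z (20 * R)" "w \<in> ball z (20 * R)" for v w
    using loc[rule_format, of "20 * R" v w] that R by auto
  define a where "a v = (F (nb v) - F v) / norm (nb v - v) - dirv nb v \<bullet> grad F v" for v
  \<comment> \<open>The jet is the gradient, plus the tangential Taylor error \<open>a v\<close>,
    minus the normal part of the gradient.\<close>
  have dec: "tjet nb F v = grad F v + a v *\<^sub>R dirv nb v - nproj (dirv nb v) (grad F v)" for v
    unfolding tjet_def a_def nproj_def by (simp add: scaleR_diff_left)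
  have ab: "\<bar>a v\<bar> \<le> 20 * R * m" if "nb v \<noteq> v" "v \<in> ball z (20 * R)" "nb v \<in> ball z (20 * R)" for v
  proof -
    have nz: "norm (nb v - v) > 0" using that by simp
    have "a v = (F (nb v) - F v - grad F v \<bullet> (nb v - v)) / norm (nb v - v)"
      unfolding a_def dirv_def by (simp add: divide_inverse inner_commute left_diff_distrib right_diff_distrib mult.commute)
    then have "\<bar>a v\<bar> = \<bar>F (nb v) - F v - grad F v \<bullet> (nb v - v)\<bar> / norm (nb v - v)" by simp
    also have "\<dots> \<le> norm (nb v - v) * (20 * R) * m / norm (nb v - v)" using ta[OF that(2,3)] nz by (intro divide_right_mono) auto
    also have "\<dots> = 20 * R * m" using nz by simp
    finally show ?thesis .
  qed
  have ux: "norm (dirv nb x) = 1" "norm (dirv nb y) = 1" using norm_dirv nbx(1) nby(1) by auto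
  have ny: "norm (y - x) \<le> 9 * R" using dxy by (simp add: dist_norm norm_minus_commute)
  let ?Nx = "nproj (dirv nb x)" and ?Ny = "nproj (dirv nb y)"
  define t1 where "t1 = norm (?Nx (grad F y) - ?Ny (grad F y))"
  define t2 where "t2 = \<bar>?Nx (grad F y) \<bullet> (y - x)\<bar>"
  have Nd: "norm (?Nx (grad F x - grad F y)) \<le> 20 * R * m"
    using norm_nproj_le[OF ux(1), of "grad F x - grad F y"] gr[OF inb(1,2)] by linarith
  have "tjet nb F x - tjet nb F y = (grad F x - grad F y) + a x *\<^sub>R dirv nb x + (- (a y *\<^sub>R dirv nb y)) + (- ?Nx (grad F x - grad F y)) + (- (?Nx (grad F y) - ?Ny (grad F y)))"
    unfolding dec nproj_diff by simp
  also have "norm \<dots> \<le> norm (grad F x - grad F y) + \<bar>a x\<bar> + \<bar>a y\<bar> + norm (?Nx (grad F x - grad F y)) + t1"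
    unfolding t1_def by (intro order_trans[OF norm_triangle_ineq] add_mono) (auto simp: ux norm_minus_commute)
  also have "\<dots> \<le> 80 * R * m + t1" using gr[OF inb(1,2)] ab[OF nbx(1) inb(1,3)] ab[OF nby(1) inb(2,4)] Nd by linarith
  finally have "norm (tjet nb F x - tjet nb F y) powr p \<le> (80 * R * m + t1) powr p" using p by (intro powr_mono2) auto
  also have "\<dots> \<le> 2 powr p * ((80 * R * m) powr p + t1 powr p)" using p R m by (intro powr_sum_le) (auto simp: t1_def)
  also have "\<dots> \<le> 2 powr p * (80 powr p * (R powr p * m powr p) + 80 powr p * (R powr p * n0))"
  proof -
    have "t1 powr p \<le> 1 * (R powr p * n0)" using T1 unfolding t1_def R_def by simp
    also have "\<dots> \<le> 80 powr p * (R powr p * n0)" using p n0 by (intro mult_right_mono ge_one_powr_ge_zero) auto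
    finally show ?thesis using R m by (intro mult_left_mono add_mono) (auto simp: powr_mult)
  qed
  also have "\<dots> = R powr p * ((2 powr p * 80 powr p) * (m powr p + n0))" by (simp add: algebra_simps)
  also have "2 powr p * 80 powr p = (160::real) powr p" by (simp add: powr_mult[symmetric])
  also have "R powr p * (160 powr p * (m powr p + n0)) \<le> R powr p * (2000 powr p * (m powr p + n0))"
    using p n0 by (intro mult_left_mono mult_right_mono powr_mono2) auto
  finally show "norm (tjet nb F x - tjet nb F y) powr p \<le> infdist z E powr p * (2000 powr p * (m powr p + n0))" unfolding R_def .
  have Rm: "R * m \<ge> 0" using R m by simp
  have i1: "\<bar>F y - F x - grad F x \<bullet> (y - x)\<bar> \<le> 180 * R * (R * m)"
  proof -
    have "norm (y - x) * (20 * R) * m \<le> (9 * R) * (20 * R) * m" using ny R m by (intro mult_right_mono) auto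
    then show ?thesis using ta[OF inb(1,2)] by (simp add: mult_ac)
  qed
  have i2: "\<bar>a x * (dirv nb x \<bullet> (y - x))\<bar> \<le> 180 * R * (R * m)"
  proof -
    have "\<bar>dirv nb x \<bullet> (y - x)\<bar> \<le> 9 * R" using Cauchy_Schwarz_ineq2[of "dirv nb x" "y - x"] ux ny by simp
    then have "\<bar>a x\<bar> * \<bar>dirv nb x \<bullet> (y - x)\<bar> \<le> (20 * R * m) * (9 * R)" using ab[OF nbx(1) inb(1,3)] by (intro mult_mono) auto
    then show ?thesis by (simp add: abs_mult mult_ac)
  qed
  have i3: "\<bar>?Nx (grad F x - grad F y) \<bullet> (y - x)\<bar> \<le> 180 * R * (R * m)"
  proof -
    have "norm (?Nx (grad F x - grad F y)) * norm (y - x) \<le> (20 * R * m) * (9 * R)" using Nd ny Rm by (intro mult_mono) auto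
    then show ?thesis using Cauchy_Schwarz_ineq2[of "?Nx (grad F x - grad F y)" "y - x"] by (simp add: mult_ac)
  qed
  have "jet_gap F (tjet nb F) x y = - (F y - F x - grad F x \<bullet> (y - x)) + a x * (dirv nb x \<bullet> (y - x)) - ?Nx (grad F x - grad F y) \<bullet> (y - x) - ?Nx (grad F y) \<bullet> (y - x)"
    unfolding jet_gap_def dec nproj_diff by (simp add: inner_diff_left inner_add_left)
  then have "\<bar>jet_gap F (tjet nb F) x y\<bar> \<le> 540 * R * (R * m) + t2" using i1 i2 i3 unfolding t2_def by linarith
  then have "\<bar>jet_gap F (tjet nb F) x y\<bar> powr p \<le> (540 * R * (R * m) + t2) powr p" using p by (intro powr_mono2) auto
  also have "\<dots> \<le> 2 powr p * ((540 * R * (R * m)) powr p + t2 powr p)" using p R m by (intro powr_sum_le) (auto simp: t2_def)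
  also have "\<dots> \<le> 2 powr p * (540 powr p * (R powr p * R powr p * m powr p) + 540 powr p * (R powr p * R powr p * n0))"
  proof -
    have "t2 powr p \<le> 1 * (R powr p * R powr p * n0)" using T2 unfolding t2_def R_def by (simp add: powr_add[symmetric])
    also have "\<dots> \<le> 540 powr p * (R powr p * R powr p * n0)" using p n0 by (intro mult_right_mono ge_one_powr_ge_zero) auto
    finally show ?thesis using R m by (intro mult_left_mono add_mono) (auto simp: powr_mult mult_ac)
  qed
  also have "\<dots> = (R powr p * R powr p) * ((2 powr p * 540 powr p) * (m powr p + n0))" by (simp add: algebra_simps)
  also have "2 powr p * 540 powr p = (1080::real) powr p" by (simp add: powr_mult[symmetric])
  also have "R powr p * R powr p = R powr (2*p)" by (simp add: powr_add[symmetric])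
  also have "R powr (2*p) * (1080 powr p * (m powr p + n0)) \<le> R powr (2*p) * (2000 powr p * (m powr p + n0))"
    using p n0 by (intro mult_left_mono mult_right_mono powr_mono2) auto
  finally show "\<bar>jet_gap F (tjet nb F) x y\<bar> powr p \<le> infdist z E powr (2*p) * (2000 powr p * (m powr p + n0))" unfolding R_def .
qed

section \<open>Cross products and projections in the plane\<close>

definition crs :: "real^2 \<Rightarrow> real^2 \<Rightarrow> real" where "crs u w = u $ 1 * w $ 2 - u $ 2 * w $ 1"

lemma inner2: "(v::real^2) \<bullet> w = v $ 1 * w $ 1 + v $ 2 * w $ 2"
  by (simp add: inner_vec_def sum_2)

lemma norm_sq2: "(norm (v::real^2))\<^sup>2 = v $ 1 * v $ 1 + v $ 2 * v $ 2"
  by (simp add: dot_square_norm[symmetric] inner2)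

text \<open>The vector \<open>(w \<bullet> u) *\<^sub>R v - (w \<bullet> v) *\<^sub>R u\<close> has
  length \<open>norm w * \<bar>crs u v\<bar>\<close>. Two vectors almost orthogonal to the same w
  are therefore almost parallel.\<close>

lemma crs_bound: "norm w * \<bar>crs u v\<bar> \<le> \<bar>w \<bullet> u\<bar> * norm v + \<bar>w \<bullet> v\<bar> * norm u"
proof -
  have "(norm ((w \<bullet> u) *\<^sub>R v - (w \<bullet> v) *\<^sub>R u))\<^sup>2 = (norm w)\<^sup>2 * (crs u v)\<^sup>2"
    unfolding norm_sq2 inner2 crs_def by (simp add: algebra_simps power2_eq_square)
  then have "(norm ((w \<bullet> u) *\<^sub>R v - (w \<bullet> v) *\<^sub>R u))\<^sup>2 = (norm w * \<bar>crs u v\<bar>)\<^sup>2" by (simp add: power_mult_distrib)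
  then have "norm ((w \<bullet> u) *\<^sub>R v - (w \<bullet> v) *\<^sub>R u) = norm w * \<bar>crs u v\<bar>" by (simp add: power2_eq_iff_nonneg)
  then show ?thesis using norm_triangle_ineq4[of "(w \<bullet> u) *\<^sub>R v" "(w \<bullet> v) *\<^sub>R u"] by simp
qed

lemma abs_crs_le: "\<bar>crs u v\<bar> \<le> norm u * norm v"
proof -
  have "(crs u v)\<^sup>2 = (norm u)\<^sup>2 * (norm v)\<^sup>2 - (u \<bullet> v)\<^sup>2"
    unfolding norm_sq2 inner2 crs_def by (simp add: algebra_simps power2_eq_square)
  then have "\<bar>crs u v\<bar>\<^sup>2 \<le> (norm u * norm v)\<^sup>2" by (simp add: power_mult_distrib)
  then show ?thesis by (rule power2_le_imp_le) simp
qed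

text \<open>For a unit vector u the inner product of normal parts is
  \<open>crs u v * crs u w\<close>.\<close>

lemma nproj_inner_le: assumes "norm u = 1" shows "\<bar>nproj u v \<bullet> w\<bar> \<le> norm v * \<bar>crs u w\<bar>"
proof -
  have n: "u $ 1 * u $ 1 + u $ 2 * u $ 2 = 1" using norm_sq2[of u] assms by simp
  have "nproj u v \<bullet> w = (u $ 1 * u $ 1 + u $ 2 * u $ 2) * (v \<bullet> w) - (u \<bullet> v) * (u \<bullet> w)"
    unfolding n nproj_def by (simp add: inner_diff_left)
  also have "\<dots> = crs u v * crs u w" unfolding inner2 crs_def by (simp add: algebra_simps)
  finally show ?thesis using abs_crs_le[of u v] assms by (simp add: abs_mult mult_right_mono)
qed

text \<open>The projections onto two lines differ by the sine of their angle times an isometry, and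
  \<open>crs u w\<close> is that sine up to sign.\<close>

lemma nproj_diff_le: assumes "norm u = 1" "norm w = 1" shows "norm (nproj u v - nproj w v) \<le> norm v * \<bar>crs u w\<bar>"
proof -
  have n: "u $ 1 * u $ 1 + u $ 2 * u $ 2 = 1" "w $ 1 * w $ 1 + w $ 2 * w $ 2 = 1" using norm_sq2[of u] norm_sq2[of w] assms by auto
  have "(norm (nproj u v - nproj w v))\<^sup>2 = (norm ((w \<bullet> v) *\<^sub>R w - (u \<bullet> v) *\<^sub>R u))\<^sup>2" by (simp add: nproj_def)
  also have "\<dots> = (norm v)\<^sup>2 * (crs u w)\<^sup>2"
  proof -
    have "((c*e+d*f)*c - (a*e+b*f)*a) * ((c*e+d*f)*c - (a*e+b*f)*a) + ((c*e+d*f)*d - (a*e+b*f)*b) * ((c*e+d*f)*d - (a*e+b*f)*b)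
        = (e*e+f*f) * ((a*d-b*c) * (a*d-b*c))" if "a*a+b*b = 1" "c*c+d*d = 1" for a b c d e f :: real
      using that by algebra
    from this[OF n] show ?thesis unfolding norm_sq2 inner2 crs_def power2_eq_square[of "_ - _"] by simp
  qed
  finally have "(norm (nproj u v - nproj w v))\<^sup>2 \<le> (norm v * \<bar>crs u w\<bar>)\<^sup>2" by (simp add: power_mult_distrib)
  then show ?thesis by (rule power2_le_imp_le) simp
qed

lemma inner_dirv_le:
  assumes "nb x \<noteq> x" "\<bar>w \<bullet> (nb x - x)\<bar> \<le> norm (nb x - x) * c" shows "\<bar>w \<bullet> dirv nb x\<bar> \<le> c"
proof -
  have "norm (nb x - x) > 0" using assms by simp
  then show ?thesis using assms(2) unfolding dirv_def inner_scaleR_right by (simp add: abs_mult field_simps)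
qed

text \<open>The two cross products are those by which \<open>nproj_diff_le\<close> and
  \<open>nproj_inner_le\<close> bound the normal parts; each has the power of R that its use
  requires.\<close>

abbreviation directions_parallel :: "(real^2) set \<Rightarrow> (real^2 \<Rightarrow> real^2) \<Rightarrow> real^2 \<Rightarrow> real \<Rightarrow> real^2 \<Rightarrow> real \<Rightarrow> bool" where
  "directions_parallel E nb i r z c \<equiv> \<forall>R>0. ball z (40 * R) \<subseteq> ball i (r / 2) \<longrightarrow> (\<forall>x\<in>E. \<forall>y\<in>E. {x, y, nb x, nb y} \<subseteq> E \<inter> ball z (20 * R) \<longrightarrow>
     nb x \<noteq> x \<longrightarrow> nb y \<noteq> y \<longrightarrow> dist x y \<le> 9 * R \<longrightarrow>
     \<bar>crs (dirv nb x) (dirv nb y)\<bar> \<le> 120 * R * c \<and> \<bar>crs (dirv nb x) (y - x)\<bar> \<le> 1080 * R * R * c)"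

abbreviation parallel_bound :: "real \<Rightarrow> real \<Rightarrow> real \<Rightarrow> bool" where
  "parallel_bound p \<kappa> C \<equiv> \<forall>E i r nb. r > 0 \<longrightarrow> curved_ok \<kappa> p E i r \<longrightarrow> (\<exists>\<mu>. \<mu> \<in> borel_measurable borel \<and> (\<forall>z. \<mu> z \<ge> 0) \<and>
     (\<integral>\<^sup>+z. ennreal (\<mu> z powr p) \<partial>lborel) \<le> ennreal (C * r powr (2 - p)) \<and>
     (AE z in lborel. directions_parallel E nb i r z (\<mu> z)))"

text \<open>Near a point \<open>i\<close> where \<open>E\<close> is close to the zero set of a function with unit gradient, the
  directions to nearest neighbours are nearly parallel to this zero set, hence to each other.\<close>

lemma curved_parallel:
  assumes p: "p > 2"
  shows "\<exists>\<kappa>>0. \<exists>C>0. parallel_bound p \<kappa> C"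
proof -
  obtain Ch where Ch: "Ch > 0" "\<forall>F g z R x y. sob p F g \<longrightarrow> R > 0 \<longrightarrow> x \<in> ball z R \<longrightarrow> y \<in> ball z R \<longrightarrow>
       norm (grad F y - grad F x) \<le> Ch * R powr (1 - 2/p) * hint p g z (2*R) powr (1/p)"
    using sob_grad_holder[OF p] by (elim exE conjE) (rule that)
  obtain Cm where Cm: "Cm > 0" "\<forall>F g S. sob p F g \<longrightarrow> S \<in> sets borel \<longrightarrow> (\<exists>m. taylor_majorant Cm p F g S m)"
    using sob_max[OF p] by (elim exE conjE) (rule that)
  \<comment> \<open>With this threshold the gradient of a witness changes by at most 1/2 within half
    the radius, so it keeps at least half of its unit length.\<close>
  define \<kappa> where "\<kappa> = (1 / (2 * Ch)) powr p"
  have k0: "\<kappa> > 0" unfolding \<kappa>_def using Ch by simp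
  have kp: "\<kappa> powr (1/p) = 1 / (2 * Ch)" unfolding \<kappa>_def using Ch p by (simp add: powr_powr)
  have Ck: "Cm * \<kappa> > 0" using k0 Cm(1) by simp
  show ?thesis
  proof (rule exI[of _ \<kappa>], rule conjI[OF k0], rule exI[of _ "Cm * \<kappa>"], rule conjI[OF Ck], intro allI impI)
    fix E :: "(real^2) set" and i r nb assume r: "r > (0::real)" and ok: "curved_ok \<kappa> p E i r"
    obtain F g where F: "sob p F g" and z0: "\<forall>y\<in>E \<inter> ball i r. F y = 0" and g1: "norm (grad F i) = 1" and h: "hint p g i r \<le> \<kappa> * r powr (2 - p)"
      using ok unfolding curved_ok_def by (elim exE conjE) (rule that)
    have big: "norm (grad F x) \<ge> 1/2" if x: "x \<in> ball i (r/2)" for x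
    proof -
      have "norm (grad F x - grad F i) \<le> Ch * (r/2) powr (1 - 2/p) * hint p g i r powr (1/p)"
        using Ch(2)[rule_format, OF F, of "r/2" i i x] x r by simp
      also have "\<dots> \<le> Ch * r powr (1 - 2/p) * (\<kappa> * r powr (2 - p)) powr (1/p)"
        using h Ch(1) p r hint_nonneg by (intro mult_mono mult_left_mono powr_mono2) auto
      also have "\<dots> = Ch * \<kappa> powr (1/p) * (r powr (1 - 2/p) * r powr ((2 - p) * (1/p)))"
        using k0 r by (simp add: powr_mult powr_powr)
      also have "r powr (1 - 2/p) * r powr ((2 - p) * (1/p)) = 1"
      proof -
        have "(1 - 2/p) + (2 - p) * (1/p) = 0" using p by (simp add: field_simps)
        then show ?thesis using r by (simp only: powr_add[symmetric]) simp
      qed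
      also have "Ch * \<kappa> powr (1/p) * 1 = 1/2" unfolding kp using Ch(1) by simp
      finally show ?thesis using g1 norm_triangle_ineq2[of "grad F i" "grad F x"] by (simp add: norm_minus_commute)
    qed
    have "ball i r \<in> sets borel" by simp
    then obtain \<mu> where mu: "\<mu> \<in> borel_measurable borel" "\<forall>z. \<mu> z \<ge> 0" 
       and mi: "(\<integral>\<^sup>+z. ennreal (\<mu> z powr p) \<partial>lborel) \<le> ennreal Cm * (\<integral>\<^sup>+z. ennreal (hnorm g z powr p) * indicator (ball i r) z \<partial>lborel)"
       and ae: "AE z in lborel. \<forall>R>0. ball z (2*R) \<subseteq> ball i r \<longrightarrow> taylor_ctrl F z R (\<mu> z)"
      using Cm(2)[rule_format, OF F, of "ball i r"] by simp (elim exE conjE, rule that)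
    show "\<exists>\<mu>. \<mu> \<in> borel_measurable borel \<and> (\<forall>z. \<mu> z \<ge> 0) \<and>
     (\<integral>\<^sup>+z. ennreal (\<mu> z powr p) \<partial>lborel) \<le> ennreal (Cm * \<kappa> * r powr (2 - p)) \<and>
     (AE z in lborel. directions_parallel E nb i r z (\<mu> z))"
    proof (intro exI[of _ \<mu>] conjI mu(1) mu(2))
      have "ennreal Cm * (\<integral>\<^sup>+z. ennreal (hnorm g z powr p) * indicator (ball i r) z \<partial>lborel) \<le> ennreal Cm * ennreal (\<kappa> * r powr (2 - p))"
        unfolding nn_hint[OF F order.strict_trans[OF zero_less_numeral p]] by (intro mult_left_mono ennreal_leI h) auto
      also have "\<dots> = ennreal (Cm * \<kappa> * r powr (2 - p))" using Cm(1) k0 by (simp add: ennreal_mult[symmetric] mult.assoc)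
      finally show "(\<integral>\<^sup>+z. ennreal (\<mu> z powr p) \<partial>lborel) \<le> ennreal (Cm * \<kappa> * r powr (2 - p))" using mi by (rule order_trans[rotated])
      show "AE z in lborel. directions_parallel E nb i r z (\<mu> z)"
        using ae
      proof (rule AE_mp, intro AE_I2 impI allI ballI conjI)
        fix z R x y
        assume l: "\<forall>R>0. ball z (2*R) \<subseteq> ball i r \<longrightarrow> taylor_ctrl F z R (\<mu> z)"
          and R: "0 < (R::real)" and sub: "ball z (40 * R) \<subseteq> ball i (r / 2)" and xy: "x \<in> E" "y \<in> E" "{x, y, nb x, nb y} \<subseteq> E \<inter> ball z (20 * R)"
          and nx: "nb x \<noteq> x" and ny: "nb y \<noteq> y" and d: "dist x y \<le> 9 * R"
        have sub2: "ball z (2 * (20 * R)) \<subseteq> ball i r" using subset_trans[OF sub, of "ball i r"] r by (simp add: subset_ball)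
        have in20: "x \<in> ball z (20 * R)" "y \<in> ball z (20 * R)" "nb x \<in> ball z (20 * R)" "nb y \<in> ball z (20 * R)" using xy(3) by auto
        have inr: "v \<in> ball i r" "v \<in> ball i (r/2)" if "v \<in> ball z (20 * R)" for v
        proof -
          have "v \<in> ball z (40 * R)" using that R by auto
          then have "v \<in> ball i (r/2)" using sub by blast
          then show "v \<in> ball i r" "v \<in> ball i (r/2)" using r by auto
        qed
        have F0: "F x = 0" "F y = 0" "F (nb x) = 0" "F (nb y) = 0" using z0 xy(3) inr(1)[OF in20(1)] inr(1)[OF in20(2)] inr(1)[OF in20(3)] inr(1)[OF in20(4)] by auto
        have gr: "norm (grad F w - grad F v) \<le> 20 * R * \<mu> z" "\<bar>F w - F v - grad F v \<bullet> (w - v)\<bar> \<le> norm (w - v) * (20 * R) * \<mu> z" 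
          if "v \<in> ball z (20 * R)" "w \<in> ball z (20 * R)" for v w
          using l[rule_format, OF _ sub2 that] R by auto
        define w where "w = grad F y"
        have wb: "norm w \<ge> 1/2" unfolding w_def using big inr(2)[OF in20(2)] by blast
        have ux: "norm (dirv nb x) = 1" "norm (dirv nb y) = 1" using norm_dirv nx ny by auto
        have a: "\<bar>grad F x \<bullet> dirv nb x\<bar> \<le> 20 * R * \<mu> z" using gr(2)[OF in20(1,3)] F0 by (intro inner_dirv_le[where nb=nb and x=x, OF nx]) (simp add: mult.assoc)
        have b: "\<bar>w \<bullet> dirv nb y\<bar> \<le> 20 * R * \<mu> z" unfolding w_def using gr(2)[OF in20(2,4)] F0 by (intro inner_dirv_le[where nb=nb and x=y, OF ny]) (simp add: mult.assoc)
        \<comment> \<open>The gradient at y replaces the one at x, so that both directions are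
          tested against the same vector and \<open>crs_bound\<close> applies. The sum 20 + 40 is
          doubled because w has length at least 1/2.\<close>
        have c: "\<bar>w \<bullet> dirv nb x\<bar> \<le> 40 * R * \<mu> z"
        proof -
          have "\<bar>(w - grad F x) \<bullet> dirv nb x\<bar> \<le> 20 * R * \<mu> z" using Cauchy_Schwarz_ineq2[of "w - grad F x" "dirv nb x"] gr(1)[OF in20(1,2)] unfolding ux w_def by simp
          then show ?thesis using a by (simp add: inner_diff_left)
        qed
        have half: "(1/2) * t \<le> norm w * t" if "t \<ge> 0" for t using wb that by (rule mult_right_mono)
        have "norm w * \<bar>crs (dirv nb x) (dirv nb y)\<bar> \<le> 60 * R * \<mu> z"
          using crs_bound[of w "dirv nb x" "dirv nb y"] b c unfolding ux by simp
        then show "\<bar>crs (dirv nb x) (dirv nb y)\<bar> \<le> 120 * R * \<mu> z" using half[of "\<bar>crs (dirv nb x) (dirv nb y)\<bar>"] by simp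
        have ny9: "norm (y - x) \<le> 9 * R" using d by (simp add: dist_norm norm_minus_commute)
        have Rm: "R * \<mu> z \<ge> 0" using R mu(2) by simp
        have e: "\<bar>w \<bullet> (y - x)\<bar> \<le> 180 * R * R * \<mu> z"
        proof -
          have "\<bar>w \<bullet> (y - x)\<bar> \<le> norm (y - x) * (20 * R * \<mu> z)" using gr(2)[OF in20(2,1)] F0 unfolding w_def by (simp add: inner_diff_right norm_minus_commute mult.assoc abs_minus_commute)
          also have "\<dots> \<le> (9 * R) * (20 * R * \<mu> z)" using ny9 Rm by (intro mult_right_mono) auto
          finally show ?thesis by (simp add: mult_ac)
        qed
        have "\<bar>w \<bullet> dirv nb x\<bar> * norm (y - x) \<le> (40 * R * \<mu> z) * (9 * R)" using c ny9 Rm by (intro mult_mono) auto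
        then have "norm w * \<bar>crs (dirv nb x) (y - x)\<bar> \<le> 540 * R * R * \<mu> z"
          using crs_bound[of w "dirv nb x" "y - x"] e unfolding ux by (simp add: mult_ac)
        then show "\<bar>crs (dirv nb x) (y - x)\<bar> \<le> 1080 * R * R * \<mu> z" using half[of "\<bar>crs (dirv nb x) (y - x)\<bar>"] by simp
      qed
    qed
  qed
qed

text \<open>The gradient at y differs from that at a point k of \<open>K\<close> by at most
  \<open>b * m z\<close>, and the gradient at k is part of the error density. For the remainder
  after subtracting the first extension, gradients on \<open>K\<close> are such errors.\<close>

lemma grad_bound_via_errdens:
  assumes p: "p > 0" and K: "finite K" "k \<in> K" and r: "r k > 0" and m: "m z \<ge> 0"
    and loc: "\<forall>R>0. \<forall>x\<in>ball z R. \<forall>y\<in>ball z R. norm (D y - D x) \<le> R * m z"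
    and b: "dist z y < b" "r k \<le> b" "dist z k < b"
  shows "norm (D y) powr p \<le> (2 * b) powr p * (m z powr p + errdens p K r (\<lambda>k. norm (D k)) z)"
proof -
  have b0: "b > 0" using b(2) r by simp
  have "norm (D y - D k) \<le> b * m z" using loc b b0 by simp
  then have "norm (D y) \<le> b * m z + norm (D k)" using norm_triangle_sub[of "D y" "D k"] by simp
  then have "norm (D y) powr p \<le> (b * m z + norm (D k)) powr p" using p by (intro powr_mono2) auto
  also have "\<dots> \<le> 2 powr p * ((b * m z) powr p + norm (D k) powr p)" using p b0 m by (intro powr_sum_le) auto
  also have "\<dots> \<le> 2 powr p * (b powr p * m z powr p + b powr p * errdens p K r (\<lambda>k. norm (D k)) z)"
  proof -
    have "norm (D k) powr p \<le> b powr p * errdens p K r (\<lambda>k. norm (D k)) z"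
      by (rule errdens_ge[where k=k and H="\<lambda>k. norm (D k)" and r=r, OF p K]) (use r b in auto)
    then show ?thesis using m b0 by (intro mult_left_mono add_mono) (auto simp: powr_mult)
  qed
  also have "\<dots> = (2 * b) powr p * (m z powr p + errdens p K r (\<lambda>k. norm (D k)) z)" using b0 by (simp add: powr_mult algebra_simps)
  finally show ?thesis .
qed

text \<open>The pointwise bound holds at almost every z of the ball of radius
  \<open>r i / 16\<close> around i and is averaged over it. The area yields the power
  \<open>2 - p\<close>; 100 exceeds 256/pi, and 10 is twice the radius \<open>5 * r i\<close> that
  reaches k.\<close>

lemma near_grad_bound:
  assumes p: "p > 2" and K: "finite K" "k \<in> K" and r: "r k > 0" "r k \<le> r i" "dist i k \<le> 4 * r i" and m: "m \<in> borel_measurable borel" "\<forall>z. m z \<ge> 0"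
    and loc: "AE z in lborel. \<forall>R>0. \<forall>x\<in>ball z R. \<forall>y\<in>ball z R. norm (D y - D x) \<le> R * m z"
    and y: "dist i y \<le> r i / 8"
  shows "ennreal (norm (D y) powr p * r i powr (2 - p)) \<le> ennreal (100 * 10 powr p) *
     (\<integral>\<^sup>+z. ennreal (m z powr p + errdens p K r (\<lambda>k. norm (D k)) z) * indicator (ball i (r i / 16)) z \<partial>lborel)"
proof -
  note [measurable] = m(1)
  define a where "a = norm (D y) powr p"
  define \<rho> where "\<rho> = r i"
  define h where "h z = m z powr p + errdens p K r (\<lambda>k. norm (D k)) z" for z
  have [measurable]: "h \<in> borel_measurable borel" unfolding h_def[abs_def] by measurable
  have rho: "\<rho> > 0" using r unfolding \<rho>_def by linarith
  have h0: "h z \<ge> 0" for z unfolding h_def using errdens_nonneg by simp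
  have "AE z in lborel. ennreal a * indicator (ball i (\<rho> / 16)) z \<le> ennreal ((10 * \<rho>) powr p) * (ennreal (h z) * indicator (ball i (\<rho> / 16)) z)"
    using loc
  proof (rule AE_mp, intro AE_I2 impI)
    fix z assume l: "\<forall>R>0. \<forall>x\<in>ball z R. \<forall>y\<in>ball z R. norm (D y - D x) \<le> R * m z"
    show "ennreal a * indicator (ball i (\<rho> / 16)) z \<le> ennreal ((10 * \<rho>) powr p) * (ennreal (h z) * indicator (ball i (\<rho> / 16)) z)"
    proof (cases "z \<in> ball i (\<rho> / 16)")
      case True
      then have d: "dist z i < \<rho> / 16" by (simp add: dist_commute)
      have "a \<le> (2 * (5 * \<rho>)) powr p * h z" unfolding a_def h_def
        by (rule grad_bound_via_errdens[where k=k and r=r and m=m and D=D, OF _ K r(1) _ l])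
           (use p m(2) d rho r y dist_triangle[of z y i] dist_triangle[of z k i] in \<open>auto simp: \<rho>_def\<close>)
      then show ?thesis using True h0 by (simp add: ennreal_mult[symmetric] ennreal_leI)
    qed simp
  qed
  then have "(\<integral>\<^sup>+z. ennreal a * indicator (ball i (\<rho> / 16)) z \<partial>lborel) \<le> (\<integral>\<^sup>+z. ennreal ((10 * \<rho>) powr p) * (ennreal (h z) * indicator (ball i (\<rho> / 16)) z) \<partial>lborel)"
    by (rule nn_integral_mono_AE)
  also have "\<dots> = ennreal ((10 * \<rho>) powr p) * (\<integral>\<^sup>+z. ennreal (h z) * indicator (ball i (\<rho> / 16)) z \<partial>lborel)"
    by (rule nn_integral_cmult, intro borel_measurable_times_ennreal borel_measurable_indicator) auto
  also have "(\<integral>\<^sup>+z. ennreal a * indicator (ball i (\<rho> / 16)) z \<partial>lborel) = ennreal a * emeasure lborel (ball i (\<rho> / 16))"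
    by (rule nn_integral_cmult_indicator) simp
  also have "emeasure lborel (ball i (\<rho> / 16)) = ennreal (pi * (\<rho> / 16)\<^sup>2)"
    using rho by (simp add: emeasure_ball unit_ball_vol_2)
  finally have main: "ennreal a * ennreal (pi * (\<rho> / 16)\<^sup>2) \<le> ennreal ((10 * \<rho>) powr p) * (\<integral>\<^sup>+z. ennreal (h z) * indicator (ball i (\<rho> / 16)) z \<partial>lborel)" .
  have "ennreal (a * \<rho> powr (2 - p)) \<le> ennreal (100 * \<rho> powr (-p)) * (ennreal a * ennreal (pi * (\<rho> / 16)\<^sup>2))"
  proof -
    have e: "\<rho> powr (2 - p) = \<rho> powr (-p) * \<rho>\<^sup>2"
      using rho by (simp add: powr_diff powr_minus divide_inverse mult.commute)
    have "\<rho>\<^sup>2 \<le> 100 * (pi * (\<rho> / 16)\<^sup>2)" 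
    proof -
      have "(256/100) * \<rho>\<^sup>2 \<le> pi * \<rho>\<^sup>2" using pi_gt3 by (intro mult_right_mono) auto
      then show ?thesis by (simp add: power_divide)
    qed
    then have "a * \<rho> powr (-p) * \<rho>\<^sup>2 \<le> a * \<rho> powr (-p) * (100 * (pi * (\<rho> / 16)\<^sup>2))" unfolding a_def by (intro mult_left_mono) auto
    then have "a * \<rho> powr (2 - p) \<le> (100 * \<rho> powr (-p)) * (a * (pi * (\<rho> / 16)\<^sup>2))" unfolding e by (simp add: mult_ac)
    then have "ennreal (a * \<rho> powr (2 - p)) \<le> ennreal ((100 * \<rho> powr (-p)) * (a * (pi * (\<rho> / 16)\<^sup>2)))" by (rule ennreal_leI)
    then show ?thesis by (simp only: ennreal_mult' zero_le_mult_iff powr_ge_zero a_def zero_le_numeral norm_ge_zero disjI1 simp_thms)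
  qed
  also have "\<dots> \<le> ennreal (100 * \<rho> powr (-p)) * (ennreal ((10 * \<rho>) powr p) * (\<integral>\<^sup>+z. ennreal (h z) * indicator (ball i (\<rho> / 16)) z \<partial>lborel))"
    by (rule mult_left_mono[OF main]) simp
  also have "\<dots> = ennreal (100 * 10 powr p) * (\<integral>\<^sup>+z. ennreal (h z) * indicator (ball i (\<rho> / 16)) z \<partial>lborel)"
  proof -
    have "100 * \<rho> powr (-p) * ((10 * \<rho>) powr p) = 100 * 10 powr p" using rho by (simp add: powr_mult powr_minus)
    then have "ennreal (100 * \<rho> powr (-p)) * ennreal ((10 * \<rho>) powr p) = ennreal (100 * 10 powr p)" by (simp add: ennreal_mult[symmetric])
    then show ?thesis by (simp only: mult.assoc[symmetric])
  qed
  finally show ?thesis unfolding a_def \<rho>_def h_def .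
qed

text \<open>The two quantities are the ones left open in \<open>tangential_jets_density\<close>. A
  vector field D takes the place of the gradient, since only its oscillation is used.\<close>

abbreviation normals_dominated :: "real \<Rightarrow> (real^2) set \<Rightarrow> (real^2 \<Rightarrow> real^2) \<Rightarrow> (real^2 \<Rightarrow> real^2) \<Rightarrow> real^2 \<Rightarrow> real \<Rightarrow> bool" where
  "normals_dominated p E nb D z c \<equiv> \<forall>x\<in>E. \<forall>y\<in>E. x \<noteq> y \<longrightarrow> dist z y = infdist z E \<longrightarrow> dist z x \<le> 8 * infdist z E \<longrightarrow>
     norm (nproj (dirv nb x) (D y) - nproj (dirv nb y) (D y)) powr p \<le> infdist z E powr p * c \<and>
     \<bar>nproj (dirv nb x) (D y) \<bullet> (y - x)\<bar> powr p \<le> infdist z E powr (2*p) * c"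

abbreviation normal_density_bound :: "real \<Rightarrow> real \<Rightarrow> real \<Rightarrow> bool" where
  "normal_density_bound p \<kappa> C \<equiv> \<forall>E nb r K D m B. finite E \<longrightarrow> nearest_nb E nb \<longrightarrow> (\<forall>x\<in>E. r x > 0 \<and> curved_ok \<kappa> p E x (r x)) \<longrightarrow>
     K \<subseteq> E \<longrightarrow> (\<forall>x\<in>E. \<exists>k\<in>K. r k \<le> r x \<and> dist x k \<le> 4 * r x) \<longrightarrow> m \<in> borel_measurable borel \<longrightarrow> (\<forall>z. m z \<ge> 0) \<longrightarrow>
     (AE z in lborel. \<forall>R>0. \<forall>x\<in>ball z R. \<forall>y\<in>ball z R. norm (D y - D x) \<le> R * m z) \<longrightarrow> B \<ge> 0 \<longrightarrow>
     (\<integral>\<^sup>+z. ennreal (m z powr p + errdens p K r (\<lambda>k. norm (D k)) z) \<partial>lborel) \<le> ennreal B \<longrightarrow>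
     (\<exists>n. n \<in> borel_measurable borel \<and> (\<forall>z. n z \<ge> 0) \<and> (\<integral>\<^sup>+z. ennreal (n z) \<partial>lborel) \<le> ennreal (C * B) \<and>
        (AE z in lborel. normals_dominated p E nb D z (n z)))"

text \<open>At distances from \<open>E\<close> large against the local scale the gradient itself is
  small, being controlled from \<open>K\<close>. At small distances the normal parts almost cancel;
  the gradient is then only a factor, which is taken out as a maximum over a ball, and the energies
  of the cross products are summed over a cover by balls of controlled overlap.\<close>

lemma normal_density:
  assumes p: "p > 2"
  shows "\<exists>\<kappa>>0. \<exists>C>0. normal_density_bound p \<kappa> C"
proof -
  obtain \<kappa> C1 where k: "\<kappa> > 0" and C1: "C1 > 0" and par: "parallel_bound p \<kappa> C1"
    using curved_parallel[OF p] by (elim exE conjE) (rule that)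
  \<comment> \<open>Covers all numerical factors below; the largest of them is 9 * 1604.\<close>
  define Q :: real where "Q = 100000 powr p"
  define A :: real where "A = 100 * 10 powr p"
  have QA: "Q > 0" "A > 0" unfolding Q_def A_def by auto
  define C where "C = Q * (1 + C1 * A)"
  have C: "C > 0" unfolding C_def using QA C1 by (simp add: add_pos_pos)
  show ?thesis
  proof (rule exI[of _ \<kappa>], rule conjI[OF k], rule exI[of _ C], rule conjI[OF C], intro allI impI)
    fix E K :: "(real^2) set" and nb D :: "real^2 \<Rightarrow> real^2" and r m :: "real^2 \<Rightarrow> real" and B :: real
    assume E: "finite E" and nb: "nearest_nb E nb" and r: "\<forall>x\<in>E. r x > 0 \<and> curved_ok \<kappa> p E x (r x)" and K: "K \<subseteq> E" "\<forall>x\<in>E. \<exists>k\<in>K. r k \<le> r x \<and> dist x k \<le> 4 * r x"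
      and m: "m \<in> borel_measurable borel" "\<forall>z. m z \<ge> 0" and loc: "AE z in lborel. \<forall>R>0. \<forall>x\<in>ball z R. \<forall>y\<in>ball z R. norm (D y - D x) \<le> R * m z"
      and B: "B \<ge> 0" "(\<integral>\<^sup>+z. ennreal (m z powr p + errdens p K r (\<lambda>k. norm (D k)) z) \<partial>lborel) \<le> ennreal B"
    have fK: "finite K" using K(1) E finite_subset by blast
    \<comment> \<open>Largest scales first, in contrast to \<open>K\<close>: every point y is within
      \<open>r i / 8\<close> of some i with \<open>r i \<ge> r y\<close>, while the balls of radius
      \<open>r i / 16\<close> stay disjoint.\<close>
    obtain I where I: "I \<subseteq> E" "\<forall>k\<in>I. \<forall>k'\<in>I. k \<noteq> k' \<longrightarrow> r k / 16 + r k' / 16 < dist k k'"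
      "\<forall>x\<in>E. \<exists>k\<in>I. - r k \<le> - r x \<and> (x = k \<or> dist x k \<le> r x / 16 + r k / 16)"
      using greedy_separated[OF E, of "\<lambda>x. r x / 16" "\<lambda>x. - r x"] by (elim exE conjE) (rule that)
    have fI: "finite I" using I(1) E finite_subset by blast
    have "\<forall>i\<in>I. \<exists>\<mu>. \<mu> \<in> borel_measurable borel \<and> (\<forall>z. \<mu> z \<ge> 0) \<and>
     (\<integral>\<^sup>+z. ennreal (\<mu> z powr p) \<partial>lborel) \<le> ennreal (C1 * r i powr (2 - p)) \<and>
     (AE z in lborel. directions_parallel E nb i (r i) z (\<mu> z))"
      by (intro ballI par[rule_format]) (use r I(1) in auto)
    then obtain \<mu> where mu: "\<forall>i\<in>I. \<mu> i \<in> borel_measurable borel \<and> (\<forall>z. \<mu> i z \<ge> 0) \<and>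
     (\<integral>\<^sup>+z. ennreal (\<mu> i z powr p) \<partial>lborel) \<le> ennreal (C1 * r i powr (2 - p)) \<and>
     (AE z in lborel. directions_parallel E nb i (r i) z (\<mu> i z))"
      unfolding bchoice_iff by (elim exE) (rule that)
    have mum: "\<mu> i \<in> borel_measurable borel" and mu0: "\<mu> i z \<ge> 0" if "i \<in> I" for i z using mu that by auto
    have mui: "(\<integral>\<^sup>+z. ennreal (\<mu> i z powr p) \<partial>lborel) \<le> ennreal (C1 * r i powr (2 - p))" if "i \<in> I" for i using mu that by auto
    have muae: "AE z in lborel. \<forall>i\<in>I. directions_parallel E nb i (r i) z (\<mu> i z)"
      by (rule AE_finite_allI[OF fI]) (use mu in blast)
    \<comment> \<open>The largest gradient that can occur as factor of a cross product controlled
      from i; the maximum is attained at a point to which \<open>near_grad_bound\<close>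
      applies.\<close>
    define \<Delta> where "\<Delta> i = Max ((\<lambda>y. norm (D y)) ` (E \<inter> cball i (r i / 8)))" for i
    have Dle: "norm (D y) \<le> \<Delta> i" if "y \<in> E" "dist i y \<le> r i / 8" for i y
      unfolding \<Delta>_def by (rule Max_ge) (use E that in auto)
    have Dat: "\<exists>y\<in>E. dist i y \<le> r i / 8 \<and> \<Delta> i = norm (D y)" if "i \<in> I" for i
    proof -
      have "i \<in> E \<inter> cball i (r i / 8)" using that I(1) r by (auto simp: less_imp_le)
      then have "\<Delta> i \<in> (\<lambda>y. norm (D y)) ` (E \<inter> cball i (r i / 8))" unfolding \<Delta>_def by (intro Max_in) (use E in auto)
      then show ?thesis by auto
    qed
    define h where "h z = m z powr p + errdens p K r (\<lambda>k. norm (D k)) z" for z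
    have h0: "h z \<ge> 0" for z unfolding h_def using errdens_nonneg by simp
    have hm: "h \<in> borel_measurable borel" unfolding h_def[abs_def] using m(1) by measurable
    \<comment> \<open>By \<open>near_grad_bound\<close> the factor \<open>\<Delta> i powr p\<close>
      cancels the power of \<open>r i\<close> in the integral of \<open>\<mu> i z powr p\<close>,
      leaving the integral of \<open>h\<close> over the i-th disjoint ball.\<close>
    define s where "s z = (\<Sum>i\<in>I. \<Delta> i powr p * \<mu> i z powr p)" for z
    have s0: "s z \<ge> 0" for z unfolding s_def by (intro sum_nonneg) auto
    have sm: "s \<in> borel_measurable borel" unfolding s_def[abs_def] using mum by measurable
    have sge: "\<Delta> i powr p * \<mu> i z powr p \<le> s z" if "i \<in> I" for i z
      unfolding s_def by (rule member_le_sum[where f="\<lambda>i. \<Delta> i powr p * \<mu> i z powr p"]) (use that fI in auto)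
    show "\<exists>n. n \<in> borel_measurable borel \<and> (\<forall>z. n z \<ge> 0) \<and> (\<integral>\<^sup>+z. ennreal (n z) \<partial>lborel) \<le> ennreal (C * B) \<and>
        (AE z in lborel. normals_dominated p E nb D z (n z))"
    proof (intro exI[of _ "\<lambda>z. Q * (h z + s z)"] conjI)
      show "(\<lambda>z. Q * (h z + s z)) \<in> borel_measurable borel" using hm sm by measurable
      show "\<forall>z. 0 \<le> Q * (h z + s z)" using h0 s0 QA by simp
      have ints: "(\<integral>\<^sup>+z. ennreal (s z) \<partial>lborel) \<le> ennreal (C1 * A * B)"
      proof -
        have "(\<integral>\<^sup>+z. ennreal (s z) \<partial>lborel) = (\<integral>\<^sup>+z. (\<Sum>i\<in>I. ennreal (\<Delta> i powr p) * ennreal (\<mu> i z powr p)) \<partial>lborel)"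
          unfolding s_def by (intro nn_integral_cong) (simp add: sum_ennreal[symmetric] ennreal_mult)
        also have "\<dots> = (\<Sum>i\<in>I. ennreal (\<Delta> i powr p) * (\<integral>\<^sup>+z. ennreal (\<mu> i z powr p) \<partial>lborel))"
          using mum by (subst nn_integral_sum) (auto intro!: sum.cong nn_integral_cmult)
        also have "\<dots> \<le> (\<Sum>i\<in>I. ennreal (C1 * A) * (\<integral>\<^sup>+z. ennreal (h z) * indicator (ball i (r i / 16)) z \<partial>lborel))"
        proof (rule sum_mono)
          fix i assume i: "i \<in> I"
          obtain y where y: "y \<in> E" "dist i y \<le> r i / 8" "\<Delta> i = norm (D y)" using Dat[OF i] by (elim bexE conjE) (rule that)
          obtain k where k: "k \<in> K" "r k \<le> r i" "dist i k \<le> 4 * r i" using K(2) i I(1) by blast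
          have "ennreal (\<Delta> i powr p) * (\<integral>\<^sup>+z. ennreal (\<mu> i z powr p) \<partial>lborel) \<le> ennreal (\<Delta> i powr p) * ennreal (C1 * r i powr (2 - p))"
            by (rule mult_left_mono[OF mui[OF i]]) simp
          also have "\<dots> = ennreal C1 * ennreal (norm (D y) powr p * r i powr (2 - p))"
            unfolding y(3) using C1 by (simp add: ennreal_mult[symmetric] mult_ac)
          also have "\<dots> \<le> ennreal C1 * (ennreal A * (\<integral>\<^sup>+z. ennreal (h z) * indicator (ball i (r i / 16)) z \<partial>lborel))"
            unfolding A_def h_def
            by (rule mult_left_mono[OF near_grad_bound[where r=r and D=D and K=K and k=k, OF p fK k(1) _ k(2,3) m loc y(2)]]) (use r K(1) k(1) in auto)
          also have "\<dots> = ennreal (C1 * A) * (\<integral>\<^sup>+z. ennreal (h z) * indicator (ball i (r i / 16)) z \<partial>lborel)"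
            using C1 QA by (simp add: ennreal_mult mult.assoc)
          finally show "ennreal (\<Delta> i powr p) * (\<integral>\<^sup>+z. ennreal (\<mu> i z powr p) \<partial>lborel) \<le> ennreal (C1 * A) * (\<integral>\<^sup>+z. ennreal (h z) * indicator (ball i (r i / 16)) z \<partial>lborel)" .
        qed
        also have "\<dots> = ennreal (C1 * A) * (\<Sum>i\<in>I. \<integral>\<^sup>+z. ennreal (h z) * indicator (ball i (r i / 16)) z \<partial>lborel)"
          by (simp add: sum_distrib_left)
        also have "\<dots> \<le> ennreal (C1 * A) * (\<integral>\<^sup>+z. ennreal (h z) \<partial>lborel)"
          by (rule mult_left_mono[OF sum_disjoint_balls[where \<rho>="\<lambda>i. r i / 16" and p=p]]) (use p fI hm I(2) in auto)
        also have "\<dots> \<le> ennreal (C1 * A) * ennreal B" unfolding h_def by (rule mult_left_mono[OF B(2)]) simp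
        also have "\<dots> = ennreal (C1 * A * B)" using C1 QA B by (simp add: ennreal_mult)
        finally show ?thesis .
      qed
      have "(\<integral>\<^sup>+z. ennreal (Q * (h z + s z)) \<partial>lborel) = (\<integral>\<^sup>+z. ennreal Q * (ennreal (h z) + ennreal (s z)) \<partial>lborel)"
        using QA h0 s0 by (intro nn_integral_cong) (simp add: ennreal_mult ennreal_plus)
      also have "\<dots> = ennreal Q * ((\<integral>\<^sup>+z. ennreal (h z) \<partial>lborel) + (\<integral>\<^sup>+z. ennreal (s z) \<partial>lborel))"
        using hm sm by (subst nn_integral_cmult, simp, subst nn_integral_add) auto
      also have "\<dots> \<le> ennreal Q * (ennreal B + ennreal (C1 * A * B))"
        using B(2) ints unfolding h_def by (intro mult_left_mono add_mono) auto
      also have "\<dots> = ennreal (C * B)" unfolding C_def using QA B(1) C1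
        by (simp add: ennreal_plus[symmetric] ennreal_mult[symmetric] algebra_simps del: ennreal_plus)
      finally show "(\<integral>\<^sup>+z. ennreal (Q * (h z + s z)) \<partial>lborel) \<le> ennreal (C * B)" .
      show "AE z in lborel. normals_dominated p E nb D z (Q * (h z + s z))"
        using AE_conjI[OF loc muae]
      proof (rule AE_mp, intro AE_I2 impI ballI, elim conjE)
        fix z x y
        assume lz: "\<forall>R>0. \<forall>x\<in>ball z R. \<forall>y\<in>ball z R. norm (D y - D x) \<le> R * m z"
          and mz: "\<forall>i\<in>I. directions_parallel E nb i (r i) z (\<mu> i z)"
          and xy: "x \<in> E" "y \<in> E" "x \<noteq> y" "dist z y = infdist z E" "dist z x \<le> 8 * infdist z E"
        define R where "R = infdist z E"
        have R: "R > 0"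
        proof (rule ccontr)
          assume "\<not> R > 0"
          then have "R = 0" using infdist_nonneg[of z E] unfolding R_def by simp
          then show False using xy unfolding R_def by simp
        qed
        have dxy: "dist x y \<le> 9 * R" using xy dist_triangle[of x y z] unfolding R_def by (simp add: dist_commute)
        have nbx: "nb x \<in> E" "nb x \<noteq> x" "dist x (nb x) \<le> 9 * R" and nby: "nb y \<in> E" "nb y \<noteq> y" "dist y (nb y) \<le> 9 * R"
          using nb xy(1-3) dxy unfolding nearest_nb_def by (metis dist_commute order_trans)+
        have inb: "x \<in> ball z (20 * R)" "y \<in> ball z (20 * R)" "nb x \<in> ball z (20 * R)" "nb y \<in> ball z (20 * R)"
          using xy R nbx(3) nby(3) dist_triangle[of z "nb x" x] dist_triangle[of z "nb y" y] unfolding R_def by auto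
        have ux: "norm (dirv nb x) = 1" "norm (dirv nb y) = 1" using norm_dirv nbx(2) nby(2) by auto
        let ?u = "dirv nb x" and ?w = "dirv nb y"
        have pw: "R powr (2*p) = R powr p * R powr p" by (simp add: powr_add[symmetric])
        have Qmono: "c powr p \<le> Q" if "0 \<le> c" "c \<le> 100000" for c unfolding Q_def using that p by (intro powr_mono2) auto
        obtain i where i: "i \<in> I" "r y \<le> r i" "dist i y \<le> r i / 8"
        proof -
          obtain i where i: "i \<in> I" "- r i \<le> - r y" "y = i \<or> dist y i \<le> r y / 16 + r i / 16" using I(3) xy(2) by blast
          then have "dist i y \<le> r i / 8" using r I(1) xy(2) by (auto simp: dist_commute less_imp_le)
          then show ?thesis using that i by simp
        qed
        have T: "norm (nproj ?u (D y) - nproj ?w (D y)) powr p \<le> R powr p * (Q * (h z + s z)) \<and> \<bar>nproj ?u (D y) \<bullet> (y - x)\<bar> powr p \<le> R powr (2*p) * (Q * (h z + s z))"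
        \<comment> \<open>Below \<open>r i / 200\<close> the ball of radius \<open>40 * R\<close>
          about z still fits into the half ball about i, since 1/8 + 41/200 is less than
          1/2.\<close>
        proof (cases "R < r i / 200")
          case True
          have sub: "ball z (40 * R) \<subseteq> ball i (r i / 2)"
          proof
            fix v assume "v \<in> ball z (40 * R)"
            then have "dist i v < r i / 8 + R + 40 * R" using dist_triangle[of i v y] dist_triangle[of y v z] i(3) xy(4) unfolding R_def by (simp add: dist_commute)
            then have "dist i v < r i / 2" using True R by linarith
            then show "v \<in> ball i (r i / 2)" by simp
          qed
          have cr: "\<bar>crs ?u ?w\<bar> \<le> 120 * R * \<mu> i z" "\<bar>crs ?u (y - x)\<bar> \<le> 1080 * R * R * \<mu> i z"
            using mz[rule_format, OF i(1) R sub xy(1,2) _ nbx(2) nby(2) dxy] inb xy nbx nby by auto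
          have D0: "norm (D y) \<le> \<Delta> i" "0 \<le> \<Delta> i" using Dle[OF xy(2) i(3)] norm_ge_zero[of "D y"] by linarith+
          have e: "(\<Delta> i * (c * \<mu> i z)) powr p \<le> c powr p * s z" if "c \<ge> 0" for c
          proof -
            have "(\<Delta> i * (c * \<mu> i z)) powr p = c powr p * (\<Delta> i powr p * \<mu> i z powr p)" using D0 that mu0[OF i(1)] by (simp add: powr_mult mult_ac)
            also have "\<dots> \<le> c powr p * s z" by (rule mult_left_mono[OF sge[OF i(1)]]) simp
            finally show ?thesis .
          qed
          have t1: "norm (nproj ?u (D y) - nproj ?w (D y)) \<le> \<Delta> i * (120 * R * \<mu> i z)"
            by (rule order_trans[OF nproj_diff_le[OF ux] mult_mono[OF D0(1) cr(1)]]) (use D0 in auto)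
          have t2: "\<bar>nproj ?u (D y) \<bullet> (y - x)\<bar> \<le> \<Delta> i * (1080 * R * R * \<mu> i z)"
            by (rule order_trans[OF nproj_inner_le[OF ux(1)] mult_mono[OF D0(1) cr(2)]]) (use D0 in auto)
          have f: "c powr p * s z \<le> Q * (h z + s z)" if "0 \<le> c" "c \<le> 100000" for c
            using Qmono[OF that] h0[of z] s0[of z] QA by (intro mult_mono) auto
          have "norm (nproj ?u (D y) - nproj ?w (D y)) powr p \<le> (120 * R) powr p * s z"
            by (rule order_trans[OF powr_mono2[OF _ _ t1] e]) (use p R in auto)
          also have "\<dots> = R powr p * (120 powr p * s z)" using R by (simp add: powr_mult)
          also have "\<dots> \<le> R powr p * (Q * (h z + s z))" by (intro mult_left_mono f) auto
          finally have a: "norm (nproj ?u (D y) - nproj ?w (D y)) powr p \<le> R powr p * (Q * (h z + s z))" .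
          have "\<bar>nproj ?u (D y) \<bullet> (y - x)\<bar> powr p \<le> (1080 * R * R) powr p * s z"
            by (rule order_trans[OF powr_mono2[OF _ _ t2] e]) (use p R in auto)
          also have "\<dots> = R powr (2*p) * (1080 powr p * s z)" unfolding pw using R by (simp add: powr_mult)
          also have "\<dots> \<le> R powr (2*p) * (Q * (h z + s z))" by (intro mult_left_mono f) auto
          finally show ?thesis using a by simp
        next
          case False
          \<comment> \<open>Here \<open>r y \<le> r i \<le> 200 * R\<close>, so k lies within
            \<open>800 * R\<close> of y and \<open>801 * R\<close> of z; hence the radius
            \<open>802 * R\<close> below.\<close>
          obtain k where k: "k \<in> K" "r k \<le> r y" "dist y k \<le> 4 * r y" using K(2) xy(2) by blast
          have v: "norm (D y) powr p \<le> (2 * (802 * R)) powr p * h z" unfolding h_def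
            by (rule grad_bound_via_errdens[where k=k and r=r and m=m and D=D, OF _ fK k(1) _ _ lz])
               (use p m(2) r K(1) k R False i(2) xy(4) dist_triangle[of z k y] in \<open>auto simp: R_def\<close>)
          have g: "(c * norm (D y)) powr p \<le> R powr p * (Q * (h z + s z)) * b powr p" if "0 \<le> c" "c = a * b" "0 \<le> a" "0 \<le> b" "a * 1604 \<le> 100000" for a b c
          proof -
            have "(c * norm (D y)) powr p = c powr p * norm (D y) powr p" using that by (simp add: powr_mult)
            also have "\<dots> \<le> c powr p * ((2 * (802 * R)) powr p * h z)" by (rule mult_left_mono[OF v]) simp
            also have "\<dots> = R powr p * ((a * 1604) powr p * h z) * b powr p" using that R by (simp add: powr_mult mult_ac)
            also have "\<dots> \<le> R powr p * (Q * (h z + s z)) * b powr p"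
              using Qmono[of "a * 1604"] that h0[of z] s0[of z] QA by (intro mult_right_mono mult_left_mono mult_mono) auto
            finally show ?thesis .
          qed
          have t1: "norm (nproj ?u (D y) - nproj ?w (D y)) \<le> 2 * norm (D y)"
            using norm_triangle_ineq4[of "nproj ?u (D y)" "nproj ?w (D y)"] norm_nproj_le[OF ux(1), of "D y"] norm_nproj_le[OF ux(2), of "D y"] by linarith
          have t2: "\<bar>nproj ?u (D y) \<bullet> (y - x)\<bar> \<le> (9 * R) * norm (D y)"
          proof -
            have "\<bar>nproj ?u (D y) \<bullet> (y - x)\<bar> \<le> norm (nproj ?u (D y)) * norm (y - x)" by (rule Cauchy_Schwarz_ineq2)
            also have "\<dots> \<le> norm (D y) * (9 * R)" using norm_nproj_le[OF ux(1), of "D y"] dxy by (intro mult_mono) (auto simp: dist_norm norm_minus_commute)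
            finally show ?thesis by (simp add: mult.commute)
          qed
          have a: "norm (nproj ?u (D y) - nproj ?w (D y)) powr p \<le> R powr p * (Q * (h z + s z)) * 1 powr p"
            by (rule order_trans[OF powr_mono2[OF _ _ t1] g[of 2 2]]) (use p in auto)
          have "\<bar>nproj ?u (D y) \<bullet> (y - x)\<bar> powr p \<le> R powr p * (Q * (h z + s z)) * R powr p"
            by (rule order_trans[OF powr_mono2[OF _ _ t2] g[of _ 9]]) (use p R in auto)
          then show ?thesis using a unfolding pw by (simp add: mult_ac)
        qed
        then show "norm (nproj ?u (D y) - nproj ?w (D y)) powr p \<le> infdist z E powr p * (Q * (h z + s z)) \<and>
            \<bar>nproj ?u (D y) \<bullet> (y - x)\<bar> powr p \<le> infdist z E powr (2*p) * (Q * (h z + s z))" unfolding R_def by auto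
      qed
    qed
  qed
qed

section \<open>Energy bounds for the jets on the separated set and for the tangential jets\<close>

lemma nn_scaled_sum:
  assumes "a \<in> borel_measurable borel" "b \<in> borel_measurable borel" "\<And>z. a z \<ge> 0" "\<And>z. b z \<ge> 0" "c \<ge> 0" "A \<ge> 0" "B \<ge> 0"
    "(\<integral>\<^sup>+z. ennreal (a z) \<partial>lborel) \<le> ennreal A" "(\<integral>\<^sup>+z. ennreal (b z) \<partial>lborel) \<le> ennreal B"
  shows "(\<integral>\<^sup>+(z::real^2). ennreal (c * (a z + b z)) \<partial>lborel) \<le> ennreal (c * (A + B))"
proof -
  have "(\<integral>\<^sup>+z. ennreal (c * (a z + b z)) \<partial>lborel) = (\<integral>\<^sup>+z. ennreal c * (ennreal (a z) + ennreal (b z)) \<partial>lborel)"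
    using assms by (intro nn_integral_cong) (simp add: ennreal_mult ennreal_plus)
  also have "\<dots> = ennreal c * ((\<integral>\<^sup>+z. ennreal (a z) \<partial>lborel) + (\<integral>\<^sup>+z. ennreal (b z) \<partial>lborel))"
    using assms by (subst nn_integral_cmult, simp, subst nn_integral_add) auto
  also have "\<dots> \<le> ennreal c * (ennreal A + ennreal B)" using assms by (intro mult_left_mono add_mono) auto
  also have "\<dots> = ennreal (c * (A + B))" using assms by (simp add: ennreal_mult ennreal_plus)
  finally show ?thesis .
qed

lemma separated_energy:
  assumes p: "p > 2" and W: "whitney_sys p C K \<Psi> \<alpha> \<beta>" and K: "finite K" and H: "\<And>k. H k = norm (grad F k - L k)" and r: "\<And>k. k \<in> K \<Longrightarrow> r k > 0"
    and sep: "\<And>k k'. k \<in> K \<Longrightarrow> k' \<in> K \<Longrightarrow> k \<noteq> k' \<Longrightarrow> 2 * r k + 2 * r k' < dist k k'"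
    and m: "m \<in> borel_measurable borel" "\<And>z. m z \<ge> 0" "(\<integral>\<^sup>+z. ennreal (m z powr p) \<partial>lborel) \<le> ennreal B1" "B1 \<ge> 0"
    and loc: "AE z in lborel. \<forall>R>0. taylor_ctrl F z R (m z)"
    and e: "(\<integral>\<^sup>+z. ennreal (errdens p K r H z) \<partial>lborel) \<le> ennreal B2" "B2 \<ge> 0"
    and f: "\<And>k. k \<in> K \<Longrightarrow> f k = F k"
  shows "jet_energy p K \<alpha> \<beta> f L \<le> C * (2 * 400 powr p * (B1 + B2))"
proof (rule whitney_sys_energy[OF W, where \<nu>="\<lambda>z. 2 * 400 powr p * (m z powr p + errdens p K r H z)"])
  show "(\<lambda>z. 2 * 400 powr p * (m z powr p + errdens p K r H z)) \<in> borel_measurable borel" using m(1) by measurable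
  show "0 \<le> 2 * 400 powr p * (m z powr p + errdens p K r H z)" for z using errdens_nonneg[of p K r H z] by simp
  show "(\<integral>\<^sup>+z. ennreal (2 * 400 powr p * (m z powr p + errdens p K r H z)) \<partial>lborel) \<le> ennreal (2 * 400 powr p * (B1 + B2))"
    by (rule nn_scaled_sum) (use m e errdens_nonneg in auto)
  show "0 \<le> 2 * 400 powr p * (B1 + B2)" using m e by simp
  show "AE z in lborel. \<forall>x\<in>K. \<forall>y\<in>K. x \<noteq> y \<longrightarrow> dist z y = infdist z K \<longrightarrow> dist z x \<le> 8 * infdist z K \<longrightarrow>
      norm (L x - L y) powr p \<le> infdist z K powr p * (2 * 400 powr p * (m z powr p + errdens p K r H z)) \<and>
      \<bar>jet_gap f L x y\<bar> powr p \<le> infdist z K powr (2*p) * (2 * 400 powr p * (m z powr p + errdens p K r H z))"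
    using loc
  proof (rule AE_mp, intro AE_I2 impI ballI)
    fix z x y assume l: "\<forall>R>0. taylor_ctrl F z R (m z)"
      and xy: "x \<in> K" "y \<in> K" "x \<noteq> y" "dist z y = infdist z K" "dist z x \<le> 8 * infdist z K"
    have g: "jet_gap f L x y = jet_gap F L x y" unfolding jet_gap_def using f xy by simp
    show "norm (L x - L y) powr p \<le> infdist z K powr p * (2 * 400 powr p * (m z powr p + errdens p K r H z)) \<and>
      \<bar>jet_gap f L x y\<bar> powr p \<le> infdist z K powr (2*p) * (2 * 400 powr p * (m z powr p + errdens p K r H z))"
      unfolding g using separated_jets_density[where H=H and r=r and L=L and F=F, OF p K H r sep m(2) l xy] by (intro conjI)
  qed
qed

text \<open>The data \<open>f\<close> need only agree with \<open>F\<close> on \<open>E\<close>: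
  tangential jets use values at points of \<open>E\<close> and at their neighbours, which again lie
  in \<open>E\<close>.\<close>

lemma tangential_energy:
  assumes p: "p > 2" and W: "whitney_sys p C E \<Psi> \<alpha> \<beta>" and nb: "nearest_nb E nb"
    and m: "m \<in> borel_measurable borel" "\<And>z. m z \<ge> 0" "(\<integral>\<^sup>+z. ennreal (m z powr p) \<partial>lborel) \<le> ennreal B1" "B1 \<ge> 0"
    and loc: "AE z in lborel. \<forall>R>0. taylor_ctrl F z R (m z)"
    and n: "n \<in> borel_measurable borel" "\<And>z. n z \<ge> 0" "(\<integral>\<^sup>+z. ennreal (n z) \<partial>lborel) \<le> ennreal B2" "B2 \<ge> 0"
    and T: "AE z in lborel. normals_dominated p E nb (grad F) z (n z)"
    and f: "\<And>x. x \<in> E \<Longrightarrow> f x = F x"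
  shows "jet_energy p E \<alpha> \<beta> f (tjet nb f) \<le> C * (2000 powr p * (B1 + B2))"
proof (rule whitney_sys_energy[OF W, where \<nu>="\<lambda>z. 2000 powr p * (m z powr p + n z)"])
  show "(\<lambda>z. 2000 powr p * (m z powr p + n z)) \<in> borel_measurable borel" using m(1) n(1) by measurable
  show "0 \<le> 2000 powr p * (m z powr p + n z)" for z using n(2)[of z] by simp
  show "(\<integral>\<^sup>+z. ennreal (2000 powr p * (m z powr p + n z)) \<partial>lborel) \<le> ennreal (2000 powr p * (B1 + B2))"
    by (rule nn_scaled_sum) (use m n in auto)
  show "0 \<le> 2000 powr p * (B1 + B2)" using m n by simp
  show "AE z in lborel. \<forall>x\<in>E. \<forall>y\<in>E. x \<noteq> y \<longrightarrow> dist z y = infdist z E \<longrightarrow> dist z x \<le> 8 * infdist z E \<longrightarrow>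
      norm (tjet nb f x - tjet nb f y) powr p \<le> infdist z E powr p * (2000 powr p * (m z powr p + n z)) \<and>
      \<bar>jet_gap f (tjet nb f) x y\<bar> powr p \<le> infdist z E powr (2*p) * (2000 powr p * (m z powr p + n z))"
    using AE_conjI[OF loc T]
  proof (rule AE_mp, intro AE_I2 impI ballI, elim conjE)
    fix z x y assume l: "\<forall>R>0. taylor_ctrl F z R (m z)"
      and t: "normals_dominated p E nb (grad F) z (n z)"
      and xy: "x \<in> E" "y \<in> E" "x \<noteq> y" "dist z y = infdist z E" "dist z x \<le> 8 * infdist z E"
    have nbE: "nb x \<in> E" "nb y \<in> E" using nb xy unfolding nearest_nb_def by metis+
    have j: "tjet nb f x = tjet nb F x" "tjet nb f y = tjet nb F y" unfolding tjet_def using f xy nbE by auto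
    have g: "jet_gap f (tjet nb f) x y = jet_gap F (tjet nb F) x y" unfolding jet_gap_def j using f xy by simp
    note t' = t[rule_format, OF xy]
    show "norm (tjet nb f x - tjet nb f y) powr p \<le> infdist z E powr p * (2000 powr p * (m z powr p + n z)) \<and>
      \<bar>jet_gap f (tjet nb f) x y\<bar> powr p \<le> infdist z E powr (2*p) * (2000 powr p * (m z powr p + n z))"
      unfolding g unfolding j using tangential_jets_density[where F=F, OF p nb m(2) l xy n(2) conjunct1[OF t'] conjunct2[OF t']] by (intro conjI)
  qed
qed

text \<open>Where \<open>curved_ok\<close> fails, functions with vanishing trace have a controlled
  gradient, which is the hypothesis of \<open>linear_selection\<close>; it is applied to each
  coordinate.\<close>

lemma gradient_selection:
  assumes p: "p > 2" and E: "finite E" "E \<noteq> {}" and k: "\<kappa> > 0" and r: "r > 0" and nok: "\<not> curved_ok \<kappa> p E x r"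
  shows "\<exists>a b. \<forall>F g. sob p F g \<longrightarrow> norm (grad F x - vector [\<Sum>y\<in>E. a y * F y, \<Sum>y\<in>E. b y * F y]) powr p \<le> 2 powr p * inverse \<kappa> * r powr (p - 2) * hint p g x r"
proof -
  define A where "A = (inverse \<kappa> * r powr (p - 2)) powr (1/p)"
  have A: "A \<ge> 0" "A powr p = inverse \<kappa> * r powr (p - 2)" unfolding A_def using p k r by (auto simp: powr_powr)
  have ex: "\<exists>a. \<forall>F g. sob p F g \<longrightarrow> \<bar>(\<Sum>y\<in>E. a y * F y) - grad F x \<bullet> axis i 1\<bar> \<le> A * hint p g x r powr (1/p)" for i
  proof (rule linear_selection[OF p E A(1)])
    fix F g assume F: "sob p F g" "\<forall>y\<in>E. F y = 0"
    have "\<bar>grad F x \<bullet> axis i 1\<bar> \<le> norm (grad F x)" using Cauchy_Schwarz_ineq2[of "grad F x" "axis i 1"] by (simp add: norm_axis_1)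
    also have "\<dots> \<le> A * hint p g x r powr (1/p)" unfolding A_def by (rule not_curved_ok_bound[OF p k r nok F])
    finally show "\<bar>grad F x \<bullet> axis i 1\<bar> \<le> A * hint p g x r powr (1/p)" .
  qed
  obtain a where a: "\<forall>F g. sob p F g \<longrightarrow> \<bar>(\<Sum>y\<in>E. a y * F y) - grad F x \<bullet> axis 1 1\<bar> \<le> A * hint p g x r powr (1/p)" using ex[of 1] by (elim exE) (rule that)
  obtain b where b: "\<forall>F g. sob p F g \<longrightarrow> \<bar>(\<Sum>y\<in>E. b y * F y) - grad F x \<bullet> axis 2 1\<bar> \<le> A * hint p g x r powr (1/p)" using ex[of 2] by (elim exE) (rule that)
  show ?thesis
  proof (rule exI[of _ a], rule exI[of _ b], intro allI impI)
    fix F g assume F: "sob p F g"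
    let ?v = "grad F x - vector [\<Sum>y\<in>E. a y * F y, \<Sum>y\<in>E. b y * F y]"
    have "norm ?v \<le> (\<Sum>i\<in>UNIV. \<bar>?v $ i\<bar>)" by (rule norm_le_l1_cart)
    also have "\<dots> \<le> 2 * (A * hint p g x r powr (1/p))"
      using a[rule_format, OF F] b[rule_format, OF F] by (simp add: sum_2 inner_axis abs_minus_commute)
    finally have "norm ?v powr p \<le> (2 * (A * hint p g x r powr (1/p))) powr p" using p by (intro powr_mono2) auto
    also have "\<dots> = 2 powr p * (A powr p * (hint p g x r powr (1/p)) powr p)" using A by (simp add: powr_mult)
    also have "(hint p g x r powr (1/p)) powr p = hint p g x r" using p hint_nonneg by (simp add: powr_powr)
    finally show "norm ?v powr p \<le> 2 powr p * inverse \<kappa> * r powr (p - 2) * hint p g x r" unfolding A by (simp only: mult.assoc)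
  qed
qed

text \<open>All directions are orthogonal to the normal of the line, so by \<open>crs_bound\<close>
  their cross products vanish and the normal parts agree exactly.\<close>

lemma collinear_dirs:
  assumes c: "collinear_pts E" and x: "x \<in> E" "nb x \<in> E" "nb x \<noteq> x" and y: "y \<in> E" "nb y \<in> E" "nb y \<noteq> y"
  shows "nproj (dirv nb x) v = nproj (dirv nb y) v" "nproj (dirv nb x) v \<bullet> (y - x) = 0"
proof -
  obtain u where u: "norm u = 1" "\<And>a b. a \<in> E \<Longrightarrow> b \<in> E \<Longrightarrow> u \<bullet> (b - a) = 0" using c unfolding collinear_pts_def by (elim exE conjE) (rule that, auto)
  have n: "norm (dirv nb x) = 1" "norm (dirv nb y) = 1" using norm_dirv x y by auto
  have o: "u \<bullet> dirv nb x = 0" "u \<bullet> dirv nb y = 0" unfolding dirv_def using u(2) x y by auto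
  have c1: "crs (dirv nb x) (dirv nb y) = 0" using crs_bound[of u "dirv nb x" "dirv nb y"] u(1) o by simp
  have c2: "crs (dirv nb x) (y - x) = 0" using crs_bound[of u "dirv nb x" "y - x"] u(1) o u(2)[OF x(1) y(1)] by simp
  show "nproj (dirv nb x) v = nproj (dirv nb y) v" using nproj_diff_le[OF n, of v] c1 by simp
  show "nproj (dirv nb x) v \<bullet> (y - x) = 0" using nproj_inner_le[OF n(1), of v "y - x"] c2 by simp
qed

text \<open>A point without neighbour is assigned itself, so that the tangential jet depends on
  nothing but values on \<open>E\<close> also for a singleton.\<close>

lemma nearest_nb_exists_in: assumes "finite E" shows "\<exists>nb. nearest_nb E nb \<and> (\<forall>x\<in>E. nb x \<in> E)"
proof -
  obtain nb where nb: "nearest_nb E nb" using nearest_nb_exists[OF assms] by (elim exE) (rule that)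
  define nb' where "nb' x = (if \<exists>y\<in>E. y \<noteq> x then nb x else x)" for x
  have eq: "nb' x = nb x" if "y \<in> E" "x \<noteq> y" for x y using that unfolding nb'_def by auto
  have "nearest_nb E nb'" unfolding nearest_nb_def
  proof (intro ballI impI)
    fix x y assume xy: "x \<in> E" "y \<in> E" "x \<noteq> y"
    show "nb' x \<in> E \<and> nb' x \<noteq> x \<and> dist x (nb' x) \<le> dist x y"
      unfolding eq[OF xy(2,3)] using nb[unfolded nearest_nb_def, rule_format, OF xy] .
  qed
  moreover have "nb' x \<in> E" if x: "x \<in> E" for x
  proof (cases "\<exists>y\<in>E. y \<noteq> x")
    case True
    then obtain y where y: "y \<in> E" "x \<noteq> y" by (elim bexE) (rule that, auto)
    show ?thesis unfolding eq[OF y] using nb[unfolded nearest_nb_def, rule_format, OF x y] by (elim conjE)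
  next
    case False
    then have "nb' x = x" unfolding nb'_def by (rule if_not_P)
    then show ?thesis using x by simp
  qed
  ultimately show ?thesis by (intro exI[of _ nb'] conjI ballI)
qed

section \<open>Linearity of the construction in the trace\<close>

abbreviation (input) "lf \<equiv> linear_functional_on_traces"

lemma lf_eval: "x \<in> E \<Longrightarrow> lf E (\<lambda>f. f x)"
  unfolding linear_functional_on_traces_def by auto

lemma lf_zero: "lf E (\<lambda>f. 0)"
  unfolding linear_functional_on_traces_def by auto

lemma lf_add: "lf E L \<Longrightarrow> lf E M \<Longrightarrow> lf E (\<lambda>f. L f + M f)"
  unfolding linear_functional_on_traces_def by (auto simp: algebra_simps) metis

lemma lf_cmult: "lf E L \<Longrightarrow> lf E (\<lambda>f. c * L f)"
  unfolding linear_functional_on_traces_def by (auto simp: algebra_simps)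

lemma lf_cmult_right: "lf E L \<Longrightarrow> lf E (\<lambda>f. L f * c)"
  using lf_cmult[of E L c] by (simp add: mult.commute)

lemma lf_diff: "lf E L \<Longrightarrow> lf E M \<Longrightarrow> lf E (\<lambda>f. L f - M f)"
  using lf_add[of E L "\<lambda>f. (-1) * M f"] lf_cmult[of E M "-1"] by simp

lemma lf_sum: "(\<And>i. i \<in> S \<Longrightarrow> lf E (L i)) \<Longrightarrow> lf E (\<lambda>f. \<Sum>i\<in>S. L i f)"
  by (induction S rule: infinite_finite_induct) (auto intro: lf_zero lf_add)

lemma linear_operatorI: "(\<And>z. lf E (\<lambda>f. T f z)) \<Longrightarrow> linear_operator_on_traces E T"
  unfolding linear_functional_on_traces_def linear_operator_on_traces_def by (auto intro!: ext)

lemma lf_wext: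
  assumes "\<And>x. x \<in> K \<Longrightarrow> lf E (\<lambda>f. \<phi> f x)" "\<And>x v. x \<in> K \<Longrightarrow> lf E (\<lambda>f. \<xi> f x \<bullet> v)"
  shows "lf E (\<lambda>f. wext \<Psi> K (\<phi> f) (\<xi> f) z)"
  unfolding wext_def by (intro lf_sum lf_cmult lf_add assms)

lemma lf_tjet:
  assumes "\<And>y. y \<in> E \<Longrightarrow> lf E (\<lambda>f. \<phi> f y)" "x \<in> E" "nb x \<in> E"
  shows "lf E (\<lambda>f. tjet nb (\<phi> f) x \<bullet> v)"
  unfolding tjet_def inner_scaleR_left divide_inverse by (intro lf_cmult_right lf_diff assms)

text \<open>The first index selects one of the two gradient differences or the gap; the p-th root of
  the coefficient makes the p-th powers add up to the energy.\<close>

definition jetfun :: "real \<Rightarrow> (real^2 \<Rightarrow> real^2 \<Rightarrow> real) \<Rightarrow> (real^2 \<Rightarrow> real^2 \<Rightarrow> real) \<Rightarrow> (real^2 \<Rightarrow> real) \<Rightarrow> (real^2 \<Rightarrow> real^2) \<Rightarrow> nat \<times> (real^2) \<times> (real^2) \<Rightarrow> real" where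
  "jetfun p \<alpha> \<beta> f \<xi> = (\<lambda>(n, x, y). if n = 0 then \<alpha> x y powr (1/p) * (\<xi> x \<bullet> axis 1 1 - \<xi> y \<bullet> axis 1 1)
     else if n = 1 then \<alpha> x y powr (1/p) * (\<xi> x \<bullet> axis 2 1 - \<xi> y \<bullet> axis 2 1)
     else \<beta> x y powr (1/p) * (f x + \<xi> x \<bullet> (y - x) - f y))"

lemma jet_energy_jetfun:
  assumes p: "p > 0" and E: "finite E" and ab: "\<And>x y. \<alpha> x y \<ge> 0" "\<And>x y. \<beta> x y \<ge> 0"
  shows "jet_energy p E \<alpha> \<beta> f \<xi> = (\<Sum>j\<in>{0,1,2} \<times> E \<times> E. \<bar>jetfun p \<alpha> \<beta> f \<xi> j\<bar> powr p)"
proof -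
  have a: "(\<alpha> x y powr (1/p)) powr p = \<alpha> x y" "(\<beta> x y powr (1/p)) powr p = \<beta> x y" for x y using p ab by (auto simp: powr_powr)
  show ?thesis unfolding sum.cartesian_product' jet_energy_def jetfun_def jet_gap_def
    by (simp add: sum.distrib abs_mult powr_mult a inner_axis distrib_left add.assoc)
qed

lemma lf_jetfun:
  assumes "\<And>x. x \<in> K \<Longrightarrow> lf E (\<lambda>f. \<phi> f x)" "\<And>x v. x \<in> K \<Longrightarrow> lf E (\<lambda>f. \<xi> f x \<bullet> v)" "j \<in> {0,1,2} \<times> K \<times> K"
  shows "lf E (\<lambda>f. jetfun p \<alpha> \<beta> (\<phi> f) (\<xi> f) j)"
proof -
  obtain n x y where j: "j = (n, x, y)" "x \<in> K" "y \<in> K" using assms(3) by auto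
  show ?thesis unfolding j jetfun_def using j(2,3)
    by (cases "n = 0"; cases "n = 1") (auto intro!: lf_cmult lf_diff lf_add assms)
qed

section \<open>The extension operator\<close>

text \<open>The assertion in terms of p-th powers, before infima are taken. In the last clause F
  stands for its trace, since the functionals depend only on values on \<open>E\<close>. The 6
  allows two energies with three functionals per ordered pair.\<close>

definition ext_operator :: "real \<Rightarrow> real \<Rightarrow> (real^2) set \<Rightarrow> ((real^2 \<Rightarrow> real) \<Rightarrow> real^2 \<Rightarrow> real) \<Rightarrow> 'j set \<Rightarrow> ('j \<Rightarrow> (real^2 \<Rightarrow> real) \<Rightarrow> real) \<Rightarrow> bool" where
  "ext_operator p C E T J \<mu> \<longleftrightarrow> (\<forall>z. lf E (\<lambda>f. T f z)) \<and> finite J \<and> card J \<le> 6 * (card E)\<^sup>2 \<and> (\<forall>j\<in>J. lf E (\<mu> j)) \<and>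
     (\<forall>f. (\<forall>x\<in>E. T f x = f x) \<and> (\<exists>g. sob p (T f) g \<and> tot p g \<le> C * (\<Sum>j\<in>J. \<bar>\<mu> j f\<bar> powr p))) \<and>
     (\<forall>F g. sob p F g \<longrightarrow> (\<Sum>j\<in>J. \<bar>\<mu> j F\<bar> powr p) \<le> C * tot p g)"

abbreviation global_majorant :: "real \<Rightarrow> real \<Rightarrow> (real^2 \<Rightarrow> real) \<Rightarrow> (2 \<Rightarrow> 2 \<Rightarrow> real^2 \<Rightarrow> real) \<Rightarrow> (real^2 \<Rightarrow> real) \<Rightarrow> bool" where
  "global_majorant C p F g m \<equiv> m \<in> borel_measurable borel \<and> (\<forall>z. m z \<ge> 0) \<and> (\<integral>\<^sup>+z. ennreal (m z powr p) \<partial>lborel) \<le> ennreal (C * tot p g) \<and>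
     (AE z in lborel. \<forall>R>0. taylor_ctrl F z R (m z))"

lemma sob_max_UNIV:
  assumes p: "p > 2"
  shows "\<exists>C>0. \<forall>F g. sob p F g \<longrightarrow> (\<exists>m. global_majorant C p F g m)"
proof -
  obtain C where C: "C > 0" "\<forall>F g S. sob p F g \<longrightarrow> S \<in> sets borel \<longrightarrow> (\<exists>m. taylor_majorant C p F g S m)"
    using sob_max[OF p] by (elim exE conjE) (rule that)
  show ?thesis
  proof (rule exI[of _ C], rule conjI[OF C(1)], intro allI impI)
    fix F g assume F: "sob p F g"
    have e: "ennreal C * (\<integral>\<^sup>+z. ennreal (hnorm g z powr p) * indicator UNIV z \<partial>lborel) = ennreal (C * tot p g)"
      using nn_tot[OF F] p C(1) tot_nonneg by (simp add: ennreal_mult)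
    show "\<exists>m. global_majorant C p F g m"
      using C(2)[rule_format, OF F, of UNIV] unfolding e by simp
  qed
qed

text \<open>Tangential jets alone suffice: the normal parts cancel exactly, so the zero density
  dominates them.\<close>

lemma collinear_ext_operator:
  assumes p: "p > 2"
  shows "\<exists>C>0. \<forall>E. finite E \<longrightarrow> E \<noteq> {} \<longrightarrow> collinear_pts E \<longrightarrow> (\<exists>T (J :: (nat \<times> (real^2) \<times> (real^2)) set) \<mu>. ext_operator p C E T J \<mu>)"
proof -
  obtain Cw where Cw: "Cw > 0" "\<forall>E. finite E \<longrightarrow> E \<noteq> {} \<longrightarrow> (\<exists>\<Psi> \<alpha> \<beta>. whitney_sys p Cw E \<Psi> \<alpha> \<beta>)"
    using whitney_extension[OF p] by (elim exE conjE) (rule that)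
  obtain Cm where Cm: "Cm > 0" "\<forall>F g. sob p F g \<longrightarrow> (\<exists>m. global_majorant Cm p F g m)"
    using sob_max_UNIV[OF p] by (elim exE conjE) (rule that)
  define C where "C = max Cw (Cw * (2000 powr p * Cm))"
  have C: "C > 0" "C \<ge> Cw" "C \<ge> Cw * (2000 powr p * Cm)" unfolding C_def using Cw(1) by auto
  show ?thesis
  proof (rule exI[of _ C], rule conjI[OF C(1)], intro allI impI)
    fix E :: "(real^2) set" assume E: "finite E" "E \<noteq> {}" and col: "collinear_pts E"
    obtain \<Psi> \<alpha> \<beta> where W: "whitney_sys p Cw E \<Psi> \<alpha> \<beta>" using Cw(2)[rule_format, OF E] by (elim exE) (rule that)
    obtain nb where nb: "nearest_nb E nb" "\<forall>x\<in>E. nb x \<in> E" using nearest_nb_exists_in[OF E(1)] by (elim exE conjE) (rule that)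
    define T where "T f = wext \<Psi> E f (tjet nb f)" for f
    define J where "J = {0,1,2::nat} \<times> E \<times> E"
    define \<mu> where "\<mu> j f = jetfun p \<alpha> \<beta> f (tjet nb f) j" for j f
    have S: "(\<Sum>j\<in>J. \<bar>\<mu> j f\<bar> powr p) = jet_energy p E \<alpha> \<beta> f (tjet nb f)" for f
      unfolding J_def \<mu>_def by (rule jet_energy_jetfun[symmetric]) (use p E whitney_sysD[OF W] in auto)
    have t: "lf E (\<lambda>f. tjet nb f x \<bullet> v)" if "x \<in> E" for x v
      by (rule lf_tjet) (use that nb lf_eval in auto)
    have "ext_operator p C E T J \<mu>" unfolding ext_operator_def
    proof (intro conjI allI ballI impI)
      show "lf E (\<lambda>f. T f z)" for z unfolding T_def by (intro lf_wext lf_eval t)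
      show "finite J" unfolding J_def using E by simp
      show "card J \<le> 6 * (card E)\<^sup>2" unfolding J_def by (simp add: card_cartesian_product power2_eq_square)
      show "lf E (\<mu> j)" if "j \<in> J" for j unfolding \<mu>_def[abs_def] by (rule lf_jetfun[where K=E]) (use that lf_eval t in \<open>auto simp: J_def\<close>)
      show "T f x = f x" if "x \<in> E" for f x unfolding T_def by (rule whitney_sysD(4)[OF W that])
      show "\<exists>g. sob p (T f) g \<and> tot p g \<le> C * (\<Sum>j\<in>J. \<bar>\<mu> j f\<bar> powr p)" for f
      proof -
        obtain g where g: "sob p (T f) g" "tot p g \<le> Cw * jet_energy p E \<alpha> \<beta> f (tjet nb f)"
          using whitney_sysD(3)[OF W, of f "tjet nb f", folded T_def] by (elim exE conjE) (rule that)
        have "jet_energy p E \<alpha> \<beta> f (tjet nb f) \<ge> 0" by (rule jet_energy_nonneg) (use whitney_sysD(1,2)[OF W] in auto)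
        then have "tot p g \<le> C * jet_energy p E \<alpha> \<beta> f (tjet nb f)" by (rule order_trans[OF g(2) mult_right_mono[OF C(2)]])
        then show ?thesis unfolding S using g(1) by (intro exI conjI)
      qed
      fix F g assume F: "sob p F g"
      obtain m where m: "m \<in> borel_measurable borel" "\<forall>z. m z \<ge> 0" "(\<integral>\<^sup>+z. ennreal (m z powr p) \<partial>lborel) \<le> ennreal (Cm * tot p g)" and
         loc: "AE z in lborel. \<forall>R>0. taylor_ctrl F z R (m z)"
        using Cm(2)[rule_format, OF F] by (elim exE conjE) (rule that)
      have "jet_energy p E \<alpha> \<beta> F (tjet nb F) \<le> Cw * (2000 powr p * (Cm * tot p g + 0))"
      proof (rule tangential_energy[where n="\<lambda>_. 0", OF p W nb(1) m(1) _ m(3) _ loc])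
        show "AE z in lborel. normals_dominated p E nb (grad F) z 0"
        proof (intro AE_I2 ballI impI)
          fix z x y assume xy: "x \<in> E" "y \<in> E" "x \<noteq> y"
          have n: "nb x \<in> E" "nb x \<noteq> x" "nb y \<in> E" "nb y \<noteq> y" using nb xy unfolding nearest_nb_def by metis+
          note c = collinear_dirs[OF col xy(1) n(1,2) xy(2) n(3,4), of "grad F y"]
          show "norm (nproj (dirv nb x) (grad F y) - nproj (dirv nb y) (grad F y)) powr p \<le> infdist z E powr p * 0 \<and>
            \<bar>nproj (dirv nb x) (grad F y) \<bullet> (y - x)\<bar> powr p \<le> infdist z E powr (2*p) * 0" unfolding c(2) unfolding c(1) by simp
        qed
      qed (use m Cm tot_nonneg[of p g] in auto)
      also have "\<dots> = (Cw * (2000 powr p * Cm)) * tot p g" by simp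
      also have "\<dots> \<le> C * tot p g" by (rule mult_right_mono[OF C(3) tot_nonneg])
      finally show "(\<Sum>j\<in>J. \<bar>\<mu> j F\<bar> powr p) \<le> C * tot p g" unfolding S .
    qed
    then show "\<exists>T (J :: (nat \<times> (real^2) \<times> (real^2)) set) \<mu>. ext_operator p C E T J \<mu>" by (intro exI)
  qed
qed

text \<open>The operator is the sum of two Whitney extensions. The functionals of the second are
  evaluated at the trace of the remainder, which is itself linear in the trace of the given
  function.\<close>

lemma curved_ext_operator:
  assumes p: "p > 2"
  shows "\<exists>C>0. \<forall>E. finite E \<longrightarrow> E \<noteq> {} \<longrightarrow> \<not> collinear_pts E \<longrightarrow> (\<exists>T (J :: (nat \<times> (real^2) \<times> (real^2) + nat \<times> (real^2) \<times> (real^2)) set) \<mu>. ext_operator p C E T J \<mu>)"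
proof -
  obtain Cw where Cw: "Cw > 0" "\<forall>E. finite E \<longrightarrow> E \<noteq> {} \<longrightarrow> (\<exists>\<Psi> \<alpha> \<beta>. whitney_sys p Cw E \<Psi> \<alpha> \<beta>)"
    using whitney_extension[OF p] by (elim exE conjE) (rule that)
  obtain Cm where Cm: "Cm > 0" "\<forall>F g. sob p F g \<longrightarrow> (\<exists>m. global_majorant Cm p F g m)"
    using sob_max_UNIV[OF p] by (elim exE conjE) (rule that)
  obtain Ct where Ct: "Ct > 0" "\<And>(x::real^2) r. r > 0 \<Longrightarrow> (\<integral>\<^sup>+z. ennreal (max r (dist z x) powr (-p)) \<partial>lborel) \<le> ennreal (Ct * r powr (2 - p))"
    by (rule tail_integral[OF p]) (erule that)
  obtain \<kappa> Cn where k: "\<kappa> > 0" and Cn: "Cn > 0" "normal_density_bound p \<kappa> Cn"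
    using normal_density[OF p] by (elim exE conjE) (rule that)
  \<comment> \<open>The gradients are selected at twice the scale, where straightness fails; this
    gives the factor \<open>2 powr (p - 2)\<close>.\<close>
  define A where "A = 2 powr p * inverse \<kappa> * 2 powr (p - 2)"
  have A: "A > 0" unfolding A_def using k by simp
  \<comment> \<open>Relative to the energy of F: \<open>c1\<close> bounds the energy of the jets on
    \<open>K\<close>, \<open>c2\<close> the Hessian of the remainder, \<open>c3\<close> the density
    passed to \<open>normal_density\<close>, and \<open>c4\<close> the energy of the tangential
    jets.\<close>
  define c1 where "c1 = Cw * (2 * 400 powr p * (Cm + A * Ct))"
  define c2 where "c2 = 2 powr p * (1 + Cw * c1)"
  define c3 where "c3 = Cm * c2 + A * Ct"
  define c4 where "c4 = Cw * (2000 powr p * (Cm * c2 + Cn * c3))"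
  have c0: "c1 > 0" "c2 > 0" "c3 > 0" "c4 > 0" unfolding c4_def c3_def c2_def c1_def using Cw(1) Cm(1) A Ct(1) Cn(1)
    by (auto intro!: mult_pos_pos add_pos_pos)
  define C where "C = max (2 powr p * Cw) (c1 + c4)"
  have C: "C > 0" "C \<ge> 2 powr p * Cw" "C \<ge> c1 + c4" unfolding C_def using c0 by auto
  show ?thesis
  proof (rule exI[of _ C], rule conjI[OF C(1)], intro allI impI)
    fix E :: "(real^2) set" assume E: "finite E" "E \<noteq> {}" and nc: "\<not> collinear_pts E"
    have "\<forall>x\<in>E. \<exists>r>0. curved_ok \<kappa> p E x r \<and> \<not> curved_ok \<kappa> p E x (2 * r)"
      by (intro ballI curved_ok_radius p E k nc)
    then obtain r where r: "\<forall>x\<in>E. r x > 0 \<and> curved_ok \<kappa> p E x (r x) \<and> \<not> curved_ok \<kappa> p E x (2 * r x)"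
      unfolding bchoice_iff by (elim exE) (rule that)
    \<comment> \<open>The radius \<open>2 * r x\<close> is that of the ball whose energy bounds the
      error of the selected gradient; disjointness lets these energies be summed.\<close>
    obtain K where K: "K \<subseteq> E" "\<forall>k\<in>K. \<forall>k'\<in>K. k \<noteq> k' \<longrightarrow> 2 * r k + 2 * r k' < dist k k'" "\<forall>x\<in>E. \<exists>k\<in>K. r k \<le> r x \<and> (x = k \<or> dist x k \<le> 2 * r x + 2 * r k)"
      using greedy_separated[OF E(1), of "\<lambda>x. 2 * r x" r] by (elim exE conjE) (rule that)
    have fK: "finite K" "K \<noteq> {}" using K(1,3) E finite_subset by auto
    have K4: "\<forall>x\<in>E. \<exists>k\<in>K. r k \<le> r x \<and> dist x k \<le> 4 * r x"
    proof
      fix x assume x: "x \<in> E"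
      then obtain k where "k \<in> K" "r k \<le> r x" "x = k \<or> dist x k \<le> 2 * r x + 2 * r k" using K(3) by blast
      then show "\<exists>k\<in>K. r k \<le> r x \<and> dist x k \<le> 4 * r x" using r x by (intro bexI[of _ k]) (auto simp: less_imp_le)
    qed
    obtain \<Psi>K \<alpha>K \<beta>K where WK: "whitney_sys p Cw K \<Psi>K \<alpha>K \<beta>K" using Cw(2)[rule_format, OF fK] by (elim exE) (rule that)
    obtain \<Psi> \<alpha> \<beta> where W: "whitney_sys p Cw E \<Psi> \<alpha> \<beta>" using Cw(2)[rule_format, OF E] by (elim exE) (rule that)
    obtain nb where nb: "nearest_nb E nb" "\<forall>x\<in>E. nb x \<in> E" using nearest_nb_exists_in[OF E(1)] by (elim exE conjE) (rule that)
    have "\<forall>x\<in>E. \<exists>a b. \<forall>F g. sob p F g \<longrightarrow> norm (grad F x - vector [\<Sum>y\<in>E. a y * F y, \<Sum>y\<in>E. b y * F y]) powr p \<le> 2 powr p * inverse \<kappa> * (2 * r x) powr (p - 2) * hint p g x (2 * r x)"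
      by (intro ballI gradient_selection p E k) (use r in auto)
    then obtain a b where ab: "\<forall>x\<in>E. \<forall>F g. sob p F g \<longrightarrow> norm (grad F x - vector [\<Sum>y\<in>E. a x y * F y, \<Sum>y\<in>E. b x y * F y]) powr p \<le> 2 powr p * inverse \<kappa> * (2 * r x) powr (p - 2) * hint p g x (2 * r x)"
      unfolding bchoice_iff by (elim exE) (rule that)
    define L where "L f x = (vector [\<Sum>y\<in>E. a x y * f y, \<Sum>y\<in>E. b x y * f y] :: real^2)" for f x
    have Lf: "lf E (\<lambda>f. L f x \<bullet> v)" for x v
      unfolding L_def inner2 vector_2 by (intro lf_add lf_cmult_right lf_sum lf_cmult lf_eval)
    \<comment> \<open>The extension of the selected jets on \<open>K\<close>; it need not agree with
      \<open>f\<close> on the rest of \<open>E\<close>.\<close>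
    define G where "G f = wext \<Psi>K K f (L f)" for f
    define h where "h f x = f x - G f x" for f x
    \<comment> \<open>On \<open>E\<close> the second extension restores exactly what
      \<open>G f\<close> misses there.\<close>
    define T where "T f z = G f z + wext \<Psi> E (h f) (tjet nb (h f)) z" for f z
    have Gf: "lf E (\<lambda>f. G f z)" for z unfolding G_def by (intro lf_wext Lf lf_eval) (use K(1) in blast)
    have hf: "lf E (\<lambda>f. h f x)" if "x \<in> E" for x unfolding h_def by (intro lf_diff Gf lf_eval that)
    have tf: "lf E (\<lambda>f. tjet nb (h f) x \<bullet> v)" if "x \<in> E" for x v by (rule lf_tjet) (use that nb hf in auto)
    define J1 where "J1 = {0,1,2::nat} \<times> K \<times> K"
    define J2 where "J2 = {0,1,2::nat} \<times> E \<times> E"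
    define J where "J = J1 <+> J2"
    define \<mu> where "\<mu> = case_sum (\<lambda>j f. jetfun p \<alpha>K \<beta>K f (L f) j) (\<lambda>j f. jetfun p \<alpha> \<beta> (h f) (tjet nb (h f)) j)"
    have fJ: "finite J1" "finite J2" unfolding J1_def J2_def using E fK by auto
    define S1 where "S1 f = jet_energy p K \<alpha>K \<beta>K f (L f)" for f
    define S2 where "S2 f = jet_energy p E \<alpha> \<beta> (h f) (tjet nb (h f))" for f
    have S0: "S1 f \<ge> 0" "S2 f \<ge> 0" for f unfolding S1_def S2_def using whitney_sysD(1,2)[OF WK] whitney_sysD(1,2)[OF W] by (auto intro!: jet_energy_nonneg)
    have S: "(\<Sum>j\<in>J. \<bar>\<mu> j f\<bar> powr p) = S1 f + S2 f" for f
    proof -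
      have 1: "S1 f = (\<Sum>j\<in>J1. \<bar>jetfun p \<alpha>K \<beta>K f (L f) j\<bar> powr p)"
        unfolding S1_def J1_def by (rule jet_energy_jetfun) (use p fK whitney_sysD[OF WK] in auto)
      have 2: "S2 f = (\<Sum>j\<in>J2. \<bar>jetfun p \<alpha> \<beta> (h f) (tjet nb (h f)) j\<bar> powr p)"
        unfolding S2_def J2_def by (rule jet_energy_jetfun) (use p E whitney_sysD[OF W] in auto)
      show ?thesis unfolding J_def 1 2 by (subst sum.Plus[OF fJ]) (simp add: \<mu>_def)
    qed
    have "ext_operator p C E T J \<mu>" unfolding ext_operator_def
    proof (intro conjI allI ballI impI)
      show "lf E (\<lambda>f. T f z)" for z unfolding T_def by (intro lf_add lf_wext Gf hf tf)
      show "finite J" unfolding J_def using fJ by simp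
      have "card K * card K \<le> card E * card E" by (intro mult_le_mono card_mono E(1) K(1))
      then have "card J1 \<le> 3 * (card E)\<^sup>2" unfolding J1_def by (simp add: card_cartesian_product power2_eq_square)
      moreover have "card J2 \<le> 3 * (card E)\<^sup>2" unfolding J2_def by (simp add: card_cartesian_product power2_eq_square)
      ultimately show "card J \<le> 6 * (card E)\<^sup>2" unfolding J_def using fJ by (simp add: card_Plus)
      show "lf E (\<mu> j)" if "j \<in> J" for j
      proof -
        have 1: "lf E (\<lambda>f. jetfun p \<alpha>K \<beta>K f (L f) i)" if "i \<in> J1" for i by (rule lf_jetfun[where K=K]) (use that lf_eval K(1) Lf in \<open>auto simp: J1_def\<close>)
        have 2: "lf E (\<lambda>f. jetfun p \<alpha> \<beta> (h f) (tjet nb (h f)) i)" if "i \<in> J2" for i by (rule lf_jetfun[where K=E]) (use that hf tf in \<open>auto simp: J2_def\<close>)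
        show ?thesis using that 1 2 unfolding J_def \<mu>_def by auto
      qed
      show "T f x = f x" if "x \<in> E" for f x unfolding T_def whitney_sysD(4)[OF W that] h_def by simp
      show "\<exists>g. sob p (T f) g \<and> tot p g \<le> C * (\<Sum>j\<in>J. \<bar>\<mu> j f\<bar> powr p)" for f
      proof -
        obtain g1 where g1: "sob p (G f) g1" "tot p g1 \<le> Cw * S1 f"
          using whitney_sysD(3)[OF WK, of f "L f", folded G_def S1_def] by (elim exE conjE) (rule that)
        obtain g2 where g2: "sob p (wext \<Psi> E (h f) (tjet nb (h f))) g2" "tot p g2 \<le> Cw * S2 f"
          using whitney_sysD(3)[OF W, of "h f" "tjet nb (h f)", folded S2_def] by (elim exE conjE) (rule that)
        have s: "sob p (T f) (\<lambda>i j x. g1 i j x + g2 i j x)" unfolding T_def[abs_def] using p by (intro sob_add g1(1) g2(1)) auto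
        have "tot p (\<lambda>i j x. g1 i j x + g2 i j x) \<le> 2 powr p * (tot p g1 + tot p g2)" by (rule tot_add[OF g1(1) g2(1)]) (use p in auto)
        also have "\<dots> \<le> 2 powr p * (Cw * S1 f + Cw * S2 f)" using g1(2) g2(2) by (intro mult_left_mono add_mono) auto
        also have "\<dots> = (2 powr p * Cw) * (S1 f + S2 f)" by (simp add: algebra_simps)
        also have "\<dots> \<le> C * (S1 f + S2 f)" using C(2) S0 by (intro mult_right_mono add_nonneg_nonneg)
        finally show ?thesis unfolding S using s by (intro exI conjI)
      qed
      fix F g assume F: "sob p F g"
      have t0: "tot p g \<ge> 0" by (rule tot_nonneg)
      define H where "H x = norm (grad F x - L F x)" for x
      obtain m where m: "m \<in> borel_measurable borel" "\<forall>z. m z \<ge> 0" "(\<integral>\<^sup>+z. ennreal (m z powr p) \<partial>lborel) \<le> ennreal (Cm * tot p g)" and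
         loc: "AE z in lborel. \<forall>R>0. taylor_ctrl F z R (m z)"
        using Cm(2)[rule_format, OF F] by (elim exE conjE) (rule that)
      have eI: "(\<integral>\<^sup>+z. ennreal (errdens p K r H z) \<partial>lborel) \<le> ennreal (A * Ct * tot p g)"
      proof (rule errdens_integral[OF p fK(1) _ _ F _ Ct])
        show "0 \<le> H x" for x by (simp add: H_def)
        show "H x powr p \<le> A * r x powr (p - 2) * hint p g x (2 * r x)" if "x \<in> K" for x
        proof -
          have x: "x \<in> E" using that K(1) by blast
          have "H x powr p \<le> 2 powr p * inverse \<kappa> * (2 * r x) powr (p - 2) * hint p g x (2 * r x)" unfolding H_def L_def using ab[rule_format, OF x F] .
          also have "(2 * r x) powr (p - 2) = 2 powr (p - 2) * r x powr (p - 2)" using r x by (simp add: powr_mult)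
          finally show ?thesis unfolding A_def by (simp only: mult.assoc)
        qed
      qed (use r K A in auto)
      have s1: "S1 F \<le> c1 * tot p g"
      proof -
        have "S1 F \<le> Cw * (2 * 400 powr p * (Cm * tot p g + A * Ct * tot p g))" unfolding S1_def
          by (rule separated_energy[where H=H and r=r and F=F, OF p WK fK(1) _ _ _ m(1) _ m(3) _ loc eI]) (use r K m Cm(1) A Ct(1) t0 in \<open>auto simp: H_def\<close>)
        also have "\<dots> = c1 * tot p g" unfolding c1_def by (simp add: algebra_simps)
        finally show ?thesis .
      qed
      obtain g1 where g1: "sob p (G F) g1" "tot p g1 \<le> Cw * S1 F"
        using whitney_sysD(3)[OF WK, of F "L F", folded G_def S1_def] by (elim exE conjE) (rule that)
      define g2 where "g2 = (\<lambda>i j x. g i j x - g1 i j x)"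
      have h2: "sob p (h F) g2" unfolding h_def[abs_def] g2_def using p by (intro sob_diff F g1(1)) auto
      have t2: "tot p g2 \<le> c2 * tot p g"
      proof -
        have "tot p g2 \<le> 2 powr p * (tot p g + tot p g1)" unfolding g2_def by (rule tot_diff[OF F g1(1)]) (use p in auto)
        also have "\<dots> \<le> 2 powr p * (tot p g + Cw * (c1 * tot p g))"
          using order_trans[OF g1(2) mult_left_mono[OF s1]] Cw(1) by (intro mult_left_mono add_left_mono) auto
        also have "\<dots> = c2 * tot p g" unfolding c2_def by (simp add: algebra_simps)
        finally show ?thesis .
      qed
      obtain m2 where m2: "m2 \<in> borel_measurable borel" "\<forall>z. m2 z \<ge> 0" "(\<integral>\<^sup>+z. ennreal (m2 z powr p) \<partial>lborel) \<le> ennreal (Cm * tot p g2)" and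
         loc2: "AE z in lborel. \<forall>R>0. taylor_ctrl (h F) z R (m2 z)"
        using Cm(2)[rule_format, OF h2] by (elim exE conjE) (rule that)
      have "Cm * tot p g2 \<le> Cm * c2 * tot p g" using mult_left_mono[OF t2, of Cm] Cm(1) by (simp add: mult.assoc)
      then have m2i: "(\<integral>\<^sup>+z. ennreal (m2 z powr p) \<partial>lborel) \<le> ennreal (Cm * c2 * tot p g)" by (rule order_trans[OF m2(3) ennreal_leI])
      \<comment> \<open>On \<open>K\<close> the first extension has the selected gradients, so the
        remainder's gradient is precisely the selection error. The same error density therefore
        serves both energies.\<close>
      have gk: "norm (grad (h F) k) = H k" if "k \<in> K" for k
        unfolding h_def[abs_def] H_def grad_linear(2)[OF sob_has_derivative[OF p F] sob_has_derivative[OF p g1(1)]] unfolding G_def whitney_sysD(5)[OF WK that] ..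
      have ee: "errdens p K r (\<lambda>k. norm (grad (h F) k)) z = errdens p K r H z" for z unfolding errdens_def by (rule sum.cong) (simp_all add: gk)
      have I3: "(\<integral>\<^sup>+z. ennreal (m2 z powr p + errdens p K r (\<lambda>k. norm (grad (h F) k)) z) \<partial>lborel) \<le> ennreal (c3 * tot p g)"
      proof -
        have "(\<integral>\<^sup>+z. ennreal (1 * (m2 z powr p + errdens p K r H z)) \<partial>lborel) \<le> ennreal (1 * (Cm * c2 * tot p g + A * Ct * tot p g))"
          by (rule nn_scaled_sum[OF _ _ _ _ _ _ _ m2i eI]) (use m2 errdens_nonneg Cm(1) c0 A Ct(1) t0 in auto)
        then show ?thesis unfolding ee c3_def by (simp add: algebra_simps)
      qed
      have loc2': "AE z in lborel. \<forall>R>0. \<forall>x\<in>ball z R. \<forall>y\<in>ball z R. norm (grad (h F) y - grad (h F) x) \<le> R * m2 z"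
        using loc2 by (rule AE_mp) (intro AE_I2 impI allI ballI, simp)
      have r1: "\<forall>x\<in>E. r x > 0 \<and> curved_ok \<kappa> p E x (r x)" using r by simp
      have c3t: "c3 * tot p g \<ge> 0" using c0 t0 by simp
      obtain n where n: "n \<in> borel_measurable borel" "\<forall>z. n z \<ge> 0" "(\<integral>\<^sup>+z. ennreal (n z) \<partial>lborel) \<le> ennreal (Cn * (c3 * tot p g))" and
        nT: "AE z in lborel. normals_dominated p E nb (grad (h F)) z (n z)"
        using Cn(2)[THEN spec[of _ E], THEN spec[of _ nb], THEN spec[of _ r], THEN spec[of _ K], THEN spec[of _ "grad (h F)"], THEN spec[of _ m2], THEN spec[of _ "c3 * tot p g"],
            THEN mp, OF E(1), THEN mp, OF nb(1), THEN mp, OF r1, THEN mp, OF K(1), THEN mp, OF K4, THEN mp, OF m2(1), THEN mp, OF m2(2), THEN mp, OF loc2', THEN mp, OF c3t, THEN mp, OF I3]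
        by (elim exE conjE) (rule that)
      have "S2 F \<le> Cw * (2000 powr p * (Cm * c2 * tot p g + Cn * (c3 * tot p g)))" unfolding S2_def
        by (rule tangential_energy[OF p W nb(1) m2(1) _ m2i _ loc2 n(1) _ n(3) _ nT]) (use m2 n Cm(1) Cn(1) c0 t0 in auto)
      also have "\<dots> = c4 * tot p g" unfolding c4_def by (simp add: algebra_simps)
      finally have "S1 F + S2 F \<le> (c1 + c4) * tot p g" using s1 by (simp add: distrib_right)
      also have "\<dots> \<le> C * tot p g" by (rule mult_right_mono[OF C(3) t0])
      finally show "(\<Sum>j\<in>J. \<bar>\<mu> j F\<bar> powr p) \<le> C * tot p g" unfolding S .
    qed
    then show "\<exists>T (J :: (nat \<times> (real^2) \<times> (real^2) + nat \<times> (real^2) \<times> (real^2)) set) \<mu>. ext_operator p C E T J \<mu>" by (intro exI)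
  qed
qed

section \<open>From p-th powers to the seminorms\<close>

lemma hess_pnorm_tot: "hess_pnorm p g = tot p g powr (1/p)"
  unfolding hess_pnorm_def tot_def hnorm_def ..

lemma in_L2p_sob: "in_L2p p F \<longleftrightarrow> (\<exists>g. sob p F g)"
  unfolding in_L2p_def sob_def by auto

lemma L2p_norm_sob: "continuous_on UNIV F \<Longrightarrow> L2p_norm p F = Inf {tot p g powr (1/p) | g. sob p F g}"
  unfolding L2p_norm_def sob_def hess_pnorm_tot by auto

lemma bdd_below_tot: "bdd_below {tot p g powr (1/p) | g. sob p F g}"
  by (rule bdd_belowI[of _ 0]) auto

lemma L2p_norm_le: assumes "sob p F g" shows "L2p_norm p F \<le> tot p g powr (1/p)"
proof -
  have "continuous_on UNIV F" using assms unfolding sob_def by simp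
  from L2p_norm_sob[OF this] show ?thesis using assms by (auto intro!: cInf_lower bdd_below_tot)
qed

lemma L2p_norm_ge: assumes "sob p F g0" "\<And>g. sob p F g \<Longrightarrow> a \<le> tot p g powr (1/p)" shows "a \<le> L2p_norm p F"
proof -
  have "continuous_on UNIV F" using assms(1) unfolding sob_def by simp
  from L2p_norm_sob[OF this] show ?thesis using assms by (auto intro!: cInf_greatest)
qed

lemma trace_norm_le: assumes "sob p F g" "\<And>x. x \<in> E \<Longrightarrow> F x = f x" shows "trace_norm p E f \<le> L2p_norm p F"
  unfolding trace_norm_def
proof (rule cInf_lower)
  show "bdd_below {L2p_norm p F |F. in_L2p p F \<and> (\<forall>x\<in>E. F x = f x)}"
    by (rule bdd_belowI[of _ 0]) (auto simp: in_L2p_sob intro!: L2p_norm_ge)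
qed (use assms in \<open>auto simp: in_L2p_sob\<close>)

text \<open>The witness \<open>F0\<close> guarantees that the set of competitors is nonempty;
  otherwise its infimum would be unspecified.\<close>

lemma trace_norm_ge:
  assumes "sob p F0 g0" "\<And>x. x \<in> E \<Longrightarrow> F0 x = f x" "\<And>F g. sob p F g \<Longrightarrow> (\<forall>x\<in>E. F x = f x) \<Longrightarrow> a \<le> tot p g powr (1/p)"
  shows "a \<le> trace_norm p E f"
  unfolding trace_norm_def
proof (rule cInf_greatest)
  show "{L2p_norm p F |F. in_L2p p F \<and> (\<forall>x\<in>E. F x = f x)} \<noteq> {}" using assms(1,2) by (auto simp: in_L2p_sob)
  fix b assume "b \<in> {L2p_norm p F |F. in_L2p p F \<and> (\<forall>x\<in>E. F x = f x)}"
  then obtain F g where "b = L2p_norm p F" "sob p F g" "\<forall>x\<in>E. F x = f x" by (auto simp: in_L2p_sob)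
  then show "a \<le> b" using assms(3) by (auto intro: L2p_norm_ge)
qed

definition trace_conclusion :: "real \<Rightarrow> real \<Rightarrow> (real^2) set \<Rightarrow> bool" where
  "trace_conclusion p C E \<longleftrightarrow> (\<exists>(T :: (real^2 \<Rightarrow> real) \<Rightarrow> (real^2 \<Rightarrow> real)) (lam :: nat \<Rightarrow> (real^2 \<Rightarrow> real) \<Rightarrow> real) (N0 :: nat).
       linear_operator_on_traces E T \<and>
       (\<forall>i<N0. linear_functional_on_traces E (lam i)) \<and>
       real N0 \<le> C * (real (card E))\<^sup>2 \<and>
       (\<forall>f :: real^2 \<Rightarrow> real.
          let M = (\<Sum>i<N0. \<bar>lam i f\<bar> powr p) powr (1 / p) in
          in_L2p p (T f) \<and> (\<forall>x\<in>E. T f x = f x) \<and>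
          M / C \<le> trace_norm p E f \<and>
          trace_norm p E f \<le> L2p_norm p (T f) \<and>
          L2p_norm p (T f) \<le> C * trace_norm p E f \<and>
          C * trace_norm p E f \<le> C\<^sup>2 * M))"

text \<open>With \<open>a = C powr (1/p)\<close>, the norm of \<open>T f\<close> is at most
  \<open>a * M\<close> and M is at most a times the trace norm. The comparison of \<open>T f\<close>
  with the trace norm thus costs \<open>a * a\<close>, whence the last condition on
  \<open>D\<close>.\<close>

lemma trace_conclusion_of_ext_operator:
  assumes p: "p > 2" and C: "C > 0" and D: "D \<ge> 6" "D \<ge> C powr (1/p)" "D \<ge> C powr (1/p) * C powr (1/p)" and ext: "ext_operator p C E T J \<mu>"
  shows "trace_conclusion p D E"
proof -
  note e = ext[unfolded ext_operator_def]
  have J: "finite J" "card J \<le> 6 * (card E)\<^sup>2" using e by auto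
  obtain h where h: "bij_betw h {0..<card J} J" using ex_bij_betw_nat_finite[OF J(1)] by blast
  define lam where "lam i = \<mu> (h i)" for i
  have S: "(\<Sum>i<card J. \<bar>lam i f\<bar> powr p) = (\<Sum>j\<in>J. \<bar>\<mu> j f\<bar> powr p)" for f
    unfolding lam_def using sum.reindex_bij_betw[OF h, of "\<lambda>j. \<bar>\<mu> j f\<bar> powr p"] by (simp add: atLeast0LessThan)
  define a where "a = C powr (1/p)"
  have a: "a > 0" "a \<le> D" "a * a \<le> D" unfolding a_def using C D by auto
  have D0: "D > 0" using D(1) by simp
  show ?thesis unfolding trace_conclusion_def Let_def
  proof (rule exI[of _ T], rule exI[of _ lam], rule exI[of _ "card J"], intro conjI allI ballI impI)
    show "linear_operator_on_traces E T" using e by (intro linear_operatorI) auto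
    show "lf E (lam i)" if "i < card J" for i
    proof -
      have "h i \<in> J" using bij_betwE[OF h] that by simp
      then show ?thesis unfolding lam_def using e by blast
    qed
    have "real (card J) \<le> 6 * (real (card E))\<^sup>2" using of_nat_mono[OF J(2), where 'a=real] by simp
    also have "\<dots> \<le> D * (real (card E))\<^sup>2" using D(1) by (intro mult_right_mono) auto
    finally show "real (card J) \<le> D * (real (card E))\<^sup>2" .
    fix f
    define s where "s = (\<Sum>j\<in>J. \<bar>\<mu> j f\<bar> powr p)"
    define M where "M = s powr (1/p)"
    have s0: "s \<ge> 0" unfolding s_def by (intro sum_nonneg) auto
    have M0: "M \<ge> 0" unfolding M_def by simp
    have Tf: "\<forall>x\<in>E. T f x = f x" using e by blast
    obtain g where g: "sob p (T f) g" "tot p g \<le> C * s" using e unfolding s_def by blast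
    show "in_L2p p (T f)" using g(1) by (auto simp: in_L2p_sob)
    show "T f x = f x" if "x \<in> E" for x using Tf that by blast
    have M: "(\<Sum>i<card J. \<bar>lam i f\<bar> powr p) powr (1/p) = M" unfolding S M_def s_def ..
    have 1: "trace_norm p E f \<le> L2p_norm p (T f)" by (rule trace_norm_le[OF g(1)]) (use Tf in blast)
    have "L2p_norm p (T f) \<le> tot p g powr (1/p)" by (rule L2p_norm_le[OF g(1)])
    also have "\<dots> \<le> (C * s) powr (1/p)" using g(2) p tot_nonneg by (intro powr_mono2) auto
    also have "\<dots> = a * M" unfolding a_def M_def using C s0 by (simp add: powr_mult)
    finally have 2: "L2p_norm p (T f) \<le> a * M" .
    have 3: "M / a \<le> trace_norm p E f"
    proof (rule trace_norm_ge[OF g(1)])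
      fix F g' assume F: "sob p F g'" "\<forall>x\<in>E. F x = f x"
      \<comment> \<open>A competitor has the same values on \<open>E\<close>, hence the same
        functionals, so its energy bounds M.\<close>
      have "\<mu> j F = \<mu> j f" if "j \<in> J" for j
        using e that F(2) unfolding linear_functional_on_traces_def by blast
      then have "s = (\<Sum>j\<in>J. \<bar>\<mu> j F\<bar> powr p)" unfolding s_def by simp
      also have "\<dots> \<le> C * tot p g'" using e F(1) by blast
      finally have "M \<le> (C * tot p g') powr (1/p)" unfolding M_def using s0 p by (intro powr_mono2) auto
      also have "\<dots> = a * tot p g' powr (1/p)" unfolding a_def using C tot_nonneg by (simp add: powr_mult)
      finally show "M / a \<le> tot p g' powr (1/p)" using a(1) by (simp add: field_simps)
    qed (use Tf in blast)
    have 3: "M \<le> a * trace_norm p E f" using 3 a(1) by (simp add: field_simps)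
    have t0: "trace_norm p E f \<ge> 0"
    proof (rule ccontr)
      assume "\<not> ?thesis"
      then have "a * trace_norm p E f < 0" using a(1) by (intro mult_pos_neg) auto
      then show False using 3 M0 by simp
    qed
    show "(\<Sum>i<card J. \<bar>lam i f\<bar> powr p) powr (1/p) / D \<le> trace_norm p E f" unfolding M
      using order_trans[OF 3 mult_right_mono[OF a(2) t0]] D0 by (simp add: field_simps)
    show "trace_norm p E f \<le> L2p_norm p (T f)" by (rule 1)
    have "L2p_norm p (T f) \<le> a * (a * trace_norm p E f)" by (rule order_trans[OF 2 mult_left_mono[OF 3]]) (use a(1) in simp)
    also have "\<dots> \<le> D * trace_norm p E f" using mult_right_mono[OF a(3) t0] by (simp add: mult.assoc)
    finally show "L2p_norm p (T f) \<le> D * trace_norm p E f" .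
    have "trace_norm p E f \<le> D * M" using 1 2 mult_right_mono[OF a(2) M0] by simp
    then show "D * trace_norm p E f \<le> D\<^sup>2 * (\<Sum>i<card J. \<bar>lam i f\<bar> powr p) powr (1/p)" unfolding M power2_eq_square
      using D0 by simp
  qed
qed

lemma tot_zero: "tot p (\<lambda>i j x. 0) = 0"
  unfolding tot_def hnorm_def by simp

theorem theorem1:
  fixes p :: real
  assumes "2 < p"
  shows "\<exists>C>0. \<forall>E :: (real^2) set. finite E \<longrightarrow>
    (\<exists>(T :: (real^2 \<Rightarrow> real) \<Rightarrow> (real^2 \<Rightarrow> real)) (lam :: nat \<Rightarrow> (real^2 \<Rightarrow> real) \<Rightarrow> real) (N0 :: nat).
       linear_operator_on_traces E T \<and>
       (\<forall>i<N0. linear_functional_on_traces E (lam i)) \<and>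
       real N0 \<le> C * (real (card E))\<^sup>2 \<and>
       (\<forall>f :: real^2 \<Rightarrow> real.
          let M = (\<Sum>i<N0. \<bar>lam i f\<bar> powr p) powr (1 / p) in
          in_L2p p (T f) \<and> (\<forall>x\<in>E. T f x = f x) \<and>
          M / C \<le> trace_norm p E f \<and>
          trace_norm p E f \<le> L2p_norm p (T f) \<and>
          L2p_norm p (T f) \<le> C * trace_norm p E f \<and>
          C * trace_norm p E f \<le> C\<^sup>2 * M))"
proof -
  obtain C1 where C1: "C1 > 0" "\<forall>E. finite E \<longrightarrow> E \<noteq> {} \<longrightarrow> collinear_pts E \<longrightarrow> (\<exists>T (J :: (nat \<times> (real^2) \<times> (real^2)) set) \<mu>. ext_operator p C1 E T J \<mu>)"
    using collinear_ext_operator[OF assms] by (elim exE conjE) (rule that)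
  obtain C2 where C2: "C2 > 0" "\<forall>E. finite E \<longrightarrow> E \<noteq> {} \<longrightarrow> \<not> collinear_pts E \<longrightarrow> (\<exists>T (J :: (nat \<times> (real^2) \<times> (real^2) + nat \<times> (real^2) \<times> (real^2)) set) \<mu>. ext_operator p C2 E T J \<mu>)"
    using curved_ext_operator[OF assms] by (elim exE conjE) (rule that)
  \<comment> \<open>All that the passage to p-th roots demands of the final constant, for each of
    the three cases.\<close>
  define t where "t c = max (c powr (1/p)) (c powr (1/p) * c powr (1/p))" for c
  define D where "D = max 6 (max (t 1) (max (t C1) (t C2)))"
  have D: "D > 0" "D \<ge> 6" "t 1 \<le> D" "t C1 \<le> D" "t C2 \<le> D" unfolding D_def by auto
  have t: "c powr (1/p) \<le> D" "c powr (1/p) * c powr (1/p) \<le> D" if "t c \<le> D" for c using that unfolding t_def by auto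
  have "trace_conclusion p D E" if E: "finite E" for E
  \<comment> \<open>The Whitney extension needs a nonempty set; for the empty set the zero operator
    without functionals is taken.\<close>
  proof (cases "E = {}")
    case True
    have s: "sob p (\<lambda>z. 0) (\<lambda>i j x. 0)" using sob_affine[of p 0 0] by simp
    have "ext_operator p 1 E (\<lambda>f z. 0) ({} :: nat set) (\<lambda>j f. 0)"
      unfolding ext_operator_def using True s tot_zero[of p] tot_nonneg by (auto intro!: lf_zero)
    then show ?thesis by (rule trace_conclusion_of_ext_operator[OF assms zero_less_one D(2) t[OF D(3)]])
  next
    case ne: False
    show ?thesis
    proof (cases "collinear_pts E")
      case True
      obtain T and J :: "(nat \<times> (real^2) \<times> (real^2)) set" and \<mu> where "ext_operator p C1 E T J \<mu>"
        using C1(2)[rule_format, OF E ne True] by (elim exE) (rule that)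
      then show ?thesis by (rule trace_conclusion_of_ext_operator[OF assms C1(1) D(2) t[OF D(4)]])
    next
      case False
      obtain T and J :: "(nat \<times> (real^2) \<times> (real^2) + nat \<times> (real^2) \<times> (real^2)) set" and \<mu> where "ext_operator p C2 E T J \<mu>"
        using C2(2)[rule_format, OF E ne False] by (elim exE) (rule that)
      then show ?thesis by (rule trace_conclusion_of_ext_operator[OF assms C2(1) D(2) t[OF D(5)]])
    qed
  qed
  then show ?thesis using D(1) unfolding trace_conclusion_def by (intro exI[of _ D] conjI allI impI)
qed

end
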